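(* Let $(X_t)_{t\in\mathbb Z}$ be a real-valued time series satisfying (MDA), let $r=r_n$ satisfy (BM) with constant $\omega>0$, and let $h:\mathbb R\to\mathbb R$ be Lebesgue-a.e. continuous with $\limsup_{r\to\infty}\mathbb E[|h(Z_r)|^{2+\nu}]<\infty$ for some $\nu>2/\omega$. Fix $k\in\mathbb N$ and write $\mathcal X_n$ for the observed sample. Then, as $n\to\infty$, the naive sliding block maxima bootstrap process $\hat{\mathbb G}^{[s],*}_{n,r}$ satisfies $$d_K\Big(\mathcal L\big(\hat{\mathbb G}_{n,r}^{[s],*}h\mid\mathcal X_n\big),\mathcal N(0,\Sigma_h^{(k)})\Big)=o_{\mathbb P}(1),\qquad \Sigma_h^{(k)}=\Sigma_h^{[s]}-\frac2k\int_0^1\xi\operatorname{Cov}(h(Z_{1,\xi}),h(Z_{2,\xi}))\,d\xi,$$ where $\Sigma_h^{[s]}=2\int_0^1\operatorname{Cov}(h(Z_{1,\xi}),h(Z_{2,\xi}))\,d\xi$. Moreover, if $\operatorname{Var}(h(Z))>0$, then $\Sigma_h^{(k)}<\Sigma_h^{[s]}$ for every $k\in\mathbb N$.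
   Context: $d_K$ is the Kolmogorov metric (supremum distance between CDFs); $\rightsquigarrow$ is weak convergence. (MDA) $(X_t)_{t\in\mathbb Z}$ is a strictly stationary real-valued time series with continuous marginal distribution. There are $(a_r)_r\subset(0,\infty)$, $(b_r)_r\subset\mathbb R$, $\gamma\in\mathbb R$ such that for all $s>0$: $a_{\lfloor rs\rfloor}/a_r\to s^{\gamma}$ and $(b_{\lfloor rs\rfloor}-b_r)/a_r\to(s^\gamma-1)/\gamma$ as $r\to\infty$ (read as $\log s$ if $\gamma=0$). Moreover $Z_r:=(\max(X_1,\dots,X_r)-b_r)/a_r\rightsquigarrow Z\sim G$, where $G(x)=\exp(-(1+\gamma x)^{-1/\gamma})\mathbf 1(1+\gamma x>0)$ is the GEV($\gamma$) CDF. (BM) With $\alpha(p)=\sup\{|\mathbb P(A\cap B)-\mathbb P(A)\mathbb P(B)|:A\in\sigma((X_t)_{t\le 0}),B\in\sigma((X_t)_{t\ge p})\}$: (a) $r_n\to\infty$, $r_n=o(n)$; (b) there are integers $\ell_n\to\infty$ with $\ell_n=o(r_n)$, $\frac{r_n}{\ell_n}\alpha(\ell_n)=o(1)$, $\frac n{r_n}\alpha(\ell_n)=o(1)$; (c) $(n/r_n)^{1+\omega}\alpha(r_n)=o(1)$ for some $\omega>0$. Naive sliding bootstrap: sliding block maxima are $M^{[s]}_{r,i}=\max(X_i,\dots,X_{i+r-1})$, $i=1,\dots,n$ (from the extended sample $X_1,\dots,X_{n+r-1}$), and $Z^{[s]}_{r,i}=(M^{[s]}_{r,i}-b_r)/a_r$.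 Assume $m(k):=n/(kr)\in\mathbb N$ and let $I_{kr,i}=\{(i-1)kr+1,\dots,ikr\}$. Independent of $(X_t)_t$, let $(W_{m(k),1},\dots,W_{m(k),m(k)})$ be multinomial with $m(k)$ trials and class probabilities $1/m(k)$ each. Put $\mathbb P^{[s]}_{n,r}=\frac1n\sum_{i=1}^n\delta_{Z^{[s]}_{r,i}}$, $\hat{\mathbb P}^{[s],*}_{n,r}=\frac1n\sum_{i=1}^{m(k)}W_{m(k),i}\sum_{s\in I_{kr,i}}\delta_{Z^{[s]}_{r,s}}$ and $\hat{\mathbb G}^{[s],*}_{n,r}=\sqrt{n/r}(\hat{\mathbb P}^{[s],*}_{n,r}-\mathbb P^{[s]}_{n,r})$; for a signed measure $\mu$, $\mu h=\int h\,d\mu$. For $\xi\in[0,1]$, $(Z_{1,\xi},Z_{2,\xi})$ has CDF $G_\xi(x,y)=G(x)^{\xi}G(y)^{\xi}G(x\wedge y)^{1-\xi}$.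
   Formalization: The d_K claim is for Var(h(Z))>0 (it can fail otherwise); if Var(h(Z))=0, Σ_h^(k)=0 and the conditional law tends weakly to δ_0 in probability. n→∞ runs over n with n/(kr_n) an integer; h is Borel; for γ<0, G=1 beyond the endpoint −1/γ. *)

theory Defs
  imports "HOL-Probability.Probability" "HOL-Library.Landau_Symbols"
begin

section \<open>Generalised extreme value distributions\<close>

text \<open>For \<open>\<gamma> < 0\<close> the support has the upper endpoint \<open>- 1 / \<gamma>\<close>, and the distribution function is
  \<open>1\<close> (not \<open>0\<close>) to the right of it.\<close>

definition gev_cdf :: "real \<Rightarrow> real \<Rightarrow> real" where
  "gev_cdf \<gamma> x =
    (if \<gamma> = 0 then exp (- exp (- x))
     else if 1 + \<gamma> * x > 0 then exp (- ((1 + \<gamma> * x) powr (- 1 / \<gamma>)))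
     else if \<gamma> > 0 then 0 else 1)"

definition gev_measure :: "real \<Rightarrow> real measure" where
  "gev_measure \<gamma> = interval_measure (gev_cdf \<gamma>)"

text \<open>HOL has \<open>0 powr 0 = 0\<close>. This is harmless here: whenever a base vanishes, so does \<open>gev_cdf\<close>
  at the smaller argument, and then the product is \<open>0\<close> under either convention.\<close>

definition gev_biv_cdf :: "real \<Rightarrow> real \<Rightarrow> real \<Rightarrow> real \<Rightarrow> real" where
  "gev_biv_cdf \<gamma> \<xi> x y =
    gev_cdf \<gamma> x powr \<xi> * gev_cdf \<gamma> y powr \<xi> * gev_cdf \<gamma> (min x y) powr (1 - \<xi>)"

definition has_biv_cdf :: "(real \<times> real) measure \<Rightarrow> (real \<Rightarrow> real \<Rightarrow> real) \<Rightarrow> bool" where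
  "has_biv_cdf Q H \<longleftrightarrow>
    prob_space Q \<and> sets Q = sets borel \<and> (\<forall>x y. measure Q ({..x} \<times> {..y}) = H x y)"


section \<open>Time series and block maxima\<close>

definition generated_sigma ::
    "'a measure \<Rightarrow> 'b measure \<Rightarrow> ('i \<Rightarrow> 'a \<Rightarrow> 'b) \<Rightarrow> 'i set \<Rightarrow> 'a measure" where
  "generated_sigma M N Y T =
    sigma (space M) (\<Union>t\<in>T. {Y t -` B \<inter> space M | B. B \<in> sets N})"

definition strictly_stationary :: "'a measure \<Rightarrow> (int \<Rightarrow> 'a \<Rightarrow> real) \<Rightarrow> bool" where
  "strictly_stationary M X \<longleftrightarrow>
    (\<forall>t. X t \<in> borel_measurable M) \<and>
    (\<forall>J u. finite J \<longrightarrow>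
      distr M (PiM J (\<lambda>_. borel)) (\<lambda>x. \<lambda>t\<in>J. X (t + u) x) =
      distr M (PiM J (\<lambda>_. borel)) (\<lambda>x. \<lambda>t\<in>J. X t x))"

definition block_max :: "(int \<Rightarrow> 'a \<Rightarrow> real) \<Rightarrow> nat \<Rightarrow> nat \<Rightarrow> 'a \<Rightarrow> real" where
  "block_max X r i x = Max ((\<lambda>t. X t x) ` {int i..<int (i + r)})"

definition norm_block_max ::
    "(nat \<Rightarrow> real) \<Rightarrow> (nat \<Rightarrow> real) \<Rightarrow> (int \<Rightarrow> 'a \<Rightarrow> real) \<Rightarrow> nat \<Rightarrow> nat \<Rightarrow> 'a \<Rightarrow> real" where
  "norm_block_max a b X r i x = (block_max X r i x - b r) / a r"

definition MDA ::
    "'a measure \<Rightarrow> (int \<Rightarrow> 'a \<Rightarrow> real) \<Rightarrow> (nat \<Rightarrow> real) \<Rightarrow> (nat \<Rightarrow> real) \<Rightarrow> real \<Rightarrow> bool" where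
  "MDA M X a b \<gamma> \<longleftrightarrow>
    strictly_stationary M X \<and>
    continuous_on UNIV (cdf (distr M borel (X 0))) \<and>
    (\<forall>r\<ge>1. a r > 0) \<and>
    (\<forall>s>0. (\<lambda>r. a (nat \<lfloor>real r * s\<rfloor>) / a r) \<longlonglongrightarrow> s powr \<gamma>) \<and>
    (\<forall>s>0. (\<lambda>r. (b (nat \<lfloor>real r * s\<rfloor>) - b r) / a r)
              \<longlonglongrightarrow> (if \<gamma> = 0 then ln s else (s powr \<gamma> - 1) / \<gamma>)) \<and>
    weak_conv_m (\<lambda>r. distr M borel (norm_block_max a b X r 1)) (gev_measure \<gamma>)"

definition alpha_mixing :: "'a measure \<Rightarrow> (int \<Rightarrow> 'a \<Rightarrow> real) \<Rightarrow> nat \<Rightarrow> real" where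
  "alpha_mixing M X p =
    (SUP (A, B) \<in> sets (generated_sigma M borel X {..0})
                \<times> sets (generated_sigma M borel X {int p..}).
      \<bar>measure M (A \<inter> B) - measure M A * measure M B\<bar>)"

definition BM :: "'a measure \<Rightarrow> (int \<Rightarrow> 'a \<Rightarrow> real) \<Rightarrow> (nat \<Rightarrow> nat) \<Rightarrow> real \<Rightarrow> bool" where
  "BM M X r \<omega> \<longleftrightarrow>
    filterlim r at_top sequentially \<and>
    (\<lambda>n. real (r n)) \<in> o(\<lambda>n. real n) \<and>
    (\<exists>l :: nat \<Rightarrow> nat.
      filterlim l at_top sequentially \<and>
      (\<lambda>n. real (l n)) \<in> o(\<lambda>n. real (r n)) \<and>
      (\<lambda>n. real (r n) / real (l n) * alpha_mixing M X (l n)) \<in> o(\<lambda>_. 1) \<and>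
      (\<lambda>n. real n / real (r n) * alpha_mixing M X (l n)) \<in> o(\<lambda>_. 1)) \<and>
    \<omega> > 0 \<and>
    (\<lambda>n. (real n / real (r n)) powr (1 + \<omega>) * alpha_mixing M X (r n)) \<in> o(\<lambda>_. 1)"


section \<open>The naive sliding block maxima bootstrap\<close>

definition multinomial ::
    "'a measure \<Rightarrow> 'i set \<Rightarrow> nat \<Rightarrow> ('i \<Rightarrow> real) \<Rightarrow> ('i \<Rightarrow> 'a \<Rightarrow> nat) \<Rightarrow> bool" where
  "multinomial M I N p W \<longleftrightarrow>
    (\<forall>i\<in>I. W i \<in> measurable M (count_space UNIV)) \<and>
    (\<forall>w. measure M {x \<in> space M. \<forall>i\<in>I. W i x = w i} =
      (if (\<Sum>i\<in>I. w i) = N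
       then fact N / (\<Prod>i\<in>I. fact (w i)) * (\<Prod>i\<in>I. p i ^ w i) else 0))"

definition emp_sliding ::
    "(nat \<Rightarrow> real) \<Rightarrow> (nat \<Rightarrow> real) \<Rightarrow> (int \<Rightarrow> 'a \<Rightarrow> real) \<Rightarrow> nat \<Rightarrow> nat \<Rightarrow> (real \<Rightarrow> real) \<Rightarrow> 'a \<Rightarrow> real"
  where
  "emp_sliding a b X n r h x = 1 / real n * (\<Sum>i = 1..n. h (norm_block_max a b X r i x))"

definition emp_sliding_boot ::
    "(nat \<Rightarrow> real) \<Rightarrow> (nat \<Rightarrow> real) \<Rightarrow> (int \<Rightarrow> 'a \<Rightarrow> real) \<Rightarrow> nat \<Rightarrow> nat \<Rightarrow> nat \<Rightarrow> (nat \<Rightarrow> 'a \<Rightarrow> nat)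
      \<Rightarrow> (real \<Rightarrow> real) \<Rightarrow> 'a \<Rightarrow> real"
  where
  "emp_sliding_boot a b X n r k W h x =
    1 / real n * (\<Sum>i = 1..n div (k * r). real (W i x) *
      (\<Sum>s = (i - 1) * (k * r) + 1..i * (k * r). h (norm_block_max a b X r s x)))"

definition boot_process ::
    "(nat \<Rightarrow> real) \<Rightarrow> (nat \<Rightarrow> real) \<Rightarrow> (int \<Rightarrow> 'a \<Rightarrow> real) \<Rightarrow> nat \<Rightarrow> nat \<Rightarrow> nat \<Rightarrow> (nat \<Rightarrow> 'a \<Rightarrow> nat)
      \<Rightarrow> (real \<Rightarrow> real) \<Rightarrow> 'a \<Rightarrow> real"
  where
  "boot_process a b X n r k W h x =
    sqrt (real n / real r) * (emp_sliding_boot a b X n r k W h x - emp_sliding a b X n r h x)"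


section \<open>Conditional laws, Kolmogorov distance, asymptotic variances\<close>

text \<open>\<open>\<kappa>\<close> is a regular version of the conditional law of \<open>Y\<close> given the sub-sigma-algebra \<open>F\<close>.\<close>

definition is_cond_law :: "'a measure \<Rightarrow> 'a measure \<Rightarrow> ('a \<Rightarrow> real) \<Rightarrow> ('a \<Rightarrow> real measure) \<Rightarrow> bool" where
  "is_cond_law M F Y \<kappa> \<longleftrightarrow>
    \<kappa> \<in> measurable F (prob_algebra borel) \<and>
    (\<forall>B\<in>sets borel. AE x in M.
      measure (\<kappa> x) B = real_cond_exp M F (indicator (Y -` B \<inter> space M)) x)"

definition kolmogorov_dist :: "real measure \<Rightarrow> real measure \<Rightarrow> real" where
  "kolmogorov_dist \<mu> \<nu> = (SUP x. \<bar>cdf \<mu> x - cdf \<nu> x\<bar>)"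

text \<open>For \<open>v > 0\<close> only; \<open>normal_density\<close> is parametrised by the standard deviation.\<close>

definition centred_normal :: "real \<Rightarrow> real measure" where
  "centred_normal v = density lborel (normal_density 0 (sqrt v))"

definition small_oP :: "'a measure \<Rightarrow> (nat \<Rightarrow> 'a \<Rightarrow> real) \<Rightarrow> nat filter \<Rightarrow> bool" where
  "small_oP M V F \<longleftrightarrow>
    (\<forall>\<epsilon>>0. ((\<lambda>n. measure M {x \<in> space M. \<bar>V n x\<bar> > \<epsilon>}) \<longlongrightarrow> 0) F)"

definition covariance :: "'b measure \<Rightarrow> ('b \<Rightarrow> real) \<Rightarrow> ('b \<Rightarrow> real) \<Rightarrow> real" where
  "covariance N f g =
    (\<integral>z. (f z - (\<integral>u. f u \<partial>N)) * (g z - (\<integral>u. g u \<partial>N)) \<partial>N)"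

definition sigma_sliding :: "(real \<Rightarrow> (real \<times> real) measure) \<Rightarrow> (real \<Rightarrow> real) \<Rightarrow> real" where
  "sigma_sliding Q h =
    2 * (\<integral>\<xi>\<in>{0..1}. covariance (Q \<xi>) (\<lambda>z. h (fst z)) (\<lambda>z. h (snd z)) \<partial>lborel)"

definition sigma_naive :: "(real \<Rightarrow> (real \<times> real) measure) \<Rightarrow> (real \<Rightarrow> real) \<Rightarrow> nat \<Rightarrow> real" where
  "sigma_naive Q h k =
    sigma_sliding Q h - 2 / real k *
      (\<integral>\<xi>\<in>{0..1}. \<xi> * covariance (Q \<xi>) (\<lambda>z. h (fst z)) (\<lambda>z. h (snd z)) \<partial>lborel)"

text \<open>Sample sizes tending to infinity along those \<open>n\<close> for which \<open>n / (k * r n)\<close> is an integer. As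
  \<open>r n\<close> tends to infinity with \<open>r n = o(n)\<close>, this divisibility fails for all large primes \<open>n\<close>, so
  it cannot be imposed on all (or all large) \<open>n\<close>.\<close>

definition admissible_sizes :: "nat \<Rightarrow> (nat \<Rightarrow> nat) \<Rightarrow> nat filter" where
  "admissible_sizes k r = inf sequentially (principal {n. k * r n dvd n})"

end

theory Submission
  imports Defs "HOL-Real_Asymp.Real_Asymp"
begin

text \<open>Given the data, the bootstrap process is a normalised sum of \<open>m\<close> independent uniform draws from
  the centred block averages, so a quantitative central limit theorem reduces the claim to two facts
  about the data: the empirical variance of the block averages converges in mean to \<open>\<Sigma>\<^sub>h\<close>, and a
  Lyapunov ratio vanishes. The latter is immediate from the moment assumption. For the former, if \<open>h\<close> is
  a finite combination of indicators of half-lines then everything is expressed through probabilities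
  that stretches of the series stay below thresholds. Mixing together with max-stability gives their
  limits, and mixing gives the law of large numbers over blocks. Such step functions are dense in \<open>L\<^sup>2\<close>
  of the GEV law among the admissible \<open>h\<close>, and both the empirical and the limiting variance are
  \<open>L\<^sup>2\<close>-continuous in \<open>h\<close>. Positivity comes from the lag covariance kernel, which is positive
  semidefinite and tends to the variance as the lag vanishes.\<close>

section \<open>Generalised extreme value distributions\<close>

text \<open>The correction with the factor \<open>2 / k\<close> is an edge effect. A block of
  \<open>k * r\<close> starting points contains \<open>k * r - d\<close> ordered pairs at lag
  \<open>d\<close>; with \<open>d = \<xi> * r\<close> this becomes the weight
  \<open>k - \<xi>\<close>, and pairs straddling two blocks are lost because weights are drawn block
  by block. Lags beyond \<open>r\<close> drop out, since the two maxima then see almost independent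
  stretches.

  Half-line indicators keep the mixing argument elementary: \<alpha>-mixing bounds probabilities of
  events, and a threshold event for a block maximum concerns finitely many coordinates, so no
  covariance inequality for unbounded functions enters. Unbounded \<open>h\<close> is reached only
  through quadratic functionals, by factoring a difference of squares.

  The variance of \<open>h\<close> under the GEV law may vanish. The limit is then a point mass, for
  which weak convergence does not give Kolmogorov convergence. Hence the limit law is described by
  its characteristic function, and the discrepancy is an arbitrary functional that vanishes along
  weakly convergent sequences.\<close>

lemma gev_cdf_nonneg: "0 \<le> gev_cdf \<gamma> x"
  and gev_cdf_le_1: "gev_cdf \<gamma> x \<le> 1"
  by (auto simp: gev_cdf_def)

lemma gev_cdf_mono:
  assumes "x \<le> y"
  shows "gev_cdf \<gamma> x \<le> gev_cdf \<gamma> y"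
proof -
  consider "\<gamma> = 0" | "\<gamma> > 0" | "\<gamma> < 0" by linarith
  then show ?thesis
  proof cases
    case 1
    then show ?thesis using assms by (simp add: gev_cdf_def)
  next
    case 2
    then have "\<gamma> * x \<le> \<gamma> * y" using assms by simp
    moreover have "(1 + \<gamma> * y) powr (- 1 / \<gamma>) \<le> (1 + \<gamma> * x) powr (- 1 / \<gamma>)" if "1 + \<gamma> * x > 0"
      using that 2 calculation by (intro powr_mono2') auto
    moreover have "1 + \<gamma> * y > 0" if "1 + \<gamma> * x > 0"
      using that \<open>\<gamma> * x \<le> \<gamma> * y\<close> by linarith
    ultimately show ?thesis using 2 by (auto simp: gev_cdf_def)
  next
    case 3
    then have "\<gamma> * y \<le> \<gamma> * x" using assms by simp
    moreover have "(1 + \<gamma> * y) powr (- 1 / \<gamma>) \<le> (1 + \<gamma> * x) powr (- 1 / \<gamma>)" if "1 + \<gamma> * y > 0"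
      using that 3 calculation by (intro powr_mono2) (auto simp: field_simps)
    moreover have "1 + \<gamma> * x > 0" if "1 + \<gamma> * y > 0"
      using that \<open>\<gamma> * y \<le> \<gamma> * x\<close> by linarith
    ultimately show ?thesis using 3 by (auto simp: gev_cdf_def)
  qed
qed

text \<open>For nonzero \<open>\<gamma>\<close> the function depends on \<open>x\<close> only
  through \<open>1 + \<gamma> * x\<close>, so a single critical point is left. There the power tends
  to infinity or to zero according to the sign of \<open>\<gamma>\<close>, which is exactly what the
  constant branch of the definition continues.\<close>

lemma gev_cdf_isCont: "isCont (gev_cdf \<gamma>) x"
proof (cases "\<gamma> = 0")
  case True
  have "gev_cdf \<gamma> = (\<lambda>x. exp (- exp (- x)))" using True by (auto simp: gev_cdf_def)
  then show ?thesis by simp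
next
  case False
  define \<Phi> where "\<Phi> y = (if y > 0 then exp (- (y powr (- 1 / \<gamma>))) else if \<gamma> > 0 then 0 else 1)" for y
  have eq: "gev_cdf \<gamma> = (\<lambda>x. \<Phi> (1 + \<gamma> * x))"
    using False by (auto simp: gev_cdf_def \<Phi>_def fun_eq_iff)
  have "isCont \<Phi> y" for y
  proof -
    consider "y > 0" | "y < 0" | "y = 0" by linarith
    then show ?thesis
    proof cases
      case 1
      have "isCont (\<lambda>y. exp (- (y powr (- 1 / \<gamma>)))) y"
        using 1 by (intro continuous_intros) auto
      moreover have "\<forall>\<^sub>F z in nhds y. \<Phi> z = exp (- (z powr (- 1 / \<gamma>)))"
        using eventually_nhds_in_open[of "{0<..}" y] 1
        by (auto elim!: eventually_mono simp: \<Phi>_def)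
      ultimately show ?thesis by (simp add: isCont_cong)
    next
      case 2
      have "\<forall>\<^sub>F z in nhds y. \<Phi> z = (if \<gamma> > 0 then 0 else 1)"
        using eventually_nhds_in_open[of "{..<0}" y] 2
        by (auto elim!: eventually_mono simp: \<Phi>_def)
      then show ?thesis by (simp add: isCont_cong)
    next
      case 3
      have right: "((\<lambda>y. exp (- (y powr (- 1 / \<gamma>)))) \<longlongrightarrow> \<Phi> 0) (at_right 0)"
      proof (cases "\<gamma> > 0")
        case True
        then have "- 1 / \<gamma> < 0" by simp
        then have "((\<lambda>y. exp (- (y powr (- 1 / \<gamma>)))) \<longlongrightarrow> 0) (at_right 0)"
          by real_asymp
        then show ?thesis using True by (simp add: \<Phi>_def)
      next
        case F: False
        then have "- 1 / \<gamma> > 0" using False by (simp add: field_simps)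
        then have "((\<lambda>y. exp (- (y powr (- 1 / \<gamma>)))) \<longlongrightarrow> 1) (at_right 0)"
          by real_asymp
        then show ?thesis using F by (simp add: \<Phi>_def)
      qed
      have "(\<Phi> \<longlongrightarrow> \<Phi> 0) (at_right 0)"
        by (rule Lim_transform_eventually[OF right])
          (auto simp: \<Phi>_def eventually_at_right_less intro: eventually_mono[OF eventually_at_right_less])
      moreover have "(\<Phi> \<longlongrightarrow> \<Phi> 0) (at_left 0)"
        by (rule tendsto_eventually) 
          (auto simp: eventually_at_filter \<Phi>_def)
      ultimately show ?thesis
        using 3 by (simp add: isCont_def filterlim_at_split)
    qed
  qed
  moreover have "isCont (\<lambda>x. 1 + \<gamma> * x) x" by (intro continuous_intros)
  ultimately have "isCont (\<lambda>x. \<Phi> (1 + \<gamma> * x)) x"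
    by (rule isCont_o2[rotated])
  then show ?thesis by (simp add: eq)
qed

lemma gev_cdf_at_bot: "(gev_cdf \<gamma> \<longlongrightarrow> 0) at_bot"
proof -
  consider "\<gamma> = 0" | "\<gamma> > 0" | "\<gamma> < 0" by linarith
  then show ?thesis
  proof cases
    case 1
    have "((\<lambda>x::real. exp (- exp (- x))) \<longlongrightarrow> 0) at_bot" by real_asymp
    moreover have "gev_cdf \<gamma> = (\<lambda>x. exp (- exp (- x)))" using 1 by (auto simp: gev_cdf_def)
    ultimately show ?thesis by simp
  next
    case 2
    have "\<forall>\<^sub>F x in at_bot. gev_cdf \<gamma> x = 0"
      using eventually_le_at_bot[of "- 1 / \<gamma>"] 2
      by (auto elim!: eventually_mono simp: gev_cdf_def field_simps)
    then show ?thesis by (rule tendsto_eventually)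
  next
    case 3
    then have p: "- 1 / \<gamma> > 0" by (simp add: field_simps)
    have "((\<lambda>x. exp (- ((1 + \<gamma> * x) powr (- 1 / \<gamma>)))) \<longlongrightarrow> 0) at_bot"
      using 3 p by real_asymp
    moreover have "\<forall>\<^sub>F x in at_bot. exp (- ((1 + \<gamma> * x) powr (- 1 / \<gamma>))) = gev_cdf \<gamma> x"
    proof (rule eventually_mono[OF eventually_le_at_bot[of 0]])
      fix x :: real assume "x \<le> 0"
      then have "1 + \<gamma> * x > 0" using 3 by (intro add_pos_nonneg mult_nonpos_nonpos) auto
      then show "exp (- ((1 + \<gamma> * x) powr (- 1 / \<gamma>))) = gev_cdf \<gamma> x" using 3 by (simp add: gev_cdf_def)
    qed
    ultimately show ?thesis by (rule Lim_transform_eventually)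
  qed
qed

lemma gev_cdf_at_top: "(gev_cdf \<gamma> \<longlongrightarrow> 1) at_top"
proof -
  consider "\<gamma> = 0" | "\<gamma> > 0" | "\<gamma> < 0" by linarith
  then show ?thesis
  proof cases
    case 1
    have "((\<lambda>x::real. exp (- exp (- x))) \<longlongrightarrow> 1) at_top" by real_asymp
    moreover have "gev_cdf \<gamma> = (\<lambda>x. exp (- exp (- x)))" using 1 by (auto simp: gev_cdf_def)
    ultimately show ?thesis by simp
  next
    case 3
    have "\<forall>\<^sub>F x in at_top. gev_cdf \<gamma> x = 1"
      using eventually_ge_at_top[of "- 1 / \<gamma>"] 3
      by (auto elim!: eventually_mono simp: gev_cdf_def field_simps)
    then show ?thesis by (rule tendsto_eventually)
  next
    case 2
    then have p: "- 1 / \<gamma> < 0" by (simp add: field_simps)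
    have "((\<lambda>x. exp (- ((1 + \<gamma> * x) powr (- 1 / \<gamma>)))) \<longlongrightarrow> 1) at_top"
      using 2 p by real_asymp
    moreover have "\<forall>\<^sub>F x in at_top. exp (- ((1 + \<gamma> * x) powr (- 1 / \<gamma>))) = gev_cdf \<gamma> x"
    proof (rule eventually_mono[OF eventually_ge_at_top[of 0]])
      fix x :: real assume "x \<ge> 0"
      then have "1 + \<gamma> * x > 0" using 2 by (intro add_pos_nonneg) auto
      then show "exp (- ((1 + \<gamma> * x) powr (- 1 / \<gamma>))) = gev_cdf \<gamma> x" using 2 by (simp add: gev_cdf_def)
    qed
    ultimately show ?thesis by (rule Lim_transform_eventually)
  qed
qed

lemma gev_cdf_right_continuous: "continuous (at_right a) (gev_cdf \<gamma>)"
  by (rule continuous_at_imp_continuous_at_within) (rule gev_cdf_isCont)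

lemma real_distribution_gev: "real_distribution (gev_measure \<gamma>)"
  unfolding gev_measure_def
  by (rule real_distribution_interval_measure)
    (simp_all only: gev_cdf_mono gev_cdf_at_bot gev_cdf_at_top gev_cdf_right_continuous)

lemma cdf_gev: "cdf (gev_measure \<gamma>) = gev_cdf \<gamma>"
  unfolding gev_measure_def
  by (rule cdf_interval_measure)
    (simp_all only: gev_cdf_mono gev_cdf_at_bot gev_cdf_right_continuous)

text \<open>The excluded point is the finite endpoint of the support; for
  \<open>\<gamma> \<le> -1\<close> the function really fails to be differentiable there.\<close>

lemma gev_cdf_differentiable:
  assumes "\<gamma> = 0 \<or> x \<noteq> - 1 / \<gamma>"
  shows "gev_cdf \<gamma> differentiable (at x)"
proof -
  consider "\<gamma> = 0" | "\<gamma> \<noteq> 0" "1 + \<gamma> * x > 0" | "\<gamma> \<noteq> 0" "1 + \<gamma> * x < 0"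
  proof -
    have "\<gamma> = 0 \<or> 1 + \<gamma> * x \<noteq> 0"
      using assms eq_divide_eq[of x "- 1" \<gamma>] by (auto simp: mult.commute)
    then show ?thesis using that by (meson linorder_cases)
  qed
  then show ?thesis
  proof cases
    case 1
    then have "gev_cdf \<gamma> = (\<lambda>x. exp (- exp (- x)))" by (auto simp: gev_cdf_def)
    moreover have "((\<lambda>x::real. exp (- exp (- x))) has_real_derivative exp (- exp (- x)) * exp (- x)) (at x)"
      by (auto intro!: derivative_eq_intros)
    ultimately show ?thesis by (auto simp: real_differentiable_def)
  next
    case 2
    have "((\<lambda>x. exp (- ((1 + \<gamma> * x) powr (- 1 / \<gamma>)))) has_real_derivative
        exp (- ((1 + \<gamma> * x) powr (- 1 / \<gamma>))) * (- ((- 1 / \<gamma>) * (1 + \<gamma> * x) powr (- 1 / \<gamma> - 1) * \<gamma>))) (at x)"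
      using 2 by (auto intro!: derivative_eq_intros)
    then have "(gev_cdf \<gamma> has_real_derivative
        exp (- ((1 + \<gamma> * x) powr (- 1 / \<gamma>))) * (- ((- 1 / \<gamma>) * (1 + \<gamma> * x) powr (- 1 / \<gamma> - 1) * \<gamma>))) (at x)"
    proof (rule has_field_derivative_transform_within_open)
      show "open {x. 1 + \<gamma> * x > 0}" by (intro open_Collect_less continuous_intros)
    qed (use 2 in \<open>auto simp: gev_cdf_def\<close>)
    then show ?thesis by (auto simp: real_differentiable_def)
  next
    case 3
    have "((\<lambda>_. if \<gamma> > 0 then 0 else 1) has_real_derivative 0) (at x)" by simp
    then have "(gev_cdf \<gamma> has_real_derivative 0) (at x)"
    proof (rule has_field_derivative_transform_within_open)
      show "open {x. 1 + \<gamma> * x < 0}" by (intro open_Collect_less continuous_intros)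
    qed (use 3 in \<open>auto simp: gev_cdf_def\<close>)
    then show ?thesis by (auto simp: real_differentiable_def)
  qed
qed

text \<open>Under the quantile representation the law of a null set \<open>N\<close> is the Lebesgue measure of a subset
  of the image of \<open>N\<close> under the distribution function, which is differentiable off one point.\<close>

lemma gev_measure_null:
  assumes N: "N \<in> null_sets lborel"
  shows "N \<in> null_sets (gev_measure \<gamma>)"
proof -
  interpret G: cdf_distribution "gev_measure \<gamma>"
    unfolding cdf_distribution_def by (rule real_distribution_gev)
  let ?\<Omega> = "restrict_space lborel {0<..<1} :: real measure"
  let ?e = "- 1 / \<gamma>"
  have Nb: "N \<in> sets borel" using N by auto
  have "negligible (gev_cdf \<gamma> ` (N - {?e}))"
  proof (rule negligible_differentiable_image_negligible)
    have "negligible N"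
      using N by (simp add: negligible_iff_null_sets null_sets_completionI)
    then show "negligible (N - {?e})" by (rule negligible_diff)
    show "gev_cdf \<gamma> differentiable_on (N - {?e})"
      by (auto simp: differentiable_on_def intro: differentiable_at_withinI[OF gev_cdf_differentiable])
  qed simp
  then have neg: "negligible (insert (gev_cdf \<gamma> ?e) (gev_cdf \<gamma> ` (N - {?e})))"
    by simp
  \<comment> \<open>The image of \<open>N\<close> need not be a Borel set, so it is enclosed in a
    Borel null set before measures are compared.\<close>
  then obtain S where S: "S \<in> null_sets lborel" "insert (gev_cdf \<gamma> ?e) (gev_cdf \<gamma> ` (N - {?e})) \<subseteq> S"
    unfolding negligible_iff_null_sets null_sets_completion_iff2 by auto
  \<comment> \<open>The quantile function is a right inverse of the distribution function: one
    inequality is its definition, the other needs left continuity.\<close>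
  have inv: "gev_cdf \<gamma> (G.I \<omega>) = \<omega>" if "\<omega> \<in> {0<..<1}" for \<omega>
  proof (rule antisym)
    show "\<omega> \<le> gev_cdf \<gamma> (G.I \<omega>)"
      using G.pseudoinverse'[rule_format, OF that, of "G.I \<omega>"] by (simp add: cdf_gev)
    show "gev_cdf \<gamma> (G.I \<omega>) \<le> \<omega>"
    proof (rule tendsto_upperbound)
      show "(gev_cdf \<gamma> \<longlongrightarrow> gev_cdf \<gamma> (G.I \<omega>)) (at_left (G.I \<omega>))"
        using gev_cdf_isCont[where x = "G.I \<omega>" and \<gamma> = \<gamma>] by (simp add: isCont_def filterlim_at_split)
      have "gev_cdf \<gamma> x \<le> \<omega>" if "x < G.I \<omega>" for x
        using G.pseudoinverse'[rule_format, OF \<open>\<omega> \<in> {0<..<1}\<close>, of x] that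
        by (metis cdf_gev linorder_not_le nle_le)
      then show "\<forall>\<^sub>F x in at_left (G.I \<omega>). gev_cdf \<gamma> x \<le> \<omega>"
        by (simp add: eventually_at_filter)
    qed simp
  qed
  have "sets ?\<Omega> = sets (restrict_space borel {0<..<1})" by (rule sets_restrict_space_cong) simp
  then have CI: "G.I \<in> measurable ?\<Omega> borel"
    using G.measurable_CI measurable_cong_sets[OF _ refl] by blast
  have Sb: "S \<inter> {0<..<1} \<in> sets lborel" using S(1) by (intro sets.Int) auto
  have "emeasure (gev_measure \<gamma>) N = emeasure (distr ?\<Omega> borel G.I) N"
    by (simp add: G.distr_I_eq_M)
  also have "\<dots> = emeasure ?\<Omega> (G.I -` N \<inter> space ?\<Omega>)"
    by (rule emeasure_distr[OF CI Nb])
  also have "\<dots> \<le> emeasure ?\<Omega> (S \<inter> {0<..<1})"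
  proof (rule emeasure_mono)
    show "G.I -` N \<inter> space ?\<Omega> \<subseteq> S \<inter> {0<..<1}"
    proof
      fix \<omega> assume \<omega>: "\<omega> \<in> G.I -` N \<inter> space ?\<Omega>"
      then have "gev_cdf \<gamma> (G.I \<omega>) = \<omega>" "G.I \<omega> \<in> N" "\<omega> \<in> {0<..<1}"
        using inv by (auto simp: space_restrict_space)
      then show "\<omega> \<in> S \<inter> {0<..<1}" using S(2) by (cases "G.I \<omega> = ?e") (auto 4 4)
    qed
    show "S \<inter> {0<..<1} \<in> sets ?\<Omega>"
      using Sb by (subst sets_restrict_space_iff) auto
  qed
  also have "\<dots> = emeasure lborel (S \<inter> {0<..<1})"
    by (rule emeasure_restrict_space) (use Sb in auto)
  also have "\<dots> \<le> emeasure lborel S"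
    using S(1) by (intro emeasure_mono) auto
  also have "\<dots> = 0" using S(1) by auto
  finally show ?thesis
    using Nb by (auto simp: null_sets_def)
qed

lemma AE_gev_of_AE_lborel:
  assumes "AE x in lborel. P x"
  shows "AE x in gev_measure \<gamma>. P x"
proof -
  obtain N where "N \<in> null_sets lborel" "{x. \<not> P x} \<subseteq> N"
    using assms by (auto simp: eventually_ae_filter)
  then show ?thesis
    using gev_measure_null[of N \<gamma>] by (auto simp: eventually_ae_filter)
qed

section \<open>Uniform convergence of distribution functions\<close>

lemma kolmogorov_dist_le:
  assumes "\<And>x. \<bar>cdf \<mu> x - cdf \<nu> x\<bar> \<le> e"
  shows "kolmogorov_dist \<mu> \<nu> \<le> e"
  unfolding kolmogorov_dist_def by (rule cSUP_least) (use assms in auto)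

lemma cdf_diff_le_kolmogorov_dist:
  assumes "real_distribution \<mu>" "real_distribution \<nu>"
  shows "\<bar>cdf \<mu> x - cdf \<nu> x\<bar> \<le> kolmogorov_dist \<mu> \<nu>"
proof -
  interpret \<mu>: real_distribution \<mu> by fact
  interpret \<nu>: real_distribution \<nu> by fact
  have "bdd_above (range (\<lambda>x. \<bar>cdf \<mu> x - cdf \<nu> x\<bar>))"
  proof (rule bdd_aboveI2)
    fix x show "\<bar>cdf \<mu> x - cdf \<nu> x\<bar> \<le> 1"
      using \<mu>.cdf_nonneg[of x] \<mu>.cdf_bounded_prob[of x] \<nu>.cdf_nonneg[of x] \<nu>.cdf_bounded_prob[of x]
      by linarith
  qed
  then show ?thesis unfolding kolmogorov_dist_def by (rule cSUP_upper[OF UNIV_I])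
qed

lemma kolmogorov_dist_nonneg:
  assumes "real_distribution \<mu>" "real_distribution \<nu>"
  shows "0 \<le> kolmogorov_dist \<mu> \<nu>"
  by (rule order_trans[OF abs_ge_zero cdf_diff_le_kolmogorov_dist[OF assms]])

lemma cdf_attains:
  assumes "real_distribution N" and cont: "\<And>x. isCont (cdf N) x" and "0 < (y::real)" "y < 1"
  shows "\<exists>x. cdf N x = y"
proof -
  interpret N: real_distribution N by fact
  obtain a where a: "cdf N a < y"
    using order_tendstoD(2)[OF N.cdf_lim_at_bot \<open>0 < y\<close>] eventually_happens'[OF trivial_limit_at_bot_linorder] by blast
  obtain b where b: "y < cdf N b"
    using order_tendstoD(1)[OF N.cdf_lim_at_top_prob \<open>y < 1\<close>] eventually_happens'[OF trivial_limit_at_top_linorder] by blast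
  have "a \<le> b" using a b N.cdf_nondecreasing[of b a] by linarith
  then obtain x where "a \<le> x" "x \<le> b" "cdf N x = y"
    using IVT[of "cdf N" a y b] a b cont by auto
  then show ?thesis by blast
qed

text \<open>This is Polya's theorem. A continuous limit has quantiles at all levels
  \<open>i / K\<close>; convergence at these finitely many points, together with monotonicity of
  both distribution functions, controls every point in between.\<close>

lemma kolmogorov_dist_tendsto_0:
  assumes \<mu>: "\<And>n. real_distribution (\<mu> n)" and N: "real_distribution N"
    and cont: "\<And>x. isCont (cdf N) x" and conv: "weak_conv_m \<mu> N"
  shows "(\<lambda>n. kolmogorov_dist (\<mu> n) N) \<longlonglongrightarrow> 0"
proof (rule LIMSEQ_I)
  interpret N: real_distribution N by fact
  fix \<epsilon> :: real assume "\<epsilon> > 0"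
  \<comment> \<open>One \<open>\<epsilon> / 4\<close> pays for the spacing of the quantile levels,
    another for the convergence at the quantiles.\<close>
  obtain K :: nat where K: "K > 0" "1 / real K < \<epsilon> / 4"
    using \<open>\<epsilon> > 0\<close> by (metis divide_pos_pos nat_approx_posE zero_less_Suc zero_less_numeral)
  have "\<exists>x. cdf N x = real i / real K" if "0 < i" "i < K" for i
    using that by (intro cdf_attains N cont) auto
  then obtain X where X: "\<And>i. 0 < i \<Longrightarrow> i < K \<Longrightarrow> cdf N (X i) = real i / real K" by metis
  have "\<forall>\<^sub>F n in sequentially. \<forall>i\<in>{0<..<K}. \<bar>cdf (\<mu> n) (X i) - cdf N (X i)\<bar> < \<epsilon> / 4"
  proof (rule eventually_ball_finite)
    show "\<forall>i\<in>{0<..<K}. \<forall>\<^sub>F n in sequentially. \<bar>cdf (\<mu> n) (X i) - cdf N (X i)\<bar> < \<epsilon> / 4"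
    proof
      fix i
      have "(\<lambda>n. cdf (\<mu> n) (X i)) \<longlonglongrightarrow> cdf N (X i)"
        using conv cont by (auto simp: weak_conv_m_def weak_conv_def)
      from tendstoD[OF this, of "\<epsilon> / 4"] \<open>\<epsilon> > 0\<close>
      show "\<forall>\<^sub>F n in sequentially. \<bar>cdf (\<mu> n) (X i) - cdf N (X i)\<bar> < \<epsilon> / 4"
        by (simp add: dist_real_def)
    qed
  qed simp
  then obtain n0 where n0: "\<And>n i. n \<ge> n0 \<Longrightarrow> 0 < i \<Longrightarrow> i < K \<Longrightarrow> \<bar>cdf (\<mu> n) (X i) - cdf N (X i)\<bar> < \<epsilon> / 4"
    unfolding eventually_sequentially by (metis greaterThanLessThan_iff)
  show "\<exists>no. \<forall>n\<ge>no. norm (kolmogorov_dist (\<mu> n) N - 0) < \<epsilon>"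
  proof (intro exI allI impI)
    fix n assume n: "n \<ge> n0"
    interpret \<mu>: real_distribution "\<mu> n" by fact
    have "\<bar>cdf (\<mu> n) x - cdf N x\<bar> \<le> \<epsilon> / 2" for x
    proof -
      define y where "y = real K * cdf N x"
      have y: "cdf N x = y / real K" using K by (simp add: y_def)
      have y0: "0 \<le> y" "y \<le> real K"
        using N.cdf_nonneg[of x] N.cdf_bounded_prob[of x] K by (auto simp: y_def mult_left_le)
      have lower: "cdf N x - \<epsilon> / 2 \<le> cdf (\<mu> n) x"
      proof (cases "y \<le> 1")
        case True
        then have "cdf N x \<le> 1 / real K" unfolding y by (simp add: divide_right_mono)
        then show ?thesis using \<mu>.cdf_nonneg[of x] K \<open>\<epsilon> > 0\<close> by linarith
      next
        case False
        \<comment> \<open>The largest integer strictly below \<open>y\<close>. Strictness matters: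
          it orders the values of \<open>cdf N\<close> strictly, and only then do the arguments
          \<open>X i\<close> and \<open>x\<close> compare.\<close>
        define i where "i = nat (\<lceil>y\<rceil> - 1)"
        have i: "0 < i" "i < K" "real i < y" "y \<le> real i + 1"
          using False y0 unfolding i_def by linarith+
        have 1: "cdf N (X i) < cdf N x" using X[OF i(1,2)] i K unfolding y by (simp add: divide_strict_right_mono)
        then have "X i \<le> x" using N.cdf_nondecreasing[of x "X i"] by linarith
        then have "cdf (\<mu> n) (X i) \<le> cdf (\<mu> n) x" by (rule \<mu>.cdf_nondecreasing)
        moreover have "cdf N x \<le> cdf N (X i) + 1 / real K"
          using i X[OF i(1,2)] unfolding y by (simp add: add_divide_distrib[symmetric] divide_right_mono)
        ultimately show ?thesis using n0[OF n i(1,2)] K by linarith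
      qed
      have upper: "cdf (\<mu> n) x \<le> cdf N x + \<epsilon> / 2"
      proof (cases "y \<ge> real K - 1")
        case True
        then have "(real K - 1) / real K \<le> cdf N x" unfolding y by (simp add: divide_right_mono)
        then have "1 - 1 / real K \<le> cdf N x" using K by (simp add: diff_divide_distrib)
        then show ?thesis using \<mu>.cdf_bounded_prob[of x] K \<open>\<epsilon> > 0\<close> by linarith
      next
        case False
        define i where "i = nat (\<lfloor>y\<rfloor> + 1)"
        have i: "0 < i" "i < K" "y < real i" "real i \<le> y + 1"
          using False y0 unfolding i_def by linarith+
        have 1: "cdf N x < cdf N (X i)" using X[OF i(1,2)] i K unfolding y by (simp add: divide_strict_right_mono)
        then have "x \<le> X i" using N.cdf_nondecreasing[of "X i" x] by linarith
        then have "cdf (\<mu> n) x \<le> cdf (\<mu> n) (X i)" by (rule \<mu>.cdf_nondecreasing)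
        moreover have "cdf N (X i) \<le> cdf N x + 1 / real K"
          using i X[OF i(1,2)] unfolding y by (simp add: add_divide_distrib[symmetric] divide_right_mono)
        ultimately show ?thesis using n0[OF n i(1,2)] K by linarith
      qed
      show ?thesis using lower upper by linarith
    qed
    then have "kolmogorov_dist (\<mu> n) N \<le> \<epsilon> / 2" by (rule kolmogorov_dist_le)
    then show "norm (kolmogorov_dist (\<mu> n) N - 0) < \<epsilon>"
      using kolmogorov_dist_nonneg[OF \<mu> N, of n] \<open>\<epsilon> > 0\<close> by simp
  qed
qed

section \<open>Centred normal laws\<close>

lemma centred_normal_eq_distr:
  assumes "v > 0"
  shows "centred_normal v = distr std_normal_distribution borel (\<lambda>x. sqrt v * x)"
proof -
  interpret S: real_distribution std_normal_distribution by (rule real_dist_normal_dist)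
  have "distributed std_normal_distribution lborel (\<lambda>x. x) std_normal_density"
    by (auto simp: distributed_def intro!: distr_id2)
  then have "distributed std_normal_distribution lborel (\<lambda>x. (sqrt v * x - 0) / sqrt v) std_normal_density"
    using assms by simp
  then have "distributed std_normal_distribution lborel (\<lambda>x. sqrt v * x) (normal_density 0 (sqrt v))"
    using assms by (subst S.normal_standard_normal_convert) auto
  then have "distr std_normal_distribution lborel (\<lambda>x. sqrt v * x) = density lborel (normal_density 0 (sqrt v))"
    by (rule distributed_distr_eq_density)
  moreover have "distr std_normal_distribution lborel (\<lambda>x. sqrt v * x) = distr std_normal_distribution borel (\<lambda>x. sqrt v * x)"
    by (rule distr_cong) auto
  ultimately show ?thesis by (simp add: centred_normal_def)
qed

lemma real_distribution_centred_normal: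
  assumes "v > 0"
  shows "real_distribution (centred_normal v)"
proof -
  interpret S: real_distribution std_normal_distribution by (rule real_dist_normal_dist)
  show ?thesis unfolding centred_normal_eq_distr[OF assms] by simp
qed

lemma char_centred_normal:
  assumes "v > 0"
  shows "char (centred_normal v) t = complex_of_real (exp (- (v * t\<^sup>2) / 2))"
proof -
  have "char (centred_normal v) t = char std_normal_distribution (sqrt v * t)"
    unfolding centred_normal_eq_distr[OF assms] char_def
    by (subst integral_distr) (auto simp: mult_ac)
  also have "\<dots> = complex_of_real (exp (- (v * t\<^sup>2) / 2))"
    using assms by (simp add: char_std_normal_distribution power_mult_distrib)
  finally show ?thesis .
qed

lemma isCont_cdf_centred_normal:
  assumes "v > 0"
  shows "isCont (cdf (centred_normal v)) x"
proof -
  interpret C: real_distribution "centred_normal v" by (rule real_distribution_centred_normal[OF assms])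
  have "AE y in lborel. y \<in> {x} \<longrightarrow> ennreal (normal_density 0 (sqrt v) y) = 0"
    using AE_lborel_singleton[of x] by eventually_elim simp
  then have "emeasure (centred_normal v) {x} = 0"
    unfolding centred_normal_def
    by (subst emeasure_density) (auto simp: nn_integral_0_iff_AE intro!: AE_I2 split: split_indicator elim!: eventually_mono)
  then show ?thesis by (simp add: C.isCont_cdf measure_def)
qed

text \<open>The point mass at zero plays the part of the centred normal law with variance
  zero.\<close>

lemma char_return_0: "char (return borel 0) t = 1"
  by (simp add: char_def integral_return)

section \<open>The multinomial distribution\<close>

text \<open>Extensional functions with bounded values form a finite set on which equality of count
  vectors is plain equality of functions.\<close>

definition compositions :: "'i set \<Rightarrow> nat \<Rightarrow> ('i \<Rightarrow> nat) set" where
  "compositions I m = {w \<in> I \<rightarrow>\<^sub>E {..m}. sum w I = m}"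

lemma finite_compositions: "finite I \<Longrightarrow> finite (compositions I m)"
  unfolding compositions_def by (rule finite_subset[of _ "I \<rightarrow>\<^sub>E {..m}"]) (auto intro: finite_PiE)

lemma compositionsI:
  assumes "finite I" "w \<in> extensional I" "sum w I = m"
  shows "w \<in> compositions I m"
  using assms member_le_sum[of _ I w] by (auto simp: compositions_def PiE_def)

text \<open>Dividing by factorials turns both sides into coefficients of exponential series, which
  multiply over the index set. The induction step is therefore the binomial identity for the
  exponential series.\<close>

lemma multinomial_theorem_fact:
  fixes x :: "'i \<Rightarrow> 'a :: {real_normed_field, banach}"
  assumes "finite I"
  shows "(\<Sum>i\<in>I. x i) ^ m /\<^sub>R fact m = (\<Sum>w\<in>compositions I m. \<Prod>i\<in>I. x i ^ w i /\<^sub>R fact (w i))"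
  using assms
proof (induction I arbitrary: m rule: finite_induct)
  case empty
  have "compositions ({} :: 'i set) m = (if m = 0 then {\<lambda>_. undefined} else {})"
    by (auto simp: compositions_def)
  then show ?case by (cases "m = 0") (simp_all add: power_0_left)
next
  case (insert j I)
  have "(\<Sum>i\<in>insert j I. x i) ^ m /\<^sub>R fact m
      = (\<Sum>l\<le>m. (x j ^ l /\<^sub>R fact l) * ((\<Sum>i\<in>I. x i) ^ (m - l) /\<^sub>R fact (m - l)))"
    using insert.hyps by (simp add: exp_series_add_commuting mult.commute)
  also have "\<dots> = (\<Sum>l\<le>m. \<Sum>w\<in>compositions I (m - l). (x j ^ l /\<^sub>R fact l) * (\<Prod>i\<in>I. x i ^ w i /\<^sub>R fact (w i)))"
    by (simp only: insert.IH sum_distrib_left)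
  also have "\<dots> = (\<Sum>(l, w)\<in>(SIGMA l:{..m}. compositions I (m - l)). (x j ^ l /\<^sub>R fact l) * (\<Prod>i\<in>I. x i ^ w i /\<^sub>R fact (w i)))"
    by (subst sum.Sigma) (auto simp: finite_compositions insert.hyps)
  also have "\<dots> = (\<Sum>w\<in>compositions (insert j I) m. \<Prod>i\<in>insert j I. x i ^ w i /\<^sub>R fact (w i))"
  \<comment> \<open>A composition over \<open>insert j I\<close> splits into its value at
    \<open>j\<close> and the remainder; resetting the value at \<open>j\<close> to
    \<open>undefined\<close> keeps the remainder extensional.\<close>
  proof (rule sum.reindex_bij_witness[where i = "\<lambda>w. (w j, w(j := undefined))" and j = "\<lambda>(l, w). w(j := l)"])
    fix a assume "a \<in> (SIGMA l:{..m}. compositions I (m - l))"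
    then obtain l w where a: "a = (l, w)" "l \<le> m" "w \<in> compositions I (m - l)" by auto
    have w: "w j = undefined" "w \<in> extensional I" "sum w I = m - l"
      using a(3) insert.hyps by (auto simp: compositions_def PiE_def extensional_def)
    have s: "(\<Sum>i\<in>I. (w(j := l)) i) = sum w I"
      using insert.hyps by (intro sum.cong) auto
    show "(\<lambda>w. (w j, w(j := undefined))) ((\<lambda>(l, w). w(j := l)) a) = a"
      using a w by (auto simp: fun_eq_iff)
    show "(\<lambda>(l, w). w(j := l)) a \<in> compositions (insert j I) m"
      using a w s insert.hyps by (auto intro!: compositionsI simp: extensional_def)
    have p: "(\<Prod>i\<in>I. x i ^ (w(j := l)) i /\<^sub>R fact ((w(j := l)) i)) = (\<Prod>i\<in>I. x i ^ w i /\<^sub>R fact (w i))"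
      using insert.hyps by (intro prod.cong) auto
    show "(\<Prod>i\<in>insert j I. x i ^ ((\<lambda>(l, w). w(j := l)) a) i /\<^sub>R fact (((\<lambda>(l, w). w(j := l)) a) i)) =
          (case a of (l, w) \<Rightarrow> (x j ^ l /\<^sub>R fact l) * (\<Prod>i\<in>I. x i ^ w i /\<^sub>R fact (w i)))"
      using a p insert.hyps by simp
  next
    fix w assume w: "w \<in> compositions (insert j I) m"
    then have w': "w \<in> extensional (insert j I)" "w j + sum w I = m"
      using insert.hyps by (auto simp: compositions_def PiE_def)
    have s: "(\<Sum>i\<in>I. (w(j := undefined)) i) = sum w I"
      using insert.hyps by (intro sum.cong) auto
    show "(\<lambda>(l, w). w(j := l)) ((\<lambda>w. (w j, w(j := undefined))) w) = w" by auto
    show "(\<lambda>w. (w j, w(j := undefined))) w \<in> (SIGMA l:{..m}. compositions I (m - l))"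
      using w' s insert.hyps by (auto intro!: compositionsI simp: extensional_def)
  qed
  finally show ?case .
qed

lemma multinomial_theorem:
  fixes x :: "'i \<Rightarrow> 'a :: {real_normed_field, banach}"
  assumes "finite I"
  shows "(\<Sum>w\<in>compositions I m. (fact m / (\<Prod>i\<in>I. fact (w i))) *\<^sub>R (\<Prod>i\<in>I. x i ^ w i)) = (\<Sum>i\<in>I. x i) ^ m"
proof -
  have "(\<Prod>i\<in>I. x i ^ w i /\<^sub>R fact (w i)) = (1 / (\<Prod>i\<in>I. fact (w i))) *\<^sub>R (\<Prod>i\<in>I. x i ^ w i)" for w
    using assms by (induction I rule: finite_induct) (simp_all add: field_simps)
  then have "fact m *\<^sub>R ((\<Sum>i\<in>I. x i) ^ m /\<^sub>R fact m) =
    (\<Sum>w\<in>compositions I m. (fact m / (\<Prod>i\<in>I. fact (w i))) *\<^sub>R (\<Prod>i\<in>I. x i ^ w i))"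
    by (simp only: multinomial_theorem_fact[OF assms] scaleR_sum_right scaleR_scaleR) simp
  then show ?thesis by simp
qed

definition multinomial_weight :: "'i set \<Rightarrow> nat \<Rightarrow> ('i \<Rightarrow> real) \<Rightarrow> ('i \<Rightarrow> nat) \<Rightarrow> real" where
  "multinomial_weight I m p w = fact m / (\<Prod>i\<in>I. fact (w i)) * (\<Prod>i\<in>I. p i ^ w i)"

locale multinomial_vector = prob_space M
  for M :: "'a measure" and I :: "'i set" and m :: nat and p :: "'i \<Rightarrow> real" and W :: "'i \<Rightarrow> 'a \<Rightarrow> nat" +
  assumes multinomial: "multinomial M I m p W" and finite_I: "finite I" and sum_p: "sum p I = 1"
begin

abbreviation count_vec :: "'a \<Rightarrow> 'i \<Rightarrow> nat" where
  "count_vec x \<equiv> \<lambda>i\<in>I. W i x"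

lemma W_measurable [measurable]: "i \<in> I \<Longrightarrow> W i \<in> measurable M (count_space UNIV)"
  using multinomial by (simp add: multinomial_def)

lemma count_vec_sets: "{x \<in> space M. \<forall>i\<in>I. W i x = w i} \<in> events"
  using finite_I by measurable

lemma count_vec_eq_iff: "w \<in> compositions I m \<Longrightarrow> count_vec x = w \<longleftrightarrow> (\<forall>i\<in>I. W i x = w i)"
  by (auto simp: compositions_def fun_eq_iff PiE_def extensional_def)

lemma prob_count_vec:
  assumes "w \<in> compositions I m"
  shows "prob {x \<in> space M. count_vec x = w} = multinomial_weight I m p w"
proof -
  have "prob {x \<in> space M. \<forall>i\<in>I. W i x = w i} = multinomial_weight I m p w"
    using multinomial assms unfolding multinomial_def multinomial_weight_def compositions_def by auto
  then show ?thesis by (simp add: count_vec_eq_iff[OF assms])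
qed

lemma count_vec_events [measurable]: "w \<in> compositions I m \<Longrightarrow> {x \<in> space M. count_vec x = w} \<in> events"
  using count_vec_sets[of w] by (simp add: count_vec_eq_iff)

text \<open>The point masses prescribed by \<open>multinomial\<close> already add up to
  \<open>(sum p I) ^ m = 1\<close> by the multinomial theorem, so no mass is left for other
  values.\<close>

lemma AE_count_vec: "AE x in M. count_vec x \<in> compositions I m"
proof -
  let ?C = "compositions I m"
  have "prob (\<Union>w\<in>?C. {x \<in> space M. count_vec x = w}) = (\<Sum>w\<in>?C. prob {x \<in> space M. count_vec x = w})"
    by (intro finite_measure_finite_Union finite_compositions finite_I)
      (auto simp: disjoint_family_on_def)
  also have "\<dots> = (\<Sum>w\<in>?C. (fact m / (\<Prod>i\<in>I. fact (w i))) *\<^sub>R (\<Prod>i\<in>I. p i ^ w i))"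
    by (intro sum.cong) (auto simp: prob_count_vec multinomial_weight_def)
  also have "\<dots> = 1" by (simp only: multinomial_theorem[OF finite_I] sum_p power_one)
  finally have "AE x in M. x \<in> (\<Union>w\<in>?C. {x \<in> space M. count_vec x = w})"
    by (intro AE_prob_1) 
  then show ?thesis by eventually_elim auto
qed

lemma AE_sum_W: "AE x in M. (\<Sum>i\<in>I. W i x) = m"
  using AE_count_vec by eventually_elim (simp add: compositions_def)

lemma expectation_count_vec:
  fixes f :: "('i \<Rightarrow> nat) \<Rightarrow> 'b :: {banach, second_countable_topology}"
  shows "(\<integral>x. f (count_vec x) \<partial>M) = (\<Sum>w\<in>compositions I m. multinomial_weight I m p w *\<^sub>R f w)"
proof -
  let ?C = "compositions I m"
  let ?E = "\<lambda>w. {x \<in> space M. count_vec x = w}"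
  have "(\<integral>x. f (count_vec x) \<partial>M) = (\<integral>x. (\<Sum>w\<in>?C. indicator (?E w) x *\<^sub>R f w) \<partial>M)"
  proof (rule integral_cong_AE)
    have eq: "f (count_vec x) = (\<Sum>w\<in>?C. indicator (?E w) x *\<^sub>R f w)" if "count_vec x \<in> ?C" "x \<in> space M" for x
    proof -
      have "(\<Sum>w\<in>?C. indicator (?E w) x *\<^sub>R f w) = (\<Sum>w\<in>?C. if w = count_vec x then f w else 0)"
        using that(2) by (intro sum.cong) auto
      then show ?thesis using that finite_compositions[OF finite_I] by simp
    qed
    show "AE x in M. f (count_vec x) = (\<Sum>w\<in>?C. indicator (?E w) x *\<^sub>R f w)"
      using AE_count_vec AE_space by eventually_elim (rule eq)
    have "count_vec \<in> measurable M (Pi\<^sub>M I (\<lambda>_. count_space UNIV))" by measurable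
    moreover have "Pi\<^sub>M I (\<lambda>_. count_space (UNIV :: nat set)) = count_space (I \<rightarrow>\<^sub>E UNIV)"
      by (rule count_space_PiM_finite) (auto simp: finite_I)
    ultimately show "(\<lambda>x. f (count_vec x)) \<in> borel_measurable M"
      using measurable_compose[of count_vec M "count_space (I \<rightarrow>\<^sub>E UNIV)" f borel] by simp
    show "(\<lambda>x. \<Sum>w\<in>?C. indicator (?E w) x *\<^sub>R f w) \<in> borel_measurable M" by measurable
  qed
  also have "\<dots> = (\<Sum>w\<in>?C. (\<integral>x. indicator (?E w) x *\<^sub>R f w \<partial>M))"
    by (intro Bochner_Integration.integral_sum integrable_scaleR_left) (auto intro!: integrable_real_indicator simp: emeasure_eq_measure)
  also have "\<dots> = (\<Sum>w\<in>?C. multinomial_weight I m p w *\<^sub>R f w)"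
  proof (intro sum.cong refl)
    fix w assume w: "w \<in> ?C"
    have "integrable M (indicat_real (?E w))"
      using w by (intro integrable_real_indicator) (auto simp: emeasure_eq_measure)
    then have "(\<integral>x. indicator (?E w) x *\<^sub>R f w \<partial>M) = (\<integral>x. indicator (?E w) x \<partial>M) *\<^sub>R f w"
      by simp
    also have "(\<integral>x. indicator (?E w) x \<partial>M) = prob (?E w)"
      using w by (subst Bochner_Integration.integral_indicator) (auto intro!: arg_cong[where f = prob])
    finally show "(\<integral>x. indicator (?E w) x *\<^sub>R f w \<partial>M) = multinomial_weight I m p w *\<^sub>R f w"
      by (simp only: prob_count_vec[OF w])
  qed
  finally show ?thesis .
qed

text \<open>The exponential of the linear form is a product of powers, so the expectation is a
  multinomial sum in the numbers \<open>p i * exp (i t c i)\<close>. No representation by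
  independent draws is constructed.\<close>

lemma char_linear_combination:
  "char (distr M borel (\<lambda>x. \<Sum>i\<in>I. real (W i x) * c i)) t = (\<Sum>i\<in>I. p i *\<^sub>R iexp (t * c i)) ^ m"
proof -
  have "char (distr M borel (\<lambda>x. \<Sum>i\<in>I. real (W i x) * c i)) t = (\<integral>x. iexp (t * (\<Sum>i\<in>I. real (W i x) * c i)) \<partial>M)"
    unfolding char_def by (subst integral_distr) auto
  also have "\<dots> = (\<integral>x. (\<lambda>w. iexp (t * (\<Sum>i\<in>I. real (w i) * c i))) (count_vec x) \<partial>M)"
    by (intro Bochner_Integration.integral_cong refl) simp
  also have "\<dots> = (\<Sum>w\<in>compositions I m. multinomial_weight I m p w *\<^sub>R iexp (t * (\<Sum>i\<in>I. real (w i) * c i)))"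
    by (rule expectation_count_vec)
  also have "\<dots> = (\<Sum>w\<in>compositions I m. (fact m / (\<Prod>i\<in>I. fact (w i))) *\<^sub>R (\<Prod>i\<in>I. (p i *\<^sub>R iexp (t * c i)) ^ w i))"
  proof (intro sum.cong refl)
    fix w
    have "iexp (t * (\<Sum>i\<in>I. real (w i) * c i)) = exp (\<Sum>i\<in>I. of_nat (w i) * (\<i> * complex_of_real (t * c i)))"
      by (simp add: sum_distrib_left mult_ac)
    also have "\<dots> = (\<Prod>i\<in>I. iexp (t * c i) ^ w i)"
      by (simp add: exp_sum finite_I exp_of_nat_mult)
    finally have e: "iexp (t * (\<Sum>i\<in>I. real (w i) * c i)) = (\<Prod>i\<in>I. iexp (t * c i) ^ w i)" .
    show "multinomial_weight I m p w *\<^sub>R iexp (t * (\<Sum>i\<in>I. real (w i) * c i)) =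
       (fact m / (\<Prod>i\<in>I. fact (w i))) *\<^sub>R (\<Prod>i\<in>I. (p i *\<^sub>R iexp (t * c i)) ^ w i)"
      unfolding e multinomial_weight_def
      by (simp add: scaleR_conv_of_real power_mult_distrib prod.distrib mult_ac)
  qed
  also have "\<dots> = (\<Sum>i\<in>I. p i *\<^sub>R iexp (t * c i)) ^ m" by (rule multinomial_theorem[OF finite_I])
  finally show ?thesis .
qed

end

section \<open>A quantitative central limit theorem for resampling\<close>

lemma exp_minus_approx:
  assumes "y \<ge> 0"
  shows "\<bar>exp (- y) - (1 - y)\<bar> \<le> (y::real)\<^sup>2"
proof -
  have "1 - y \<le> exp (- y)" using exp_ge_add_one_self[of "- y"] by simp
  moreover have "exp (- y) \<le> 1 - y + y\<^sup>2"
  proof -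
    have "exp (- y) \<le> 1 / (1 + y)"
      using exp_ge_add_one_self[of y] assms by (simp add: exp_minus inverse_eq_divide frac_le)
    also have "\<dots> \<le> 1 - y + y\<^sup>2"
    proof -
      have "1 \<le> (1 - y + y\<^sup>2) * (1 + y)"
        using assms by (simp add: algebra_simps power2_eq_square)
      then show ?thesis using assms by (simp add: pos_divide_le_eq)
    qed
    finally show ?thesis .
  qed
  ultimately show ?thesis by (simp add: abs_le_iff)
qed

text \<open>For \<open>|x| \<le> 1\<close> the cubic Taylor remainder is the better one, for larger
  \<open>|x|\<close> the quadratic one; a power between 2 and 3 dominates both. This is the origin
  of the upper limit 3 on the moment exponent.\<close>

lemma iexp_approx_powr:
  assumes "2 \<le> p" "p \<le> 3"
  shows "cmod (iexp x - (1 + \<i> * x - complex_of_real (x\<^sup>2 / 2))) \<le> \<bar>x\<bar> powr p"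
proof -
  have e: "(\<Sum>k\<le>2. (\<i> * complex_of_real x) ^ k / fact k) = 1 + \<i> * x - complex_of_real (x\<^sup>2 / 2)"
    by (simp add: numeral_2_eq_2 complex_eq_iff)
  show ?thesis
  proof (cases "\<bar>x\<bar> \<le> 1")
    case True
    have "cmod (iexp x - (1 + \<i> * x - complex_of_real (x\<^sup>2 / 2))) \<le> \<bar>x\<bar> ^ 3 / 6"
      using iexp_approx1[of x 2] unfolding e by (simp add: numeral_3_eq_3)
    also have "\<dots> \<le> \<bar>x\<bar> ^ 3" by simp
    also have "\<dots> \<le> \<bar>x\<bar> powr p"
    proof (cases "x = 0")
      case False
      then have "\<bar>x\<bar> ^ 3 = \<bar>x\<bar> powr 3" by simp
      also have "\<dots> \<le> \<bar>x\<bar> powr p" using True False assms by (intro powr_mono') auto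
      finally show ?thesis .
    qed simp
    finally show ?thesis .
  next
    case False
    have "cmod (iexp x - (1 + \<i> * x - complex_of_real (x\<^sup>2 / 2))) \<le> \<bar>x\<bar> ^ 2"
      using iexp_approx2[of x 2] unfolding e by (simp add: numeral_2_eq_2)
    also have "\<dots> = \<bar>x\<bar> powr 2" using False by simp
    also have "\<dots> \<le> \<bar>x\<bar> powr p" using False assms by (intro powr_mono) auto
    finally show ?thesis .
  qed
qed

text \<open>The sum of the \<open>p\<close>-th absolute moments of \<open>m\<close> independent
  summands, each uniform on the values \<open>c i / sqrt m\<close>.\<close>

definition lyapunov_ratio :: "real \<Rightarrow> nat \<Rightarrow> (nat \<Rightarrow> real) \<Rightarrow> real" where
  "lyapunov_ratio p m c = real m powr (1 - p / 2) * ((\<Sum>i=1..m. \<bar>c i\<bar> powr p) / real m)"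

definition mean_square :: "nat \<Rightarrow> (nat \<Rightarrow> real) \<Rightarrow> real" where
  "mean_square m c = (\<Sum>i=1..m. (c i)\<^sup>2) / real m"

text \<open>The law with characteristic function \<open>t \<mapsto> (m\<^sup>-\<^sup>1 \<Sum> exp (i t c\<^sub>i / \<surd>m))\<^sup>m\<close> is that of the
  normalised sum of \<open>m\<close> independent uniform draws from \<open>c\<^sub>1, \<dots>, c\<^sub>m\<close>.\<close>

definition resample_law :: "real measure \<Rightarrow> nat \<Rightarrow> (nat \<Rightarrow> real) \<Rightarrow> bool" where
  "resample_law \<mu> m c \<longleftrightarrow> real_distribution \<mu> \<and> m > 0 \<and> (\<Sum>i=1..m. c i) = 0 \<and>
    (\<forall>t. char \<mu> t = (\<Sum>i=1..m. (1 / real m) *\<^sub>R iexp (t * (c i / sqrt (real m)))) ^ m)"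

text \<open>Both terms are \<open>m\<close>-th powers of numbers in the unit disc, so their distance
  is at most \<open>m\<close> times the distance of the bases. The linear Taylor term cancels
  because the \<open>c i\<close> sum to zero, and the quadratic one is the variance.\<close>

lemma resample_law_char_bound:
  assumes \<mu>: "resample_law \<mu> m c" and p: "2 \<le> p" "p \<le> 3"
  shows "cmod (char \<mu> t - complex_of_real (exp (- (t\<^sup>2 * mean_square m c / 2))))
    \<le> \<bar>t\<bar> powr p * lyapunov_ratio p m c + (t\<^sup>2 * mean_square m c / 2)\<^sup>2 / real m"
proof -
  have m: "m > 0" and c0: "(\<Sum>i=1..m. c i) = 0"
    and ch: "char \<mu> t = (\<Sum>i=1..m. (1 / real m) *\<^sub>R iexp (t * (c i / sqrt (real m)))) ^ m"
    using \<mu> by (auto simp: resample_law_def)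
  define v where "v = mean_square m c"
  define x where "x i = t * (c i / sqrt (real m))" for i
  define y where "y = t\<^sup>2 * v / 2 / real m"
  have v0: "v \<ge> 0" by (simp add: v_def mean_square_def sum_nonneg)
  then have y0: "y \<ge> 0" by (simp add: y_def)
  define z where "z = (\<Sum>i=1..m. (1 / real m) *\<^sub>R iexp (x i))"
  have "cmod z \<le> (\<Sum>i=1..m. cmod ((1 / real m) *\<^sub>R iexp (x i)))" unfolding z_def by (rule norm_sum)
  also have "\<dots> = 1" using m by simp
  finally have z1: "cmod z \<le> 1" .
  have sx: "(\<Sum>i=1..m. x i) = 0"
    unfolding x_def using c0 by (simp flip: sum_distrib_left sum_divide_distrib)
  have sx2: "(\<Sum>i=1..m. (x i)\<^sup>2) = t\<^sup>2 * v"
    unfolding x_def v_def mean_square_def using m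
    by (simp add: power_mult_distrib power_divide flip: sum_distrib_left sum_divide_distrib)
  have "(\<Sum>i=1..m. (1 / real m) *\<^sub>R (1 + \<i> * x i - complex_of_real ((x i)\<^sup>2 / 2)))
      = (1 / real m) *\<^sub>R (real m + \<i> * complex_of_real (\<Sum>i=1..m. x i) - complex_of_real ((\<Sum>i=1..m. (x i)\<^sup>2) / 2))"
    by (simp add: sum.distrib sum_subtractf sum_distrib_left sum_divide_distrib flip: scaleR_sum_right)
  also have "\<dots> = complex_of_real (1 - y)"
    unfolding sx sx2 y_def using m by (simp add: scaleR_conv_of_real field_simps)
  finally have lin: "complex_of_real (1 - y) = (\<Sum>i=1..m. (1 / real m) *\<^sub>R (1 + \<i> * x i - complex_of_real ((x i)\<^sup>2 / 2)))" ..
  have "cmod (z - complex_of_real (1 - y))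
      = cmod (\<Sum>i=1..m. (1 / real m) *\<^sub>R (iexp (x i) - (1 + \<i> * x i - complex_of_real ((x i)\<^sup>2 / 2))))"
    unfolding lin z_def by (simp only: scaleR_diff_right sum_subtractf)
  also have "\<dots> \<le> (\<Sum>i=1..m. cmod ((1 / real m) *\<^sub>R (iexp (x i) - (1 + \<i> * x i - complex_of_real ((x i)\<^sup>2 / 2)))))"
    by (rule norm_sum)
  also have "\<dots> \<le> (\<Sum>i=1..m. (1 / real m) * \<bar>x i\<bar> powr p)"
    unfolding norm_scaleR by (intro sum_mono mult_mono iexp_approx_powr p) auto
  also have "\<dots> = \<bar>t\<bar> powr p * lyapunov_ratio p m c / real m"
  proof -
    have "\<bar>x i\<bar> powr p = \<bar>t\<bar> powr p * real m powr (- p / 2) * \<bar>c i\<bar> powr p" for i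
    proof -
      have "\<bar>x i\<bar> = \<bar>t\<bar> * (\<bar>c i\<bar> / sqrt (real m))" by (simp add: x_def abs_mult)
      then have "\<bar>x i\<bar> powr p = \<bar>t\<bar> powr p * (\<bar>c i\<bar> powr p / sqrt (real m) powr p)"
        by (simp only: powr_mult powr_divide)
      also have "sqrt (real m) powr p = real m powr (p / 2)"
        by (simp add: powr_half_sqrt[symmetric] powr_powr)
      finally show ?thesis by (simp add: powr_minus divide_simps)
    qed
    then have "(\<Sum>i=1..m. (1 / real m) * \<bar>x i\<bar> powr p)
      = \<bar>t\<bar> powr p * (real m powr (- p / 2) * (\<Sum>i=1..m. \<bar>c i\<bar> powr p) / real m)"
      by (simp add: sum_distrib_left sum_divide_distrib mult_ac)
    also have "real m powr (- p / 2) = real m powr (1 - p / 2) / real m"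
      using m powr_diff[of "real m" "1 - p / 2" 1] by simp
    finally show ?thesis by (simp add: lyapunov_ratio_def)
  qed
  finally have b1: "cmod (z - complex_of_real (1 - y)) \<le> \<bar>t\<bar> powr p * lyapunov_ratio p m c / real m" .
  \<comment> \<open>The passage from \<open>1 - y\<close> to \<open>exp (- y)\<close> is needed
    before taking powers: \<open>1 - y\<close> may lie outside the unit disc,
    \<open>exp (- y)\<close> does not.\<close>
  have b2: "cmod (complex_of_real (exp (- y)) - complex_of_real (1 - y)) \<le> y\<^sup>2"
    using exp_minus_approx[OF y0] by (simp only: norm_of_real flip: of_real_diff)
  have b3: "cmod (z - complex_of_real (exp (- y))) \<le> \<bar>t\<bar> powr p * lyapunov_ratio p m c / real m + y\<^sup>2"
    using norm_triangle_ineq4[of "z - complex_of_real (1 - y)" "complex_of_real (exp (- y)) - complex_of_real (1 - y)"] b1 b2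
    by simp
  have "exp (- (t\<^sup>2 * v / 2)) = exp (- y) ^ m"
    unfolding y_def using m by (simp add: exp_of_nat_mult[symmetric])
  then have "cmod (char \<mu> t - complex_of_real (exp (- (t\<^sup>2 * v / 2)))) = cmod (z ^ m - complex_of_real (exp (- y)) ^ m)"
    by (simp add: ch z_def x_def)
  also have "\<dots> \<le> real m * cmod (z - complex_of_real (exp (- y)))"
    by (rule norm_power_diff) (use z1 y0 in auto)
  also have "\<dots> \<le> real m * (\<bar>t\<bar> powr p * lyapunov_ratio p m c / real m + y\<^sup>2)"
    by (intro mult_left_mono b3) auto
  also have "\<dots> = \<bar>t\<bar> powr p * lyapunov_ratio p m c + (t\<^sup>2 * v / 2)\<^sup>2 / real m"
    using m by (simp add: y_def field_simps power2_eq_square)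
  finally show ?thesis by (simp add: v_def)
qed

text \<open>Specifying \<open>N\<close> by its characteristic function alone covers
  \<open>\<sigma> = 0\<close>, where the limit has no density.\<close>

lemma resample_law_weak_conv:
  assumes \<mu>: "\<And>j. resample_law (\<mu> j) (m j) (c j)" and p: "2 \<le> p" "p \<le> 3"
    and m: "(\<lambda>j. 1 / real (m j)) \<longlonglongrightarrow> 0"
    and v: "(\<lambda>j. mean_square (m j) (c j)) \<longlonglongrightarrow> \<sigma>"
    and L: "(\<lambda>j. lyapunov_ratio p (m j) (c j)) \<longlonglongrightarrow> 0"
    and N: "real_distribution N" "\<And>t. char N t = complex_of_real (exp (- (\<sigma> * t\<^sup>2) / 2))"
  shows "weak_conv_m \<mu> N"
proof (rule levy_continuity)
  show "real_distribution (\<mu> j)" for j using \<mu> by (auto simp: resample_law_def)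
  show "real_distribution N" by fact
  fix t
  let ?v = "\<lambda>j. mean_square (m j) (c j)"
  have "(\<lambda>j. \<bar>t\<bar> powr p * lyapunov_ratio p (m j) (c j) + (t\<^sup>2 * ?v j / 2)\<^sup>2 * (1 / real (m j)))
     \<longlonglongrightarrow> \<bar>t\<bar> powr p * 0 + (t\<^sup>2 * \<sigma> / 2)\<^sup>2 * 0"
    by (intro tendsto_intros m v L) auto
  then have "(\<lambda>j. \<bar>t\<bar> powr p * lyapunov_ratio p (m j) (c j) + (t\<^sup>2 * ?v j / 2)\<^sup>2 / real (m j)) \<longlonglongrightarrow> 0"
    by simp
  then have "(\<lambda>j. char (\<mu> j) t - complex_of_real (exp (- (t\<^sup>2 * ?v j / 2)))) \<longlonglongrightarrow> 0"
    by (rule Lim_null_comparison[rotated]) (intro always_eventually allI resample_law_char_bound \<mu> p)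
  moreover have "(\<lambda>j. complex_of_real (exp (- (t\<^sup>2 * ?v j / 2)))) \<longlonglongrightarrow> complex_of_real (exp (- (t\<^sup>2 * \<sigma> / 2)))"
    by (intro tendsto_intros v) auto
  ultimately have "(\<lambda>j. (char (\<mu> j) t - complex_of_real (exp (- (t\<^sup>2 * ?v j / 2)))) + complex_of_real (exp (- (t\<^sup>2 * ?v j / 2))))
     \<longlonglongrightarrow> 0 + complex_of_real (exp (- (t\<^sup>2 * \<sigma> / 2)))"
    by (rule tendsto_add)
  then show "(\<lambda>j. char (\<mu> j) t) \<longlonglongrightarrow> char N t"
    by (simp add: N(2) mult.commute)
qed

text \<open>Along any sequence the weak limit is the same, so by contradiction the convergence is uniform
  over all resampling laws whose size, variance and Lyapunov ratio are within \<open>\<delta>\<close> of their limits.\<close>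

lemma resample_law_uniform:
  assumes p: "2 \<le> p" "p \<le> 3"
    and N: "real_distribution N" "\<And>t. char N t = complex_of_real (exp (- (\<sigma> * t\<^sup>2) / 2))"
    and D: "\<And>\<mu>. (\<And>j. real_distribution (\<mu> j)) \<Longrightarrow> weak_conv_m \<mu> N \<Longrightarrow> (\<lambda>j. D (\<mu> j)) \<longlonglongrightarrow> (0::real)"
    and "\<epsilon> > 0"
  shows "\<exists>\<delta>>0. \<forall>\<mu> m c. resample_law \<mu> m c \<longrightarrow> 1 / real m < \<delta> \<longrightarrow> \<bar>mean_square m c - \<sigma>\<bar> < \<delta> \<longrightarrow>
    lyapunov_ratio p m c < \<delta> \<longrightarrow> D \<mu> < \<epsilon>"
proof (rule ccontr)
  assume "\<not> ?thesis"
  then have "\<forall>\<delta>>0. \<exists>\<mu> m c. resample_law \<mu> m c \<and> 1 / real m < \<delta> \<and> \<bar>mean_square m c - \<sigma>\<bar> < \<delta> \<and>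
    lyapunov_ratio p m c < \<delta> \<and> D \<mu> \<ge> \<epsilon>"
    by (meson linorder_not_less)
  then have "\<forall>j. \<exists>\<mu> m c. resample_law \<mu> m c \<and> 1 / real m < inverse (real (Suc j)) \<and>
    \<bar>mean_square m c - \<sigma>\<bar> < inverse (real (Suc j)) \<and>
    lyapunov_ratio p m c < inverse (real (Suc j)) \<and> D \<mu> \<ge> \<epsilon>"
    by (metis inverse_positive_iff_positive of_nat_0_less_iff zero_less_Suc)
  then obtain \<mu> m c where H: "\<And>j. resample_law (\<mu> j) (m j) (c j)" "\<And>j. 1 / real (m j) < inverse (real (Suc j))"
    "\<And>j. \<bar>mean_square (m j) (c j) - \<sigma>\<bar> < inverse (real (Suc j))"
    "\<And>j. lyapunov_ratio p (m j) (c j) < inverse (real (Suc j))" "\<And>j. D (\<mu> j) \<ge> \<epsilon>"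
    by metis
  have "(\<lambda>j. mean_square (m j) (c j) - \<sigma>) \<longlonglongrightarrow> 0"
    by (rule Lim_null_comparison[OF _ LIMSEQ_inverse_real_of_nat])
      (use H(3) in \<open>auto intro!: always_eventually less_imp_le\<close>)
  moreover have "(\<lambda>j. 1 / real (m j)) \<longlonglongrightarrow> 0"
    by (rule Lim_null_comparison[OF _ LIMSEQ_inverse_real_of_nat])
      (use H(2) in \<open>auto intro!: always_eventually less_imp_le\<close>)
  moreover have "(\<lambda>j. lyapunov_ratio p (m j) (c j)) \<longlonglongrightarrow> 0"
    by (rule Lim_null_comparison[OF _ LIMSEQ_inverse_real_of_nat])
      (use H(4) in \<open>auto intro!: always_eventually less_imp_le simp: lyapunov_ratio_def sum_nonneg\<close>)
  ultimately have "weak_conv_m \<mu> N"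
    by (intro resample_law_weak_conv[OF H(1) p _ _ _ N]) (auto simp: LIM_zero_iff)
  then have "(\<lambda>j. D (\<mu> j)) \<longlonglongrightarrow> 0"
    using H(1) by (intro D) (auto simp: resample_law_def)
  then show False
    using H(5) \<open>\<epsilon> > 0\<close> LIMSEQ_le_const[of "\<lambda>j. D (\<mu> j)" 0 \<epsilon>] by auto
qed

text \<open>Zero lies off the boundary of the tail set, which is thus a continuity set of the point
  mass.\<close>

lemma tail_tendsto_0_of_weak_conv_return:
  assumes "\<And>j. real_distribution (\<mu> j)" "weak_conv_m \<mu> (return borel 0)" "\<delta> > (0::real)"
  shows "(\<lambda>j. measure (\<mu> j) {y. \<bar>y\<bar> > \<delta>}) \<longlonglongrightarrow> 0"
proof -
  interpret R: prob_space "return borel (0::real)" by (rule prob_space_return) simp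
  have R: "real_distribution (return borel (0::real))" by standard auto
  have o: "open {y::real. \<bar>y\<bar> > \<delta>}" by (intro open_Collect_less continuous_intros)
  have "(\<lambda>j. measure (\<mu> j) {y. \<bar>y\<bar> > \<delta>}) \<longlonglongrightarrow> measure (return borel 0) {y. \<bar>y\<bar> > \<delta>}"
  proof (rule weak_conv_imp_continuity_set_conv[OF assms(1) R assms(2)])
    show "{y::real. \<bar>y\<bar> > \<delta>} \<in> sets borel" using o by auto
    have "closed {y::real. \<delta> \<le> \<bar>y\<bar>}" by (intro closed_Collect_le continuous_intros)
    then have "closure {y::real. \<bar>y\<bar> > \<delta>} \<subseteq> {y. \<delta> \<le> \<bar>y\<bar>}"
      by (intro closure_minimal) auto
    then have "0 \<notin> frontier {y::real. \<bar>y\<bar> > \<delta>}" using assms(3) by (auto simp: frontier_def)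
    then show "emeasure (return borel 0) (frontier {y::real. \<bar>y\<bar> > \<delta>}) = 0"
      by (subst emeasure_return) auto
  qed
  also have "measure (return borel 0) {y::real. \<bar>y\<bar> > \<delta>} = 0"
    using o assms(3) by (subst measure_return) auto
  finally show ?thesis .
qed

section \<open>The conditional law of the bootstrap process\<close>

lemma generated_sigma_measurable:
  assumes "t \<in> T" "Y t \<in> measurable M N"
  shows "Y t \<in> measurable (generated_sigma M N Y T) N"
proof (rule measurableI)
  have sp: "(\<Union>t\<in>T. {Y t -` B \<inter> space M |B. B \<in> sets N}) \<subseteq> Pow (space M)" by auto
  have s: "space (generated_sigma M N Y T) = space M"
    unfolding generated_sigma_def using sp by (rule space_measure_of)
  show "Y t x \<in> space N" if "x \<in> space (generated_sigma M N Y T)" for x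
    using that assms(2) unfolding s by (rule measurable_space[rotated])
  show "Y t -` B \<inter> space (generated_sigma M N Y T) \<in> sets (generated_sigma M N Y T)" if "B \<in> sets N" for B
    unfolding s unfolding generated_sigma_def sets_measure_of[OF sp]
    using that assms(1) by (intro sigma_sets.Basic) auto
qed

lemma subalgebra_generated_sigma:
  assumes "\<And>t. t \<in> T \<Longrightarrow> Y t \<in> measurable M N"
  shows "subalgebra M (generated_sigma M N Y T)"
proof -
  have sp: "(\<Union>t\<in>T. {Y t -` B \<inter> space M |B. B \<in> sets N}) \<subseteq> Pow (space M)" by auto
  have "sets (generated_sigma M N Y T) \<subseteq> sets M"
    unfolding generated_sigma_def sets_measure_of[OF sp]
    using assms by (intro sets.sigma_sets_subset) (auto intro: measurable_sets)
  then show ?thesis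
    unfolding subalgebra_def generated_sigma_def by (simp add: space_measure_of[OF sp])
qed

lemma generated_sigma_mono:
  assumes "T \<subseteq> T'"
  shows "sets (generated_sigma M N Y T) \<subseteq> sets (generated_sigma M N Y T')"
proof -
  have "(\<Union>t\<in>T. {Y t -` B \<inter> space M |B. B \<in> sets N}) \<subseteq> Pow (space M)" for T by auto
  then show ?thesis
    unfolding generated_sigma_def using assms by (simp add: sets_measure_of) (intro sigma_sets_mono' UN_mono order_refl)
qed

text \<open>A conditional law is pinned down at each threshold only up to a null set depending on
  the threshold. Rational thresholds keep the union of these sets null, and right continuity
  recovers the others.\<close>

lemma real_distribution_eqI_rat:
  assumes A: "real_distribution A" and B: "real_distribution B"
    and eq: "\<And>q. q \<in> \<rat> \<Longrightarrow> cdf A q = cdf B q"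
  shows "A = B"
proof -
  have le: "cdf B y \<le> cdf A y" if A: "real_distribution A" and B: "real_distribution B"
    and eq: "\<And>q. q \<in> \<rat> \<Longrightarrow> cdf A q = cdf B q" for A B y
  proof (rule ccontr)
    interpret A: real_distribution A by fact
    interpret B: real_distribution B by fact
    assume "\<not> cdf B y \<le> cdf A y"
    then have "cdf A y < cdf B y" by simp
    moreover have "(cdf A \<longlongrightarrow> cdf A y) (at_right y)"
      using A.cdf_is_right_cont[of y] by (simp add: continuous_within)
    ultimately have "\<forall>\<^sub>F z in at_right y. cdf A z < cdf B y" by (intro order_tendstoD(2))
    then obtain d where d: "d > y" "\<And>z. y < z \<Longrightarrow> z < d \<Longrightarrow> cdf A z < cdf B y"
      unfolding eventually_at_right_field by blast
    obtain q where q: "q \<in> \<rat>" "y < q" "q < d" using Rats_dense_in_real[OF d(1)] by blast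
    have "cdf B y \<le> cdf B q" using q by (intro B.cdf_nondecreasing) auto
    then show False using d(2)[OF q(2,3)] eq[OF q(1)] by simp
  qed
  have "cdf A y = cdf B y" for y
    using le[OF A B eq, of y] le[OF B A eq[symmetric], of y] by linarith
  then show ?thesis by (intro cdf_unique[OF A B] ext)
qed

text \<open>The freezing principle: when the weights are independent of \<open>F\<close>,
  conditioning on \<open>F\<close> freezes the \<open>F\<close>-measurable argument and averages
  over the weights. Since \<open>\<kappa>\<close> is known only through conditional probabilities,
  it is identified by uniqueness of conditional expectations, threshold by threshold.\<close>

lemma (in multinomial_vector) cond_law_eq_distr:
  assumes F: "subalgebra M F"
    and indep: "indep_set (sets F) (sets (generated_sigma M (count_space UNIV) W I))"
    and g [measurable]: "\<And>w. g w \<in> borel_measurable F"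
    and Y: "\<And>x. x \<in> space M \<Longrightarrow> Y x = g (count_vec x) x"
    and \<kappa>: "is_cond_law M F Y \<kappa>"
  shows "AE x in M. \<kappa> x = distr M borel (\<lambda>\<omega>. g (count_vec \<omega>) x)"
proof -
  interpret S: finite_measure_subalgebra M F by standard (rule F)
  let ?C = "compositions I m"
  let ?E = "\<lambda>w. {x \<in> space M. count_vec x = w}"
  let ?p = "multinomial_weight I m p"
  have finC: "finite ?C" by (rule finite_compositions[OF finite_I])
  have gM [measurable]: "g w \<in> borel_measurable M" for w
    using measurable_from_subalg[OF F g] .
  have sF: "space F = space M" using F by (simp add: subalgebra_def)
  have cv: "(\<lambda>x. f (count_vec x)) \<in> borel_measurable M" for f :: "('i \<Rightarrow> nat) \<Rightarrow> real"
  proof -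
    have "count_vec \<in> measurable M (Pi\<^sub>M I (\<lambda>_. count_space UNIV))" by measurable
    moreover have "Pi\<^sub>M I (\<lambda>_. count_space (UNIV :: nat set)) = count_space (I \<rightarrow>\<^sub>E UNIV)"
      by (rule count_space_PiM_finite) (auto simp: finite_I)
    ultimately show ?thesis
      using measurable_compose[of count_vec M "count_space (I \<rightarrow>\<^sub>E UNIV)" f borel] by simp
  qed
  have Eg: "?E w \<in> sets (generated_sigma M (count_space UNIV) W I)" if "w \<in> ?C" for w
  proof -
    let ?S = "generated_sigma M (count_space UNIV) W I"
    have [measurable]: "i \<in> I \<Longrightarrow> W i \<in> measurable ?S (count_space UNIV)" for i
      by (rule generated_sigma_measurable) auto
    have s: "space ?S = space M"
      using subalgebra_generated_sigma[of I W M "count_space UNIV"] by (simp add: subalgebra_def)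
    have "{x \<in> space ?S. \<forall>i\<in>I. W i x = w i} \<in> sets ?S" using finite_I by measurable
    then show ?thesis using that by (simp add: s count_vec_eq_iff)
  qed
  define H where "H y x = (\<Sum>w\<in>?C. ?p w * indicator {..y} (g w x))" for y x
  have H_cdf: "cdf (distr M borel (\<lambda>\<omega>. g (count_vec \<omega>) x)) y = H y x" for x y
  proof -
    have "cdf (distr M borel (\<lambda>\<omega>. g (count_vec \<omega>) x)) y = prob {\<omega> \<in> space M. g (count_vec \<omega>) x \<le> y}"
      unfolding cdf_def by (subst measure_distr) (auto intro!: cv arg_cong[where f = prob])
    also have "\<dots> = (\<integral>\<omega>. indicator {..y} (g (count_vec \<omega>) x) \<partial>M)"
    proof -
      have "{\<omega> \<in> space M. g (count_vec \<omega>) x \<le> y} \<in> events"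
        using measurable_sets[OF cv[of "\<lambda>w. g w x"], of "{..y}"] by (simp add: vimage_def Int_def conj_commute)
      then have "prob {\<omega> \<in> space M. g (count_vec \<omega>) x \<le> y} = (\<integral>\<omega>. indicat_real {\<omega> \<in> space M. g (count_vec \<omega>) x \<le> y} \<omega> \<partial>M)"
        by simp
      also have "\<dots> = (\<integral>\<omega>. indicator {..y} (g (count_vec \<omega>) x) \<partial>M)"
        by (intro Bochner_Integration.integral_cong refl) (simp add: indicator_def)
      finally show ?thesis .
    qed
    also have "\<dots> = H y x"
      by (subst expectation_count_vec) (simp add: H_def)
    finally show ?thesis .
  qed
  have AE_y: "AE x in M. cdf (\<kappa> x) y = H y x" for y
  proof -
    let ?f = "indicator (Y -` {..y} \<inter> space M) :: 'a \<Rightarrow> real"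
    have AE_f: "AE x in M. ?f x = (\<Sum>w\<in>?C. indicator (?E w) x * indicator {..y} (g w x))"
    proof -
      have eq: "?f x = (\<Sum>w\<in>?C. indicator (?E w) x * indicator {..y} (g w x))"
        if "count_vec x \<in> ?C" "x \<in> space M" for x
      proof -
        have "(\<Sum>w\<in>?C. indicator (?E w) x * indicator {..y} (g w x)) =
          (\<Sum>w\<in>?C. if w = count_vec x then indicator {..y} (g w x) else (0::real))"
          using that(2) by (intro sum.cong) auto
        also have "\<dots> = indicator {..y} (g (count_vec x) x)" using that finC by simp
        finally show ?thesis using that(2) by (simp add: Y indicator_def)
      qed
      show ?thesis using AE_count_vec AE_space by eventually_elim (rule eq)
    qed
    have int: "integrable M (\<lambda>x. indicator (?E w) x * indicator A x * indicator {..y} (g w x) :: real)"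
      if "w \<in> ?C" "A \<in> sets F" for w A
    proof (rule integrable_const_bound[where B = 1])
      have [measurable]: "A \<in> sets M" using that(2) F by (auto simp: subalgebra_def)
      show "(\<lambda>x. indicator (?E w) x * indicator A x * indicator {..y} (g w x) :: real) \<in> borel_measurable M"
        using that(1) by measurable
    qed (auto split: split_indicator)
    have "AE x in M. real_cond_exp M F ?f x = H y x"
    proof (rule S.real_cond_exp_charact)
      have "{x \<in> space M. g (count_vec x) x \<le> y} \<in> events"
      proof -
        have "{x \<in> space M. g (count_vec x) x \<le> y} =
          {x \<in> space M. count_vec x \<in> ?C \<and> g (count_vec x) x \<le> y} \<union>
          {x \<in> space M. count_vec x \<notin> ?C \<and> g (count_vec x) x \<le> y}" by auto
        have fin: "count_vec \<in> measurable M (count_space (I \<rightarrow>\<^sub>E UNIV))"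
        proof -
          have "count_vec \<in> measurable M (Pi\<^sub>M I (\<lambda>_. count_space UNIV))" by measurable
          then show ?thesis by (simp add: count_space_PiM_finite finite_I)
        qed
        \<comment> \<open>The diagonal map \<open>x \<mapsto> g (count_vec x) x\<close> is
          measurable because the count vector has only countably many values; each section
          \<open>g w\<close> is measurable by assumption.\<close>
        have "countable (I \<rightarrow>\<^sub>E (UNIV :: nat set))" by (rule countable_PiE) (auto simp: finite_I)
        then have "(\<lambda>x. g (count_vec x) x) \<in> borel_measurable M"
          by (rule measurable_compose_countable'[where f = g, OF gM fin])
        then show ?thesis by measurable
      qed
      moreover have "Y -` {..y} \<inter> space M = {x \<in> space M. g (count_vec x) x \<le> y}" using Y by auto
      ultimately have Yev: "Y -` {..y} \<inter> space M \<in> events" by simp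
      then show "integrable M ?f" by (intro integrable_real_indicator) (auto simp: emeasure_eq_measure)
      show HF: "H y \<in> borel_measurable F" unfolding H_def[abs_def] by measurable
      then have HM: "H y \<in> borel_measurable M" by (rule measurable_from_subalg[OF F])
      show "integrable M (H y)"
      proof (rule integrable_const_bound[where B = "\<Sum>w\<in>?C. \<bar>?p w\<bar>"])
        have "\<bar>H y x\<bar> \<le> (\<Sum>w\<in>?C. \<bar>?p w\<bar>)" for x
          unfolding H_def by (rule order_trans[OF sum_abs sum_mono]) (auto split: split_indicator)
        then show "AE x in M. norm (H y x) \<le> (\<Sum>w\<in>?C. \<bar>?p w\<bar>)" by simp
      qed (rule HM)
      fix A assume A: "A \<in> sets F"
      then have [measurable]: "A \<in> sets M" using F by (auto simp: subalgebra_def)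
      have "(\<integral>x\<in>A. ?f x \<partial>M) = (\<integral>x. (\<Sum>w\<in>?C. indicator (?E w) x * indicator A x * indicator {..y} (g w x)) \<partial>M)"
        unfolding set_lebesgue_integral_def
      proof (rule integral_cong_AE)
        show "(\<lambda>x. indicat_real A x *\<^sub>R ?f x) \<in> borel_measurable M" using Yev by measurable
        show "(\<lambda>x. \<Sum>w\<in>?C. indicator (?E w) x * indicator A x * indicator {..y} (g w x) :: real) \<in> borel_measurable M"
          by measurable
        show "AE x in M. indicat_real A x *\<^sub>R ?f x = (\<Sum>w\<in>?C. indicator (?E w) x * indicator A x * indicator {..y} (g w x))"
          using AE_f by eventually_elim (simp add: sum_distrib_left mult_ac)
      qed
      also have "\<dots> = (\<Sum>w\<in>?C. \<integral>x. indicator (?E w) x * indicator A x * indicator {..y} (g w x) \<partial>M)"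
        using A by (intro Bochner_Integration.integral_sum int)
      also have "\<dots> = (\<Sum>w\<in>?C. ?p w * (\<integral>x. indicator A x * indicator {..y} (g w x) \<partial>M))"
      proof (intro sum.cong refl)
        \<comment> \<open>On the event that the weights equal \<open>w\<close>, the threshold event
          depends on the data only; independence then separates the two factors.\<close>
        fix w assume w: "w \<in> ?C"
        let ?B = "A \<inter> {x \<in> space F. g w x \<le> y}"
        have BF: "?B \<in> sets F" using A by measurable
        have Asp: "A \<subseteq> space M" using sets.sets_into_space[OF A] sF by simp
        have BM: "?B \<in> events" "?E w \<inter> ?B \<in> events"
          using BF F w by (auto simp: subalgebra_def intro!: sets.Int)
        have "(\<integral>x. indicator (?E w) x * indicator A x * indicator {..y} (g w x) \<partial>M) = (\<integral>x. indicat_real (?E w \<inter> ?B) x \<partial>M)"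
          using Asp sF by (intro Bochner_Integration.integral_cong refl) (auto simp: indicator_def)
        also have "\<dots> = prob (?B \<inter> ?E w)"
          using BM by (simp add: Int_commute)
        also have "\<dots> = prob ?B * prob (?E w)" by (rule indep_setD[OF indep BF Eg[OF w]])
        also have "prob ?B = (\<integral>x. indicat_real ?B x \<partial>M)" using BM by simp
        also have "\<dots> = (\<integral>x. indicator A x * indicator {..y} (g w x) \<partial>M)"
          using Asp sF by (intro Bochner_Integration.integral_cong refl) (auto simp: indicator_def)
        finally show "(\<integral>x. indicator (?E w) x * indicator A x * indicator {..y} (g w x) \<partial>M) =
          ?p w * (\<integral>x. indicator A x * indicator {..y} (g w x) \<partial>M)"
          by (simp only: prob_count_vec[OF w] mult.commute)
      qed
      also have "\<dots> = (\<integral>x. (\<Sum>w\<in>?C. ?p w * (indicator A x * indicator {..y} (g w x))) \<partial>M)"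
      proof (subst Bochner_Integration.integral_sum)
        show "integrable M (\<lambda>x. ?p w * (indicator A x * indicator {..y} (g w x)))" for w
          by (intro integrable_mult_right integrable_const_bound[where B = 1]) (auto split: split_indicator)
      qed simp
      also have "\<dots> = (\<integral>x\<in>A. H y x \<partial>M)"
        unfolding set_lebesgue_integral_def H_def by (simp add: sum_distrib_left mult_ac)
      finally show "(\<integral>x\<in>A. ?f x \<partial>M) = (\<integral>x\<in>A. H y x \<partial>M)" .
    qed
    moreover have "AE x in M. measure (\<kappa> x) {..y} = real_cond_exp M F ?f x"
      using \<kappa> unfolding is_cond_law_def by auto
    ultimately show ?thesis by eventually_elim (simp add: cdf_def)
  qed
  have "AE x in M. \<forall>q\<in>\<rat>. cdf (\<kappa> x) q = H q x"
    by (subst AE_ball_countable) (auto simp: countable_rat AE_y)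
  then show ?thesis
    using AE_space
  proof eventually_elim
    fix x assume x: "\<forall>q\<in>\<rat>. cdf (\<kappa> x) q = H q x" "x \<in> space M"
    have "\<kappa> x \<in> space (prob_algebra borel)"
      using \<kappa> x(2) sF unfolding is_cond_law_def by (auto intro: measurable_space)
    then have \<kappa>x: "prob_space (\<kappa> x)" "sets (\<kappa> x) = sets borel" by (auto simp: space_prob_algebra)
    then have "real_distribution (\<kappa> x)"
      by (auto simp: real_distribution_def real_distribution_axioms_def)
    moreover have "real_distribution (distr M borel (\<lambda>\<omega>. g (count_vec \<omega>) x))"
      by (rule real_distribution_distr) (rule cv)
    ultimately show "\<kappa> x = distr M borel (\<lambda>\<omega>. g (count_vec \<omega>) x)"
      by (rule real_distribution_eqI_rat) (use x in \<open>simp add: H_cdf\<close>)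
  qed
qed

section \<open>Block averages and the bootstrap process\<close>

lemma sum_blocks:
  fixes f :: "nat \<Rightarrow> 'b :: comm_monoid_add"
  shows "(\<Sum>s=1..m * N. f s) = (\<Sum>i=1..m. \<Sum>s=(i - 1) * N + 1..i * N. f s)"
proof (induction m)
  case (Suc m)
  have "(\<Sum>s=1..Suc m * N. f s) = (\<Sum>s=1..m * N. f s) + (\<Sum>s=m * N + 1..m * N + N. f s)"
    by (subst sum.ub_add_nat[symmetric]) (auto simp: add.commute)
  also have "\<dots> = (\<Sum>i=1..m. \<Sum>s=(i - 1) * N + 1..i * N. f s) + (\<Sum>s=m * N + 1..m * N + N. f s)"
    by (simp only: Suc.IH)
  also have "\<dots> = (\<Sum>i=1..Suc m. \<Sum>s=(i - 1) * N + 1..i * N. f s)"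
    by (simp add: add.commute)
  finally show ?case .
qed simp

definition block_avg ::
    "(nat \<Rightarrow> real) \<Rightarrow> (nat \<Rightarrow> real) \<Rightarrow> (int \<Rightarrow> 'a \<Rightarrow> real) \<Rightarrow> nat \<Rightarrow> nat \<Rightarrow> (real \<Rightarrow> real) \<Rightarrow> nat \<Rightarrow> 'a \<Rightarrow> real"
  where
  "block_avg a b X r k h i x =
    (\<Sum>s=(i - 1) * (k * r) + 1..i * (k * r). h (norm_block_max a b X r s x)) / real (k * r)"

text \<open>The factor \<open>sqrt k\<close> absorbs the part of
  \<open>sqrt (n / r) = sqrt m * sqrt k\<close> that is not the scaling of a sum of \<open>m\<close>
  draws.\<close>

definition block_dev ::
    "(nat \<Rightarrow> real) \<Rightarrow> (nat \<Rightarrow> real) \<Rightarrow> (int \<Rightarrow> 'a \<Rightarrow> real) \<Rightarrow> nat \<Rightarrow> nat \<Rightarrow> nat \<Rightarrow> (real \<Rightarrow> real) \<Rightarrow> 'a \<Rightarrow> nat \<Rightarrow> real"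
  where
  "block_dev a b X r k m h x i =
    sqrt (real k) * (block_avg a b X r k h i x - (\<Sum>j=1..m. block_avg a b X r k h j x) / real m)"

lemma block_max_measurable:
  assumes "\<And>t. t \<in> {int i..<int (i + r)} \<Longrightarrow> X t \<in> borel_measurable F"
  shows "block_max X r i \<in> borel_measurable F"
  unfolding block_max_def[abs_def] using assms by (intro borel_measurable_Max) auto

lemma norm_block_max_measurable:
  assumes "\<And>t. t \<in> {int i..<int (i + r)} \<Longrightarrow> X t \<in> borel_measurable F"
  shows "norm_block_max a b X r i \<in> borel_measurable F"
  unfolding norm_block_max_def[abs_def] using block_max_measurable[OF assms]
  by (intro borel_measurable_divide borel_measurable_diff borel_measurable_const) auto

text \<open>With the data frozen the process is a linear form in the multinomial weights, whose
  coefficients are the centred block averages divided by \<open>sqrt m\<close>; its characteristic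
  function is then an exact \<open>m\<close>-th power.\<close>

lemma boot_cond_law:
  fixes M :: "'a measure"
  assumes M: "prob_space M" and X: "\<And>t. X t \<in> borel_measurable M" and h: "h \<in> borel_measurable borel"
    and m: "m > 0" and r: "r > 0" and k: "k > 0" and n: "n = m * (k * r)"
    and W: "multinomial M {1..m} m (\<lambda>_. 1 / real m) W"
    and indep: "prob_space.indep_set M (sets (generated_sigma M borel X UNIV))
      (sets (generated_sigma M (count_space UNIV) W {1..m}))"
    and \<kappa>: "is_cond_law M (generated_sigma M borel X {1..int (n + r) - 1}) (boot_process a b X n r k W h) \<kappa>"
  shows "AE x in M. resample_law (\<kappa> x) m (block_dev a b X r k m h x)"
proof -
  interpret multinomial_vector M "{1..m}" m "\<lambda>_. 1 / real m" W
    by (intro multinomial_vector.intro multinomial_vector_axioms.intro M W) (use m in auto)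
  let ?F = "generated_sigma M borel X {1..int (n + r) - 1}"
  let ?Z = "\<lambda>s x. h (norm_block_max a b X r s x)"
  let ?B = "\<lambda>i x. block_avg a b X r k h i x"
  let ?N = "k * r"
  have N: "?N > 0" using k r by simp
  define g where "g w x = sqrt (real n / real r) *
    (1 / real n * (\<Sum>i=1..m. real (w i) * (\<Sum>s=(i - 1) * ?N + 1..i * ?N. ?Z s x)) - emp_sliding a b X n r h x)"
    for w :: "nat \<Rightarrow> nat" and x
  have FM: "subalgebra M ?F" by (rule subalgebra_generated_sigma) (rule X)
  have Zs: "?Z s \<in> borel_measurable ?F" if "s \<in> {1..n}" for s
    using that by (intro measurable_compose[OF norm_block_max_measurable h] generated_sigma_measurable X) auto
  have le: "s \<in> {1..n}" if "i \<in> {1..m}" "s \<in> {(i - 1) * ?N + 1..i * ?N}" for i s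
  proof -
    have "i * ?N \<le> m * ?N" using that(1) by (intro mult_right_mono) auto
    then have "i * ?N \<le> n" by (simp only: n)
    moreover have "1 \<le> s" "s \<le> i * ?N" using that(2) by auto
    ultimately have "1 \<le> s" "s \<le> n" by (auto intro: order_trans)
    then show ?thesis by simp
  qed
  have "AE x in M. \<kappa> x = distr M borel (\<lambda>\<omega>. g (count_vec \<omega>) x)"
  proof (rule cond_law_eq_distr[OF FM _ _ _ \<kappa>])
    show "indep_set (sets ?F) (sets (generated_sigma M (count_space UNIV) W {1..m}))"
      using indep generated_sigma_mono[of "{1..int (n + r) - 1}" UNIV M borel X]
      unfolding indep_sets2_eq by blast
    show "g w \<in> borel_measurable ?F" for w
      unfolding g_def[abs_def] emp_sliding_def[abs_def]
      by (intro borel_measurable_times borel_measurable_const borel_measurable_diff borel_measurable_sum Zs)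
        (assumption | rule le)+
    have "n div ?N = m" using n N by simp
    then show "boot_process a b X n r k W h x = g (count_vec x) x" for x
      unfolding boot_process_def emp_sliding_boot_def g_def by simp
  qed
  then show ?thesis
  proof eventually_elim
    fix x assume \<kappa>x: "\<kappa> x = distr M borel (\<lambda>\<omega>. g (count_vec \<omega>) x)"
    define c where "c = block_dev a b X r k m h x"
    have SB: "(\<Sum>s=(i - 1) * ?N + 1..i * ?N. ?Z s x) = real ?N * ?B i x" for i
      using N by (simp add: block_avg_def)
    have emp: "emp_sliding a b X n r h x = (\<Sum>j=1..m. ?B j x) / real m"
    proof -
      have "emp_sliding a b X n r h x = 1 / real n * (\<Sum>i=1..m. real ?N * ?B i x)"
        unfolding emp_sliding_def n sum_blocks[of _ m ?N] SB ..
      also have "\<dots> = (\<Sum>j=1..m. ?B j x) / real m"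
        using N m unfolding n by (simp add: sum_distrib_left[symmetric])
      finally show ?thesis .
    qed
    have g_eq: "g w x = (\<Sum>i=1..m. real (w i) * (c i / sqrt (real m)))" if "sum w {1..m} = m" for w
    proof -
      have sw: "(\<Sum>i=1..m. real (w i)) = real m" using that by (metis of_nat_sum)
      have sq: "sqrt (real n / real r) = sqrt (real m) * sqrt (real k)"
        using r unfolding n by (simp add: real_sqrt_mult)
      have sm: "sqrt (real m) * sqrt (real m) = real m" by simp
      have "1 / real n * (\<Sum>i=1..m. real (w i) * (real ?N * ?B i x)) = (\<Sum>i=1..m. real (w i) * ?B i x) / real m"
        using N m unfolding n by (simp add: sum_distrib_left sum_divide_distrib mult_ac)
      then have "g w x = sqrt (real m) * sqrt (real k) * ((\<Sum>i=1..m. real (w i) * ?B i x) / real m - (\<Sum>j=1..m. ?B j x) / real m)"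
        unfolding g_def SB emp sq by simp
      \<comment> \<open>The weights add up to \<open>m\<close>, so the overall mean can itself be
        written as a weighted sum; this is how the centring moves into each coefficient.\<close>
      also have "(\<Sum>j=1..m. ?B j x) / real m = (\<Sum>i=1..m. real (w i) * ((\<Sum>j=1..m. ?B j x) / real m)) / real m"
        by (simp only: sum_distrib_right[symmetric] sw) (use m in simp)
      also have "sqrt (real m) * sqrt (real k) * ((\<Sum>i=1..m. real (w i) * ?B i x) / real m -
          (\<Sum>i=1..m. real (w i) * ((\<Sum>j=1..m. ?B j x) / real m)) / real m)
        = (sqrt (real m) / real m) * (\<Sum>i=1..m. real (w i) * c i)"
      proof -
        have "(\<Sum>i=1..m. real (w i) * c i) = sqrt (real k) * ((\<Sum>i=1..m. real (w i) * ?B i x) -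
          (\<Sum>i=1..m. real (w i) * ((\<Sum>j=1..m. ?B j x) / real m)))"
          unfolding sum_subtractf[symmetric] sum_distrib_left c_def block_dev_def
          by (intro sum.cong refl) (simp only: right_diff_distrib mult_ac)
        moreover have "sqrt (real m) * sqrt (real k) * (A / real m - D / real m) = sqrt (real m) / real m * (sqrt (real k) * (A - D))"
          for A D :: real by (simp add: diff_divide_distrib[symmetric])
        ultimately show ?thesis by presburger
      qed
      also have "sqrt (real m) / real m = 1 / sqrt (real m)"
        using m sm by (simp add: field_simps)
      also have "1 / sqrt (real m) * (\<Sum>i=1..m. real (w i) * c i) = (\<Sum>i=1..m. real (w i) * (c i / sqrt (real m)))"
        by (simp add: sum_divide_distrib)
      finally show ?thesis .
    qed
    have "\<kappa> x = distr M borel (\<lambda>\<omega>. \<Sum>i=1..m. real (W i \<omega>) * (c i / sqrt (real m)))"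
      unfolding \<kappa>x
    proof (rule distr_cong_AE)
      show "AE \<omega> in M. g (count_vec \<omega>) x = (\<Sum>i=1..m. real (W i \<omega>) * (c i / sqrt (real m)))"
        using AE_sum_W by eventually_elim (simp add: g_eq)
      show "(\<lambda>\<omega>. g (count_vec \<omega>) x) \<in> borel_measurable M"
        unfolding g_def
        by (intro borel_measurable_times borel_measurable_const borel_measurable_diff borel_measurable_sum) simp
    qed auto
    moreover have "(\<Sum>i=1..m. c i) = 0"
      using m unfolding c_def block_dev_def by (simp add: sum_distrib_left[symmetric] sum_subtractf)
    ultimately show "resample_law (\<kappa> x) m (block_dev a b X r k m h x)"
      using m char_linear_combination[of "\<lambda>i. c i / sqrt (real m)"]
      unfolding resample_law_def c_def[symmetric] by simp
  qed
qed

section \<open>Strongly mixing stationary sequences\<close>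

locale stationary_series = prob_space M
  for M :: "'a measure" and X :: "int \<Rightarrow> 'a \<Rightarrow> real" +
  assumes stationary: "strictly_stationary M X"
begin

lemma X_measurable [measurable]: "X t \<in> borel_measurable M"
  using stationary by (simp add: strictly_stationary_def)

text \<open>Constraints carry labels instead of being indexed by time. Several labels may share a
  time point, so an intersection is simply a cylinder over the disjoint union of the label sets,
  even when time windows overlap.\<close>

definition cyl :: "'j set \<Rightarrow> ('j \<Rightarrow> int) \<Rightarrow> ('j \<Rightarrow> real set) \<Rightarrow> 'a set" where
  "cyl K \<tau> S = {x \<in> space M. \<forall>j\<in>K. X (\<tau> j) x \<in> S j}"

lemma cyl_in_generated_sigma:
  assumes "finite K" "\<And>j. j \<in> K \<Longrightarrow> S j \<in> sets borel" "\<And>j. j \<in> K \<Longrightarrow> \<tau> j \<in> T"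
  shows "cyl K \<tau> S \<in> sets (generated_sigma M borel X T)"
proof -
  let ?F = "generated_sigma M borel X T"
  have m: "X (\<tau> j) \<in> borel_measurable ?F" if "j \<in> K" for j
    using assms(3)[OF that] by (rule generated_sigma_measurable) simp
  have s: "space ?F = space M"
    using subalgebra_generated_sigma[of T X M borel] by (simp add: subalgebra_def)
  have "{x \<in> space ?F. X (\<tau> j) x \<in> S j} \<in> sets ?F" if "j \<in> K" for j
    using measurable_sets[OF m[OF that] assms(2)[OF that]] by (simp add: vimage_def Int_def conj_commute)
  then have "{x \<in> space ?F. \<forall>j\<in>K. X (\<tau> j) x \<in> S j} \<in> sets ?F"
    using assms(1) by (intro sets.sets_Collect_finite_All) auto
  then show ?thesis by (simp add: cyl_def s)
qed

lemma cyl_events: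
  assumes "finite K" "\<And>j. j \<in> K \<Longrightarrow> S j \<in> sets borel"
  shows "cyl K \<tau> S \<in> events"
  using cyl_in_generated_sigma[of K S \<tau> UNIV] assms subalgebra_generated_sigma[of UNIV X M borel]
  by (auto simp: subalgebra_def)

lemma prob_cyl_shift:
  assumes "finite K" "\<And>j. j \<in> K \<Longrightarrow> S j \<in> sets borel"
  shows "prob (cyl K (\<lambda>j. \<tau> j + d) S) = prob (cyl K \<tau> S)"
proof -
  let ?J = "\<tau> ` K"
  \<comment> \<open>Labels sharing a time point are merged into one constraint, since stationarity
    speaks of a finite set of distinct times.\<close>
  define B where "B t = (\<Inter>j\<in>{j\<in>K. \<tau> j = t}. S j)" for t
  have Bb: "B t \<in> sets borel" if "t \<in> ?J" for t
    unfolding B_def using that assms by (intro sets.finite_INT) auto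
  let ?A = "PiE ?J B"
  have A: "?A \<in> sets (PiM ?J (\<lambda>_. borel))"
    using assms(1) Bb by (intro sets_PiM_I_finite) auto
  have m: "(\<lambda>x. \<lambda>t\<in>?J. X (t + u) x) \<in> measurable M (PiM ?J (\<lambda>_. borel))" for u
    by (intro measurable_restrict) simp
  have pre: "(\<lambda>x. \<lambda>t\<in>?J. X (t + u) x) -` ?A \<inter> space M = cyl K (\<lambda>j. \<tau> j + u) S" for u
    by (auto simp: cyl_def B_def PiE_iff) metis
  have e: "measure (distr M (PiM ?J (\<lambda>_. borel)) (\<lambda>x. \<lambda>t\<in>?J. X (t + u) x)) ?A = prob (cyl K (\<lambda>j. \<tau> j + u) S)" for u
    by (subst measure_distr[OF m A]) (simp only: pre)
  have "distr M (PiM ?J (\<lambda>_. borel)) (\<lambda>x. \<lambda>t\<in>?J. X (t + d) x) = distr M (PiM ?J (\<lambda>_. borel)) (\<lambda>x. \<lambda>t\<in>?J. X t x)"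
    using stationary assms(1) unfolding strictly_stationary_def by blast
  then show ?thesis using e[of d] e[of 0] by simp
qed

lemma cyl_Int: "cyl K \<tau> S \<inter> cyl K' \<tau>' S' = cyl (K <+> K') (case_sum \<tau> \<tau>') (case_sum S S')"
  by (simp add: cyl_def Plus_def ball_Un set_eq_iff) blast

lemma prob_cyl_Int_shift:
  assumes "finite K" "\<And>j. j \<in> K \<Longrightarrow> S j \<in> sets borel"
    and "finite K'" "\<And>j. j \<in> K' \<Longrightarrow> S' j \<in> sets borel"
  shows "prob (cyl K (\<lambda>j. \<tau> j + d) S \<inter> cyl K' (\<lambda>j. \<tau>' j + d) S') = prob (cyl K \<tau> S \<inter> cyl K' \<tau>' S')"
proof -
  have c: "case_sum (\<lambda>j. \<tau> j + d) (\<lambda>j. \<tau>' j + d) = (\<lambda>j. case_sum \<tau> \<tau>' j + d)"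
    by (auto simp: fun_eq_iff split: sum.split)
  show ?thesis
    unfolding cyl_Int c by (rule prob_cyl_shift) (use assms in auto)
qed

lemma abs_cov_events_le_1: "\<bar>prob (A \<inter> B) - prob A * prob B\<bar> \<le> 1"
proof -
  have "prob A * prob B \<le> 1" by (intro mult_le_one) auto
  moreover have "0 \<le> prob A * prob B" by simp
  ultimately show ?thesis
    using prob_le_1[of "A \<inter> B"] measure_nonneg[of M "A \<inter> B"] by linarith
qed

lemma alpha_mixing_upper:
  assumes "A \<in> sets (generated_sigma M borel X {..0})" "B \<in> sets (generated_sigma M borel X {int p..})"
  shows "\<bar>prob (A \<inter> B) - prob A * prob B\<bar> \<le> alpha_mixing M X p"
proof -
  have "(case (A, B) of (A, B) \<Rightarrow> \<bar>prob (A \<inter> B) - prob A * prob B\<bar>) \<le> alpha_mixing M X p"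
    unfolding alpha_mixing_def
  proof (rule cSUP_upper)
    show "(A, B) \<in> sets (generated_sigma M borel X {..0}) \<times> sets (generated_sigma M borel X {int p..})"
      using assms by simp
    show "bdd_above ((\<lambda>(A, B). \<bar>prob (A \<inter> B) - prob A * prob B\<bar>) `
        (sets (generated_sigma M borel X {..0}) \<times> sets (generated_sigma M borel X {int p..})))"
      by (rule bdd_aboveI[of _ 1]) (auto simp: abs_cov_events_le_1)
  qed
  then show ?thesis by simp
qed

lemma alpha_mixing_nonneg: "0 \<le> alpha_mixing M X p"
  using alpha_mixing_upper[of "{}" "{}" p] by simp

text \<open>The mixing coefficient is anchored at time 0; stationarity moves the separating time
  \<open>q\<close> there.\<close>

lemma mixing_cyl:
  assumes K: "finite K" "\<And>j. j \<in> K \<Longrightarrow> S j \<in> sets borel"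
    and K': "finite K'" "\<And>j. j \<in> K' \<Longrightarrow> S' j \<in> sets borel"
    and sep: "\<And>j. j \<in> K \<Longrightarrow> \<tau> j \<le> q" "\<And>j. j \<in> K' \<Longrightarrow> q + int p \<le> \<tau>' j"
  shows "\<bar>prob (cyl K \<tau> S \<inter> cyl K' \<tau>' S') - prob (cyl K \<tau> S) * prob (cyl K' \<tau>' S')\<bar> \<le> alpha_mixing M X p"
proof -
  let ?A = "cyl K (\<lambda>j. \<tau> j + (- q)) S" and ?B = "cyl K' (\<lambda>j. \<tau>' j + (- q)) S'"
  have "\<bar>prob (?A \<inter> ?B) - prob ?A * prob ?B\<bar> \<le> alpha_mixing M X p"
    by (intro alpha_mixing_upper cyl_in_generated_sigma K K') (use sep in \<open>auto simp: algebra_simps\<close>)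
  then show ?thesis
    by (simp only: prob_cyl_Int_shift[OF K K'] prob_cyl_shift[OF K] prob_cyl_shift[OF K'])
qed

text \<open>A block may reach into the next one, so the mixing bound applies once the block indices differ by
  at least three.\<close>

lemma block_average_L2:
  assumes P: "finite P" "\<And>q. q \<in> P \<Longrightarrow> 0 \<le> w q" "sum w P = 1"
    and K: "\<And>q. q \<in> P \<Longrightarrow> finite (K q)" "\<And>q j. q \<in> P \<Longrightarrow> j \<in> K q \<Longrightarrow> S q j \<in> sets borel"
    and \<tau>: "\<And>q j. q \<in> P \<Longrightarrow> j \<in> K q \<Longrightarrow> 1 \<le> \<tau> q j \<and> \<tau> q j \<le> 2 * int N"
    and p: "p \<le> N" and m: "m > 0"
  defines "U \<equiv> \<lambda>i x. \<Sum>q\<in>P. w q * indicator (cyl (K q) (\<lambda>j. \<tau> q j + int (i * N)) (S q)) x"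
    and "\<mu> \<equiv> \<Sum>q\<in>P. w q * prob (cyl (K q) (\<tau> q) (S q))"
  shows "expectation (\<lambda>x. ((\<Sum>i<m. U i x) / real m - \<mu>)\<^sup>2) \<le> 5 / real m + alpha_mixing M X p"
proof -
  let ?\<alpha> = "alpha_mixing M X p"
  let ?E = "\<lambda>i q. cyl (K q) (\<lambda>j. \<tau> q j + int (i * N)) (S q)"
  let ?c = "\<lambda>i j. expectation (\<lambda>x. (U i x - \<mu>) * (U j x - \<mu>))"
  have E: "?E i q \<in> events" if "q \<in> P" for i q
    by (intro cyl_events K that)
  have prE: "prob (?E i q) = prob (cyl (K q) (\<tau> q) (S q))" if "q \<in> P" for i q
    by (rule prob_cyl_shift) (use K that in auto)
  have U0: "0 \<le> U i x" for i x
    unfolding U_def by (intro sum_nonneg mult_nonneg_nonneg P) auto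
  have U1: "U i x \<le> 1" for i x
  proof -
    have "U i x \<le> (\<Sum>q\<in>P. w q)"
      unfolding U_def by (intro sum_mono mult_left_le P) (auto simp: indicator_def)
    then show ?thesis using P by simp
  qed
  have Um [measurable]: "U i \<in> borel_measurable M" for i
    unfolding U_def[abs_def] using E by (intro borel_measurable_sum borel_measurable_times borel_measurable_const borel_measurable_indicator)
  have \<mu>01: "0 \<le> \<mu>" "\<mu> \<le> 1"
  proof -
    show "0 \<le> \<mu>" unfolding \<mu>_def by (intro sum_nonneg mult_nonneg_nonneg P) auto
    have "\<mu> \<le> (\<Sum>q\<in>P. w q)" unfolding \<mu>_def by (intro sum_mono mult_left_le P) auto
    then show "\<mu> \<le> 1" using P by simp
  qed
  have Ub: "\<bar>U i x - \<mu>\<bar> \<le> 1" for i x using U0[of i x] U1[of i x] \<mu>01 by linarith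
  have pb: "\<bar>(U i x - \<mu>) * (U j x - \<mu>)\<bar> \<le> 1" for i j x
    unfolding abs_mult by (intro mult_le_one Ub) auto
  have int1: "integrable M (\<lambda>x. (U i x - \<mu>) * (U j x - \<mu>))" for i j
    by (rule integrable_const_bound[where B = 1]) (use pb in auto)
  have intU: "integrable M (U i)" for i
    by (rule integrable_const_bound[where B = 1]) (use U0 U1 in auto)
  have intE: "integrable M (\<lambda>x. w q * indicat_real A x)" if "A \<in> events" for q A
    using that by (intro integrable_mult_right integrable_real_indicator) (auto simp: emeasure_eq_measure)
  have expU: "expectation (U i) = \<mu>" for i
  proof -
    have "expectation (U i) = (\<Sum>q\<in>P. expectation (\<lambda>x. w q * indicat_real (?E i q) x))"
      unfolding U_def using E by (intro Bochner_Integration.integral_sum intE) auto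
    also have "\<dots> = \<mu>"
      unfolding \<mu>_def
    proof (intro sum.cong refl)
      fix q assume q: "q \<in> P"
      show "expectation (\<lambda>x. w q * indicat_real (?E i q) x) = w q * prob (cyl (K q) (\<tau> q) (S q))"
        using E[OF q, of i] prE[OF q, of i] by (simp add: Int_absorb2[OF sets.sets_into_space])
    qed
    finally show ?thesis .
  qed
  have c1: "?c i j \<le> 1" for i j
  proof -
    have "?c i j \<le> expectation (\<lambda>x. 1)"
      by (intro integral_mono int1) (use pb in \<open>auto simp: abs_le_iff\<close>)
    then show ?thesis by (simp add: prob_space)
  qed
  \<comment> \<open>Expanding both averages leaves covariances of single events. As the weights sum
    to one, the number of events in \<open>P\<close> does not enlarge the bound.\<close>
  have c\<alpha>: "?c i j \<le> ?\<alpha>" if ij: "i + 3 \<le> j" for i j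
  proof -
    have intUU: "integrable M (\<lambda>x. U i x * U j x)"
      by (rule integrable_const_bound[where B = 1]) (use U0 U1 in \<open>auto intro!: mult_le_one\<close>)
    have "?c i j = expectation (\<lambda>x. U i x * U j x - \<mu> * U i x - \<mu> * U j x + \<mu> * \<mu>)"
      by (intro Bochner_Integration.integral_cong refl) (simp add: algebra_simps)
    also have "\<dots> = expectation (\<lambda>x. U i x * U j x) - \<mu> * \<mu>"
      using intU intUU expU by (simp add: prob_space)
    also have "expectation (\<lambda>x. U i x * U j x)
       = expectation (\<lambda>x. \<Sum>q\<in>P. \<Sum>q'\<in>P. w q * w q' * indicat_real (?E i q \<inter> ?E j q') x)"
      unfolding U_def sum_product by (intro Bochner_Integration.integral_cong refl sum.cong) (simp add: indicator_inter_arith)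
    also have "\<dots> = (\<Sum>q\<in>P. \<Sum>q'\<in>P. w q * w q' * prob (?E i q \<inter> ?E j q'))"
      using E by (subst Bochner_Integration.integral_sum,
          (intro Bochner_Integration.integrable_sum integrable_mult_right integrable_real_indicator; auto simp: emeasure_eq_measure),
          intro sum.cong refl, subst Bochner_Integration.integral_sum,
          (intro integrable_mult_right integrable_real_indicator; auto simp: emeasure_eq_measure), intro sum.cong refl) simp
    also have "\<dots> - \<mu> * \<mu> = (\<Sum>q\<in>P. \<Sum>q'\<in>P. w q * w q' * (prob (?E i q \<inter> ?E j q') - prob (?E i q) * prob (?E j q')))"
      unfolding \<mu>_def sum_product sum_subtractf[symmetric]
    proof (intro sum.cong refl)
      fix q q' assume q: "q \<in> P" "q' \<in> P"
      have "W * A - w q * B * (w q' * C) = w q * w q' * (A' - B * C)" if "W = w q * w q'" "A = A'" for W A A' B C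
        using that by (simp add: algebra_simps)
      then show "w q * w q' * prob (?E i q \<inter> ?E j q') - w q * prob (cyl (K q) (\<tau> q) (S q)) * (w q' * prob (cyl (K q') (\<tau> q') (S q'))) =
        w q * w q' * (prob (?E i q \<inter> ?E j q') - prob (?E i q) * prob (?E j q'))"
        unfolding prE[OF q(1)] prE[OF q(2)] by blast
    qed
    also have "\<dots> \<le> (\<Sum>q\<in>P. \<Sum>q'\<in>P. w q * w q' * ?\<alpha>)"
    proof (intro sum_mono mult_left_mono)
      fix q q' assume q: "q \<in> P" "q' \<in> P"
      \<comment> \<open>Block \<open>i\<close> constrains times up to \<open>(i + 2) * N\<close>,
        block \<open>j\<close> only times beyond \<open>(i + 3) * N\<close>; this leaves a gap of at
        least \<open>N\<close>, hence of at least \<open>p\<close>.\<close>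
      have "int (i * N) + 3 * int N \<le> int (j * N)"
      proof -
        have "(i + 3) * N \<le> j * N" using ij by (rule mult_right_mono) simp
        then have "int ((i + 3) * N) \<le> int (j * N)" by (simp only: of_nat_le_iff)
        then show ?thesis by (simp add: algebra_simps)
      qed
      note sep = this
      have "\<bar>prob (?E i q \<inter> ?E j q') - prob (?E i q) * prob (?E j q')\<bar> \<le> ?\<alpha>"
      proof (rule mixing_cyl[where q = "int (i * N) + 2 * int N"])
        show "\<tau> q l + int (i * N) \<le> int (i * N) + 2 * int N" if "l \<in> K q" for l
          using \<tau>[OF q(1) that] by linarith
        show "int (i * N) + 2 * int N + int p \<le> \<tau> q' l + int (j * N)" if "l \<in> K q'" for l
          using \<tau>[OF q(2) that] sep p by linarith
      qed (use K q in auto)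
      then show "prob (?E i q \<inter> ?E j q') - prob (?E i q) * prob (?E j q') \<le> ?\<alpha>" by linarith
    qed (use P in auto)
    also have "\<dots> = ?\<alpha>"
      using P(3) by (simp flip: sum_distrib_right sum_distrib_left)
    finally show ?thesis .
  qed
  \<comment> \<open>Each \<open>i\<close> has at most five indices \<open>j\<close> within distance
    two, whose covariances are bounded trivially by 1. This yields the term
    \<open>5 / m\<close>.\<close>
  have c: "?c i j \<le> ?\<alpha> + (if j \<in> {i - 2..i + 2} then 1 else 0)" for i j
  proof -
    consider "i + 3 \<le> j" | "j + 3 \<le> i" | "j \<in> {i - 2..i + 2}" by fastforce
    then show ?thesis
    proof cases
      case 2
      then show ?thesis using c\<alpha>[of j i] by (simp add: mult.commute)
    next
      case 3
      then show ?thesis using c1[of i j] alpha_mixing_nonneg[of p] by simp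
    qed (use c\<alpha> in auto)
  qed
  have "((\<Sum>i<m. U i x) / real m - \<mu>)\<^sup>2 = (\<Sum>i<m. \<Sum>j<m. (U i x - \<mu>) * (U j x - \<mu>)) / (real m)\<^sup>2" for x
  proof -
    have "(\<Sum>i<m. U i x) / real m - \<mu> = (\<Sum>i<m. U i x - \<mu>) / real m"
      using m by (simp add: sum_subtractf diff_divide_distrib)
    then show ?thesis by (simp add: power_divide power2_eq_square sum_product)
  qed
  then have "expectation (\<lambda>x. ((\<Sum>i<m. U i x) / real m - \<mu>)\<^sup>2) = (\<Sum>i<m. \<Sum>j<m. ?c i j) / (real m)\<^sup>2"
    using int1 by simp
  also have "\<dots> \<le> (\<Sum>i<m. \<Sum>j<m. ?\<alpha> + (if j \<in> {i - 2..i + 2} then 1 else 0)) / (real m)\<^sup>2"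
    by (intro divide_right_mono sum_mono c) auto
  also have "\<dots> \<le> (\<Sum>i<m. real m * ?\<alpha> + 5) / (real m)\<^sup>2"
  proof (intro divide_right_mono sum_mono)
    fix i
    have "(\<Sum>j<m. (if j \<in> {i - 2..i + 2} then 1 else 0 :: real)) = real (card ({..<m} \<inter> {i - 2..i + 2}))"
      by (simp add: sum.If_cases) (rule arg_cong[where f = card], auto)
    also have "\<dots> \<le> real (card {i - 2..i + 2})" by (intro of_nat_mono card_mono) auto
    also have "\<dots> \<le> 5" by simp
    finally show "(\<Sum>j<m. ?\<alpha> + (if j \<in> {i - 2..i + 2} then 1 else 0)) \<le> real m * ?\<alpha> + 5"
      by (simp add: sum.distrib)
  qed simp
  also have "\<dots> = 5 / real m + ?\<alpha>"
    using m by (simp add: field_simps power2_eq_square)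
  finally show ?thesis .
qed

lemma expectation_abs_le_sqrt:
  assumes [measurable]: "Y \<in> borel_measurable M" and b: "\<And>x. \<bar>Y x\<bar> \<le> B" and e: "expectation (\<lambda>x. (Y x)\<^sup>2) \<le> e"
  shows "expectation (\<lambda>x. \<bar>Y x\<bar>) \<le> sqrt e"
proof -
  have i: "integrable M (\<lambda>x. \<bar>Y x\<bar>)" by (rule integrable_const_bound[where B = B]) (use b in auto)
  have "(Y x)\<^sup>2 \<le> B\<^sup>2" for x using b[of x] by (metis abs_ge_zero power2_abs power_mono)
  then have i2: "integrable M (\<lambda>x. \<bar>Y x\<bar>\<^sup>2)" by (intro integrable_const_bound[where B = "B\<^sup>2"]) auto
  have "0 \<le> variance (\<lambda>x. \<bar>Y x\<bar>)" by (rule variance_positive)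
  also have "\<dots> = expectation (\<lambda>x. (Y x)\<^sup>2) - (expectation (\<lambda>x. \<bar>Y x\<bar>))\<^sup>2"
    using variance_eq[OF i i2] by simp
  finally have "(expectation (\<lambda>x. \<bar>Y x\<bar>))\<^sup>2 \<le> e" using e by simp
  then show ?thesis by (rule real_le_rsqrt)
qed

end

section \<open>Block maxima in the domain of attraction\<close>

text \<open>Max-stability with explicit constants. They are precisely the limits that
  \<open>MDA\<close> prescribes for the ratios of norming sequences, which is what makes the two fit
  together.\<close>

lemma gev_cdf_max_stable:
  assumes "\<xi> > 0"
  shows "gev_cdf \<gamma> ((x - (if \<gamma> = 0 then ln \<xi> else (\<xi> powr \<gamma> - 1) / \<gamma>)) / \<xi> powr \<gamma>) = gev_cdf \<gamma> x powr \<xi>"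
proof (cases "\<gamma> = 0")
  case True
  have "exp (ln \<xi> - x) = \<xi> * exp (- x)" using assms by (simp add: exp_diff exp_minus divide_inverse)
  then show ?thesis using True assms by (simp add: gev_cdf_def powr_def)
next
  case False
  define y where "y = (x - (\<xi> powr \<gamma> - 1) / \<gamma>) / \<xi> powr \<gamma>"
  have p: "\<xi> powr \<gamma> > 0" using assms by simp
  have y: "1 + \<gamma> * y = (1 + \<gamma> * x) / \<xi> powr \<gamma>"
    using False p unfolding y_def by (simp add: field_simps)
  then have pos: "1 + \<gamma> * y > 0 \<longleftrightarrow> 1 + \<gamma> * x > 0" using p by (simp add: zero_less_divide_iff)
  have "(1 + \<gamma> * y) powr (- 1 / \<gamma>) = (1 + \<gamma> * x) powr (- 1 / \<gamma>) * \<xi>" if "1 + \<gamma> * x > 0"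
  proof -
    have "(1 + \<gamma> * y) powr (- 1 / \<gamma>) = (1 + \<gamma> * x) powr (- 1 / \<gamma>) / (\<xi> powr \<gamma>) powr (- 1 / \<gamma>)"
      unfolding y using that p by (simp add: powr_divide)
    also have "(\<xi> powr \<gamma>) powr (- 1 / \<gamma>) = inverse \<xi>"
      using False assms by (simp add: powr_powr powr_minus)
    finally show ?thesis by (simp only: divide_inverse inverse_inverse_eq)
  qed
  then have "gev_cdf \<gamma> y = gev_cdf \<gamma> x powr \<xi>"
    using False pos assms by (auto simp: gev_cdf_def powr_def)
  then show ?thesis using False by (simp add: y_def)
qed

lemma gev_biv_cdf_commute: "gev_biv_cdf \<gamma> \<xi> x y = gev_biv_cdf \<gamma> \<xi> y x"
  by (simp add: gev_biv_cdf_def min.commute mult.commute mult.left_commute)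

lemma gev_biv_cdf_nonneg: "0 \<le> gev_biv_cdf \<gamma> \<xi> x y"
  by (simp add: gev_biv_cdf_def)

lemma gev_biv_cdf_le_1:
  assumes "0 \<le> \<xi>" "\<xi> \<le> 1"
  shows "gev_biv_cdf \<gamma> \<xi> x y \<le> 1"
  unfolding gev_biv_cdf_def
  by (intro mult_le_one powr_le1) (use assms in \<open>auto simp: gev_cdf_nonneg gev_cdf_le_1\<close>)

lemma gev_biv_cdf_measurable: "(\<lambda>\<xi>. gev_biv_cdf \<gamma> \<xi> x y) \<in> borel_measurable borel"
  unfolding gev_biv_cdf_def powr_def by measurable

text \<open>The maximum with 0 reflects that \<open>nat\<close> sends negative integers to
  0.\<close>

lemma nat_floor_mult_tendsto:
  assumes r: "filterlim r at_top sequentially"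
  shows "(\<lambda>n. real (nat \<lfloor>real (r n) * \<xi>\<rfloor>) / real (r n)) \<longlonglongrightarrow> max 0 \<xi>"
proof (rule filterlim_compose[OF _ r])
  show "(\<lambda>n. real (nat \<lfloor>real n * \<xi>\<rfloor>) / real n) \<longlonglongrightarrow> max 0 \<xi>"
  proof (cases "\<xi> \<ge> 0")
    case True
    have "(\<lambda>n. \<xi> - 1 / real n) \<longlonglongrightarrow> \<xi> - 0" by (intro tendsto_intros lim_const_over_n)
    then have l: "(\<lambda>n. \<xi> - 1 / real n) \<longlonglongrightarrow> \<xi>" by simp
    have "(\<lambda>n. real (nat \<lfloor>real n * \<xi>\<rfloor>) / real n) \<longlonglongrightarrow> \<xi>"
    proof (rule tendsto_sandwich[OF _ _ l tendsto_const])
      show "\<forall>\<^sub>F n in sequentially. \<xi> - 1 / real n \<le> real (nat \<lfloor>real n * \<xi>\<rfloor>) / real n"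
      proof (rule eventually_mono[OF eventually_gt_at_top[of 0]])
        fix n :: nat assume n: "0 < n"
        have "real n * \<xi> - 1 \<le> real (nat \<lfloor>real n * \<xi>\<rfloor>)" using True by linarith
        then have "(real n * \<xi> - 1) / real n \<le> real (nat \<lfloor>real n * \<xi>\<rfloor>) / real n" by (intro divide_right_mono) auto
        then show "\<xi> - 1 / real n \<le> real (nat \<lfloor>real n * \<xi>\<rfloor>) / real n" using n by (simp add: diff_divide_distrib)
      qed
      show "\<forall>\<^sub>F n in sequentially. real (nat \<lfloor>real n * \<xi>\<rfloor>) / real n \<le> \<xi>"
      proof (rule eventually_mono[OF eventually_gt_at_top[of 0]])
        fix n :: nat assume n: "0 < n"
        have "0 \<le> real n * \<xi>" using True by simp
        then have "real (nat \<lfloor>real n * \<xi>\<rfloor>) \<le> real n * \<xi>" by linarith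
        then show "real (nat \<lfloor>real n * \<xi>\<rfloor>) / real n \<le> \<xi>" using n by (simp add: divide_le_eq mult.commute)
      qed
    qed
    then show ?thesis using True by simp
  next
    case False
    then have "real n * \<xi> \<le> 0" for n by (simp add: mult_nonneg_nonpos)
    then have "real n * \<xi> < 1" for n by (rule order_le_less_trans) simp
    then have "\<lfloor>real n * \<xi>\<rfloor> < 1" for n by (simp add: floor_less_iff)
    then have "nat \<lfloor>real n * \<xi>\<rfloor> = 0" for n by (metis int_one_le_iff_zero_less linorder_not_less nat_le_0)
    then show ?thesis using False by simp
  qed
qed

locale extremal_series = stationary_series +
  fixes a b :: "nat \<Rightarrow> real" and \<gamma> :: real
  assumes mda: "MDA M X a b \<gamma>"
begin

lemma a_pos: "r \<ge> 1 \<Longrightarrow> a r > 0"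
  using mda by (simp add: MDA_def)

definition lev :: "nat \<Rightarrow> real \<Rightarrow> real" where
  "lev r x = a r * x + b r"

text \<open>The stretch is \<open>s + 1, ..., s + q\<close>: here \<open>s\<close> is the time just
  before it, so consecutive stretches join without an offset.\<close>

definition runs :: "int \<Rightarrow> nat \<Rightarrow> real \<Rightarrow> 'a set" where
  "runs s q u = cyl {1..int q} (\<lambda>t. t + s) (\<lambda>_. {..u})"

lemma runs_iff: "x \<in> runs s q u \<longleftrightarrow> x \<in> space M \<and> (\<forall>t\<in>{s + 1..s + int q}. X t x \<le> u)"
proof -
  have e: "{s + 1..s + int q} = (\<lambda>t. t + s) ` {1..int q}" by (simp add: add.commute)
  have "(\<forall>t\<in>{s + 1..s + int q}. X t x \<le> u) \<longleftrightarrow> (\<forall>j\<in>{1..int q}. X (j + s) x \<le> u)"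
    unfolding e by blast
  then show ?thesis by (simp add: runs_def cyl_def)
qed

lemma runs_events [measurable]: "runs s q u \<in> events"
  unfolding runs_def by (rule cyl_events) auto

lemma prob_runs_shift: "prob (runs s q u) = prob (runs 0 q u)"
  unfolding runs_def using prob_cyl_shift[of "{1..int q}" "\<lambda>_. {..u}" "\<lambda>t. t" s] by simp

lemma norm_block_max_le_iff:
  assumes "r > 0"
  shows "norm_block_max a b X r s x \<le> y \<longleftrightarrow> (\<forall>t\<in>{int s..<int (s + r)}. X t x \<le> lev r y)"
proof -
  have a: "a r > 0" using a_pos assms by simp
  have "norm_block_max a b X r s x \<le> y \<longleftrightarrow> block_max X r s x \<le> lev r y"
    using a by (simp add: norm_block_max_def lev_def divide_le_eq algebra_simps)
  also have "\<dots> \<longleftrightarrow> (\<forall>t\<in>{int s..<int (s + r)}. X t x \<le> lev r y)"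
    unfolding block_max_def using assms by (subst Max_le_iff) auto
  finally show ?thesis .
qed

lemma norm_block_max_le_eq_runs:
  assumes "r > 0"
  shows "{x \<in> space M. norm_block_max a b X r (Suc s) x \<le> y} = runs (int s) r (lev r y)"
proof -
  have "{int (Suc s)..<int (Suc s + r)} = {int s + 1..int s + int r}" by auto
  then show ?thesis by (auto simp: runs_iff norm_block_max_le_iff[OF assms])
qed

lemma norm_block_max_measurable' [measurable]: "norm_block_max a b X r s \<in> borel_measurable M"
  by (rule norm_block_max_measurable) simp

text \<open>The level \<open>lev r x\<close> is rewritten in the norming of the block length
  \<open>q r\<close>. Its position there converges by the regularity of \<open>a\<close> and
  \<open>b\<close>; since the argument moves with \<open>r\<close>, uniform convergence of the
  distribution functions is used, and max-stability evaluates the limit.\<close>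

lemma prob_runs_floor_tendsto:
  assumes \<xi>: "\<xi> > 0"
  shows "(\<lambda>r. prob (runs 0 (nat \<lfloor>real r * \<xi>\<rfloor>) (lev r x))) \<longlonglongrightarrow> gev_cdf \<gamma> x powr \<xi>"
proof -
  define \<mu> where "\<mu> r = distr M borel (norm_block_max a b X r 1)" for r
  define q where "q r = nat \<lfloor>real r * \<xi>\<rfloor>" for r
  define \<beta> where "\<beta> = (if \<gamma> = 0 then ln \<xi> else (\<xi> powr \<gamma> - 1) / \<gamma>)"
  define y where "y r = (lev r x - b (q r)) / a (q r)" for r
  have \<mu>d: "real_distribution (\<mu> r)" for r unfolding \<mu>_def by simp
  have dK: "(\<lambda>r. kolmogorov_dist (\<mu> r) (gev_measure \<gamma>)) \<longlonglongrightarrow> 0"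
  proof (rule kolmogorov_dist_tendsto_0[OF \<mu>d real_distribution_gev])
    show "weak_conv_m \<mu> (gev_measure \<gamma>)" using mda by (simp add: MDA_def \<mu>_def[abs_def])
  qed (simp add: cdf_gev gev_cdf_isCont)
  have qinf: "filterlim q at_top sequentially"
    unfolding q_def using \<xi> by real_asymp
  have ev: "\<forall>\<^sub>F r in sequentially. r \<ge> 1 \<and> q r \<ge> 1"
    using eventually_ge_at_top[of 1] qinf[THEN eventually_compose_filterlim[OF eventually_ge_at_top[of 1]]]
    by eventually_elim simp
  have y: "y \<longlonglongrightarrow> (x - \<beta>) / \<xi> powr \<gamma>"
  proof (rule Lim_transform_eventually)
    have "(\<lambda>r. a (q r) / a r) \<longlonglongrightarrow> \<xi> powr \<gamma>" "(\<lambda>r. (b (q r) - b r) / a r) \<longlonglongrightarrow> \<beta>"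
      using mda \<xi> unfolding MDA_def q_def \<beta>_def by auto
    then show "(\<lambda>r. (x - (b (q r) - b r) / a r) / (a (q r) / a r)) \<longlonglongrightarrow> (x - \<beta>) / \<xi> powr \<gamma>"
      using \<xi> by (intro tendsto_intros) auto
    show "\<forall>\<^sub>F r in sequentially. (x - (b (q r) - b r) / a r) / (a (q r) / a r) = y r"
      using ev
    proof eventually_elim
      fix r assume "1 \<le> r \<and> 1 \<le> q r"
      then have "a r > 0" "a (q r) > 0" using a_pos by auto
      then show "(x - (b (q r) - b r) / a r) / (a (q r) / a r) = y r"
        by (simp add: y_def lev_def field_simps)
    qed
  qed
  have "(\<lambda>r. cdf (gev_measure \<gamma>) (y r)) \<longlonglongrightarrow> gev_cdf \<gamma> ((x - \<beta>) / \<xi> powr \<gamma>)"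
    unfolding cdf_gev by (rule isCont_tendsto_compose[OF gev_cdf_isCont y])
  moreover have "(\<lambda>r. cdf (\<mu> (q r)) (y r) - cdf (gev_measure \<gamma>) (y r)) \<longlonglongrightarrow> 0"
  proof (rule Lim_null_comparison)
    show "(\<lambda>r. kolmogorov_dist (\<mu> (q r)) (gev_measure \<gamma>)) \<longlonglongrightarrow> 0"
      by (rule filterlim_compose[OF dK qinf])
    show "\<forall>\<^sub>F r in sequentially. norm (cdf (\<mu> (q r)) (y r) - cdf (gev_measure \<gamma>) (y r)) \<le> kolmogorov_dist (\<mu> (q r)) (gev_measure \<gamma>)"
      by (intro always_eventually allI) (simp add: cdf_diff_le_kolmogorov_dist \<mu>d real_distribution_gev)
  qed
  ultimately have "(\<lambda>r. (cdf (\<mu> (q r)) (y r) - cdf (gev_measure \<gamma>) (y r)) + cdf (gev_measure \<gamma>) (y r)) \<longlonglongrightarrow> 0 + gev_cdf \<gamma> ((x - \<beta>) / \<xi> powr \<gamma>)"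
    by (intro tendsto_add)
  then have "(\<lambda>r. cdf (\<mu> (q r)) (y r)) \<longlonglongrightarrow> gev_cdf \<gamma> x powr \<xi>"
    using gev_cdf_max_stable[OF \<xi>, of \<gamma> x] by (simp add: \<beta>_def)
  then show ?thesis
  proof (rule Lim_transform_eventually)
    show "\<forall>\<^sub>F r in sequentially. cdf (\<mu> (q r)) (y r) = prob (runs 0 (nat \<lfloor>real r * \<xi>\<rfloor>) (lev r x))"
      using ev
    proof eventually_elim
      fix r assume r: "1 \<le> r \<and> 1 \<le> q r"
      then have "a (q r) > 0" using a_pos by auto
      then have "lev (q r) (y r) = lev r x" by (simp add: lev_def[of "q r"] y_def)
      then have "{x \<in> space M. norm_block_max a b X (q r) 1 x \<le> y r} = runs 0 (q r) (lev r x)"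
        using norm_block_max_le_eq_runs[of "q r" 0 "y r"] r by simp
      moreover have "cdf (\<mu> (q r)) (y r) = prob {x \<in> space M. norm_block_max a b X (q r) 1 x \<le> y r}"
        unfolding cdf_def \<mu>_def by (subst measure_distr) (auto intro!: arg_cong[where f = prob])
      ultimately show "cdf (\<mu> (q r)) (y r) = prob (runs 0 (nat \<lfloor>real r * \<xi>\<rfloor>) (lev r x))"
        by (simp add: q_def)
    qed
  qed
qed

section \<open>Stretches of arbitrary asymptotic length\<close>

lemma runs_antimono: "q \<le> q' \<Longrightarrow> runs s q' u \<subseteq> runs s q u"
  by (auto simp: runs_iff)

lemma prob_runs_antimono: "q \<le> q' \<Longrightarrow> prob (runs s q' u) \<le> prob (runs s q u)"
  by (intro finite_measure_mono runs_antimono) auto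


text \<open>Longer stretches are less likely to stay low, and the limit is continuous in
  \<open>\<xi>\<close>, so lengths of the form \<open>floor (r * \<zeta>)\<close> on either side of
  \<open>\<xi>\<close> enclose the general case.\<close>

lemma prob_runs_le_tendsto:
  assumes r: "filterlim r at_top sequentially"
    and q: "(\<lambda>n. real (q n) / real (r n)) \<longlonglongrightarrow> \<xi>" and \<xi>: "\<xi> > 0"
  shows "(\<lambda>n. prob (runs 0 (q n) (lev (r n) x))) \<longlonglongrightarrow> gev_cdf \<gamma> x powr \<xi>"
proof -
  let ?p = "\<lambda>n. prob (runs 0 (q n) (lev (r n) x))"
  have r0: "\<forall>\<^sub>F n in sequentially. r n > 0"
    using r[THEN eventually_compose_filterlim[OF eventually_gt_at_top[of 0]]] .
  have lim: "(\<lambda>n. prob (runs 0 (nat \<lfloor>real (r n) * \<zeta>\<rfloor>) (lev (r n) x))) \<longlonglongrightarrow> gev_cdf \<gamma> x powr \<zeta>" if "\<zeta> > 0" for \<zeta>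
    by (rule filterlim_compose[OF prob_runs_floor_tendsto[OF that] r])
  have cont: "((\<lambda>\<zeta>. gev_cdf \<gamma> x powr \<zeta>) \<longlongrightarrow> gev_cdf \<gamma> x powr \<xi>) (at \<xi>)"
    by (cases "gev_cdf \<gamma> x = 0") (auto intro!: tendsto_intros)
  have fl: "real (nat \<lfloor>real (r n) * \<zeta>\<rfloor>) \<le> real (r n) * \<zeta>" "real (r n) * \<zeta> - 1 \<le> real (nat \<lfloor>real (r n) * \<zeta>\<rfloor>)"
    if "\<zeta> > 0" for n \<zeta>
  proof -
    have "0 \<le> real (r n) * \<zeta>" using that by simp
    then show "real (nat \<lfloor>real (r n) * \<zeta>\<rfloor>) \<le> real (r n) * \<zeta>" "real (r n) * \<zeta> - 1 \<le> real (nat \<lfloor>real (r n) * \<zeta>\<rfloor>)"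
      by linarith+
  qed
  show ?thesis
  proof (rule order_tendstoI)
    fix l assume l: "l < gev_cdf \<gamma> x powr \<xi>"
    have "\<forall>\<^sub>F \<zeta> in at_right \<xi>. l < gev_cdf \<gamma> x powr \<zeta>"
      using order_tendstoD(1)[OF cont l] by (auto simp: eventually_at_split)
    then obtain d where d: "d > \<xi>" "\<And>\<zeta>. \<xi> < \<zeta> \<Longrightarrow> \<zeta> < d \<Longrightarrow> l < gev_cdf \<gamma> x powr \<zeta>"
      unfolding eventually_at_right_field by blast
    \<comment> \<open>Two intermediate points are needed: the distance from \<open>\<zeta>'\<close>
      to \<open>\<zeta>\<close>, multiplied by \<open>r n\<close>, absorbs the loss of rounding
      down.\<close>
    define \<zeta> where "\<zeta> = (\<xi> + d) / 2"
    define \<zeta>' where "\<zeta>' = (\<xi> + \<zeta>) / 2"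
    have z: "\<xi> < \<zeta>'" "\<zeta>' < \<zeta>" "\<zeta> < d" "\<zeta> > 0" using d \<xi> by (auto simp: \<zeta>_def \<zeta>'_def)
    have "\<forall>\<^sub>F n in sequentially. l < prob (runs 0 (nat \<lfloor>real (r n) * \<zeta>\<rfloor>) (lev (r n) x))"
      using z by (intro order_tendstoD(1)[OF lim] d) auto
    moreover have "\<forall>\<^sub>F n in sequentially. real (q n) / real (r n) < \<zeta>'"
      using z by (intro order_tendstoD(2)[OF q]) auto
    moreover have "\<forall>\<^sub>F n in sequentially. real (r n) * (\<zeta> - \<zeta>') \<ge> 1"
    proof -
      have "filterlim (\<lambda>n. real (r n)) at_top sequentially" by (rule filterlim_compose[OF filterlim_real_sequentially r])
      then have "\<forall>\<^sub>F n in sequentially. real (r n) \<ge> 1 / (\<zeta> - \<zeta>')" by (simp add: filterlim_at_top)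
      then show ?thesis by eventually_elim (use z in \<open>simp add: field_simps\<close>)
    qed
    ultimately show "\<forall>\<^sub>F n in sequentially. l < ?p n"
      using r0
    proof eventually_elim
      fix n assume H: "l < prob (runs 0 (nat \<lfloor>real (r n) * \<zeta>\<rfloor>) (lev (r n) x))" "real (q n) / real (r n) < \<zeta>'"
        "1 \<le> real (r n) * (\<zeta> - \<zeta>')" "r n > 0"
      have "real (q n) < real (r n) * \<zeta>'" using H by (simp add: divide_less_eq mult.commute)
      then have "real (q n) < real (nat \<lfloor>real (r n) * \<zeta>\<rfloor>)"
        using H(3) fl(2)[OF z(4), of n] unfolding right_diff_distrib by linarith
      then show "l < ?p n"
        using H(1) prob_runs_antimono[of "q n" "nat \<lfloor>real (r n) * \<zeta>\<rfloor>" 0 "lev (r n) x"] by linarith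
    qed
  next
    fix l assume l: "gev_cdf \<gamma> x powr \<xi> < l"
    have "\<forall>\<^sub>F \<zeta> in at_left \<xi>. gev_cdf \<gamma> x powr \<zeta> < l"
      using order_tendstoD(2)[OF cont l] by (auto simp: eventually_at_split)
    then obtain d where d: "d < \<xi>" "\<And>\<zeta>. d < \<zeta> \<Longrightarrow> \<zeta> < \<xi> \<Longrightarrow> gev_cdf \<gamma> x powr \<zeta> < l"
      unfolding eventually_at_left_field by blast
    \<comment> \<open>One intermediate point suffices here, since rounding down already goes in the
      favourable direction. The maximum with 0 keeps it positive.\<close>
    define \<zeta> where "\<zeta> = (\<xi> + max d 0) / 2"
    have z: "\<zeta> < \<xi>" "d < \<zeta>" "\<zeta> > 0" using d \<xi> by (auto simp: \<zeta>_def)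
    have "\<forall>\<^sub>F n in sequentially. prob (runs 0 (nat \<lfloor>real (r n) * \<zeta>\<rfloor>) (lev (r n) x)) < l"
      using z by (intro order_tendstoD(2)[OF lim] d) auto
    moreover have "\<forall>\<^sub>F n in sequentially. \<zeta> < real (q n) / real (r n)"
      using z by (intro order_tendstoD(1)[OF q]) auto
    ultimately show "\<forall>\<^sub>F n in sequentially. ?p n < l"
      using r0
    proof eventually_elim
      fix n assume H: "prob (runs 0 (nat \<lfloor>real (r n) * \<zeta>\<rfloor>) (lev (r n) x)) < l" "\<zeta> < real (q n) / real (r n)" "r n > 0"
      have "real (r n) * \<zeta> < real (q n)" using H by (simp add: less_divide_eq mult.commute)
      then have "real (nat \<lfloor>real (r n) * \<zeta>\<rfloor>) < real (q n)" using fl(1)[OF z(3), of n] by linarith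
      then show "?p n < l"
        using H(1) prob_runs_antimono[of "nat \<lfloor>real (r n) * \<zeta>\<rfloor>" "q n" 0 "lev (r n) x"] by linarith
    qed
  qed
qed

text \<open>Stretches of length about \<open>\<zeta> * r\<close> have limiting probability
  \<open>G(x)\<close> to the power \<open>\<zeta>\<close>, which is close to 1 for small
  \<open>\<zeta>\<close> provided that \<open>G(x) > 0\<close>. A stretch of length
  \<open>o(r)\<close> is eventually shorter.\<close>

lemma prob_runs_negligible:
  assumes r: "filterlim r at_top sequentially"
    and q: "(\<lambda>n. real (q n) / real (r n)) \<longlonglongrightarrow> 0" and G: "gev_cdf \<gamma> x > 0"
  shows "(\<lambda>n. prob (runs 0 (q n) (lev (r n) x))) \<longlonglongrightarrow> 1"
proof (rule order_tendstoI)
  fix l :: real assume "1 < l"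
  then show "\<forall>\<^sub>F n in sequentially. prob (runs 0 (q n) (lev (r n) x)) < l"
    by (intro always_eventually allI) (meson le_less_trans prob_le_1)
next
  fix l :: real assume l: "l < 1"
  have "((\<lambda>\<zeta>. gev_cdf \<gamma> x powr \<zeta>) \<longlongrightarrow> gev_cdf \<gamma> x powr 0) (at_right 0)"
    using G by (intro tendsto_intros) auto
  then have "\<forall>\<^sub>F \<zeta> in at_right 0. l < gev_cdf \<gamma> x powr \<zeta>"
    using l G by (intro order_tendstoD(1)) auto
  then obtain d where d: "d > 0" "\<And>\<zeta>. 0 < \<zeta> \<Longrightarrow> \<zeta> < d \<Longrightarrow> l < gev_cdf \<gamma> x powr \<zeta>"
    unfolding eventually_at_right_field by blast
  define \<zeta> where "\<zeta> = d / 2"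
  have z: "0 < \<zeta>" "\<zeta> < d" using d by (auto simp: \<zeta>_def)
  \<comment> \<open>Taking the maximum gives a sequence with an exact positive asymptotic ratio, as
    the previous limit theorem demands, while never shortening the stretch.\<close>
  define q' where "q' n = max (q n) (nat \<lfloor>real (r n) * \<zeta>\<rfloor>)" for n
  have "(\<lambda>n. max (real (q n) / real (r n)) (real (nat \<lfloor>real (r n) * \<zeta>\<rfloor>) / real (r n))) \<longlonglongrightarrow> max 0 (max 0 \<zeta>)"
    by (intro tendsto_max q nat_floor_mult_tendsto r)
  moreover have "max (real (q n) / real (r n)) (real (nat \<lfloor>real (r n) * \<zeta>\<rfloor>) / real (r n)) = real (q' n) / real (r n)" for n
    unfolding q'_def by (simp add: of_nat_max max_divide_distrib_right)
  ultimately have "(\<lambda>n. real (q' n) / real (r n)) \<longlonglongrightarrow> \<zeta>" using z by simp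
  then have "(\<lambda>n. prob (runs 0 (q' n) (lev (r n) x))) \<longlonglongrightarrow> gev_cdf \<gamma> x powr \<zeta>"
    using z by (intro prob_runs_le_tendsto r) auto
  from order_tendstoD(1)[OF this d(2)[OF z]]
  show "\<forall>\<^sub>F n in sequentially. l < prob (runs 0 (q n) (lev (r n) x))"
  proof eventually_elim
    fix n assume "l < prob (runs 0 (q' n) (lev (r n) x))"
    then show "l < prob (runs 0 (q n) (lev (r n) x))"
      using prob_runs_antimono[of "q n" "q' n" 0 "lev (r n) x"] by (simp add: q'_def)
  qed
qed

section \<open>Joint probabilities of several stretches\<close>

lemma mixing_runs_Int:
  assumes "s + int q + int p \<le> s' + 1"
  shows "\<bar>prob (runs s q u \<inter> runs s' q' u') - prob (runs s q u) * prob (runs s' q' u')\<bar> \<le> alpha_mixing M X p"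
  unfolding runs_def by (rule mixing_cyl[where q = "s + int q"]) (use assms in auto)

text \<open>Mixing is applied twice, first across the left gap and then across the right one. The
  order of the last two stretches guarantees that both lie beyond the left gap.\<close>

lemma mixing_runs_Int3:
  assumes "s + int q + int p \<le> s' + 1" "s' + int q' + int p \<le> s'' + 1" "s' \<le> s''"
  shows "\<bar>prob (runs s q u \<inter> (runs s' q' u' \<inter> runs s'' q'' u'')) -
     prob (runs s q u) * (prob (runs s' q' u') * prob (runs s'' q'' u''))\<bar> \<le> 2 * alpha_mixing M X p"
proof -
  let ?A = "runs s q u" and ?B = "runs s' q' u'" and ?C = "runs s'' q'' u''"
  have 1: "\<bar>prob (?A \<inter> (?B \<inter> ?C)) - prob ?A * prob (?B \<inter> ?C)\<bar> \<le> alpha_mixing M X p"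
    unfolding runs_def cyl_Int[of "{1..int q'}"]
    by (rule mixing_cyl[where q = "s + int q"]) (use assms in \<open>auto simp: Plus_def\<close>)
  have "\<bar>prob ?A * (prob (?B \<inter> ?C) - prob ?B * prob ?C)\<bar> \<le> 1 * alpha_mixing M X p"
    unfolding abs_mult by (intro mult_mono mixing_runs_Int assms) auto
  then show ?thesis using 1 by (simp add: right_diff_distrib)
qed

definition pair_prob :: "nat \<Rightarrow> nat \<Rightarrow> real \<Rightarrow> real \<Rightarrow> real" where
  "pair_prob r d x y = prob (runs 0 r (lev r x) \<inter> runs (int d) r (lev r y))"

lemma prob_runs_pair: "prob (runs s r (lev r x) \<inter> runs (s + int d) r (lev r y)) = pair_prob r d x y"
proof -
  have "runs (s + int d) r v = cyl {1..int r} (\<lambda>t. (t + int d) + s) (\<lambda>_. {..v})" for v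
    by (simp add: runs_def add.assoc add.commute[of s])
  moreover have "runs s r v = cyl {1..int r} (\<lambda>t. (t + 0) + s) (\<lambda>_. {..v})" for v
    by (simp add: runs_def)
  ultimately show ?thesis
    by (simp only: pair_prob_def runs_def) (rule prob_cyl_Int_shift; simp)
qed

end

locale block_scheme = extremal_series +
  fixes r l :: "nat \<Rightarrow> nat"
  assumes r_lim: "filterlim r at_top sequentially"
    and l_lim: "(\<lambda>n. real (l n) / real (r n)) \<longlonglongrightarrow> 0"
    and alpha_lim: "(\<lambda>n. alpha_mixing M X (l n)) \<longlonglongrightarrow> 0"
begin

lemma r_pos: "\<forall>\<^sub>F n in sequentially. r n > 0"
  using r_lim[THEN eventually_compose_filterlim[OF eventually_gt_at_top[of 0]]] .

lemma prob_runs_r_tendsto: "(\<lambda>n. prob (runs 0 (r n) (lev (r n) x))) \<longlonglongrightarrow> gev_cdf \<gamma> x"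
proof -
  have "(\<lambda>n. real (r n) / real (r n)) \<longlonglongrightarrow> 1"
    by (rule tendsto_eventually) (use r_pos in \<open>eventually_elim, simp\<close>)
  from prob_runs_le_tendsto[OF r_lim this] show ?thesis by (simp add: gev_cdf_nonneg)
qed

text \<open>Windows more than one block length apart are disjoint with a gap that eventually exceeds
  \<open>l n\<close>, so mixing makes them independent in the limit.\<close>

lemma pair_prob_tendsto_far:
  assumes d: "(\<lambda>n. real (d n) / real (r n)) \<longlonglongrightarrow> \<xi>" and \<xi>: "\<xi> > 1"
  shows "(\<lambda>n. pair_prob (r n) (d n) x y) \<longlonglongrightarrow> gev_cdf \<gamma> x * gev_cdf \<gamma> y"
proof -
  let ?p = "\<lambda>n. prob (runs 0 (r n) (lev (r n) x)) * prob (runs (int (d n)) (r n) (lev (r n) y))"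
  have "(\<lambda>n. real (d n) / real (r n) - real (l n) / real (r n)) \<longlonglongrightarrow> \<xi> - 0" by (intro tendsto_intros d l_lim)
  then have "\<forall>\<^sub>F n in sequentially. 1 < real (d n) / real (r n) - real (l n) / real (r n)"
    using \<xi> by (intro order_tendstoD(1)) auto
  then have "\<forall>\<^sub>F n in sequentially. norm (pair_prob (r n) (d n) x y - ?p n) \<le> alpha_mixing M X (l n)"
    using r_pos
  proof eventually_elim
    fix n assume "1 < real (d n) / real (r n) - real (l n) / real (r n)" "r n > 0"
    then have "real (r n) < real (d n) - real (l n)" by (simp add: diff_divide_distrib[symmetric] less_divide_eq)
    then have "0 + int (r n) + int (l n) \<le> int (d n) + 1" by linarith
    then show "norm (pair_prob (r n) (d n) x y - ?p n) \<le> alpha_mixing M X (l n)"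
      unfolding pair_prob_def real_norm_def by (rule mixing_runs_Int)
  qed
  then have "(\<lambda>n. pair_prob (r n) (d n) x y - ?p n) \<longlonglongrightarrow> 0"
    by (rule Lim_null_comparison[OF _ alpha_lim])
  moreover have "?p \<longlonglongrightarrow> gev_cdf \<gamma> x * gev_cdf \<gamma> y"
    unfolding prob_runs_shift[of "int _"] by (intro tendsto_intros prob_runs_r_tendsto)
  ultimately have "(\<lambda>n. (pair_prob (r n) (d n) x y - ?p n) + ?p n) \<longlonglongrightarrow> 0 + gev_cdf \<gamma> x * gev_cdf \<gamma> y"
    by (rule tendsto_add)
  then show ?thesis by simp
qed

text \<open>Two overlapping windows form three stretches: seen by the first only, by both, and by
  the second only, with relative lengths \<open>\<xi>\<close>, \<open>1 - \<xi>\<close>,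
  \<open>\<xi>\<close>. On the overlap the smaller threshold decides. Cutting \<open>l n\<close>
  points off the first two stretches creates the gaps that mixing needs.\<close>

lemma pair_prob_tendsto_near:
  assumes d: "(\<lambda>n. real (d n) / real (r n)) \<longlonglongrightarrow> \<xi>" and \<xi>: "0 < \<xi>" "\<xi> < 1"
  shows "(\<lambda>n. pair_prob (r n) (d n) x y) \<longlonglongrightarrow> gev_biv_cdf \<gamma> \<xi> x y"
proof -
  define v where "v = min x y"
  let ?u = "\<lambda>n z. lev (r n) z"
  define A where "A n = runs 0 (d n - l n) (?u n x)" for n
  define B where "B n = runs (int (d n)) (r n - d n - l n) (?u n v)" for n
  define C where "C n = runs (int (r n)) (d n) (?u n y)" for n
  define E where "E n = runs 0 (r n) (?u n x) \<inter> runs (int (d n)) (r n) (?u n y)" for n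
  define E' where "E' n = A n \<inter> (B n \<inter> C n)" for n
  let ?P = "\<lambda>n. prob (A n) * (prob (B n) * prob (C n))"
  have "(\<lambda>n. real (d n) / real (r n) - real (l n) / real (r n)) \<longlonglongrightarrow> \<xi> - 0" by (intro tendsto_intros d l_lim)
  then have dl: "\<forall>\<^sub>F n in sequentially. 0 < real (d n) / real (r n) - real (l n) / real (r n)"
    using \<xi> by (intro order_tendstoD(1)) auto
  have "(\<lambda>n. real (d n) / real (r n) + real (l n) / real (r n)) \<longlonglongrightarrow> \<xi> + 0" by (intro tendsto_intros d l_lim)
  then have dl': "\<forall>\<^sub>F n in sequentially. real (d n) / real (r n) + real (l n) / real (r n) < 1"
    using \<xi> by (intro order_tendstoD(2)) auto
  have ev: "\<forall>\<^sub>F n in sequentially. r n > 0 \<and> l n < d n \<and> d n + l n < r n"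
    using dl dl' r_pos
    by eventually_elim (auto simp: diff_divide_distrib[symmetric] add_divide_distrib[symmetric] zero_less_divide_iff divide_less_eq)
  have Alim: "(\<lambda>n. prob (A n)) \<longlonglongrightarrow> gev_cdf \<gamma> x powr \<xi>"
    unfolding A_def
  proof (rule prob_runs_le_tendsto[OF r_lim _ \<xi>(1)])
    have "(\<lambda>n. real (d n) / real (r n) - real (l n) / real (r n)) \<longlonglongrightarrow> \<xi> - 0" by (intro tendsto_intros d l_lim)
    then show "(\<lambda>n. real (d n - l n) / real (r n)) \<longlonglongrightarrow> \<xi>"
      by (rule Lim_transform_eventually[THEN tendsto_eq_rhs]) (use ev in \<open>auto elim!: eventually_mono simp: diff_divide_distrib add_divide_distrib of_nat_diff\<close>)
  qed
  have Blim: "(\<lambda>n. prob (B n)) \<longlonglongrightarrow> gev_cdf \<gamma> v powr (1 - \<xi>)"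
    unfolding B_def prob_runs_shift[of "int _"]
  proof (rule prob_runs_le_tendsto[OF r_lim])
    have "(\<lambda>n. 1 - real (d n) / real (r n) - real (l n) / real (r n)) \<longlonglongrightarrow> 1 - \<xi> - 0" by (intro tendsto_intros d l_lim)
    then show "(\<lambda>n. real (r n - d n - l n) / real (r n)) \<longlonglongrightarrow> 1 - \<xi>"
      by (rule Lim_transform_eventually[THEN tendsto_eq_rhs]) (use ev in \<open>auto elim!: eventually_mono simp: diff_divide_distrib add_divide_distrib of_nat_diff\<close>)
  qed (use \<xi> in simp)
  have Clim: "(\<lambda>n. prob (C n)) \<longlonglongrightarrow> gev_cdf \<gamma> y powr \<xi>"
    unfolding C_def prob_runs_shift[of "int _"] by (rule prob_runs_le_tendsto[OF r_lim d \<xi>(1)])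
  have Plim: "?P \<longlonglongrightarrow> gev_biv_cdf \<gamma> \<xi> x y"
    using tendsto_mult[OF Alim tendsto_mult[OF Blim Clim]] by (simp add: gev_biv_cdf_def v_def mult_ac)
  have "(\<lambda>n. prob (E' n) - ?P n) \<longlonglongrightarrow> 0"
  proof (rule Lim_null_comparison)
    have "(\<lambda>n. 2 * alpha_mixing M X (l n)) \<longlonglongrightarrow> 2 * 0" by (intro tendsto_intros alpha_lim)
    then show "(\<lambda>n. 2 * alpha_mixing M X (l n)) \<longlonglongrightarrow> 0" by simp
    show "\<forall>\<^sub>F n in sequentially. norm (prob (E' n) - ?P n) \<le> 2 * alpha_mixing M X (l n)"
      using ev by eventually_elim (unfold E'_def A_def B_def C_def real_norm_def, rule mixing_runs_Int3, auto simp: of_nat_diff)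
  qed
  from tendsto_add[OF this Plim] have E'lim: "(\<lambda>n. prob (E' n)) \<longlonglongrightarrow> gev_biv_cdf \<gamma> \<xi> x y" by simp
  have levv: "r n > 0 \<Longrightarrow> ?u n v = min (?u n x) (?u n y)" for n
    using a_pos[of "r n"] by (simp add: v_def lev_def min_def)
  have sub: "\<forall>\<^sub>F n in sequentially. E n \<subseteq> E' n"
    using ev by eventually_elim (auto simp: E_def E'_def A_def B_def C_def runs_iff levv)
  then have upper: "\<forall>\<^sub>F n in sequentially. prob (E n) \<le> prob (E' n)"
    by eventually_elim (auto intro!: finite_measure_mono simp: E'_def A_def B_def C_def)
  have "(\<lambda>n. prob (E n)) \<longlonglongrightarrow> gev_biv_cdf \<gamma> \<xi> x y"
  \<comment> \<open>If \<open>G\<close> vanishes at the smaller threshold the removed gaps need not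
    be negligible, but the limit is 0 and the upper bound suffices.\<close>
  proof (cases "gev_cdf \<gamma> v = 0")
    case True
    then have z: "gev_biv_cdf \<gamma> \<xi> x y = 0" by (simp add: gev_biv_cdf_def v_def)
    show ?thesis
      unfolding z
    proof (rule tendsto_sandwich[OF _ _ tendsto_const E'lim[unfolded z]])
    qed (simp_all add: upper)
  next
    case False
    then have Gv: "gev_cdf \<gamma> v > 0" using gev_cdf_nonneg[of \<gamma> v] by linarith
    then have Gx: "gev_cdf \<gamma> x > 0" using gev_cdf_mono[of v x \<gamma>] by (simp add: v_def)
    let ?g = "\<lambda>n. (1 - prob (runs 0 (l n) (?u n x))) + (1 - prob (runs 0 (l n) (?u n v)))"
    have "?g \<longlonglongrightarrow> (1 - 1) + (1 - 1)"
      by (intro tendsto_intros prob_runs_negligible[OF r_lim l_lim] Gx Gv)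
    then have glim: "?g \<longlonglongrightarrow> 0" by simp
    have lower: "\<forall>\<^sub>F n in sequentially. prob (E' n) - ?g n \<le> prob (E n)"
      using ev
    proof eventually_elim
      fix n assume n: "r n > 0 \<and> l n < d n \<and> d n + l n < r n"
      \<comment> \<open>These are the two removed gaps. Where both stay below their levels, the
        trimmed event implies the full one.\<close>
      let ?R1 = "runs (int (d n - l n)) (l n) (?u n x)" and ?R2 = "runs (int (r n - l n)) (l n) (?u n v)"
      have sub: "E' n \<subseteq> E n \<union> ((space M - ?R1) \<union> (space M - ?R2))"
      proof
        fix \<omega> assume \<omega>: "\<omega> \<in> E' n"
        show "\<omega> \<in> E n \<union> ((space M - ?R1) \<union> (space M - ?R2))"
        proof (cases "\<omega> \<in> ?R1 \<and> \<omega> \<in> ?R2")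
          case True
          have sp: "\<omega> \<in> space M" using True by (simp add: runs_iff)
          have a1: "X t \<omega> \<le> ?u n x" if "1 \<le> t" "t \<le> int (d n)" for t
            using that \<omega> True n by (cases "t \<le> int (d n - l n)") (auto simp: E'_def A_def runs_iff of_nat_diff)
          have a2: "X t \<omega> \<le> ?u n v" if "int (d n) + 1 \<le> t" "t \<le> int (r n)" for t
            using that \<omega> True n by (cases "t \<le> int (r n - l n)") (auto simp: E'_def B_def runs_iff of_nat_diff)
          have a3: "X t \<omega> \<le> ?u n y" if "int (r n) + 1 \<le> t" "t \<le> int (r n) + int (d n)" for t
            using that \<omega> by (auto simp: E'_def C_def runs_iff)
          have "X t \<omega> \<le> ?u n x" if "1 \<le> t" "t \<le> int (r n)" for t
            using a1[of t] a2[of t] that levv[of n] n by (cases "t \<le> int (d n)") auto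
          moreover have "X t \<omega> \<le> ?u n y" if "int (d n) + 1 \<le> t" "t \<le> int (d n) + int (r n)" for t
            using a2[of t] a3[of t] that levv[of n] n by (cases "t \<le> int (r n)") auto
          ultimately show ?thesis using sp by (auto simp: E_def runs_iff)
        next
          case False
          then show ?thesis using \<omega> by (auto simp: E'_def A_def runs_iff)
        qed
      qed
      have "prob (E' n) \<le> prob (E n \<union> ((space M - ?R1) \<union> (space M - ?R2)))"
        using sub by (intro finite_measure_mono) (auto simp: E_def)
      also have "\<dots> \<le> prob (E n) + prob ((space M - ?R1) \<union> (space M - ?R2))"
        by (intro measure_subadditive) (auto simp: E_def emeasure_eq_measure)
      also have "prob ((space M - ?R1) \<union> (space M - ?R2)) \<le> prob (space M - ?R1) + prob (space M - ?R2)"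
        by (intro measure_subadditive) (auto simp: emeasure_eq_measure)
      also have "prob (space M - ?R1) + prob (space M - ?R2) = ?g n"
        by (simp add: prob_compl prob_runs_shift[of "int _"])
      finally show "prob (E' n) - ?g n \<le> prob (E n)" by simp
    qed
    have "(\<lambda>n. prob (E' n) - ?g n) \<longlonglongrightarrow> gev_biv_cdf \<gamma> \<xi> x y - 0" by (intro tendsto_diff E'lim glim)
    then have "(\<lambda>n. prob (E' n) - ?g n) \<longlonglongrightarrow> gev_biv_cdf \<gamma> \<xi> x y" by simp
    from tendsto_sandwich[OF lower upper this E'lim] show ?thesis .
  qed
  then show ?thesis by (simp add: E_def pair_prob_def)
qed

end

section \<open>Variance of a block average\<close>

text \<open>Summation along diagonals. Separate functions serve the two sides because the thresholds
  \<open>x\<close> and \<open>y\<close> break the symmetry; lag 0 is counted on both sides and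
  subtracted once.\<close>

lemma sum_square_by_lag:
  fixes F :: "nat \<Rightarrow> nat \<Rightarrow> real"
  assumes 1: "\<And>s d. F s (s + d) = \<phi> d" and 2: "\<And>s d. F (s + d) s = \<psi> d"
  shows "(\<Sum>s<N. \<Sum>s'<N. F s s') = (\<Sum>d<N. (real N - real d) * (\<phi> d + \<psi> d)) - real N * \<phi> 0"
proof (induction N)
  case (Suc N)
  have rev: "(\<Sum>s<N. g (N - s)) = (\<Sum>d<Suc N. g d) - g 0" for g :: "nat \<Rightarrow> real"
  proof -
    have "(\<Sum>s<N. g (N - s)) = (\<Sum>d<N. g (Suc d))"
      by (rule sum.reindex_bij_witness[where i = "\<lambda>d. N - 1 - d" and j = "\<lambda>s. N - 1 - s"]) (auto simp: Suc_diff_Suc)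
    also have "\<dots> = (\<Sum>d<Suc N. g d) - g 0"
      by (subst sum.lessThan_Suc_shift) simp
    finally show ?thesis .
  qed
  have c: "(\<Sum>s<N. F s N) = (\<Sum>d<Suc N. \<phi> d) - \<phi> 0"
  proof -
    have "F s N = \<phi> (N - s)" if "s < N" for s using 1[of s "N - s"] that by simp
    then show ?thesis using rev[of \<phi>] by simp
  qed
  have r: "(\<Sum>s<N. F N s) = (\<Sum>d<Suc N. \<psi> d) - \<psi> 0"
  proof -
    have "F N s = \<psi> (N - s)" if "s < N" for s using 2[of s "N - s"] that by simp
    then show ?thesis using rev[of \<psi>] by simp
  qed
  have z: "F N N = \<phi> 0" "\<psi> 0 = \<phi> 0" using 1[of N 0] 2[of N 0] by auto
  have "(\<Sum>s<Suc N. \<Sum>s'<Suc N. F s s') = (\<Sum>s<N. \<Sum>s'<N. F s s') + (\<Sum>s<N. F s N) + (\<Sum>s<N. F N s) + F N N"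
    by (simp add: sum.distrib)
  also have "\<dots> = (\<Sum>d<N. (real N - real d) * (\<phi> d + \<psi> d)) + (\<Sum>d<Suc N. \<phi> d + \<psi> d) - real (Suc N) * \<phi> 0"
    unfolding Suc.IH c r z by (simp add: sum.distrib algebra_simps)
  also have "(\<Sum>d<N. (real N - real d) * (\<phi> d + \<psi> d)) + (\<Sum>d<Suc N. \<phi> d + \<psi> d)
      = (\<Sum>d<Suc N. (real (Suc N) - real d) * (\<phi> d + \<psi> d))"
    by (simp add: sum.distrib[symmetric] algebra_simps)
  finally show ?case .
qed simp

text \<open>The lag sum is written as the integral of a step function in
  \<open>\<xi> = d / r\<close>, so that dominated convergence can replace a Riemann sum argument
  with moving summands.\<close>

lemma integral_floor_step:
  assumes r: "r > 0"
  shows "(\<integral>\<xi>. indicator {0..<real N / real r} \<xi> * w (nat \<lfloor>real r * \<xi>\<rfloor>) \<partial>lborel) = (\<Sum>d<N. w d) / real r"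
    (is "?I = _")
proof -
  let ?J = "\<lambda>d. {real d / real r..<real (Suc d) / real r}"
  have J: "\<xi> \<in> ?J d \<longleftrightarrow> 0 \<le> \<xi> \<and> nat \<lfloor>real r * \<xi>\<rfloor> = d" for \<xi> d
  proof -
    have "\<xi> \<in> ?J d \<longleftrightarrow> real d \<le> real r * \<xi> \<and> real r * \<xi> < real d + 1"
      using r by (simp add: divide_le_eq less_divide_eq mult.commute add.commute)
    also have "\<dots> \<longleftrightarrow> 0 \<le> real r * \<xi> \<and> nat \<lfloor>real r * \<xi>\<rfloor> = d"
      by (auto simp: nat_eq_iff floor_eq_iff; linarith)
    also have "\<dots> \<longleftrightarrow> 0 \<le> \<xi> \<and> nat \<lfloor>real r * \<xi>\<rfloor> = d"
      using r by (simp add: zero_le_mult_iff)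
    finally show ?thesis .
  qed
  have "indicator {0..<real N / real r} \<xi> * w (nat \<lfloor>real r * \<xi>\<rfloor>) = (\<Sum>d<N. w d * indicator (?J d) \<xi>)" for \<xi>
  proof (cases "0 \<le> \<xi>")
    case True
    have "(\<Sum>d<N. w d * indicator (?J d) \<xi>) = (\<Sum>d<N. if d = nat \<lfloor>real r * \<xi>\<rfloor> then w d else 0)"
      using True J by (intro sum.cong) (auto simp: indicator_def)
    also have "\<dots> = (if nat \<lfloor>real r * \<xi>\<rfloor> < N then w (nat \<lfloor>real r * \<xi>\<rfloor>) else 0)" by simp
    also have "nat \<lfloor>real r * \<xi>\<rfloor> < N \<longleftrightarrow> \<xi> < real N / real r"
    proof -
      have "nat \<lfloor>real r * \<xi>\<rfloor> < N \<longleftrightarrow> real r * \<xi> < real N"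
      proof -
        have "0 \<le> \<lfloor>real r * \<xi>\<rfloor>" using True by simp
        then show ?thesis by (simp add: nat_less_iff floor_less_iff)
      qed
      then show ?thesis using r by (simp add: less_divide_eq mult.commute)
    qed
    finally show ?thesis using True by (simp add: indicator_def)
  next
    case False
    then show ?thesis using J by (simp add: indicator_def)
  qed
  then have "?I = (\<integral>\<xi>. (\<Sum>d<N. w d * indicator (?J d) \<xi>) \<partial>lborel)" by simp
  also have "\<dots> = (\<Sum>d<N. w d * measure lborel (?J d))"
    by (subst Bochner_Integration.integral_sum)
      (auto intro!: integrable_mult_right integrable_real_indicator emeasure_bounded_finite)
  also have "\<dots> = (\<Sum>d<N. w d) / real r"
    using r by (simp add: sum_divide_distrib divide_right_mono diff_divide_distrib[symmetric])
  finally show ?thesis .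
qed

text \<open>The expected product of two block averages, of the indicators of
  \<open>Z \<le> x\<close> and of \<open>Z \<le> y\<close>, over the same \<open>N\<close> starting
  points.\<close>

definition (in extremal_series) block_pair_prob :: "nat \<Rightarrow> nat \<Rightarrow> real \<Rightarrow> real \<Rightarrow> real" where
  "block_pair_prob N q x y = (\<Sum>s<N. \<Sum>s'<N. prob (runs (int s) q (lev q x) \<inter> runs (int s') q (lev q y))) / (real N)\<^sup>2"

context block_scheme
begin

lemma pair_prob_01: "0 \<le> pair_prob q d x y" "pair_prob q d x y \<le> 1"
  by (auto simp: pair_prob_def)

text \<open>Lags \<open>d = \<xi> * r\<close> with \<open>\<xi> < 1\<close> contribute the bivariate
  limit, those with \<open>\<xi> > 1\<close> contribute nothing after centring. The points 0 and 1
  form a null set, and the integrand is bounded by \<open>k\<close> on an interval of length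
  \<open>k\<close>.\<close>

lemma lag_sum_tendsto:
  assumes k: "k > 0"
  shows "(\<lambda>n. (\<Sum>d<k * r n. (real (k * r n) - real d) * (pair_prob (r n) d x y - gev_cdf \<gamma> x * gev_cdf \<gamma> y)) / (real (k * r n))\<^sup>2)
    \<longlonglongrightarrow> (\<integral>\<xi>. indicator {0<..<1} \<xi> * ((real k - \<xi>) * (gev_biv_cdf \<gamma> \<xi> x y - gev_cdf \<gamma> x * gev_cdf \<gamma> y)) \<partial>lborel) / (real k)\<^sup>2"
    (is "?S \<longlonglongrightarrow> ?L")
proof -
  let ?G = "gev_cdf \<gamma> x * gev_cdf \<gamma> y"
  have G01: "0 \<le> ?G" "?G \<le> 1" by (auto simp: gev_cdf_nonneg gev_cdf_le_1 mult_le_one)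
  define w where "w n d = (real k - real d / real (r n)) * (pair_prob (r n) d x y - ?G)" for n d
  define f where "f n \<xi> = indicator {0..<real k} \<xi> * w n (nat \<lfloor>real (r n) * \<xi>\<rfloor>)" for n \<xi>
  define g where "g \<xi> = indicator {0<..<1} \<xi> * ((real k - \<xi>) * (gev_biv_cdf \<gamma> \<xi> x y - ?G))" for \<xi> :: real
  have fm [measurable]: "f n \<in> borel_measurable borel" for n
  proof -
    have "(\<lambda>\<xi>::real. w n (nat \<lfloor>real (r n) * \<xi>\<rfloor>)) \<in> borel_measurable borel"
      by (rule measurable_compose_countable[where f = "\<lambda>d _. w n d" and g = "\<lambda>\<xi>. nat \<lfloor>real (r n) * \<xi>\<rfloor>"]) simp_all
    then show ?thesis unfolding f_def[abs_def] by measurable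
  qed
  have gm [measurable]: "g \<in> borel_measurable borel"
    unfolding g_def[abs_def] using gev_biv_cdf_measurable[of \<gamma> x y] by measurable
  have lim: "(\<lambda>n. f n \<xi>) \<longlonglongrightarrow> g \<xi>" if ne: "\<xi> \<noteq> 0" "\<xi> \<noteq> 1" for \<xi>
  proof -
    define d where "d n = nat \<lfloor>real (r n) * \<xi>\<rfloor>" for n
    have d: "(\<lambda>n. real (d n) / real (r n)) \<longlonglongrightarrow> \<xi>" if "\<xi> > 0"
      unfolding d_def using nat_floor_mult_tendsto[OF r_lim, of \<xi>] that by simp
    consider "\<xi> < 0" | "0 < \<xi>" "\<xi> < 1" | "1 < \<xi>" using ne by linarith
    then show ?thesis
    proof cases
      case 1
      then show ?thesis by (simp add: f_def g_def)
    next
      case 2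
      have "(\<lambda>n. (real k - real (d n) / real (r n)) * (pair_prob (r n) (d n) x y - ?G)) \<longlonglongrightarrow> (real k - \<xi>) * (gev_biv_cdf \<gamma> \<xi> x y - ?G)"
        by (intro tendsto_intros d[OF 2(1)] pair_prob_tendsto_near 2)
      moreover have "\<xi> < real k" using 2 k by linarith
      ultimately show ?thesis using 2 by (simp add: f_def g_def w_def d_def)
    next
      case 3
      have "(\<lambda>n. (real k - real (d n) / real (r n)) * (pair_prob (r n) (d n) x y - ?G)) \<longlonglongrightarrow> (real k - \<xi>) * (?G - ?G)"
      proof -
        have "\<xi> > 0" using 3 by simp
        then show ?thesis by (intro tendsto_intros d pair_prob_tendsto_far[OF _ 3])
      qed
      then have "(\<lambda>n. indicator {0..<real k} \<xi> * ((real k - real (d n) / real (r n)) * (pair_prob (r n) (d n) x y - ?G))) \<longlonglongrightarrow> indicator {0..<real k} \<xi> * ((real k - \<xi>) * (?G - ?G))"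
        by (rule tendsto_mult[OF tendsto_const])
      then show ?thesis using 3 by (simp add: f_def g_def w_def d_def)
    qed
  qed
  have fb: "\<bar>f n \<xi>\<bar> \<le> real k * indicator {0..<real k} \<xi>" if "r n > 0" for n \<xi>
  proof (cases "\<xi> \<in> {0..<real k}")
    case True
    define d where "d = nat \<lfloor>real (r n) * \<xi>\<rfloor>"
    have "0 \<le> real (r n) * \<xi>" using True by simp
    then have "real d \<le> real (r n) * \<xi>" unfolding d_def by linarith
    then have "real d / real (r n) \<le> \<xi>" using that by (simp add: divide_le_eq mult.commute)
    then have "\<bar>real k - real d / real (r n)\<bar> \<le> real k" using True by (simp add: abs_le_iff)
    moreover have "\<bar>pair_prob (r n) d x y - ?G\<bar> \<le> 1" using pair_prob_01[of "r n" d x y] G01 by linarith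
    ultimately have "\<bar>w n d\<bar> \<le> real k * 1" unfolding w_def abs_mult by (intro mult_mono) auto
    then show ?thesis using True by (simp add: f_def d_def abs_mult)
  qed (simp add: f_def)
  \<comment> \<open>The dominating function is valid only when \<open>r n > 0\<close>, so the
    sequence is shifted past the finitely many exceptions.\<close>
  obtain n0 where n0: "\<And>n. n \<ge> n0 \<Longrightarrow> r n > 0" using r_pos unfolding eventually_sequentially by blast
  have "(\<lambda>n. \<integral>\<xi>. f (n + n0) \<xi> \<partial>lborel) \<longlonglongrightarrow> (\<integral>\<xi>. g \<xi> \<partial>lborel)"
  proof (rule integral_dominated_convergence[where w = "\<lambda>\<xi>. real k * indicator {0..<real k} \<xi>"])
    show "AE \<xi> in lborel. (\<lambda>n. f (n + n0) \<xi>) \<longlonglongrightarrow> g \<xi>"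
      using AE_lborel_singleton[of 0] AE_lborel_singleton[of 1]
      by eventually_elim (intro LIMSEQ_ignore_initial_segment lim)
    show "integrable lborel (\<lambda>\<xi>. real k * indicator {0..<real k} \<xi>)"
      by (intro integrable_mult_right integrable_real_indicator emeasure_bounded_finite) auto
    show "AE \<xi> in lborel. norm (f (n + n0) \<xi>) \<le> real k * indicator {0..<real k} \<xi>" for n
      using fb n0 by auto
  qed simp_all
  then have "(\<lambda>n. \<integral>\<xi>. f n \<xi> \<partial>lborel) \<longlonglongrightarrow> (\<integral>\<xi>. g \<xi> \<partial>lborel)"
    by (rule LIMSEQ_offset)
  then have "(\<lambda>n. (\<integral>\<xi>. f n \<xi> \<partial>lborel) / (real k)\<^sup>2) \<longlonglongrightarrow> (\<integral>\<xi>. g \<xi> \<partial>lborel) / (real k)\<^sup>2"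
    using k by (intro tendsto_intros) auto
  then show ?thesis
    unfolding g_def
  proof (rule Lim_transform_eventually)
    show "\<forall>\<^sub>F n in sequentially. (\<integral>\<xi>. f n \<xi> \<partial>lborel) / (real k)\<^sup>2 = ?S n"
      using r_pos
    proof eventually_elim
      fix n assume r: "r n > 0"
      have "(\<integral>\<xi>. f n \<xi> \<partial>lborel) = (\<Sum>d<k * r n. w n d) / real (r n)"
        using integral_floor_step[OF r, of "k * r n" "w n"] r by (simp add: f_def)
      also have "(\<Sum>d<k * r n. w n d) = (\<Sum>d<k * r n. (real (k * r n) - real d) * (pair_prob (r n) d x y - ?G)) / real (r n)"
        unfolding w_def sum_divide_distrib using r by (intro sum.cong refl) (simp add: field_simps)
      finally show "(\<integral>\<xi>. f n \<xi> \<partial>lborel) / (real k)\<^sup>2 = ?S n"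
        by (simp add: power2_eq_square mult_ac)
    qed
  qed
qed

text \<open>The factor 2 comes from the two orders of a pair, whose limits agree because the
  bivariate law is symmetric. The doubly counted diagonal is of order
  \<open>1 / (k * r)\<close>.\<close>

lemma block_pair_prob_tendsto:
  assumes k: "k > 0"
  shows "(\<lambda>n. block_pair_prob (k * r n) (r n) x y) \<longlonglongrightarrow> gev_cdf \<gamma> x * gev_cdf \<gamma> y +
    2 / (real k)\<^sup>2 * (\<integral>\<xi>. indicator {0<..<1} \<xi> * ((real k - \<xi>) * (gev_biv_cdf \<gamma> \<xi> x y - gev_cdf \<gamma> x * gev_cdf \<gamma> y)) \<partial>lborel)"
proof -
  let ?G = "gev_cdf \<gamma> x * gev_cdf \<gamma> y"
  let ?N = "\<lambda>n. k * r n"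
  let ?I = "\<lambda>x y. (\<integral>\<xi>. indicator {0<..<1} \<xi> * ((real k - \<xi>) * (gev_biv_cdf \<gamma> \<xi> x y - gev_cdf \<gamma> x * gev_cdf \<gamma> y)) \<partial>lborel)"
  let ?S = "\<lambda>n x y. (\<Sum>d<?N n. (real (?N n) - real d) * (pair_prob (r n) d x y - gev_cdf \<gamma> x * gev_cdf \<gamma> y)) / (real (?N n))\<^sup>2"
  have I: "?I y x = ?I x y" by (simp add: gev_biv_cdf_commute[of \<gamma> _ y x] mult.commute[of "gev_cdf \<gamma> y"])
  have eq: "block_pair_prob (?N n) (r n) x y = ?G + ?S n x y + ?S n y x - (pair_prob (r n) 0 x y - ?G) / real (?N n)"
    if "r n > 0" for n
  proof -
    let ?F = "\<lambda>s s'. prob (runs (int s) (r n) (lev (r n) x) \<inter> runs (int s') (r n) (lev (r n) y)) - ?G"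
    have N: "real (?N n) > 0" using that k by simp
    have "(\<Sum>s<?N n. \<Sum>s'<?N n. ?F s s') =
        (\<Sum>d<?N n. (real (?N n) - real d) * ((pair_prob (r n) d x y - ?G) + (pair_prob (r n) d y x - ?G))) - real (?N n) * (pair_prob (r n) 0 x y - ?G)"
      by (rule sum_square_by_lag) (simp_all add: prob_runs_pair Int_commute[of "runs (int _ + int _) _ _"])
    also have "(\<Sum>d<?N n. (real (?N n) - real d) * ((pair_prob (r n) d x y - ?G) + (pair_prob (r n) d y x - ?G)))
      = (\<Sum>d<?N n. (real (?N n) - real d) * (pair_prob (r n) d x y - ?G)) + (\<Sum>d<?N n. (real (?N n) - real d) * (pair_prob (r n) d y x - ?G))"
      by (simp only: distrib_left sum.distrib)
    finally have e1: "(\<Sum>s<?N n. \<Sum>s'<?N n. ?F s s') / (real (?N n))\<^sup>2 = ?S n x y + ?S n y x - (pair_prob (r n) 0 x y - ?G) / real (?N n)"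
      using N by (simp only: add_divide_distrib diff_divide_distrib mult.commute[of "gev_cdf \<gamma> y" "gev_cdf \<gamma> x"]) (simp add: power2_eq_square diff_divide_distrib)
    have "(\<Sum>s<?N n. \<Sum>s'<?N n. ?F s s') = (\<Sum>s<?N n. \<Sum>s'<?N n. prob (runs (int s) (r n) (lev (r n) x) \<inter> runs (int s') (r n) (lev (r n) y))) - (real (?N n))\<^sup>2 * ?G"
      by (simp add: sum_subtractf power2_eq_square)
    then have "(\<Sum>s<?N n. \<Sum>s'<?N n. ?F s s') / (real (?N n))\<^sup>2 = block_pair_prob (?N n) (r n) x y - ?G"
      using that k by (simp only: diff_divide_distrib block_pair_prob_def) simp
    then show ?thesis using e1 by linarith
  qed
  have "(\<lambda>n. (pair_prob (r n) 0 x y - ?G) / real (?N n)) \<longlonglongrightarrow> 0"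
  proof (rule Lim_null_comparison)
    have "filterlim (\<lambda>n. real (r n)) at_top sequentially" by (rule filterlim_compose[OF filterlim_real_sequentially r_lim])
    then show "(\<lambda>n. 1 / real (r n)) \<longlonglongrightarrow> 0"
      by (intro tendsto_divide_0[OF tendsto_const] filterlim_at_top_imp_at_infinity)
    show "\<forall>\<^sub>F n in sequentially. norm ((pair_prob (r n) 0 x y - ?G) / real (?N n)) \<le> 1 / real (r n)"
      using r_pos
    proof eventually_elim
      fix n assume "r n > 0"
      have "0 \<le> ?G" "?G \<le> 1" by (auto simp: gev_cdf_nonneg gev_cdf_le_1 mult_le_one)
      then have "\<bar>pair_prob (r n) 0 x y - ?G\<bar> \<le> 1" using pair_prob_01[of "r n" 0 x y] by linarith
      moreover have "real (r n) \<le> real (?N n)" unfolding of_nat_le_iff using k by (cases k) auto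
      ultimately show "norm ((pair_prob (r n) 0 x y - ?G) / real (?N n)) \<le> 1 / real (r n)"
        using \<open>r n > 0\<close> k unfolding real_norm_def abs_divide by (intro frac_le) auto
    qed
  qed
  then have "(\<lambda>n. ?G + ?S n x y + ?S n y x - (pair_prob (r n) 0 x y - ?G) / real (?N n))
     \<longlonglongrightarrow> ?G + ?I x y / (real k)\<^sup>2 + ?I y x / (real k)\<^sup>2 - 0"
    by (intro tendsto_diff tendsto_add tendsto_const lag_sum_tendsto k)
  then have "(\<lambda>n. block_pair_prob (?N n) (r n) x y) \<longlonglongrightarrow> ?G + ?I x y / (real k)\<^sup>2 + ?I y x / (real k)\<^sup>2 - 0"
    by (rule Lim_transform_eventually) (use r_pos in \<open>eventually_elim, simp only: eq\<close>)
  then show ?thesis unfolding I by (simp add: field_simps)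
qed

end

section \<open>Mean square deviation of block averages\<close>

subsection \<open>Bounded convergence in mean\<close>

context prob_space
begin

text \<open>The uniform bound makes this mode of convergence stable under products, so limits of
  polynomials in empirical frequencies can be taken termwise.\<close>

definition mean_lim :: "(nat \<Rightarrow> 'a \<Rightarrow> real) \<Rightarrow> real \<Rightarrow> bool" where
  "mean_lim Y y \<longleftrightarrow> (\<forall>n. Y n \<in> borel_measurable M) \<and> (\<exists>B. \<forall>n x. \<bar>Y n x\<bar> \<le> B) \<and>
    (\<lambda>n. expectation (\<lambda>x. \<bar>Y n x - y\<bar>)) \<longlonglongrightarrow> 0"

lemma integrable_bounded_diff:
  fixes Y :: "'a \<Rightarrow> real"
  assumes "Y \<in> borel_measurable M" "\<And>x. \<bar>Y x\<bar> \<le> B"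
  shows "integrable M (\<lambda>x. \<bar>Y x - y\<bar>)"
proof (rule integrable_const_bound[where B = "B + \<bar>y\<bar>"])
  show "AE x in M. norm \<bar>Y x - y\<bar> \<le> B + \<bar>y\<bar>"
    by (intro AE_I2) (use assms(2) in \<open>auto intro: order_trans[OF abs_triangle_ineq4]\<close>)
qed (use assms in measurable)

lemma mean_lim_const: "mean_lim (\<lambda>_ _. c) c"
  by (auto simp: mean_lim_def)

lemma mean_lim_add:
  assumes "mean_lim Y y" "mean_lim Z z"
  shows "mean_lim (\<lambda>n x. Y n x + Z n x) (y + z)"
proof -
  obtain B where B: "\<And>n x. \<bar>Y n x\<bar> \<le> B" using assms(1) unfolding mean_lim_def by blast
  obtain C where C: "\<And>n x. \<bar>Z n x\<bar> \<le> C" using assms(2) unfolding mean_lim_def by blast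
  have m [measurable]: "Y n \<in> borel_measurable M" "Z n \<in> borel_measurable M" for n
    using assms unfolding mean_lim_def by auto
  have "(\<lambda>n. expectation (\<lambda>x. \<bar>Y n x + Z n x - (y + z)\<bar>)) \<longlonglongrightarrow> 0"
  proof (rule tendsto_sandwich[OF _ _ tendsto_const])
    show "\<forall>\<^sub>F n in sequentially. 0 \<le> expectation (\<lambda>x. \<bar>Y n x + Z n x - (y + z)\<bar>)" by simp
    show "\<forall>\<^sub>F n in sequentially. expectation (\<lambda>x. \<bar>Y n x + Z n x - (y + z)\<bar>) \<le>
      expectation (\<lambda>x. \<bar>Y n x - y\<bar>) + expectation (\<lambda>x. \<bar>Z n x - z\<bar>)"
    proof (intro always_eventually allI)
      fix n
      have i: "integrable M (\<lambda>x. \<bar>Y n x - y\<bar>)" "integrable M (\<lambda>x. \<bar>Z n x - z\<bar>)"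
        using integrable_bounded_diff[OF m(1) B] integrable_bounded_diff[OF m(2) C] by auto
      have "expectation (\<lambda>x. \<bar>Y n x + Z n x - (y + z)\<bar>) \<le> expectation (\<lambda>x. \<bar>Y n x - y\<bar> + \<bar>Z n x - z\<bar>)"
        by (rule integral_mono_AE') (use i in \<open>auto simp: abs_le_iff\<close>)
      then show "expectation (\<lambda>x. \<bar>Y n x + Z n x - (y + z)\<bar>) \<le> expectation (\<lambda>x. \<bar>Y n x - y\<bar>) + expectation (\<lambda>x. \<bar>Z n x - z\<bar>)"
        using i by simp
    qed
    have "(\<lambda>n. expectation (\<lambda>x. \<bar>Y n x - y\<bar>) + expectation (\<lambda>x. \<bar>Z n x - z\<bar>)) \<longlonglongrightarrow> 0 + 0"
      using assms unfolding mean_lim_def by (intro tendsto_add) auto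
    then show "(\<lambda>n. expectation (\<lambda>x. \<bar>Y n x - y\<bar>) + expectation (\<lambda>x. \<bar>Z n x - z\<bar>)) \<longlonglongrightarrow> 0" by simp
  qed
  moreover have "\<bar>Y n x + Z n x\<bar> \<le> B + C" for n x using B[of n x] C[of n x] by linarith
  ultimately show ?thesis unfolding mean_lim_def by auto
qed

lemma mean_lim_mult:
  assumes "mean_lim Y y" "mean_lim Z z"
  shows "mean_lim (\<lambda>n x. Y n x * Z n x) (y * z)"
proof -
  obtain B where B: "\<And>n x. \<bar>Y n x\<bar> \<le> B" using assms(1) unfolding mean_lim_def by blast
  obtain C where C: "\<And>n x. \<bar>Z n x\<bar> \<le> C" using assms(2) unfolding mean_lim_def by blast
  have m [measurable]: "Y n \<in> borel_measurable M" "Z n \<in> borel_measurable M" for n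
    using assms unfolding mean_lim_def by auto
  have B0: "B \<ge> 0" using B[of 0 undefined] by linarith
  have "(\<lambda>n. expectation (\<lambda>x. \<bar>Y n x * Z n x - y * z\<bar>)) \<longlonglongrightarrow> 0"
  proof (rule tendsto_sandwich[OF _ _ tendsto_const])
    show "\<forall>\<^sub>F n in sequentially. 0 \<le> expectation (\<lambda>x. \<bar>Y n x * Z n x - y * z\<bar>)" by simp
    show "\<forall>\<^sub>F n in sequentially. expectation (\<lambda>x. \<bar>Y n x * Z n x - y * z\<bar>) \<le>
      \<bar>z\<bar> * expectation (\<lambda>x. \<bar>Y n x - y\<bar>) + B * expectation (\<lambda>x. \<bar>Z n x - z\<bar>)"
    proof (intro always_eventually allI)
      fix n
      have i: "integrable M (\<lambda>x. \<bar>Y n x - y\<bar>)" "integrable M (\<lambda>x. \<bar>Z n x - z\<bar>)"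
        using integrable_bounded_diff[OF m(1) B] integrable_bounded_diff[OF m(2) C] by auto
      have "\<bar>Y n x * Z n x - y * z\<bar> \<le> \<bar>z\<bar> * \<bar>Y n x - y\<bar> + B * \<bar>Z n x - z\<bar>" for x
      proof -
        have "Y n x * Z n x - y * z = z * (Y n x - y) + Y n x * (Z n x - z)" by (simp add: algebra_simps)
        then have "\<bar>Y n x * Z n x - y * z\<bar> \<le> \<bar>z\<bar> * \<bar>Y n x - y\<bar> + \<bar>Y n x\<bar> * \<bar>Z n x - z\<bar>"
          by (metis abs_mult abs_triangle_ineq)
        also have "\<bar>Y n x\<bar> * \<bar>Z n x - z\<bar> \<le> B * \<bar>Z n x - z\<bar>" by (intro mult_right_mono B) auto
        finally show ?thesis by simp
      qed
      then have "expectation (\<lambda>x. \<bar>Y n x * Z n x - y * z\<bar>) \<le> expectation (\<lambda>x. \<bar>z\<bar> * \<bar>Y n x - y\<bar> + B * \<bar>Z n x - z\<bar>)"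
        by (intro integral_mono_AE') (use i B0 in auto)
      then show "expectation (\<lambda>x. \<bar>Y n x * Z n x - y * z\<bar>) \<le> \<bar>z\<bar> * expectation (\<lambda>x. \<bar>Y n x - y\<bar>) + B * expectation (\<lambda>x. \<bar>Z n x - z\<bar>)"
        using i by simp
    qed
    have "(\<lambda>n. \<bar>z\<bar> * expectation (\<lambda>x. \<bar>Y n x - y\<bar>) + B * expectation (\<lambda>x. \<bar>Z n x - z\<bar>)) \<longlonglongrightarrow> \<bar>z\<bar> * 0 + B * 0"
      using assms unfolding mean_lim_def by (intro tendsto_add tendsto_mult tendsto_const) auto
    then show "(\<lambda>n. \<bar>z\<bar> * expectation (\<lambda>x. \<bar>Y n x - y\<bar>) + B * expectation (\<lambda>x. \<bar>Z n x - z\<bar>)) \<longlonglongrightarrow> 0" by simp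
  qed
  moreover have "\<bar>Y n x * Z n x\<bar> \<le> B * C" for n x
    unfolding abs_mult by (intro mult_mono B C B0) auto
  ultimately show ?thesis unfolding mean_lim_def by auto
qed

lemma mean_lim_sum:
  assumes "finite J" "\<And>j. j \<in> J \<Longrightarrow> mean_lim (Y j) (y j)"
  shows "mean_lim (\<lambda>n x. \<Sum>j\<in>J. Y j n x) (\<Sum>j\<in>J. y j)"
  using assms
proof (induction J rule: finite_induct)
  case empty
  then show ?case using mean_lim_const[of 0] by simp
next
  case (insert j J)
  then show ?case using mean_lim_add[of "Y j" "y j" "\<lambda>n x. \<Sum>j\<in>J. Y j n x"] by simp
qed

lemma mean_limI_L2:
  assumes m: "\<And>n. Y n \<in> borel_measurable M" and B: "\<And>n x. \<bar>Y n x\<bar> \<le> B"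
    and e: "\<forall>\<^sub>F n in sequentially. expectation (\<lambda>x. \<bar>Y n x - y' n\<bar>) \<le> e n"
    and lim: "e \<longlonglongrightarrow> 0" "y' \<longlonglongrightarrow> y"
  shows "mean_lim Y y"
proof -
  have "(\<lambda>n. expectation (\<lambda>x. \<bar>Y n x - y\<bar>)) \<longlonglongrightarrow> 0"
  proof (rule tendsto_sandwich[OF _ _ tendsto_const])
    show "\<forall>\<^sub>F n in sequentially. 0 \<le> expectation (\<lambda>x. \<bar>Y n x - y\<bar>)" by simp
    show "\<forall>\<^sub>F n in sequentially. expectation (\<lambda>x. \<bar>Y n x - y\<bar>) \<le> e n + \<bar>y' n - y\<bar>"
      using e
    proof eventually_elim
      fix n assume n: "expectation (\<lambda>x. \<bar>Y n x - y' n\<bar>) \<le> e n"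
      have i: "integrable M (\<lambda>x. \<bar>Y n x - y' n\<bar>)" by (rule integrable_bounded_diff[OF m B])
      have "expectation (\<lambda>x. \<bar>Y n x - y\<bar>) \<le> expectation (\<lambda>x. \<bar>Y n x - y' n\<bar> + \<bar>y' n - y\<bar>)"
        by (rule integral_mono_AE') (use i in \<open>auto simp: abs_le_iff\<close>)
      also have "\<dots> = expectation (\<lambda>x. \<bar>Y n x - y' n\<bar>) + \<bar>y' n - y\<bar>" using i by (simp add: prob_space)
      finally show "expectation (\<lambda>x. \<bar>Y n x - y\<bar>) \<le> e n + \<bar>y' n - y\<bar>" using n by simp
    qed
    have "(\<lambda>n. e n + \<bar>y' n - y\<bar>) \<longlonglongrightarrow> 0 + 0"
      by (intro tendsto_add lim tendsto_rabs_zero LIM_zero)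
    then show "(\<lambda>n. e n + \<bar>y' n - y\<bar>) \<longlonglongrightarrow> 0" by simp
  qed
  then show ?thesis unfolding mean_lim_def using m B by auto
qed

end

subsection \<open>Empirical block frequencies\<close>

text \<open>Thresholds carry labels, so the same one may occur twice; this happens when indicators
  of adjacent cells are written as differences of half-line indicators.\<close>

definition step_fun :: "'j set \<Rightarrow> ('j \<Rightarrow> real) \<Rightarrow> ('j \<Rightarrow> real) \<Rightarrow> real \<Rightarrow> real" where
  "step_fun J c y x = (\<Sum>j\<in>J. c j * indicator {..y j} x)"

lemma step_fun_measurable [measurable]: "step_fun J c y \<in> borel_measurable borel"
  unfolding step_fun_def[abs_def] by measurable

context extremal_series
begin

text \<open>These averages and \<open>avg_one\<close> are the building blocks of the empirical
  variance: for a step function it is a quadratic polynomial in them.\<close>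

definition avg_pair :: "nat \<Rightarrow> nat \<Rightarrow> nat \<Rightarrow> real \<Rightarrow> real \<Rightarrow> 'a \<Rightarrow> real" where
  "avg_pair q N m x y \<omega> = (\<Sum>i<m. \<Sum>s<N. \<Sum>s'<N.
     indicator (runs (int (i * N) + int s) q (lev q x) \<inter> runs (int (i * N) + int s') q (lev q y)) \<omega> / (real N)\<^sup>2) / real m"

definition avg_one :: "nat \<Rightarrow> nat \<Rightarrow> nat \<Rightarrow> real \<Rightarrow> 'a \<Rightarrow> real" where
  "avg_one q N m x \<omega> = (\<Sum>i<m. \<Sum>s<N. indicator (runs (int (i * N) + int s) q (lev q x)) \<omega> / real N) / real m"

lemma avg_pair_measurable [measurable]: "avg_pair q N m x y \<in> borel_measurable M"
  unfolding avg_pair_def[abs_def] by measurable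

lemma avg_one_measurable [measurable]: "avg_one q N m x \<in> borel_measurable M"
  unfolding avg_one_def[abs_def] by measurable

lemma avg_pair_abs: "\<bar>avg_pair q N m x y \<omega>\<bar> \<le> 1"
proof -
  have "(\<Sum>s<N. \<Sum>s'<N. indicator (A s s') \<omega> / (real N)\<^sup>2 :: real) \<le> 1" for A
  proof -
    have "(\<Sum>s<N. \<Sum>s'<N. indicator (A s s') \<omega> / (real N)\<^sup>2 :: real) \<le> (\<Sum>s<N. \<Sum>s'<N. 1 / (real N)\<^sup>2)"
      by (intro sum_mono divide_right_mono) (auto simp: indicator_def)
    also have "\<dots> \<le> 1" by (simp add: power2_eq_square)
    finally show ?thesis .
  qed
  then have "avg_pair q N m x y \<omega> \<le> (\<Sum>i<m. 1) / real m"
    unfolding avg_pair_def by (intro divide_right_mono sum_mono) auto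
  also have "\<dots> \<le> 1" by simp
  finally have "avg_pair q N m x y \<omega> \<le> 1" .
  moreover have "0 \<le> avg_pair q N m x y \<omega>" unfolding avg_pair_def by (intro divide_nonneg_nonneg sum_nonneg) auto
  ultimately show ?thesis by simp
qed

lemma avg_one_abs: "\<bar>avg_one q N m x \<omega>\<bar> \<le> 1"
proof -
  have "(\<Sum>s<N. indicator (A s) \<omega> / real N :: real) \<le> 1" for A
  proof -
    have "(\<Sum>s<N. indicator (A s) \<omega> / real N :: real) \<le> (\<Sum>s<N. 1 / real N)"
      by (intro sum_mono divide_right_mono) (auto simp: indicator_def)
    also have "\<dots> \<le> 1" by simp
    finally show ?thesis .
  qed
  then have "avg_one q N m x \<omega> \<le> (\<Sum>i<m. 1) / real m"
    unfolding avg_one_def by (intro divide_right_mono sum_mono) auto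
  also have "\<dots> \<le> 1" by simp
  finally have "avg_one q N m x \<omega> \<le> 1" .
  moreover have "0 \<le> avg_one q N m x \<omega>" unfolding avg_one_def by (intro divide_nonneg_nonneg sum_nonneg) auto
  ultimately show ?thesis by simp
qed

lemma runs_eq_cyl: "runs (d + s) q u = cyl {1..int q} (\<lambda>t. (t + s) + d) (\<lambda>_. {..u})"
  by (simp add: runs_def add.assoc add.commute[of s])

lemma runs_Int_eq_cyl:
  "runs (d + s) q u \<inter> runs (d + s') q u' =
    cyl ({1..int q} <+> {1..int q}) (\<lambda>j. case_sum (\<lambda>t. t + s) (\<lambda>t. t + s') j + d) (case_sum (\<lambda>_. {..u}) (\<lambda>_. {..u'}))"
proof -
  have "case_sum (\<lambda>t. t + s + d) (\<lambda>t. t + s' + d) = (\<lambda>j. case_sum (\<lambda>t. t + s) (\<lambda>t. t + s') j + d)"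
    by (auto simp: fun_eq_iff split: sum.split)
  then show ?thesis unfolding runs_eq_cyl cyl_Int by simp
qed

lemma avg_pair_mean:
  assumes q: "q \<le> N" and p: "p \<le> N" and m: "m > 0" and N: "N > 0"
  shows "expectation (\<lambda>\<omega>. \<bar>avg_pair q N m x y \<omega> - block_pair_prob N q x y\<bar>) \<le> sqrt (5 / real m + alpha_mixing M X p)"
proof (rule expectation_abs_le_sqrt)
  \<comment> \<open>All pairs of starting points within a block receive equal weight. A stretch
    starts after an offset below \<open>N\<close> and has length \<open>q \<le> N\<close>, so it
    ends by time \<open>2 * N\<close>.\<close>
  let ?P = "{..<N} \<times> {..<N}"
  let ?w = "\<lambda>_::nat \<times> nat. 1 / (real N)\<^sup>2"
  let ?K = "\<lambda>_::nat \<times> nat. {1..int q} <+> {1..int q}"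
  let ?\<tau> = "\<lambda>(s, s'). case_sum (\<lambda>t. t + int s) (\<lambda>t. t + int s')"
  let ?S = "\<lambda>_::nat \<times> nat. case_sum (\<lambda>_::int. {..lev q x}) (\<lambda>_::int. {..lev q y})"
  show "\<bar>avg_pair q N m x y \<omega> - block_pair_prob N q x y\<bar> \<le> 1 + \<bar>block_pair_prob N q x y\<bar>" for \<omega>
    using avg_pair_abs[of q N m x y \<omega>] by linarith
  have "expectation (\<lambda>\<omega>. ((\<Sum>i<m. \<Sum>z\<in>?P. ?w z * indicator (cyl (?K z) (\<lambda>j. ?\<tau> z j + int (i * N)) (?S z)) \<omega>) / real m
      - (\<Sum>z\<in>?P. ?w z * prob (cyl (?K z) (?\<tau> z) (?S z))))\<^sup>2) \<le> 5 / real m + alpha_mixing M X p"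
  proof (rule block_average_L2[OF _ _ _ _ _ _ p m])
    show "(\<Sum>z\<in>?P. ?w z) = 1" using N by (simp add: card_cartesian_product power2_eq_square)
    show "1 \<le> ?\<tau> z j \<and> ?\<tau> z j \<le> 2 * int N" if "z \<in> ?P" "j \<in> ?K z" for z j
      using that q by (cases z) (auto simp: Plus_def)
    show "?S z j \<in> sets borel" for z j by (cases j) auto
  qed (auto intro: finite_Plus)
  moreover have "(\<Sum>i<m. \<Sum>z\<in>?P. ?w z * indicator (cyl (?K z) (\<lambda>j. ?\<tau> z j + int (i * N)) (?S z)) \<omega>) / real m = avg_pair q N m x y \<omega>" for \<omega>
    unfolding avg_pair_def runs_Int_eq_cyl sum.cartesian_product
    by (intro arg_cong2[where f = "(/)"] sum.cong refl) clarsimp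
  moreover have "(\<Sum>z\<in>?P. ?w z * prob (cyl (?K z) (?\<tau> z) (?S z))) = block_pair_prob N q x y"
  proof -
    have e: "runs (int s) q u \<inter> runs (int s') q u' =
        cyl ({1..int q} <+> {1..int q}) (case_sum (\<lambda>t. t + int s) (\<lambda>t. t + int s')) (case_sum (\<lambda>_. {..u}) (\<lambda>_. {..u'}))" for s s' u u'
      using runs_Int_eq_cyl[of 0 "int s" q u "int s'" u'] by simp
    show ?thesis
      unfolding block_pair_prob_def e sum.cartesian_product sum_divide_distrib
      by (intro sum.cong refl) clarsimp
  qed
  ultimately show "expectation (\<lambda>\<omega>. (avg_pair q N m x y \<omega> - block_pair_prob N q x y)\<^sup>2) \<le> 5 / real m + alpha_mixing M X p"
    by simp
qed measurable

lemma avg_one_mean: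
  assumes q: "q \<le> N" and p: "p \<le> N" and m: "m > 0" and N: "N > 0"
  shows "expectation (\<lambda>\<omega>. \<bar>avg_one q N m x \<omega> - prob (runs 0 q (lev q x))\<bar>) \<le> sqrt (5 / real m + alpha_mixing M X p)"
proof (rule expectation_abs_le_sqrt)
  let ?K = "\<lambda>_::nat. {1..int q}"
  let ?\<tau> = "\<lambda>s t. t + int s"
  let ?S = "\<lambda>_::nat. \<lambda>_::int. {..lev q x}"
  show "\<bar>avg_one q N m x \<omega> - prob (runs 0 q (lev q x))\<bar> \<le> 1 + \<bar>prob (runs 0 q (lev q x))\<bar>" for \<omega>
    using avg_one_abs[of q N m x \<omega>] by linarith
  have "expectation (\<lambda>\<omega>. ((\<Sum>i<m. \<Sum>s<N. 1 / real N * indicator (cyl (?K s) (\<lambda>j. ?\<tau> s j + int (i * N)) (?S s)) \<omega>) / real m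
      - (\<Sum>s<N. 1 / real N * prob (cyl (?K s) (?\<tau> s) (?S s))))\<^sup>2) \<le> 5 / real m + alpha_mixing M X p"
    by (rule block_average_L2[OF _ _ _ _ _ _ p m]) (use q N in auto)
  moreover have "(\<Sum>i<m. \<Sum>s<N. 1 / real N * indicator (cyl (?K s) (\<lambda>j. ?\<tau> s j + int (i * N)) (?S s)) \<omega>) / real m = avg_one q N m x \<omega>" for \<omega>
    unfolding avg_one_def runs_eq_cyl by simp
  moreover have "(\<Sum>s<N. 1 / real N * prob (cyl (?K s) (?\<tau> s) (?S s))) = prob (runs 0 q (lev q x))"
    using N by (simp add: runs_def[symmetric] prob_runs_shift[of "int _"])
  ultimately show "expectation (\<lambda>\<omega>. (avg_one q N m x \<omega> - prob (runs 0 q (lev q x)))\<^sup>2) \<le> 5 / real m + alpha_mixing M X p"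
    by simp
qed measurable

end

subsection \<open>Step functions\<close>

lemma mean_square_block_dev:
  assumes m: "m > 0"
  shows "mean_square m (block_dev a b X r k m h \<omega>) =
    real k * ((\<Sum>i=1..m. (block_avg a b X r k h i \<omega>)\<^sup>2) / real m - ((\<Sum>i=1..m. block_avg a b X r k h i \<omega>) / real m)\<^sup>2)"
proof -
  let ?B = "\<lambda>i. block_avg a b X r k h i \<omega>"
  define A where "A = (\<Sum>i=1..m. ?B i) / real m"
  have A: "(\<Sum>i=1..m. ?B i) = real m * A" using m by (simp add: A_def)
  have "(\<Sum>i=1..m. (block_dev a b X r k m h \<omega> i)\<^sup>2) = (\<Sum>i=1..m. real k * ((?B i)\<^sup>2 - 2 * A * ?B i + A\<^sup>2))"
  proof (intro sum.cong refl)
    fix i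
    have bd: "block_dev a b X r k m h \<omega> i = sqrt (real k) * (?B i - A)" by (simp only: block_dev_def A_def)
    show "(block_dev a b X r k m h \<omega> i)\<^sup>2 = real k * ((?B i)\<^sup>2 - 2 * A * ?B i + A\<^sup>2)"
      by (subst bd) (simp add: power_mult_distrib power2_diff algebra_simps)
  qed
  also have "\<dots> = real k * ((\<Sum>i=1..m. (?B i)\<^sup>2) - 2 * A * (\<Sum>i=1..m. ?B i) + real m * A\<^sup>2)"
    by (simp add: sum_distrib_left[symmetric] sum.distrib sum_subtractf)
  also have "\<dots> = real k * ((\<Sum>i=1..m. (?B i)\<^sup>2) - real m * A\<^sup>2)"
    unfolding A by (simp add: power2_eq_square algebra_simps)
  finally show ?thesis
    unfolding mean_square_def A_def[symmetric] using m by (simp add: right_diff_distrib diff_divide_distrib)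
qed

lemma block_avg_Suc:
  "block_avg a b X r k h (Suc i) \<omega> = (\<Sum>s<k * r. h (norm_block_max a b X r (Suc (i * (k * r) + s)) \<omega>)) / real (k * r)"
proof -
  have "(\<Sum>s=i * (k * r) + 1..i * (k * r) + k * r. h (norm_block_max a b X r s \<omega>)) = (\<Sum>s<k * r. h (norm_block_max a b X r (Suc (i * (k * r) + s)) \<omega>))"
    by (rule sum.reindex_bij_witness[where i = "\<lambda>s. Suc (i * (k * r) + s)" and j = "\<lambda>s. s - Suc (i * (k * r))"]) auto
  then show ?thesis by (simp add: block_avg_def add.commute)
qed

lemma sum_from_1_eq: "(\<Sum>i=1..m. f i) = (\<Sum>i<m. f (Suc i))" for f :: "nat \<Rightarrow> 'b :: comm_monoid_add"
  by (rule sum.reindex_bij_witness[where i = Suc and j = "\<lambda>i. i - 1"]) auto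

context extremal_series
begin

lemma step_fun_norm_block_max:
  assumes "q > 0" "\<omega> \<in> space M"
  shows "step_fun J c y (norm_block_max a b X q (Suc s) \<omega>) = (\<Sum>j\<in>J. c j * indicator (runs (int s) q (lev q (y j))) \<omega>)"
proof -
  have "norm_block_max a b X q (Suc s) \<omega> \<le> z \<longleftrightarrow> \<omega> \<in> runs (int s) q (lev q z)" for z
    using norm_block_max_le_eq_runs[OF assms(1), of s z] assms(2) by auto
  then show ?thesis unfolding step_fun_def by (intro sum.cong refl) (simp add: indicator_def)
qed

lemma mean_square_step_fun:
  assumes q: "q > 0" and k: "k > 0" and m: "m > 0" and \<omega>: "\<omega> \<in> space M"
  shows "mean_square m (block_dev a b X q k m (step_fun J c y) \<omega>) =
    real k * ((\<Sum>j\<in>J. \<Sum>j'\<in>J. c j * c j' * avg_pair q (k * q) m (y j) (y j') \<omega>) - (\<Sum>j\<in>J. c j * avg_one q (k * q) m (y j) \<omega>)\<^sup>2)"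
proof -
  let ?N = "k * q"
  define I where "I i j = (\<Sum>s<?N. indicator (runs (int (i * ?N) + int s) q (lev q (y j))) \<omega>) / real ?N" for i j
  have B: "block_avg a b X q k (step_fun J c y) (Suc i) \<omega> = (\<Sum>j\<in>J. c j * I i j)" for i
  proof -
    have "block_avg a b X q k (step_fun J c y) (Suc i) \<omega> =
      (\<Sum>s<?N. \<Sum>j\<in>J. c j * indicator (runs (int (i * ?N) + int s) q (lev q (y j))) \<omega>) / real ?N"
      unfolding block_avg_Suc step_fun_norm_block_max[OF q \<omega>] by simp
    also have "\<dots> = (\<Sum>j\<in>J. c j * I i j)"
      unfolding I_def by (subst sum.swap) (simp only: sum_distrib_left sum_divide_distrib times_divide_eq_right)
    finally show ?thesis .
  qed
  have pair: "avg_pair q ?N m (y j) (y j') \<omega> = (\<Sum>i<m. I i j * I i j') / real m" for j j'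
    unfolding avg_pair_def I_def
    by (simp only: times_divide_times_eq sum_product sum_divide_distrib indicator_inter_arith power2_eq_square)
  have one: "avg_one q ?N m (y j) \<omega> = (\<Sum>i<m. I i j) / real m" for j
    unfolding avg_one_def I_def by (simp only: sum_divide_distrib)
  have "(\<Sum>i<m. (\<Sum>j\<in>J. c j * I i j)\<^sup>2) / real m = (\<Sum>i<m. \<Sum>j\<in>J. \<Sum>j'\<in>J. c j * c j' * (I i j * I i j')) / real m"
    by (simp only: power2_eq_square sum_product mult_ac)
  also have "(\<Sum>i<m. \<Sum>j\<in>J. \<Sum>j'\<in>J. c j * c j' * (I i j * I i j')) = (\<Sum>j\<in>J. \<Sum>i<m. \<Sum>j'\<in>J. c j * c j' * (I i j * I i j'))"
    by (rule sum.swap)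
  also have "\<dots> = (\<Sum>j\<in>J. \<Sum>j'\<in>J. \<Sum>i<m. c j * c j' * (I i j * I i j'))"
    by (intro sum.cong refl sum.swap)
  also have "\<dots> / real m = (\<Sum>j\<in>J. \<Sum>j'\<in>J. c j * c j' * avg_pair q ?N m (y j) (y j') \<omega>)"
    unfolding pair by (simp only: sum_distrib_left sum_divide_distrib times_divide_eq_right)
  finally have sq: "(\<Sum>i<m. (\<Sum>j\<in>J. c j * I i j)\<^sup>2) / real m = (\<Sum>j\<in>J. \<Sum>j'\<in>J. c j * c j' * avg_pair q ?N m (y j) (y j') \<omega>)" .
  have "(\<Sum>i<m. \<Sum>j\<in>J. c j * I i j) / real m = (\<Sum>j\<in>J. c j * avg_one q ?N m (y j) \<omega>)"
    unfolding one by (subst sum.swap) (simp only: sum_distrib_left sum_divide_distrib times_divide_eq_right)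
  then show ?thesis
    unfolding mean_square_block_dev[OF m] sum_from_1_eq B using sq by simp
qed

definition lag_integral :: "nat \<Rightarrow> real \<Rightarrow> real \<Rightarrow> real" where
  "lag_integral k x y = (\<integral>\<xi>. indicator {0<..<1} \<xi> * ((real k - \<xi>) * (gev_biv_cdf \<gamma> \<xi> x y - gev_cdf \<gamma> x * gev_cdf \<gamma> y)) \<partial>lborel)"

text \<open>The factor \<open>2 / k\<close> is the \<open>2 / k^2\<close> of
  \<open>block_pair_prob_tendsto\<close> times the \<open>k\<close> from the squared scaling in
  \<open>block_dev\<close>.\<close>

definition step_var :: "nat \<Rightarrow> 'j set \<Rightarrow> ('j \<Rightarrow> real) \<Rightarrow> ('j \<Rightarrow> real) \<Rightarrow> real" where
  "step_var k J c y = 2 / real k * (\<Sum>j\<in>J. \<Sum>j'\<in>J. c j * c j' * lag_integral k (y j) (y j'))"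

end

context block_scheme
begin

lemma l_le_r: "\<forall>\<^sub>F n in sequentially. l n \<le> r n"
proof -
  have "\<forall>\<^sub>F n in sequentially. real (l n) / real (r n) < 1" by (rule order_tendstoD(2)[OF l_lim]) simp
  then show ?thesis using r_pos by eventually_elim (simp add: divide_less_eq)
qed

context
  fixes k :: nat and m :: "nat \<Rightarrow> nat"
  assumes k: "k > 0" and m: "filterlim m at_top sequentially"
begin

lemma m_pos: "\<forall>\<^sub>F n in sequentially. m n > 0"
  using m[THEN eventually_compose_filterlim[OF eventually_gt_at_top[of 0]]] .

lemma error_tendsto_0: "(\<lambda>n. sqrt (5 / real (m n) + alpha_mixing M X (l n))) \<longlonglongrightarrow> 0"
proof -
  have "filterlim (\<lambda>n. real (m n)) at_top sequentially" by (rule filterlim_compose[OF filterlim_real_sequentially m])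
  then have "(\<lambda>n. 5 / real (m n)) \<longlonglongrightarrow> 0"
    by (intro tendsto_divide_0[OF tendsto_const] filterlim_at_top_imp_at_infinity)
  from tendsto_real_sqrt[OF tendsto_add[OF this alpha_lim]] show ?thesis by simp
qed

lemma ev_sizes: "\<forall>\<^sub>F n in sequentially. m n > 0 \<and> r n > 0 \<and> r n \<le> k * r n \<and> l n \<le> k * r n"
  using m_pos r_pos l_le_r
proof eventually_elim
  fix n assume "m n > 0" "r n > 0" "l n \<le> r n"
  moreover have "r n \<le> k * r n" using k by (cases k) auto
  ultimately show "m n > 0 \<and> r n > 0 \<and> r n \<le> k * r n \<and> l n \<le> k * r n" by (metis order_trans)
qed

lemma mean_lim_avg_pair:
  "mean_lim (\<lambda>n. avg_pair (r n) (k * r n) (m n) x y) (gev_cdf \<gamma> x * gev_cdf \<gamma> y + 2 / (real k)\<^sup>2 * lag_integral k x y)"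
proof (rule mean_limI_L2[where B = 1])
  show "\<forall>\<^sub>F n in sequentially. expectation (\<lambda>\<omega>. \<bar>avg_pair (r n) (k * r n) (m n) x y \<omega> - block_pair_prob (k * r n) (r n) x y\<bar>)
      \<le> sqrt (5 / real (m n) + alpha_mixing M X (l n))"
    using ev_sizes by eventually_elim (rule avg_pair_mean; use k in simp)
  show "(\<lambda>n. block_pair_prob (k * r n) (r n) x y) \<longlonglongrightarrow> gev_cdf \<gamma> x * gev_cdf \<gamma> y + 2 / (real k)\<^sup>2 * lag_integral k x y"
    unfolding lag_integral_def by (rule block_pair_prob_tendsto[OF k])
qed (auto simp: avg_pair_abs error_tendsto_0)

lemma mean_lim_avg_one: "mean_lim (\<lambda>n. avg_one (r n) (k * r n) (m n) x) (gev_cdf \<gamma> x)"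
proof (rule mean_limI_L2[where B = 1])
  show "\<forall>\<^sub>F n in sequentially. expectation (\<lambda>\<omega>. \<bar>avg_one (r n) (k * r n) (m n) x \<omega> - prob (runs 0 (r n) (lev (r n) x))\<bar>)
      \<le> sqrt (5 / real (m n) + alpha_mixing M X (l n))"
    using ev_sizes by eventually_elim (rule avg_one_mean; use k in simp)
qed (auto simp: avg_one_abs error_tendsto_0 prob_runs_r_tendsto)

text \<open>The empirical second moment of the block averages contributes products
  \<open>G(x) * G(y)\<close>; these cancel against the limit of the squared overall mean, and only
  the lag integrals remain.\<close>

lemma mean_square_step_fun_tendsto:
  assumes J: "finite J"
  shows "(\<lambda>n. expectation (\<lambda>\<omega>. \<bar>mean_square (m n) (block_dev a b X (r n) k (m n) (step_fun J c y) \<omega>) - step_var k J c y\<bar>)) \<longlonglongrightarrow> 0"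
proof -
  define V where "V n \<omega> = real k * ((\<Sum>j\<in>J. \<Sum>j'\<in>J. c j * c j' * avg_pair (r n) (k * r n) (m n) (y j) (y j') \<omega>)
     + (- 1) * ((\<Sum>j\<in>J. c j * avg_one (r n) (k * r n) (m n) (y j) \<omega>) * (\<Sum>j\<in>J. c j * avg_one (r n) (k * r n) (m n) (y j) \<omega>)))" for n \<omega>
  have "mean_lim V (real k * ((\<Sum>j\<in>J. \<Sum>j'\<in>J. c j * c j' * (gev_cdf \<gamma> (y j) * gev_cdf \<gamma> (y j') + 2 / (real k)\<^sup>2 * lag_integral k (y j) (y j')))
     + (- 1) * ((\<Sum>j\<in>J. c j * gev_cdf \<gamma> (y j)) * (\<Sum>j\<in>J. c j * gev_cdf \<gamma> (y j)))))"
    (is "mean_lim V ?v")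
    unfolding V_def[abs_def]
    by (intro mean_lim_mult mean_lim_add mean_lim_sum mean_lim_const mean_lim_avg_pair mean_lim_avg_one J)
  moreover have "?v = step_var k J c y"
  proof -
    have "(\<Sum>j\<in>J. \<Sum>j'\<in>J. c j * c j' * (gev_cdf \<gamma> (y j) * gev_cdf \<gamma> (y j') + 2 / (real k)\<^sup>2 * lag_integral k (y j) (y j')))
      = (\<Sum>j\<in>J. c j * gev_cdf \<gamma> (y j)) * (\<Sum>j\<in>J. c j * gev_cdf \<gamma> (y j)) + 2 / (real k)\<^sup>2 * (\<Sum>j\<in>J. \<Sum>j'\<in>J. c j * c j' * lag_integral k (y j) (y j'))"
    proof -
      have "(\<Sum>j\<in>J. \<Sum>j'\<in>J. c j * c j' * (gev_cdf \<gamma> (y j) * gev_cdf \<gamma> (y j') + 2 / (real k)\<^sup>2 * lag_integral k (y j) (y j'))) =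
        (\<Sum>j\<in>J. \<Sum>j'\<in>J. (c j * gev_cdf \<gamma> (y j)) * (c j' * gev_cdf \<gamma> (y j')) + 2 / (real k)\<^sup>2 * (c j * c j' * lag_integral k (y j) (y j')))"
        by (intro sum.cong refl) (simp only: distrib_left mult_ac)
      also have "\<dots> = (\<Sum>j\<in>J. \<Sum>j'\<in>J. (c j * gev_cdf \<gamma> (y j)) * (c j' * gev_cdf \<gamma> (y j')))
          + (\<Sum>j\<in>J. \<Sum>j'\<in>J. 2 / (real k)\<^sup>2 * (c j * c j' * lag_integral k (y j) (y j')))"
        by (simp only: sum.distrib)
      finally show ?thesis by (simp only: sum_distrib_left[symmetric] sum_distrib_right[symmetric])
    qed
    then show ?thesis using k by (simp add: step_var_def power2_eq_square)
  qed
  ultimately have "(\<lambda>n. expectation (\<lambda>\<omega>. \<bar>V n \<omega> - step_var k J c y\<bar>)) \<longlonglongrightarrow> 0"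
    by (simp add: mean_lim_def)
  then show ?thesis
  proof (rule Lim_transform_eventually)
    show "\<forall>\<^sub>F n in sequentially. expectation (\<lambda>\<omega>. \<bar>V n \<omega> - step_var k J c y\<bar>) =
      expectation (\<lambda>\<omega>. \<bar>mean_square (m n) (block_dev a b X (r n) k (m n) (step_fun J c y) \<omega>) - step_var k J c y\<bar>)"
      using ev_sizes
      by eventually_elim (intro Bochner_Integration.integral_cong refl, simp add: mean_square_step_fun k V_def power2_eq_square)
  qed
qed

end

end

subsection \<open>Comparison of test functions\<close>

lemma abs_mult_le_weighted:
  assumes "\<theta> > (0::real)"
  shows "\<bar>u * v\<bar> \<le> (\<theta> * u\<^sup>2 + v\<^sup>2 / \<theta>) / 2"
proof -
  define s where "s = sqrt \<theta>"
  have s: "s > 0" "s\<^sup>2 = \<theta>" using assms by (auto simp: s_def)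
  have "0 \<le> (s * \<bar>u\<bar> - \<bar>v\<bar> / s)\<^sup>2" by simp
  also have "\<dots> = \<theta> * u\<^sup>2 + v\<^sup>2 / \<theta> - 2 * \<bar>u * v\<bar>"
    using s by (simp add: power2_diff power_mult_distrib power_divide abs_mult)
  finally show ?thesis by simp
qed

text \<open>A difference of squares factors into \<open>c - c'\<close> and \<open>c + c'\<close>.
  The first factor is small for a good approximation and the second stays bounded;
  \<open>\<theta>\<close> balances them.\<close>

lemma mean_square_diff_le:
  assumes "\<theta> > 0"
  shows "\<bar>mean_square m c - mean_square m c'\<bar> \<le> (\<theta> * mean_square m (\<lambda>i. c i - c' i) + mean_square m (\<lambda>i. c i + c' i) / \<theta>) / 2"
proof -
  have "mean_square m c - mean_square m c' = (\<Sum>i=1..m. (c i - c' i) * (c i + c' i)) / real m"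
    unfolding mean_square_def by (simp add: diff_divide_distrib[symmetric] sum_subtractf[symmetric] power2_eq_square algebra_simps)
  then have "\<bar>mean_square m c - mean_square m c'\<bar> \<le> (\<Sum>i=1..m. \<bar>(c i - c' i) * (c i + c' i)\<bar>) / real m"
    by (simp add: abs_divide divide_right_mono sum_abs)
  also have "\<dots> \<le> (\<Sum>i=1..m. (\<theta> * (c i - c' i)\<^sup>2 + (c i + c' i)\<^sup>2 / \<theta>) / 2) / real m"
    by (intro divide_right_mono sum_mono abs_mult_le_weighted assms) simp
  also have "\<dots> = (\<theta> * mean_square m (\<lambda>i. c i - c' i) + mean_square m (\<lambda>i. c i + c' i) / \<theta>) / 2"
    unfolding mean_square_def by (simp add: sum_divide_distrib sum.distrib sum_distrib_left add_divide_distrib mult_ac)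
  finally show ?thesis .
qed

lemma block_avg_diff: "block_avg a b X r k (\<lambda>x. f x - g x) i \<omega> = block_avg a b X r k f i \<omega> - block_avg a b X r k g i \<omega>"
  by (simp add: block_avg_def sum_subtractf diff_divide_distrib)

lemma block_avg_add: "block_avg a b X r k (\<lambda>x. f x + g x) i \<omega> = block_avg a b X r k f i \<omega> + block_avg a b X r k g i \<omega>"
  by (simp add: block_avg_def sum.distrib add_divide_distrib)

lemma block_dev_diff: "block_dev a b X r k m (\<lambda>x. f x - g x) \<omega> i = block_dev a b X r k m f \<omega> i - block_dev a b X r k m g \<omega> i"
  by (simp add: block_dev_def block_avg_diff sum_subtractf diff_divide_distrib algebra_simps)

lemma block_dev_add: "block_dev a b X r k m (\<lambda>x. f x + g x) \<omega> i = block_dev a b X r k m f \<omega> i + block_dev a b X r k m g \<omega> i"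
  by (simp add: block_dev_def block_avg_add sum.distrib add_divide_distrib algebra_simps)

lemma avg_square_le:
  fixes f :: "nat \<Rightarrow> real"
  shows "((\<Sum>i<n. f i) / real n)\<^sup>2 \<le> (\<Sum>i<n. (f i)\<^sup>2) / real n"
proof (cases "n = 0")
  case False
  have "(\<Sum>i<n. f i)\<^sup>2 \<le> (\<Sum>i<n. (f i)\<^sup>2) * real n"
    using sum_squared_le_sum_of_squares[of f "{..<n}"] by simp
  then have "(\<Sum>i<n. f i)\<^sup>2 / (real n)\<^sup>2 \<le> ((\<Sum>i<n. (f i)\<^sup>2) * real n) / (real n)\<^sup>2"
    by (rule divide_right_mono) simp
  then show ?thesis using False by (simp add: power_divide power2_eq_square)
qed simp

lemma mean_square_block_dev_le:
  assumes m: "m > 0"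
  shows "mean_square m (block_dev a b X r k m f \<omega>) \<le>
    real k * ((\<Sum>i<m. (\<Sum>s<k * r. (f (norm_block_max a b X r (Suc (i * (k * r) + s)) \<omega>))\<^sup>2) / real (k * r)) / real m)"
proof -
  have "mean_square m (block_dev a b X r k m f \<omega>) \<le> real k * ((\<Sum>i=1..m. (block_avg a b X r k f i \<omega>)\<^sup>2) / real m)"
    unfolding mean_square_block_dev[OF m] by (intro mult_left_mono) auto
  also have "\<dots> \<le> real k * ((\<Sum>i<m. (\<Sum>s<k * r. (f (norm_block_max a b X r (Suc (i * (k * r) + s)) \<omega>))\<^sup>2) / real (k * r)) / real m)"
    unfolding sum_from_1_eq block_avg_Suc by (intro mult_left_mono divide_right_mono sum_mono avg_square_le) auto
  finally show ?thesis .
qed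

section \<open>Square integrable test functions\<close>

subsection \<open>Density of step functions\<close>

text \<open>Sampling a bounded almost everywhere continuous function at grid points approximates it by
  dominated convergence.\<close>

lemma step_fun_dense_bounded:
  assumes N: "real_distribution N" and h [measurable]: "h \<in> borel_measurable borel"
    and cont: "AE x in N. isCont h x" and b: "\<And>x. \<bar>h x\<bar> \<le> (C::real)" and \<epsilon>: "\<epsilon> > 0"
  shows "\<exists>(J :: (int \<times> bool) set) c y. finite J \<and> (\<integral>x. (h x - step_fun J c y x)\<^sup>2 \<partial>N) < \<epsilon>"
proof -
  interpret N: real_distribution N by fact
  \<comment> \<open>The left end of the cell, open on the left and closed on the right, that
    contains \<open>x\<close>. This orientation makes the cell indicator a difference of indicators
    of sets \<open>{..z}\<close>.\<close>
  define grid where "grid n x = real_of_int (\<lceil>real (Suc n) * x\<rceil> - 1) / real (Suc n)" for n x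
  define g where "g n x = (if \<bar>\<lceil>real (Suc n) * x\<rceil> - 1\<bar> \<le> int ((Suc n)\<^sup>2) then h (grid n x) else 0)" for n x
  have grid: "\<bar>grid n x - x\<bar> \<le> 1 / real (Suc n)" for n x
  proof -
    have "\<bar>real_of_int (\<lceil>real (Suc n) * x\<rceil> - 1) - real (Suc n) * x\<bar> \<le> 1" by linarith
    then have "\<bar>real_of_int (\<lceil>real (Suc n) * x\<rceil> - 1) - real (Suc n) * x\<bar> / real (Suc n) \<le> 1 / real (Suc n)"
      by (intro divide_right_mono) auto
    also have "\<bar>real_of_int (\<lceil>real (Suc n) * x\<rceil> - 1) - real (Suc n) * x\<bar> / real (Suc n) = \<bar>grid n x - x\<bar>"
    proof -
      have "grid n x - x = (real_of_int (\<lceil>real (Suc n) * x\<rceil> - 1) - real (Suc n) * x) / real (Suc n)"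
        unfolding grid_def diff_divide_distrib by simp
      then show ?thesis by simp
    qed
    finally show ?thesis .
  qed
  have gm [measurable]: "g n \<in> borel_measurable borel" for n
  proof -
    have "(\<lambda>x. real (Suc n) * x) \<in> borel_measurable borel" by measurable
    then have "(\<lambda>x. \<lceil>real (Suc n) * x\<rceil>) \<in> measurable borel (count_space UNIV)"
      by (rule measurable_compose[OF _ measurable_real_ceiling])
    from measurable_compose[OF this, of "\<lambda>i. if \<bar>i - 1\<bar> \<le> int ((Suc n)\<^sup>2) then h (real_of_int (i - 1) / real (Suc n)) else 0" borel]
    show ?thesis unfolding g_def[abs_def] grid_def[abs_def] by simp
  qed
  have gb: "\<bar>g n x\<bar> \<le> C" for n x
  proof -
    have "0 \<le> C" using b[of 0] by linarith
    then show ?thesis using b by (simp add: g_def)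
  qed
  have lim: "(\<lambda>n. g n x) \<longlonglongrightarrow> h x" if "isCont h x" for x
  proof -
    have "(\<lambda>n. grid n x - x) \<longlonglongrightarrow> 0"
    proof (rule Lim_null_comparison)
      show "(\<lambda>n. 1 / real (Suc n)) \<longlonglongrightarrow> 0" using LIMSEQ_inverse_real_of_nat by (simp add: inverse_eq_divide)
    qed (use grid in auto)
    then have "(\<lambda>n. grid n x) \<longlonglongrightarrow> x" by (rule LIM_zero_cancel)
    then have "(\<lambda>n. h (grid n x)) \<longlonglongrightarrow> h x" by (rule isCont_tendsto_compose[OF that])
    then show ?thesis
    proof (rule Lim_transform_eventually)
      show "\<forall>\<^sub>F n in sequentially. h (grid n x) = g n x"
      proof (rule eventually_sequentiallyI[of "nat \<lceil>\<bar>x\<bar> + 1\<rceil>"])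
        fix n assume "nat \<lceil>\<bar>x\<bar> + 1\<rceil> \<le> n"
        then have n: "\<bar>x\<bar> + 1 \<le> real (Suc n)" by linarith
        have "\<bar>real_of_int (\<lceil>real (Suc n) * x\<rceil> - 1)\<bar> \<le> \<bar>real (Suc n) * x\<bar> + 1" by linarith
        also have "\<dots> = real (Suc n) * \<bar>x\<bar> + 1" by (simp add: abs_mult)
        also have "\<dots> \<le> real (Suc n) * \<bar>x\<bar> + real (Suc n)" by simp
        also have "\<dots> = real (Suc n) * (\<bar>x\<bar> + 1)" by (simp add: algebra_simps)
        also have "\<dots> \<le> real (Suc n) * real (Suc n)" by (intro mult_left_mono n) auto
        finally have "real_of_int \<bar>\<lceil>real (Suc n) * x\<rceil> - 1\<bar> \<le> real_of_int (int ((Suc n)\<^sup>2))"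
          by (simp only: of_int_abs power2_eq_square of_int_of_nat_eq of_nat_mult of_int_mult)
        then have "\<bar>\<lceil>real (Suc n) * x\<rceil> - 1\<bar> \<le> int ((Suc n)\<^sup>2)" by (simp only: of_int_le_iff)
        then show "h (grid n x) = g n x" by (simp add: g_def)
      qed
    qed
  qed
  have "(\<lambda>n. \<integral>x. (h x - g n x)\<^sup>2 \<partial>N) \<longlonglongrightarrow> (\<integral>x. 0 \<partial>N)"
  proof (rule integral_dominated_convergence[where w = "\<lambda>_. (2 * C)\<^sup>2"])
    show "AE x in N. (\<lambda>n. (h x - g n x)\<^sup>2) \<longlonglongrightarrow> 0"
      using cont
    proof eventually_elim
      fix x assume "isCont h x"
      from tendsto_power[OF tendsto_diff[OF tendsto_const lim[OF this]], of "h x" 2]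
      show "(\<lambda>n. (h x - g n x)\<^sup>2) \<longlonglongrightarrow> 0" by simp
    qed
    show "AE x in N. norm ((h x - g n x)\<^sup>2) \<le> (2 * C)\<^sup>2" for n
    proof (intro AE_I2)
      fix x
      have "\<bar>h x - g n x\<bar> \<le> 2 * C" using b[of x] gb[of n x] by linarith
      then show "norm ((h x - g n x)\<^sup>2) \<le> (2 * C)\<^sup>2" using power_mono[of "\<bar>h x - g n x\<bar>" "2 * C" 2] by simp
    qed
  qed auto
  then have "\<forall>\<^sub>F n in sequentially. (\<integral>x. (h x - g n x)\<^sup>2 \<partial>N) < \<epsilon>"
    using \<epsilon> by (intro order_tendstoD(2)) auto
  then obtain n where n: "(\<integral>x. (h x - g n x)\<^sup>2 \<partial>N) < \<epsilon>" by (auto simp: eventually_sequentially)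
  define D where "D = {i. \<bar>i\<bar> \<le> int ((Suc n)\<^sup>2)}"
  have "D \<subseteq> {- int ((Suc n)\<^sup>2)..int ((Suc n)\<^sup>2)}" unfolding D_def by auto
  then have D: "finite D" by (rule finite_subset) simp
  \<comment> \<open>The Boolean part of a label tells whether the half-line ends at the right or the
    left end of the cell, and thereby the sign of its coefficient.\<close>
  define c where "c = (\<lambda>(i, u). (if u then 1 else - 1) * h (real_of_int i / real (Suc n)))"
  define y where "y = (\<lambda>(i, u). (real_of_int i + (if u then 1 else 0)) / real (Suc n))"
  have "g n x = step_fun (D \<times> UNIV) c y x" for x
  proof -
    let ?i = "\<lceil>real (Suc n) * x\<rceil> - 1"
    have "step_fun (D \<times> UNIV) c y x = (\<Sum>i\<in>D. \<Sum>u\<in>UNIV. c (i, u) * indicator {..y (i, u)} x)"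
      unfolding step_fun_def sum.cartesian_product by (intro sum.cong refl) (simp only: case_prod_beta prod.collapse)
    also have "\<dots> = (\<Sum>i\<in>D. if i = ?i then h (real_of_int i / real (Suc n)) else 0)"
    proof (intro sum.cong refl)
      fix i
      have le: "x \<le> z / real (Suc n) \<longleftrightarrow> real (Suc n) * x \<le> z" for z by (simp add: le_divide_eq mult.commute)
      have "i = ?i \<longleftrightarrow> real_of_int i < real (Suc n) * x \<and> real (Suc n) * x \<le> real_of_int i + 1" by linarith
      then show "(\<Sum>u\<in>UNIV. c (i, u) * indicator {..y (i, u)} x) = (if i = ?i then h (real_of_int i / real (Suc n)) else 0)"
        using le[of "real_of_int i"] le[of "real_of_int i + 1"]
        by (auto simp: UNIV_bool c_def y_def indicator_def simp del: of_nat_Suc)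
    qed
    also have "\<dots> = g n x" using D by (simp add: g_def grid_def D_def)
    finally show ?thesis ..
  qed
  then have "(\<integral>x. (h x - step_fun (D \<times> UNIV) c y x)\<^sup>2 \<partial>N) < \<epsilon>" using n by simp
  moreover have "finite (D \<times> (UNIV :: bool set))" using D by simp
  ultimately show ?thesis by blast
qed

lemma square_diff_le: "(u - v)\<^sup>2 \<le> 2 * (u - w)\<^sup>2 + 2 * (w - v)\<^sup>2" for u v w :: real
proof -
  have "0 \<le> ((u - w) - (w - v))\<^sup>2" by simp
  then show ?thesis by (simp add: power2_eq_square algebra_simps)
qed

lemma step_fun_square_integrable:
  assumes "prob_space N" "sets N = sets borel" "finite J"
  shows "integrable N (\<lambda>x. (step_fun J c y x)\<^sup>2)"
proof -
  interpret prob_space N by fact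
  have "\<bar>step_fun J c y x\<bar> \<le> (\<Sum>j\<in>J. \<bar>c j\<bar>)" for x
    unfolding step_fun_def by (rule order_trans[OF sum_abs sum_mono]) (auto simp: indicator_def)
  then have "(step_fun J c y x)\<^sup>2 \<le> (\<Sum>j\<in>J. \<bar>c j\<bar>)\<^sup>2" for x
    using power_mono[of "\<bar>step_fun J c y x\<bar>" _ 2] by fastforce
  moreover have "step_fun J c y \<in> borel_measurable N"
    using assms(2) by (simp cong: measurable_cong_sets)
  ultimately show ?thesis by (intro integrable_const_bound[where B = "(\<Sum>j\<in>J. \<bar>c j\<bar>)\<^sup>2"]) auto
qed

lemma integrable_square_diff:
  fixes f g :: "'a \<Rightarrow> real"
  assumes [measurable]: "f \<in> borel_measurable N" "g \<in> borel_measurable N"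
    and "integrable N (\<lambda>x. (f x)\<^sup>2)" "integrable N (\<lambda>x. (g x)\<^sup>2)"
  shows "integrable N (\<lambda>x. (f x - g x)\<^sup>2)" "integrable N (\<lambda>x. (f x + g x)\<^sup>2)"
proof -
  have i: "integrable N (\<lambda>x. 2 * (f x)\<^sup>2 + 2 * (g x)\<^sup>2)" using assms by auto
  show "integrable N (\<lambda>x. (f x - g x)\<^sup>2)"
    by (rule Bochner_Integration.integrable_bound[OF i]) (use square_diff_le[of _ _ 0] in auto)
  show "integrable N (\<lambda>x. (f x + g x)\<^sup>2)"
    by (rule Bochner_Integration.integrable_bound[OF i]) (use square_diff_le[of _ "- _" 0] in auto)
qed

text \<open>Truncation of \<open>h\<close> at height \<open>n\<close> keeps continuity points and
  converges in mean square by domination with the square of \<open>h\<close>, which reduces the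
  claim to bounded functions.\<close>

lemma step_fun_dense:
  assumes N: "real_distribution N" and h [measurable]: "h \<in> borel_measurable borel"
    and cont: "AE x in N. isCont h x" and int: "integrable N (\<lambda>x. (h x)\<^sup>2)" and \<epsilon>: "\<epsilon> > 0"
  shows "\<exists>(J :: (int \<times> bool) set) c y. finite J \<and> (\<integral>x. (h x - step_fun J c y x)\<^sup>2 \<partial>N) < \<epsilon>"
proof -
  interpret N: real_distribution N by fact
  define H where "H n x = max (- real n) (min (real n) (h x))" for n x
  have Hm [measurable]: "H n \<in> borel_measurable borel" for n unfolding H_def[abs_def] by measurable
  have "(\<lambda>n. \<integral>x. (h x - H n x)\<^sup>2 \<partial>N) \<longlonglongrightarrow> (\<integral>x. 0 \<partial>N)"
  proof (rule integral_dominated_convergence[where w = "\<lambda>x. (h x)\<^sup>2"])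
    show "AE x in N. (\<lambda>n. (h x - H n x)\<^sup>2) \<longlonglongrightarrow> 0"
    proof (intro AE_I2 tendsto_eventually eventually_sequentiallyI)
      fix x n assume "nat \<lceil>\<bar>h x\<bar>\<rceil> \<le> n"
      then have "\<bar>h x\<bar> \<le> real n" by linarith
      then show "(h x - H n x)\<^sup>2 = 0" by (auto simp: H_def)
    qed
    show "AE x in N. norm ((h x - H n x)\<^sup>2) \<le> (h x)\<^sup>2" for n
    proof (intro AE_I2)
      fix x
      have "\<bar>h x - H n x\<bar> \<le> \<bar>h x\<bar>" by (auto simp: H_def)
      then show "norm ((h x - H n x)\<^sup>2) \<le> (h x)\<^sup>2" by (simp add: abs_le_square_iff)
    qed
  qed (use int in auto)
  \<comment> \<open>A quarter each for truncation and for the step function, because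
    \<open>square_diff_le\<close> doubles both errors.\<close>
  then have "\<forall>\<^sub>F n in sequentially. (\<integral>x. (h x - H n x)\<^sup>2 \<partial>N) < \<epsilon> / 4"
    using \<epsilon> by (intro order_tendstoD(2)) auto
  then obtain n where n: "(\<integral>x. (h x - H n x)\<^sup>2 \<partial>N) < \<epsilon> / 4" by (auto simp: eventually_sequentially)
  have Hb: "\<bar>H n x\<bar> \<le> real n" for x by (auto simp: H_def)
  have "AE x in N. isCont (H n) x"
    using cont by eventually_elim (auto simp: H_def[abs_def] intro!: continuous_max continuous_min)
  then obtain J :: "(int \<times> bool) set" and c y where J: "finite J" "(\<integral>x. (H n x - step_fun J c y x)\<^sup>2 \<partial>N) < \<epsilon> / 4"
    using step_fun_dense_bounded[OF N Hm _ Hb, of "\<epsilon> / 4"] \<epsilon> by auto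
  have iH: "integrable N (\<lambda>x. (H n x)\<^sup>2)"
  proof (rule N.integrable_const_bound[where B = "(real n)\<^sup>2"])
    show "AE x in N. norm ((H n x)\<^sup>2) \<le> (real n)\<^sup>2"
      using power_mono[OF Hb, of _ 2] by auto
  qed simp
  have iS: "integrable N (\<lambda>x. (step_fun J c y x)\<^sup>2)"
    by (rule step_fun_square_integrable) (auto intro: J N.prob_space_axioms)
  have i1: "integrable N (\<lambda>x. (h x - H n x)\<^sup>2)" "integrable N (\<lambda>x. (H n x - step_fun J c y x)\<^sup>2)"
    by (auto intro!: integrable_square_diff int iH iS)
  have "(\<integral>x. (h x - step_fun J c y x)\<^sup>2 \<partial>N) \<le> (\<integral>x. 2 * (h x - H n x)\<^sup>2 + 2 * (H n x - step_fun J c y x)\<^sup>2 \<partial>N)"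
    by (rule integral_mono_AE') (use i1 in \<open>auto intro: square_diff_le\<close>)
  also have "\<dots> < \<epsilon>" using i1 n J(2) by simp
  finally show ?thesis using J(1) by blast
qed

text \<open>The weights \<open>\<theta>\<close> come from \<open>2 |u v| \<le> \<theta> u\<^sup>2 + v\<^sup>2 / \<theta>\<close>, which replaces the Cauchy-Schwarz inequality
  in the comparison of quadratic functionals of \<open>h\<close> and of a step function.\<close>

lemma step_fun_approx:
  assumes N: "real_distribution N" and h [measurable]: "h \<in> borel_measurable borel"
    and cont: "AE x in N. isCont h x" and int: "integrable N (\<lambda>x. (h x)\<^sup>2)" and \<epsilon>: "\<epsilon> > 0"
  shows "\<exists>(J :: (int \<times> bool) set) c y \<theta>. finite J \<and> \<theta> > 0 \<and>
    \<theta> * (\<integral>x. (h x - step_fun J c y x)\<^sup>2 \<partial>N) + (\<integral>x. (h x + step_fun J c y x)\<^sup>2 \<partial>N) / \<theta> < \<epsilon>"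
proof -
  interpret N: real_distribution N by fact
  define H2 where "H2 = (\<integral>x. (h x)\<^sup>2 \<partial>N)"
  have H2: "H2 \<ge> 0" by (simp add: H2_def)
  \<comment> \<open>Once the squared error is at most 1, \<open>8 * H2 + 2\<close> bounds the
    integral of the squared sum; this \<open>\<theta>\<close> brings its share down to half of
    \<open>\<epsilon>\<close>. Only afterwards is the error \<open>\<eta>\<close> made small against
    \<open>\<theta>\<close>.\<close>
  define \<theta> where "\<theta> = (8 * H2 + 2) * 2 / \<epsilon>"
  have \<theta>: "\<theta> > 0" using H2 \<epsilon> by (simp add: \<theta>_def)
  define \<eta> where "\<eta> = min 1 (\<epsilon> / (2 * \<theta>))"
  have \<eta>: "\<eta> > 0" using \<epsilon> \<theta> by (simp add: \<eta>_def)
  obtain J :: "(int \<times> bool) set" and c y where J: "finite J" "(\<integral>x. (h x - step_fun J c y x)\<^sup>2 \<partial>N) < \<eta>"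
    using step_fun_dense[OF N h cont int \<eta>] by blast
  let ?g = "step_fun J c y"
  have iS: "integrable N (\<lambda>x. (?g x)\<^sup>2)"
    by (rule step_fun_square_integrable) (auto intro: J N.prob_space_axioms)
  have i: "integrable N (\<lambda>x. (h x - ?g x)\<^sup>2)" by (auto intro!: integrable_square_diff int iS)
  have "(h x + ?g x)\<^sup>2 \<le> 8 * (h x)\<^sup>2 + 2 * (h x - ?g x)\<^sup>2" for x
    using square_diff_le[of "h x" "- ?g x" "- h x"] by (simp add: power2_eq_square algebra_simps)
  then have "(\<integral>x. (h x + ?g x)\<^sup>2 \<partial>N) \<le> (\<integral>x. 8 * (h x)\<^sup>2 + 2 * (h x - ?g x)\<^sup>2 \<partial>N)"
    by (intro integral_mono_AE') (use i int in auto)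
  also have "\<dots> = 8 * H2 + 2 * (\<integral>x. (h x - ?g x)\<^sup>2 \<partial>N)" using i int by (simp add: H2_def)
  also have "\<dots> \<le> 8 * H2 + 2" using J(2) by (simp add: \<eta>_def)
  finally have "(\<integral>x. (h x + ?g x)\<^sup>2 \<partial>N) / \<theta> \<le> (8 * H2 + 2) / \<theta>" using \<theta> by (intro divide_right_mono) auto
  also have "(8 * H2 + 2) / \<theta> = \<epsilon> / 2" using H2 \<epsilon> by (simp add: \<theta>_def field_simps)
  finally have 1: "(\<integral>x. (h x + ?g x)\<^sup>2 \<partial>N) / \<theta> \<le> \<epsilon> / 2" .
  have "\<theta> * (\<integral>x. (h x - ?g x)\<^sup>2 \<partial>N) < \<theta> * \<eta>" using J(2) \<theta> by (intro mult_strict_left_mono)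
  also have "\<dots> \<le> \<theta> * (\<epsilon> / (2 * \<theta>))" using \<theta> by (intro mult_left_mono) (auto simp: \<eta>_def)
  also have "\<dots> = \<epsilon> / 2" using \<theta> by simp
  finally have 2: "\<theta> * (\<integral>x. (h x - ?g x)\<^sup>2 \<partial>N) < \<epsilon> / 2" .
  have "\<theta> * (\<integral>x. (h x - ?g x)\<^sup>2 \<partial>N) + (\<integral>x. (h x + ?g x)\<^sup>2 \<partial>N) / \<theta> < \<epsilon> / 2 + \<epsilon> / 2"
    by (rule add_less_le_mono[OF 2 1])
  then have "finite J \<and> \<theta> > 0 \<and> \<theta> * (\<integral>x. (h x - ?g x)\<^sup>2 \<partial>N) + (\<integral>x. (h x + ?g x)\<^sup>2 \<partial>N) / \<theta> < \<epsilon>"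
    using J(1) \<theta> by (simp only: field_sum_of_halves simp_thms)
  then show ?thesis by blast
qed

subsection \<open>Moments of normalised block maxima\<close>

lemma abs_mono_nonneg: "0 \<le> u \<Longrightarrow> u \<le> v \<Longrightarrow> \<bar>u\<bar> \<le> \<bar>v\<bar>" for u v :: real
  by linarith

lemma abs_add_powr_le:
  fixes u v :: real
  assumes "p > 0"
  shows "\<bar>u + v\<bar> powr p \<le> 2 powr p * (\<bar>u\<bar> powr p + \<bar>v\<bar> powr p)"
proof -
  have "\<bar>u + v\<bar> \<le> 2 * max \<bar>u\<bar> \<bar>v\<bar>" by linarith
  then have "\<bar>u + v\<bar> powr p \<le> (2 * max \<bar>u\<bar> \<bar>v\<bar>) powr p" using assms by (intro powr_mono2) auto
  also have "\<dots> = 2 powr p * (max \<bar>u\<bar> \<bar>v\<bar>) powr p" by (simp add: powr_mult)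
  also have "(max \<bar>u\<bar> \<bar>v\<bar>) powr p \<le> \<bar>u\<bar> powr p + \<bar>v\<bar> powr p" by (auto simp: max_def)
  finally show ?thesis by simp
qed

text \<open>The tangent to the convex power function at the mean lies below it, and summing the
  tangent inequality kills the linear term. The point 0 is treated apart because the tangent
  inequality is drawn from convexity on the open half-line.\<close>

lemma powr_Jensen:
  fixes f :: "nat \<Rightarrow> real"
  assumes p: "p \<ge> 1" and f: "\<And>i. i < n \<Longrightarrow> f i \<ge> 0"
  shows "((\<Sum>i<n. f i) / real n) powr p \<le> (\<Sum>i<n. f i powr p) / real n"
proof (cases "(\<Sum>i<n. f i) / real n > 0")
  case False
  moreover have "(\<Sum>i<n. f i) / real n \<ge> 0" using f by (intro divide_nonneg_nonneg sum_nonneg) auto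
  ultimately have z: "(\<Sum>i<n. f i) / real n = 0" by linarith
  show ?thesis unfolding z by (auto intro!: divide_nonneg_nonneg sum_nonneg)
next
  case True
  define \<mu> where "\<mu> = (\<Sum>i<n. f i) / real n"
  have \<mu>: "\<mu> > 0" using True by (simp add: \<mu>_def)
  have n: "n > 0" using True by (cases n) auto
  have tangent: "\<mu> powr p + p * \<mu> powr (p - 1) * (x - \<mu>) \<le> x powr p" if x: "x \<ge> 0" for x
  proof (cases "x = 0")
    case True
    have "\<mu> powr (p - 1) * \<mu> = \<mu> powr p" using \<mu> by (simp add: powr_diff)
    then have "\<mu> powr p + p * \<mu> powr (p - 1) * (x - \<mu>) = (1 - p) * \<mu> powr p"
      using True by (simp add: algebra_simps)
    also have "\<dots> \<le> 0" using p by (simp add: mult_nonpos_nonneg)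
    finally show ?thesis using True by simp
  next
    case False
    have "((\<lambda>x. x powr p) has_real_derivative p * \<mu> powr (p - 1)) (at \<mu> within {0<..})"
      using \<mu> by (auto intro!: derivative_eq_intros)
    then have "x powr p - \<mu> powr p \<ge> p * \<mu> powr (p - 1) * (x - \<mu>)"
      using convex_on_imp_above_tangent[OF powr_convex[OF p], of \<mu> x] False x \<mu> by (simp add: interior_open)
    then show ?thesis by simp
  qed
  have "real n * \<mu> powr p = (\<Sum>i<n. \<mu> powr p + p * \<mu> powr (p - 1) * (f i - \<mu>))"
    using n by (simp add: sum.distrib sum_distrib_left[symmetric] sum_subtractf \<mu>_def)
  also have "\<dots> \<le> (\<Sum>i<n. f i powr p)" using f by (intro sum_mono tangent) auto
  finally show ?thesis using n unfolding \<mu>_def[symmetric] by (simp add: le_divide_eq mult.commute)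
qed

text \<open>The constant collects \<open>k powr (p / 2)\<close> from the scaling by
  \<open>sqrt k\<close>, and \<open>2 powr p * 2\<close> from separating a block average from the
  overall mean, each of which Jensen's inequality bounds by the same average of powers.\<close>

lemma lyapunov_ratio_block_dev_le:
  assumes p: "p \<ge> 1" and m: "m > 0"
  shows "lyapunov_ratio p m (block_dev a b X r k m h \<omega>) \<le> real m powr (1 - p / 2) * (real k powr (p / 2) * (2 powr p * 2) *
    ((\<Sum>i<m. (\<Sum>s<k * r. \<bar>h (norm_block_max a b X r (Suc (i * (k * r) + s)) \<omega>)\<bar> powr p) / real (k * r)) / real m))"
proof -
  let ?B = "\<lambda>i. block_avg a b X r k h (Suc i) \<omega>"
  let ?A = "(\<Sum>i<m. ?B i) / real m"
  let ?P = "(\<Sum>i<m. \<bar>?B i\<bar> powr p) / real m"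
  have "\<bar>?A\<bar> powr p \<le> ((\<Sum>i<m. \<bar>?B i\<bar>) / real m) powr p"
    using p by (intro powr_mono2) (auto simp: abs_divide intro!: divide_right_mono)
  also have "\<dots> \<le> ?P" by (rule powr_Jensen[OF p]) simp
  finally have A: "\<bar>?A\<bar> powr p \<le> ?P" .
  have c: "\<bar>block_dev a b X r k m h \<omega> (Suc i)\<bar> powr p \<le> real k powr (p / 2) * (2 powr p * (\<bar>?B i\<bar> powr p + ?P))" for i
  proof -
    have "\<bar>block_dev a b X r k m h \<omega> (Suc i)\<bar> powr p = sqrt (real k) powr p * \<bar>?B i + (- ?A)\<bar> powr p"
      unfolding block_dev_def sum_from_1_eq by (simp add: abs_mult powr_mult)
    also have "sqrt (real k) powr p = real k powr (p / 2)" by (simp add: powr_half_sqrt[symmetric] powr_powr)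
    also have "\<bar>?B i + (- ?A)\<bar> powr p \<le> 2 powr p * (\<bar>?B i\<bar> powr p + \<bar>- ?A\<bar> powr p)"
      using p by (intro abs_add_powr_le) auto
    also have "\<bar>- ?A\<bar> powr p \<le> ?P" using A by simp
    finally show ?thesis by (simp add: mult_left_mono)
  qed
  have "(\<Sum>i=1..m. \<bar>block_dev a b X r k m h \<omega> i\<bar> powr p) / real m \<le> (\<Sum>i<m. real k powr (p / 2) * (2 powr p * (\<bar>?B i\<bar> powr p + ?P))) / real m"
    unfolding sum_from_1_eq by (intro divide_right_mono sum_mono c) simp
  also have "\<dots> = real k powr (p / 2) * (2 powr p * 2) * ?P"
    using m by (simp add: sum_distrib_left[symmetric] sum.distrib)
  also have "\<dots> \<le> real k powr (p / 2) * (2 powr p * 2) *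
    ((\<Sum>i<m. (\<Sum>s<k * r. \<bar>h (norm_block_max a b X r (Suc (i * (k * r) + s)) \<omega>)\<bar> powr p) / real (k * r)) / real m)"
  proof (intro mult_left_mono divide_right_mono sum_mono)
    fix i
    have "\<bar>?B i\<bar> powr p \<le> ((\<Sum>s<k * r. \<bar>h (norm_block_max a b X r (Suc (i * (k * r) + s)) \<omega>)\<bar>) / real (k * r)) powr p"
      unfolding block_avg_Suc using p by (intro powr_mono2) (auto simp: abs_divide intro!: divide_right_mono)
    also have "\<dots> \<le> (\<Sum>s<k * r. \<bar>h (norm_block_max a b X r (Suc (i * (k * r) + s)) \<omega>)\<bar> powr p) / real (k * r)"
      by (rule powr_Jensen[OF p]) simp
    finally show "\<bar>?B i\<bar> powr p \<le> (\<Sum>s<k * r. \<bar>h (norm_block_max a b X r (Suc (i * (k * r) + s)) \<omega>)\<bar> powr p) / real (k * r)" .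
  qed auto
  finally show ?thesis unfolding lyapunov_ratio_def by (rule mult_left_mono) simp
qed

lemma (in prob_space) expectation_double_avg:
  fixes F :: "nat \<Rightarrow> nat \<Rightarrow> 'a \<Rightarrow> real"
  assumes "\<And>i s. integrable M (F i s)" "\<And>i s. expectation (F i s) = e" "m > 0" "N > 0"
  shows "integrable M (\<lambda>\<omega>. (\<Sum>i<m. (\<Sum>s<N. F i s \<omega>) / real N) / real m)"
    and "expectation (\<lambda>\<omega>. (\<Sum>i<m. (\<Sum>s<N. F i s \<omega>) / real N) / real m) = e"
  using assms by simp_all

context extremal_series
begin

section \<open>Transfer of moment bounds to all blocks by stationarity\<close>

lemma distr_norm_block_max:
  assumes "q > 0"
  shows "distr M borel (norm_block_max a b X q (Suc s)) = distr M borel (norm_block_max a b X q 1)"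
proof (rule cdf_unique)
  have "cdf (distr M borel (norm_block_max a b X q (Suc s))) y = prob (runs (int s) q (lev q y))" for s y
    unfolding cdf_def norm_block_max_le_eq_runs[OF assms, symmetric]
    by (subst measure_distr) (auto intro!: arg_cong[where f = prob])
  from this[of s] this[of 0]
  show "cdf (distr M borel (norm_block_max a b X q (Suc s))) = cdf (distr M borel (norm_block_max a b X q 1))"
    by (auto simp: fun_eq_iff prob_runs_shift[of "int _"])
qed auto

lemma norm_block_max_integral:
  fixes f :: "real \<Rightarrow> real"
  assumes "q > 0" and f [measurable]: "f \<in> borel_measurable borel"
  shows "integrable M (\<lambda>\<omega>. f (norm_block_max a b X q (Suc s) \<omega>)) \<longleftrightarrow> integrable M (\<lambda>\<omega>. f (norm_block_max a b X q 1 \<omega>))"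
    and "expectation (\<lambda>\<omega>. f (norm_block_max a b X q (Suc s) \<omega>)) = expectation (\<lambda>\<omega>. f (norm_block_max a b X q 1 \<omega>))"
proof -
  have "integrable M (\<lambda>\<omega>. f (norm_block_max a b X q s \<omega>)) \<longleftrightarrow> integrable (distr M borel (norm_block_max a b X q s)) f"
    "expectation (\<lambda>\<omega>. f (norm_block_max a b X q s \<omega>)) = (\<integral>x. f x \<partial>distr M borel (norm_block_max a b X q s))" for s
    by (auto simp: integrable_distr_eq integral_distr)
  then show "integrable M (\<lambda>\<omega>. f (norm_block_max a b X q (Suc s) \<omega>)) \<longleftrightarrow> integrable M (\<lambda>\<omega>. f (norm_block_max a b X q 1 \<omega>))"
    "expectation (\<lambda>\<omega>. f (norm_block_max a b X q (Suc s) \<omega>)) = expectation (\<lambda>\<omega>. f (norm_block_max a b X q 1 \<omega>))"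
    using distr_norm_block_max[OF assms(1), of s] by simp_all
qed

lemma block_avg_measurable:
  assumes [measurable]: "h \<in> borel_measurable borel"
  shows "block_avg a b X q k h i \<in> borel_measurable M"
  unfolding block_avg_def[abs_def] by measurable

lemma block_dev_measurable:
  assumes "h \<in> borel_measurable borel"
  shows "(\<lambda>\<omega>. block_dev a b X q k m h \<omega> i) \<in> borel_measurable M"
  unfolding block_dev_def using block_avg_measurable[OF assms, measurable] by measurable

lemma mean_square_measurable:
  assumes "h \<in> borel_measurable borel"
  shows "(\<lambda>\<omega>. mean_square m (block_dev a b X q k m h \<omega>)) \<in> borel_measurable M"
  unfolding mean_square_def using block_dev_measurable[OF assms, measurable] by measurable

lemma lyapunov_ratio_measurable:
  assumes "h \<in> borel_measurable borel"
  shows "(\<lambda>\<omega>. lyapunov_ratio p m (block_dev a b X q k m h \<omega>)) \<in> borel_measurable M"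
  unfolding lyapunov_ratio_def using block_dev_measurable[OF assms, measurable] by measurable

lemma mean_square_nonneg: "0 \<le> mean_square m c"
  by (simp add: mean_square_def sum_nonneg)

text \<open>The bound involves neither the number of blocks nor the dependence between them. Applied
  to \<open>h\<close> minus and plus a step function, it carries an approximation in mean square
  over to the empirical variance.\<close>

lemma expectation_mean_square_le:
  assumes q: "q > 0" and k: "k > 0" and m: "m > 0" and f [measurable]: "f \<in> borel_measurable borel"
    and int: "integrable M (\<lambda>\<omega>. (f (norm_block_max a b X q 1 \<omega>))\<^sup>2)"
  shows "integrable M (\<lambda>\<omega>. mean_square m (block_dev a b X q k m f \<omega>))"
    and "expectation (\<lambda>\<omega>. mean_square m (block_dev a b X q k m f \<omega>)) \<le> real k * expectation (\<lambda>\<omega>. (f (norm_block_max a b X q 1 \<omega>))\<^sup>2)"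
proof -
  let ?F = "\<lambda>i s \<omega>. (f (norm_block_max a b X q (Suc (i * (k * q) + s)) \<omega>))\<^sup>2"
  have F: "integrable M (?F i s)" "expectation (?F i s) = expectation (\<lambda>\<omega>. (f (norm_block_max a b X q 1 \<omega>))\<^sup>2)" for i s
    using norm_block_max_integral[OF q, of "\<lambda>x. (f x)\<^sup>2"] int by simp_all
  have N: "k * q > 0" using k q by simp
  note E = expectation_double_avg[where F = ?F, OF F m N]
  have i: "integrable M (\<lambda>\<omega>. real k * ((\<Sum>i<m. (\<Sum>s<k * q. ?F i s \<omega>) / real (k * q)) / real m))"
    by (intro integrable_mult_right E)
  have "norm (mean_square m (block_dev a b X q k m f \<omega>)) \<le> norm (real k * ((\<Sum>i<m. (\<Sum>s<k * q. ?F i s \<omega>) / real (k * q)) / real m))" for \<omega>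
    unfolding real_norm_def
    by (rule abs_mono_nonneg[OF mean_square_nonneg mean_square_block_dev_le[OF m]])
  then show int: "integrable M (\<lambda>\<omega>. mean_square m (block_dev a b X q k m f \<omega>))"
    by (intro Bochner_Integration.integrable_bound[OF i mean_square_measurable[OF f]]) auto
  have "expectation (\<lambda>\<omega>. mean_square m (block_dev a b X q k m f \<omega>)) \<le> expectation (\<lambda>\<omega>. real k * ((\<Sum>i<m. (\<Sum>s<k * q. ?F i s \<omega>) / real (k * q)) / real m))"
    by (intro integral_mono int i mean_square_block_dev_le m)
  also have "\<dots> = real k * expectation (\<lambda>\<omega>. (f (norm_block_max a b X q 1 \<omega>))\<^sup>2)"
    by (simp only: integral_mult_right_zero E(2))
  finally show "expectation (\<lambda>\<omega>. mean_square m (block_dev a b X q k m f \<omega>)) \<le> real k * expectation (\<lambda>\<omega>. (f (norm_block_max a b X q 1 \<omega>))\<^sup>2)" .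
qed

lemma expectation_lyapunov_ratio_le:
  assumes q: "q > 0" and k: "k > 0" and m: "m > 0" and h [measurable]: "h \<in> borel_measurable borel" and p: "p \<ge> 1"
    and int: "integrable M (\<lambda>\<omega>. \<bar>h (norm_block_max a b X q 1 \<omega>)\<bar> powr p)"
  shows "integrable M (\<lambda>\<omega>. lyapunov_ratio p m (block_dev a b X q k m h \<omega>))"
    and "expectation (\<lambda>\<omega>. lyapunov_ratio p m (block_dev a b X q k m h \<omega>)) \<le>
      real m powr (1 - p / 2) * (real k powr (p / 2) * (2 powr p * 2) * expectation (\<lambda>\<omega>. \<bar>h (norm_block_max a b X q 1 \<omega>)\<bar> powr p))"
proof -
  let ?F = "\<lambda>i s \<omega>. \<bar>h (norm_block_max a b X q (Suc (i * (k * q) + s)) \<omega>)\<bar> powr p"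
  have F: "integrable M (?F i s)" "expectation (?F i s) = expectation (\<lambda>\<omega>. \<bar>h (norm_block_max a b X q 1 \<omega>)\<bar> powr p)" for i s
    using norm_block_max_integral[OF q, of "\<lambda>x. \<bar>h x\<bar> powr p"] int by simp_all
  have N: "k * q > 0" using k q by simp
  note E = expectation_double_avg[where F = ?F, OF F m N]
  let ?U = "\<lambda>\<omega>. real m powr (1 - p / 2) * (real k powr (p / 2) * (2 powr p * 2) * ((\<Sum>i<m. (\<Sum>s<k * q. ?F i s \<omega>) / real (k * q)) / real m))"
  have i: "integrable M ?U" by (intro integrable_mult_right E)
  have L: "lyapunov_ratio p m (block_dev a b X q k m h \<omega>) \<le> ?U \<omega>" for \<omega>
    by (rule lyapunov_ratio_block_dev_le[OF p m])
  moreover have "0 \<le> lyapunov_ratio p m (block_dev a b X q k m h \<omega>)" for \<omega>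
    by (simp add: lyapunov_ratio_def sum_nonneg)
  ultimately have "norm (lyapunov_ratio p m (block_dev a b X q k m h \<omega>)) \<le> norm (?U \<omega>)" for \<omega>
    unfolding real_norm_def by (intro abs_mono_nonneg)
  then show int: "integrable M (\<lambda>\<omega>. lyapunov_ratio p m (block_dev a b X q k m h \<omega>))"
    by (intro Bochner_Integration.integrable_bound[OF i lyapunov_ratio_measurable[OF h]] AE_I2)
  have "expectation (\<lambda>\<omega>. lyapunov_ratio p m (block_dev a b X q k m h \<omega>)) \<le> expectation ?U"
    by (intro integral_mono int i L)
  also have "\<dots> = real m powr (1 - p / 2) * (real k powr (p / 2) * (2 powr p * 2) * expectation (\<lambda>\<omega>. \<bar>h (norm_block_max a b X q 1 \<omega>)\<bar> powr p))"
    by (simp only: integral_mult_right_zero E(2))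
  finally show "expectation (\<lambda>\<omega>. lyapunov_ratio p m (block_dev a b X q k m h \<omega>)) \<le>
      real m powr (1 - p / 2) * (real k powr (p / 2) * (2 powr p * 2) * expectation (\<lambda>\<omega>. \<bar>h (norm_block_max a b X q 1 \<omega>)\<bar> powr p))" .
qed

end

subsection \<open>Convergence of the conditional variance\<close>

lemma emeasure_eq_0_of_AE:
  assumes "AE x in N. P x" "space N = UNIV"
  shows "emeasure N {x. \<not> P x} = 0"
proof -
  obtain S where S: "S \<in> null_sets N" "{x \<in> space N. \<not> P x} \<subseteq> S" using assms(1) by (auto simp: eventually_ae_filter)
  then have "emeasure N {x. \<not> P x} \<le> emeasure N S" using assms(2) by (intro emeasure_mono) auto
  then show ?thesis using S(1) by auto
qed

text \<open>Where the square exceeds \<open>C\<close>, the factor \<open>|u|\<close> to the power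
  \<open>p - 2\<close> is at least \<open>C powr (p / 2 - 1)\<close>.\<close>

lemma square_le_truncation:
  fixes u :: real
  assumes C: "C > 0" and p: "p > 2"
  shows "u\<^sup>2 \<le> min (u\<^sup>2) C + C powr (1 - p / 2) * \<bar>u\<bar> powr p"
proof (cases "u\<^sup>2 \<le> C")
  case True
  then show ?thesis by simp
next
  case False
  then have u: "u \<noteq> 0" using C by auto
  have "\<bar>u\<bar> powr p = (u\<^sup>2) powr (p / 2)"
    using u powr_powr[of "\<bar>u\<bar>" 2 "p / 2"] by simp
  also have "\<dots> = u\<^sup>2 * (u\<^sup>2) powr (p / 2 - 1)"
    using u by (simp add: powr_diff)
  also have "\<dots> \<ge> u\<^sup>2 * C powr (p / 2 - 1)"
    using False C p by (intro mult_left_mono powr_mono2) auto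
  finally have "C powr (1 - p / 2) * (u\<^sup>2 * C powr (p / 2 - 1)) \<le> C powr (1 - p / 2) * \<bar>u\<bar> powr p"
    by (intro mult_left_mono) auto
  moreover have "C powr (1 - p / 2) * C powr (p / 2 - 1) = 1"
    using C by (simp add: powr_add[symmetric])
  ultimately have "u\<^sup>2 \<le> C powr (1 - p / 2) * \<bar>u\<bar> powr p"
    by (metis mult.assoc mult.commute mult.right_neutral)
  moreover have "0 \<le> min (u\<^sup>2) C" using C by simp
  ultimately show ?thesis by linarith
qed

lemma square_le_1_add_powr:
  fixes u :: real
  assumes "p \<ge> 2"
  shows "u\<^sup>2 \<le> 1 + \<bar>u\<bar> powr p"
proof (cases "\<bar>u\<bar> \<le> 1")
  case True
  then have "u\<^sup>2 \<le> 1" by (simp add: abs_square_le_1)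
  then show ?thesis by (simp add: add_increasing2)
next
  case False
  then have "u\<^sup>2 = \<bar>u\<bar> powr 2" by simp
  also have "\<dots> \<le> \<bar>u\<bar> powr p" using False assms by (intro powr_mono) auto
  finally show ?thesis by simp
qed

lemma step_fun_bound: "\<bar>step_fun J c y x\<bar> \<le> (\<Sum>j\<in>J. \<bar>c j\<bar>)"
  unfolding step_fun_def by (rule order_trans[OF sum_abs sum_mono]) (auto simp: indicator_def)

context block_scheme
begin

abbreviation Zn :: "nat \<Rightarrow> 'a \<Rightarrow> real" where
  "Zn n \<equiv> norm_block_max a b X (r n) 1"

lemma weak_conv_r: "weak_conv_m (\<lambda>n. distr M borel (Zn n)) (gev_measure \<gamma>)"
proof -
  have "weak_conv_m (\<lambda>r. distr M borel (norm_block_max a b X r 1)) (gev_measure \<gamma>)"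
    using mda by (simp add: MDA_def)
  then show ?thesis
    unfolding weak_conv_m_def weak_conv_def by (auto intro: filterlim_compose[OF _ r_lim])
qed

definition moment_bound :: "(real \<Rightarrow> real) \<Rightarrow> real \<Rightarrow> bool" where
  "moment_bound f p \<longleftrightarrow> (\<exists>K. \<forall>\<^sub>F n in sequentially.
     integrable M (\<lambda>\<omega>. \<bar>f (Zn n \<omega>)\<bar> powr p) \<and> expectation (\<lambda>\<omega>. \<bar>f (Zn n \<omega>)\<bar> powr p) \<le> K)"

text \<open>The truncations of the squared function are bounded and almost everywhere continuous, so
  weak convergence passes to them. The moment of order above 2 makes the truncated remainder
  uniformly small, and monotone convergence gives integrability under the limit.\<close>

lemma second_moment:
  assumes f [measurable]: "f \<in> borel_measurable borel" and cont: "AE x in lborel. isCont f x"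
    and p: "p > 2" and mom: "moment_bound f p"
  shows "integrable (gev_measure \<gamma>) (\<lambda>x. (f x)\<^sup>2)"
    and "\<And>\<epsilon>. \<epsilon> > 0 \<Longrightarrow> \<forall>\<^sub>F n in sequentially. integrable M (\<lambda>\<omega>. (f (Zn n \<omega>))\<^sup>2) \<and>
      expectation (\<lambda>\<omega>. (f (Zn n \<omega>))\<^sup>2) \<le> (\<integral>x. (f x)\<^sup>2 \<partial>gev_measure \<gamma>) + \<epsilon>"
proof -
  interpret G: real_distribution "gev_measure \<gamma>" by (rule real_distribution_gev)
  obtain K where K: "\<forall>\<^sub>F n in sequentially. integrable M (\<lambda>\<omega>. \<bar>f (Zn n \<omega>)\<bar> powr p) \<and> expectation (\<lambda>\<omega>. \<bar>f (Zn n \<omega>)\<bar> powr p) \<le> K"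
    using mom unfolding moment_bound_def by blast
  define F where "F C x = min ((f x)\<^sup>2) C" for C x
  have Fm [measurable]: "F C \<in> borel_measurable borel" for C unfolding F_def[abs_def] by measurable
  have Fb: "\<bar>F C x\<bar> \<le> C" if "C \<ge> 0" for C x using that by (auto simp: F_def)
  have FM: "integrable M (\<lambda>\<omega>. F C (Zn n \<omega>))" if "C \<ge> 0" for C n
    by (rule integrable_const_bound[where B = C]) (use Fb[OF that] in auto)
  have FG: "integrable (gev_measure \<gamma>) (F C)" if "C \<ge> 0" for C
    by (rule G.integrable_const_bound[where B = C]) (use Fb[OF that] in auto)
  have lim: "(\<lambda>n. expectation (\<lambda>\<omega>. F C (Zn n \<omega>))) \<longlonglongrightarrow> (\<integral>x. F C x \<partial>gev_measure \<gamma>)" if C: "C \<ge> 0" for C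
  proof -
    have "AE x in gev_measure \<gamma>. isCont (F C) x"
      using AE_gev_of_AE_lborel[OF cont, of \<gamma>]
      by eventually_elim (auto simp: F_def[abs_def] intro!: continuous_min continuous_intros)
    then have "emeasure (gev_measure \<gamma>) {x. \<not> isCont (F C) x} = 0" by (rule emeasure_eq_0_of_AE) simp
    then have "(\<lambda>n. integral\<^sup>L (distr M borel (Zn n)) (F C)) \<longlonglongrightarrow> integral\<^sup>L (gev_measure \<gamma>) (F C)"
      by (intro weak_conv_imp_bdd_ae_continuous_conv[where B = C] weak_conv_r real_distribution_gev)
        (use Fb[OF C] in auto)
    then show ?thesis by (simp add: integral_distr)
  qed
  have i2: "\<forall>\<^sub>F n in sequentially. integrable M (\<lambda>\<omega>. (f (Zn n \<omega>))\<^sup>2) \<and> expectation (\<lambda>\<omega>. (f (Zn n \<omega>))\<^sup>2) \<le> 1 + K"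
    using K
  proof eventually_elim
    fix n assume n: "integrable M (\<lambda>\<omega>. \<bar>f (Zn n \<omega>)\<bar> powr p) \<and> expectation (\<lambda>\<omega>. \<bar>f (Zn n \<omega>)\<bar> powr p) \<le> K"
    have i: "integrable M (\<lambda>\<omega>. 1 + \<bar>f (Zn n \<omega>)\<bar> powr p)" using n by auto
    have le: "(f (Zn n \<omega>))\<^sup>2 \<le> 1 + \<bar>f (Zn n \<omega>)\<bar> powr p" for \<omega> using p by (intro square_le_1_add_powr) auto
    have int: "integrable M (\<lambda>\<omega>. (f (Zn n \<omega>))\<^sup>2)"
      by (rule Bochner_Integration.integrable_bound[OF i]) (use le in \<open>auto intro!: AE_I2\<close>)
    have "expectation (\<lambda>\<omega>. (f (Zn n \<omega>))\<^sup>2) \<le> expectation (\<lambda>\<omega>. 1 + \<bar>f (Zn n \<omega>)\<bar> powr p)"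
      by (intro integral_mono int i le)
    also have "\<dots> = 1 + expectation (\<lambda>\<omega>. \<bar>f (Zn n \<omega>)\<bar> powr p)" using n by (simp add: prob_space)
    finally show "integrable M (\<lambda>\<omega>. (f (Zn n \<omega>))\<^sup>2) \<and> expectation (\<lambda>\<omega>. (f (Zn n \<omega>))\<^sup>2) \<le> 1 + K"
      using int n by linarith
  qed
  have FGK: "(\<integral>x. F C x \<partial>gev_measure \<gamma>) \<le> 1 + K" if C: "C \<ge> 0" for C
  proof (rule tendsto_upperbound[OF lim[OF C]])
    show "\<forall>\<^sub>F n in sequentially. expectation (\<lambda>\<omega>. F C (Zn n \<omega>)) \<le> 1 + K"
      using i2
    proof eventually_elim
      fix n assume n: "integrable M (\<lambda>\<omega>. (f (Zn n \<omega>))\<^sup>2) \<and> expectation (\<lambda>\<omega>. (f (Zn n \<omega>))\<^sup>2) \<le> 1 + K"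
      have "expectation (\<lambda>\<omega>. F C (Zn n \<omega>)) \<le> expectation (\<lambda>\<omega>. (f (Zn n \<omega>))\<^sup>2)"
        by (intro integral_mono FM C) (use n in \<open>auto simp: F_def\<close>)
      then show "expectation (\<lambda>\<omega>. F C (Zn n \<omega>)) \<le> 1 + K" using n by linarith
    qed
  qed simp
  show int: "integrable (gev_measure \<gamma>) (\<lambda>x. (f x)\<^sup>2)"
  proof -
    have mono: "incseq (\<lambda>i. \<integral>x. F (real i) x \<partial>gev_measure \<gamma>)"
      by (intro incseq_SucI integral_mono FG) (auto simp: F_def)
    obtain L where L: "(\<lambda>i. \<integral>x. F (real i) x \<partial>gev_measure \<gamma>) \<longlonglongrightarrow> L"
      by (rule incseq_convergent[OF mono, of "1 + K"]) (use FGK in auto)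
    show ?thesis
    proof (rule integrable_monotone_convergence[OF _ _ _ L])
      show "integrable (gev_measure \<gamma>) (F (real i))" for i by (rule FG) simp
      show "AE x in gev_measure \<gamma>. mono (\<lambda>n. F (real n) x)" by (auto simp: mono_def F_def)
      show "AE x in gev_measure \<gamma>. (\<lambda>i. F (real i) x) \<longlonglongrightarrow> (f x)\<^sup>2"
      proof (intro AE_I2 tendsto_eventually eventually_sequentiallyI)
        fix x n assume "nat \<lceil>(f x)\<^sup>2\<rceil> \<le> n"
        then have "(f x)\<^sup>2 \<le> real n" by linarith
        then show "F (real n) x = (f x)\<^sup>2" by (simp add: F_def)
      qed
    qed simp
  qed
  fix \<epsilon> :: real assume \<epsilon>: "\<epsilon> > 0"
  \<comment> \<open>The remainder beyond level \<open>C\<close> is at most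
    \<open>C powr (1 - p / 2) * K\<close> for all large \<open>n\<close>; the exponent is negative,
    which permits a choice of \<open>C\<close> independent of \<open>n\<close>.\<close>
  have "((\<lambda>C. C powr (1 - p / 2) * K) \<longlongrightarrow> 0 * K) at_top"
    using p by (intro tendsto_mult tendsto_const tendsto_neg_powr filterlim_ident) auto
  then have "\<forall>\<^sub>F C in at_top. C powr (1 - p / 2) * K < \<epsilon> / 2"
    using \<epsilon> by (intro order_tendstoD(2)) auto
  then have "\<forall>\<^sub>F C in at_top. C > 0 \<and> C powr (1 - p / 2) * K < \<epsilon> / 2"
    using eventually_gt_at_top[of 0] by eventually_elim simp
  then obtain C where C: "C > 0" "C powr (1 - p / 2) * K < \<epsilon> / 2"
    using eventually_happens'[OF trivial_limit_at_top_linorder] by blast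
  have FGle: "(\<integral>x. F C x \<partial>gev_measure \<gamma>) \<le> (\<integral>x. (f x)\<^sup>2 \<partial>gev_measure \<gamma>)"
    using C by (intro integral_mono FG int) (auto simp: F_def)
  have "\<forall>\<^sub>F n in sequentially. expectation (\<lambda>\<omega>. F C (Zn n \<omega>)) < (\<integral>x. F C x \<partial>gev_measure \<gamma>) + \<epsilon> / 2"
    using C \<epsilon> by (intro order_tendstoD(2)[OF lim]) auto
  then show "\<forall>\<^sub>F n in sequentially. integrable M (\<lambda>\<omega>. (f (Zn n \<omega>))\<^sup>2) \<and>
      expectation (\<lambda>\<omega>. (f (Zn n \<omega>))\<^sup>2) \<le> (\<integral>x. (f x)\<^sup>2 \<partial>gev_measure \<gamma>) + \<epsilon>"
    using i2 K
  proof eventually_elim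
    fix n assume n: "expectation (\<lambda>\<omega>. F C (Zn n \<omega>)) < (\<integral>x. F C x \<partial>gev_measure \<gamma>) + \<epsilon> / 2"
      "integrable M (\<lambda>\<omega>. (f (Zn n \<omega>))\<^sup>2) \<and> expectation (\<lambda>\<omega>. (f (Zn n \<omega>))\<^sup>2) \<le> 1 + K"
      "integrable M (\<lambda>\<omega>. \<bar>f (Zn n \<omega>)\<bar> powr p) \<and> expectation (\<lambda>\<omega>. \<bar>f (Zn n \<omega>)\<bar> powr p) \<le> K"
    have iF: "integrable M (\<lambda>\<omega>. F C (Zn n \<omega>))" using C by (intro FM) auto
    have "expectation (\<lambda>\<omega>. (f (Zn n \<omega>))\<^sup>2) \<le> expectation (\<lambda>\<omega>. F C (Zn n \<omega>) + C powr (1 - p / 2) * \<bar>f (Zn n \<omega>)\<bar> powr p)"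
      by (intro integral_mono) (use n iF square_le_truncation[OF C(1) p] in \<open>auto simp: F_def\<close>)
    also have "\<dots> = expectation (\<lambda>\<omega>. F C (Zn n \<omega>)) + C powr (1 - p / 2) * expectation (\<lambda>\<omega>. \<bar>f (Zn n \<omega>)\<bar> powr p)"
      using n iF by simp
    also have "C powr (1 - p / 2) * expectation (\<lambda>\<omega>. \<bar>f (Zn n \<omega>)\<bar> powr p) \<le> C powr (1 - p / 2) * K"
      using n by (intro mult_left_mono) auto
    finally show "integrable M (\<lambda>\<omega>. (f (Zn n \<omega>))\<^sup>2) \<and>
      expectation (\<lambda>\<omega>. (f (Zn n \<omega>))\<^sup>2) \<le> (\<integral>x. (f x)\<^sup>2 \<partial>gev_measure \<gamma>) + \<epsilon>"
      using n C FGle by linarith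
  qed
qed

text \<open>It brings \<open>h\<close> plus or minus a step function back under the hypotheses that
  \<open>h\<close> satisfies.\<close>

lemma moment_bound_add_bounded:
  assumes f [measurable]: "f \<in> borel_measurable borel" and g [measurable]: "g \<in> borel_measurable borel"
    and p: "p > 0" and mom: "moment_bound f p" and B: "\<And>x. \<bar>g x\<bar> \<le> B"
  shows "moment_bound (\<lambda>x. f x + g x) p"
proof -
  obtain K where K: "\<forall>\<^sub>F n in sequentially. integrable M (\<lambda>\<omega>. \<bar>f (Zn n \<omega>)\<bar> powr p) \<and> expectation (\<lambda>\<omega>. \<bar>f (Zn n \<omega>)\<bar> powr p) \<le> K"
    using mom unfolding moment_bound_def by blast
  have le: "\<bar>f x + g x\<bar> powr p \<le> 2 powr p * (\<bar>f x\<bar> powr p + B powr p)" for x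
  proof -
    have "\<bar>f x + g x\<bar> powr p \<le> 2 powr p * (\<bar>f x\<bar> powr p + \<bar>g x\<bar> powr p)" by (rule abs_add_powr_le[OF p])
    also have "\<dots> \<le> 2 powr p * (\<bar>f x\<bar> powr p + B powr p)" using p B by (intro mult_left_mono add_left_mono powr_mono2) auto
    finally show ?thesis .
  qed
  have "\<forall>\<^sub>F n in sequentially. integrable M (\<lambda>\<omega>. \<bar>f (Zn n \<omega>) + g (Zn n \<omega>)\<bar> powr p) \<and>
     expectation (\<lambda>\<omega>. \<bar>f (Zn n \<omega>) + g (Zn n \<omega>)\<bar> powr p) \<le> 2 powr p * (K + B powr p)"
    using K
  proof eventually_elim
    fix n assume n: "integrable M (\<lambda>\<omega>. \<bar>f (Zn n \<omega>)\<bar> powr p) \<and> expectation (\<lambda>\<omega>. \<bar>f (Zn n \<omega>)\<bar> powr p) \<le> K"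
    have i: "integrable M (\<lambda>\<omega>. 2 powr p * (\<bar>f (Zn n \<omega>)\<bar> powr p + B powr p))" using n by auto
    have int: "integrable M (\<lambda>\<omega>. \<bar>f (Zn n \<omega>) + g (Zn n \<omega>)\<bar> powr p)"
      by (rule Bochner_Integration.integrable_bound[OF i]) (use le in \<open>auto intro!: AE_I2\<close>)
    have "expectation (\<lambda>\<omega>. \<bar>f (Zn n \<omega>) + g (Zn n \<omega>)\<bar> powr p) \<le> expectation (\<lambda>\<omega>. 2 powr p * (\<bar>f (Zn n \<omega>)\<bar> powr p + B powr p))"
      by (intro integral_mono int i le)
    also have "\<dots> = 2 powr p * (expectation (\<lambda>\<omega>. \<bar>f (Zn n \<omega>)\<bar> powr p) + B powr p)" using n by (simp add: prob_space)
    also have "\<dots> \<le> 2 powr p * (K + B powr p)" using n by (intro mult_left_mono) auto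
    finally show "integrable M (\<lambda>\<omega>. \<bar>f (Zn n \<omega>) + g (Zn n \<omega>)\<bar> powr p) \<and>
     expectation (\<lambda>\<omega>. \<bar>f (Zn n \<omega>) + g (Zn n \<omega>)\<bar> powr p) \<le> 2 powr p * (K + B powr p)" using int by simp
  qed
  then show ?thesis unfolding moment_bound_def by blast
qed

lemma step_fun_isCont_AE: "finite J \<Longrightarrow> AE x in lborel. isCont (step_fun J c y) x"
proof -
  assume J: "finite J"
  have "AE x in lborel. \<forall>j\<in>J. x \<noteq> y j"
    by (intro AE_finite_allI J) (rule AE_lborel_singleton)
  then show ?thesis
  proof eventually_elim
    fix x assume x: "\<forall>j\<in>J. x \<noteq> y j"
    have "isCont (indicat_real {..y j}) x" if "j \<in> J" for j
      using x that by (subst isCont_indicator) auto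
    then show "isCont (step_fun J c y) x" unfolding step_fun_def[abs_def] by (intro continuous_intros) auto
  qed
qed

context
  fixes k :: nat and m :: "nat \<Rightarrow> nat" and h :: "real \<Rightarrow> real" and p :: real
  assumes k: "k > 0" and m: "filterlim m at_top sequentially"
    and h [measurable]: "h \<in> borel_measurable borel" and cont: "AE x in lborel. isCont h x"
    and p: "p > 2" and mom: "moment_bound h p"
begin

text \<open>The candidate limit \<open>V\<close> is kept abstract and known only through its
  distance to the limits for step functions. This separates the analysis of the data from that of
  the bivariate laws, which enter when \<open>V\<close> is chosen.\<close>

lemma mean_square_tendsto:
  assumes V: "C \<ge> 0" "\<And>(J :: (int \<times> bool) set) c y \<theta>. finite J \<Longrightarrow> \<theta> > 0 \<Longrightarrow>
    \<bar>V - step_var k J c y\<bar> \<le> C * (\<theta> * (\<integral>x. (h x - step_fun J c y x)\<^sup>2 \<partial>gev_measure \<gamma>) + (\<integral>x. (h x + step_fun J c y x)\<^sup>2 \<partial>gev_measure \<gamma>) / \<theta>)"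
  shows "(\<lambda>n. expectation (\<lambda>\<omega>. \<bar>mean_square (m n) (block_dev a b X (r n) k (m n) h \<omega>) - V\<bar>)) \<longlonglongrightarrow> 0"
proof (rule LIMSEQ_I)
  fix \<epsilon> :: real assume \<epsilon>: "\<epsilon> > 0"
  let ?G = "gev_measure \<gamma>"
  let ?ms = "\<lambda>n f \<omega>. mean_square (m n) (block_dev a b X (r n) k (m n) f \<omega>)"
  \<comment> \<open>The errors are at most \<open>k * e\<close> for replacing \<open>h\<close> by a
    step function, \<open>e\<close> for the convergence at that step function, and
    \<open>C * e\<close> for replacing \<open>V\<close>.\<close>
  define e where "e = \<epsilon> / (C + real k + 2)"
  have e: "e > 0" using \<epsilon> V(1) by (simp add: e_def)
  obtain J :: "(int \<times> bool) set" and c y \<theta> where J: "finite J" and \<theta>: "\<theta> > 0" and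
    A: "\<theta> * (\<integral>x. (h x - step_fun J c y x)\<^sup>2 \<partial>?G) + (\<integral>x. (h x + step_fun J c y x)\<^sup>2 \<partial>?G) / \<theta> < e"
    using step_fun_approx[OF real_distribution_gev h AE_gev_of_AE_lborel[OF cont] second_moment(1)[OF h cont p mom] e] by blast
  let ?g = "step_fun J c y"
  let ?I1 = "\<integral>x. (h x - ?g x)\<^sup>2 \<partial>?G" and ?I2 = "\<integral>x. (h x + ?g x)\<^sup>2 \<partial>?G"
  \<comment> \<open>The slack in the two second moments, weighted as in the comparison inequality,
    adds up to exactly \<open>e\<close>.\<close>
  define \<delta> where "\<delta> = e / (\<theta> + 1 / \<theta>)"
  have \<delta>: "\<delta> > 0" using e \<theta> by (simp add: \<delta>_def add_pos_pos)
  have \<delta>e: "\<theta> * \<delta> + \<delta> / \<theta> = e"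
  proof -
    have "\<theta> * \<delta> + \<delta> / \<theta> = (\<theta> + 1 / \<theta>) * \<delta>" by (simp add: algebra_simps)
    also have "\<dots> = e" using \<theta> by (simp add: \<delta>_def add_pos_pos less_imp_neq[symmetric])
    finally show ?thesis .
  qed
  have contg: "AE x in lborel. isCont ?g x" by (rule step_fun_isCont_AE[OF J])
  have cont1: "AE x in lborel. isCont (\<lambda>x. h x - ?g x) x"
    using cont contg by eventually_elim (intro continuous_intros; assumption)
  have cont2: "AE x in lborel. isCont (\<lambda>x. h x + ?g x) x"
    using cont contg by eventually_elim (intro continuous_intros; assumption)
  have mom2: "moment_bound (\<lambda>x. h x + ?g x) p"
    by (rule moment_bound_add_bounded[OF h _ _ mom step_fun_bound]) (use p in auto)
  have "moment_bound (\<lambda>x. h x + (- ?g x)) p"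
    by (rule moment_bound_add_bounded[OF h _ _ mom, where B = "\<Sum>j\<in>J. \<bar>c j\<bar>"]) (use p step_fun_bound in auto)
  then have mom1: "moment_bound (\<lambda>x. h x - ?g x) p" by simp
  have ev1: "\<forall>\<^sub>F n in sequentially. integrable M (\<lambda>\<omega>. (h (Zn n \<omega>) - ?g (Zn n \<omega>))\<^sup>2) \<and> expectation (\<lambda>\<omega>. (h (Zn n \<omega>) - ?g (Zn n \<omega>))\<^sup>2) \<le> ?I1 + \<delta>"
    by (rule second_moment(2)[OF _ cont1 p mom1 \<delta>]) measurable
  have ev2: "\<forall>\<^sub>F n in sequentially. integrable M (\<lambda>\<omega>. (h (Zn n \<omega>) + ?g (Zn n \<omega>))\<^sup>2) \<and> expectation (\<lambda>\<omega>. (h (Zn n \<omega>) + ?g (Zn n \<omega>))\<^sup>2) \<le> ?I2 + \<delta>"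
    by (rule second_moment(2)[OF _ cont2 p mom2 \<delta>]) measurable
  have evh: "\<forall>\<^sub>F n in sequentially. integrable M (\<lambda>\<omega>. (h (Zn n \<omega>))\<^sup>2)"
    using second_moment(2)[OF h cont p mom zero_less_one] by eventually_elim simp
  have evs: "\<forall>\<^sub>F n in sequentially. expectation (\<lambda>\<omega>. \<bar>?ms n ?g \<omega> - step_var k J c y\<bar>) < e"
    by (rule order_tendstoD(2)[OF mean_square_step_fun_tendsto[OF k m J] e])
  have "\<forall>\<^sub>F n in sequentially. norm (expectation (\<lambda>\<omega>. \<bar>?ms n h \<omega> - V\<bar>) - 0) < \<epsilon>"
    using ev1 ev2 evh evs ev_sizes[OF k m]
  proof eventually_elim
    fix n
    assume H1: "integrable M (\<lambda>\<omega>. (h (Zn n \<omega>) - ?g (Zn n \<omega>))\<^sup>2) \<and> expectation (\<lambda>\<omega>. (h (Zn n \<omega>) - ?g (Zn n \<omega>))\<^sup>2) \<le> ?I1 + \<delta>"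
      and H2: "integrable M (\<lambda>\<omega>. (h (Zn n \<omega>) + ?g (Zn n \<omega>))\<^sup>2) \<and> expectation (\<lambda>\<omega>. (h (Zn n \<omega>) + ?g (Zn n \<omega>))\<^sup>2) \<le> ?I2 + \<delta>"
      and Hh: "integrable M (\<lambda>\<omega>. (h (Zn n \<omega>))\<^sup>2)"
      and Hs: "expectation (\<lambda>\<omega>. \<bar>?ms n ?g \<omega> - step_var k J c y\<bar>) < e"
      and sz: "m n > 0 \<and> r n > 0 \<and> r n \<le> k * r n \<and> l n \<le> k * r n"
    have sz': "r n > 0" "k > 0" "m n > 0" using sz k by auto
    have m1: "(\<lambda>x. h x - ?g x) \<in> borel_measurable borel" and m2: "(\<lambda>x. h x + ?g x) \<in> borel_measurable borel" by measurable
    note E1 = expectation_mean_square_le[OF sz' m1 conjunct1[OF H1]]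
    note E2 = expectation_mean_square_le[OF sz' m2 conjunct1[OF H2]]
    note Eh = expectation_mean_square_le[OF sz' h Hh]
    have Hg: "integrable M (\<lambda>\<omega>. (?g (Zn n \<omega>))\<^sup>2)"
    proof (rule integrable_const_bound[where B = "(\<Sum>j\<in>J. \<bar>c j\<bar>)\<^sup>2"])
      show "AE \<omega> in M. norm ((?g (Zn n \<omega>))\<^sup>2) \<le> (\<Sum>j\<in>J. \<bar>c j\<bar>)\<^sup>2"
        using power_mono[OF step_fun_bound, of J c y _ 2] by auto
    qed measurable
    note Eg = expectation_mean_square_le[OF sz' step_fun_measurable Hg]
    let ?R = "\<lambda>\<omega>. (\<theta> * ?ms n (\<lambda>x. h x - ?g x) \<omega> + ?ms n (\<lambda>x. h x + ?g x) \<omega> / \<theta>) / 2"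
    have iR: "integrable M ?R" using E1(1) E2(1) by auto
    have R: "\<bar>?ms n h \<omega> - ?ms n ?g \<omega>\<bar> \<le> ?R \<omega>" for \<omega>
      using mean_square_diff_le[OF \<theta>, of "m n" "block_dev a b X (r n) k (m n) h \<omega>" "block_dev a b X (r n) k (m n) ?g \<omega>"]
      unfolding block_dev_diff[symmetric] block_dev_add[symmetric] .
    have ER: "expectation ?R \<le> real k * e"
    proof -
      have "expectation ?R = (\<theta> * expectation (?ms n (\<lambda>x. h x - ?g x)) + expectation (?ms n (\<lambda>x. h x + ?g x)) / \<theta>) / 2"
        using E1(1) E2(1) by simp
      also have "\<dots> \<le> (\<theta> * (real k * (?I1 + \<delta>)) + (real k * (?I2 + \<delta>)) / \<theta>) / 2"
      proof (intro divide_right_mono add_mono mult_left_mono)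
        have "expectation (?ms n (\<lambda>x. h x - ?g x)) \<le> real k * expectation (\<lambda>\<omega>. (h (Zn n \<omega>) - ?g (Zn n \<omega>))\<^sup>2)" by (rule E1(2))
        also have "\<dots> \<le> real k * (?I1 + \<delta>)" using H1 by (intro mult_left_mono) auto
        finally show "expectation (?ms n (\<lambda>x. h x - ?g x)) \<le> real k * (?I1 + \<delta>)" .
        have "expectation (?ms n (\<lambda>x. h x + ?g x)) \<le> real k * expectation (\<lambda>\<omega>. (h (Zn n \<omega>) + ?g (Zn n \<omega>))\<^sup>2)" by (rule E2(2))
        also have "\<dots> \<le> real k * (?I2 + \<delta>)" using H2 by (intro mult_left_mono) auto
        finally show "expectation (?ms n (\<lambda>x. h x + ?g x)) \<le> real k * (?I2 + \<delta>)" .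
      qed (use \<theta> in auto)
      also have "\<dots> = real k / 2 * ((\<theta> * ?I1 + ?I2 / \<theta>) + (\<theta> * \<delta> + \<delta> / \<theta>))"
        using \<theta> by (simp add: field_simps)
      also have "\<dots> \<le> real k / 2 * (e + e)" using A \<delta>e by (intro mult_left_mono) auto
      finally show ?thesis by simp
    qed
    have ims: "integrable M (\<lambda>\<omega>. \<bar>?ms n ?g \<omega> - step_var k J c y\<bar>)" using Eg(1) by auto
    have "expectation (\<lambda>\<omega>. \<bar>?ms n h \<omega> - V\<bar>) \<le> expectation (\<lambda>\<omega>. ?R \<omega> + \<bar>?ms n ?g \<omega> - step_var k J c y\<bar> + \<bar>step_var k J c y - V\<bar>)"
    proof (rule integral_mono)
      show "integrable M (\<lambda>\<omega>. \<bar>?ms n h \<omega> - V\<bar>)" using Eh(1) by auto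
      show "integrable M (\<lambda>\<omega>. ?R \<omega> + \<bar>?ms n ?g \<omega> - step_var k J c y\<bar> + \<bar>step_var k J c y - V\<bar>)" using iR ims by auto
      show "\<bar>?ms n h \<omega> - V\<bar> \<le> ?R \<omega> + \<bar>?ms n ?g \<omega> - step_var k J c y\<bar> + \<bar>step_var k J c y - V\<bar>" for \<omega>
        using R[of \<omega>] by linarith
    qed
    also have "\<dots> = expectation ?R + expectation (\<lambda>\<omega>. \<bar>?ms n ?g \<omega> - step_var k J c y\<bar>) + \<bar>step_var k J c y - V\<bar>"
      using iR ims by (simp add: prob_space)
    also have "\<bar>step_var k J c y - V\<bar> \<le> C * e"
    proof -
      have "\<bar>V - step_var k J c y\<bar> \<le> C * (\<theta> * ?I1 + ?I2 / \<theta>)" by (rule V(2)[OF J \<theta>])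
      also have "\<dots> \<le> C * e" using A V(1) by (intro mult_left_mono) auto
      finally show ?thesis by (simp add: abs_minus_commute)
    qed
    finally have "expectation (\<lambda>\<omega>. \<bar>?ms n h \<omega> - V\<bar>) < real k * e + e + C * e" using ER Hs by linarith
    also have "\<dots> < (C + real k + 2) * e" using e by (simp add: algebra_simps)
    also have "\<dots> = \<epsilon>" using V(1) by (simp add: e_def)
    finally show "norm (expectation (\<lambda>\<omega>. \<bar>?ms n h \<omega> - V\<bar>) - 0) < \<epsilon>" by simp
  qed
  then show "\<exists>no. \<forall>n\<ge>no. norm (expectation (\<lambda>\<omega>. \<bar>?ms n h \<omega> - V\<bar>) - 0) < \<epsilon>"
    by (simp add: eventually_sequentially)
qed

lemma mean_square_integrable: "\<forall>\<^sub>F n in sequentially. integrable M (\<lambda>\<omega>. mean_square (m n) (block_dev a b X (r n) k (m n) h \<omega>))"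
  using second_moment(2)[OF h cont p mom zero_less_one] ev_sizes[OF k m]
  by eventually_elim (use k in \<open>auto intro!: expectation_mean_square_le(1)\<close>)

lemma lyapunov_ratio_tendsto:
  shows "\<forall>\<^sub>F n in sequentially. integrable M (\<lambda>\<omega>. lyapunov_ratio p (m n) (block_dev a b X (r n) k (m n) h \<omega>))"
    and "(\<lambda>n. expectation (\<lambda>\<omega>. lyapunov_ratio p (m n) (block_dev a b X (r n) k (m n) h \<omega>))) \<longlonglongrightarrow> 0"
proof -
  obtain K where K: "\<forall>\<^sub>F n in sequentially. integrable M (\<lambda>\<omega>. \<bar>h (Zn n \<omega>)\<bar> powr p) \<and> expectation (\<lambda>\<omega>. \<bar>h (Zn n \<omega>)\<bar> powr p) \<le> K"
    using mom unfolding moment_bound_def by blast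
  let ?c = "real k powr (p / 2) * (2 powr p * 2)"
  have ev: "\<forall>\<^sub>F n in sequentially. integrable M (\<lambda>\<omega>. lyapunov_ratio p (m n) (block_dev a b X (r n) k (m n) h \<omega>)) \<and>
    expectation (\<lambda>\<omega>. lyapunov_ratio p (m n) (block_dev a b X (r n) k (m n) h \<omega>)) \<le> real (m n) powr (1 - p / 2) * (?c * K)"
    using K ev_sizes[OF k m]
  proof eventually_elim
    fix n assume H: "integrable M (\<lambda>\<omega>. \<bar>h (Zn n \<omega>)\<bar> powr p) \<and> expectation (\<lambda>\<omega>. \<bar>h (Zn n \<omega>)\<bar> powr p) \<le> K"
      and sz: "m n > 0 \<and> r n > 0 \<and> r n \<le> k * r n \<and> l n \<le> k * r n"
    have sz': "r n > 0" "k > 0" "m n > 0" "p \<ge> 1" using sz k p by auto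
    note E = expectation_lyapunov_ratio_le[OF sz'(1,2,3) h sz'(4) conjunct1[OF H]]
    have "real (m n) powr (1 - p / 2) * (?c * expectation (\<lambda>\<omega>. \<bar>h (Zn n \<omega>)\<bar> powr p)) \<le> real (m n) powr (1 - p / 2) * (?c * K)"
      using H by (intro mult_left_mono) auto
    then show "integrable M (\<lambda>\<omega>. lyapunov_ratio p (m n) (block_dev a b X (r n) k (m n) h \<omega>)) \<and>
      expectation (\<lambda>\<omega>. lyapunov_ratio p (m n) (block_dev a b X (r n) k (m n) h \<omega>)) \<le> real (m n) powr (1 - p / 2) * (?c * K)"
      using E by linarith
  qed
  then show "\<forall>\<^sub>F n in sequentially. integrable M (\<lambda>\<omega>. lyapunov_ratio p (m n) (block_dev a b X (r n) k (m n) h \<omega>))"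
    by eventually_elim simp
  show "(\<lambda>n. expectation (\<lambda>\<omega>. lyapunov_ratio p (m n) (block_dev a b X (r n) k (m n) h \<omega>))) \<longlonglongrightarrow> 0"
  proof (rule tendsto_sandwich[OF _ _ tendsto_const])
    show "\<forall>\<^sub>F n in sequentially. 0 \<le> expectation (\<lambda>\<omega>. lyapunov_ratio p (m n) (block_dev a b X (r n) k (m n) h \<omega>))"
      by (intro always_eventually allI integral_nonneg_AE) (auto simp: lyapunov_ratio_def sum_nonneg)
    show "\<forall>\<^sub>F n in sequentially. expectation (\<lambda>\<omega>. lyapunov_ratio p (m n) (block_dev a b X (r n) k (m n) h \<omega>)) \<le> real (m n) powr (1 - p / 2) * (?c * K)"
      using ev by eventually_elim simp
    have "filterlim (\<lambda>n. real (m n)) at_top sequentially" by (rule filterlim_compose[OF filterlim_real_sequentially m])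
    then have "(\<lambda>n. real (m n) powr (1 - p / 2) * (?c * K)) \<longlonglongrightarrow> 0 * (?c * K)"
      using p by (intro tendsto_mult tendsto_const tendsto_neg_powr) auto
    then show "(\<lambda>n. real (m n) powr (1 - p / 2) * (?c * K)) \<longlonglongrightarrow> 0" by simp
  qed
qed

end

end

section \<open>Covariances under the bivariate limit laws\<close>

lemma pair_integral_le:
  fixes u v :: "'b \<Rightarrow> real"
  assumes [measurable]: "u \<in> borel_measurable N" "v \<in> borel_measurable N"
    and "integrable N (\<lambda>z. (u z)\<^sup>2)" "integrable N (\<lambda>z. (v z)\<^sup>2)" and \<theta>: "\<theta> > 0"
  shows "integrable N (\<lambda>z. u z * v z)"
    and "\<bar>\<integral>z. u z * v z \<partial>N\<bar> \<le> (\<theta> * (\<integral>z. (u z)\<^sup>2 \<partial>N) + (\<integral>z. (v z)\<^sup>2 \<partial>N) / \<theta>) / 2"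
proof -
  have i: "integrable N (\<lambda>z. (\<theta> * (u z)\<^sup>2 + (v z)\<^sup>2 / \<theta>) / 2)" using assms by auto
  have le: "\<bar>u z * v z\<bar> \<le> (\<theta> * (u z)\<^sup>2 + (v z)\<^sup>2 / \<theta>) / 2" for z by (rule abs_mult_le_weighted[OF \<theta>])
  have le': "norm (u z * v z) \<le> norm ((\<theta> * (u z)\<^sup>2 + (v z)\<^sup>2 / \<theta>) / 2)" for z
    using le[of z] by simp
  show int: "integrable N (\<lambda>z. u z * v z)"
    by (rule Bochner_Integration.integrable_bound[OF i]) (use le' in auto)
  have "\<bar>\<integral>z. u z * v z \<partial>N\<bar> \<le> (\<integral>z. \<bar>u z * v z\<bar> \<partial>N)" by (rule integral_abs_bound)
  also have "\<dots> \<le> (\<integral>z. (\<theta> * (u z)\<^sup>2 + (v z)\<^sup>2 / \<theta>) / 2 \<partial>N)"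
    using int i le by (intro integral_mono) auto
  also have "\<dots> = (\<theta> * (\<integral>z. (u z)\<^sup>2 \<partial>N) + (\<integral>z. (v z)\<^sup>2 \<partial>N) / \<theta>) / 2" using assms by simp
  finally show "\<bar>\<integral>z. u z * v z \<partial>N\<bar> \<le> (\<theta> * (\<integral>z. (u z)\<^sup>2 \<partial>N) + (\<integral>z. (v z)\<^sup>2 \<partial>N) / \<theta>) / 2" .
qed

lemma gev_biv_cdf_at_top:
  assumes "0 \<le> \<xi>" "\<xi> \<le> 1"
  shows "(\<lambda>n. gev_biv_cdf \<gamma> \<xi> x (real n)) \<longlonglongrightarrow> gev_cdf \<gamma> x"
proof -
  have "(\<lambda>n. gev_cdf \<gamma> (real n)) \<longlonglongrightarrow> 1" by (rule filterlim_compose[OF gev_cdf_at_top filterlim_real_sequentially])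
  then have "(\<lambda>n. gev_cdf \<gamma> x powr \<xi> * gev_cdf \<gamma> (real n) powr \<xi> * gev_cdf \<gamma> x powr (1 - \<xi>)) \<longlonglongrightarrow> gev_cdf \<gamma> x powr \<xi> * 1 powr \<xi> * gev_cdf \<gamma> x powr (1 - \<xi>)"
    by (intro tendsto_mult tendsto_const tendsto_powr) auto
  moreover have "gev_cdf \<gamma> x powr \<xi> * 1 powr \<xi> * gev_cdf \<gamma> x powr (1 - \<xi>) = gev_cdf \<gamma> x"
    using gev_cdf_nonneg[of \<gamma> x] by (cases "gev_cdf \<gamma> x = 0") (auto simp: powr_add[symmetric])
  moreover have "\<forall>\<^sub>F n in sequentially. gev_cdf \<gamma> x powr \<xi> * gev_cdf \<gamma> (real n) powr \<xi> * gev_cdf \<gamma> x powr (1 - \<xi>) = gev_biv_cdf \<gamma> \<xi> x (real n)"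
  proof (rule eventually_sequentiallyI)
    fix n assume "nat \<lceil>x\<rceil> \<le> n"
    then have "x \<le> real n" by linarith
    then show "gev_cdf \<gamma> x powr \<xi> * gev_cdf \<gamma> (real n) powr \<xi> * gev_cdf \<gamma> x powr (1 - \<xi>) = gev_biv_cdf \<gamma> \<xi> x (real n)"
      by (simp add: gev_biv_cdf_def min_absorb1)
  qed
  ultimately show ?thesis by (auto intro: Lim_transform_eventually)
qed

definition step_cov :: "real \<Rightarrow> 'j set \<Rightarrow> ('j \<Rightarrow> real) \<Rightarrow> ('j \<Rightarrow> real) \<Rightarrow> real \<Rightarrow> real" where
  "step_cov \<gamma> J c y \<xi> = (\<Sum>j\<in>J. \<Sum>j'\<in>J. c j * c j' * (gev_biv_cdf \<gamma> \<xi> (y j) (y j') - gev_cdf \<gamma> (y j) * gev_cdf \<gamma> (y j')))"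

locale gev_pair =
  fixes \<gamma> \<xi> :: real and R :: "(real \<times> real) measure"
  assumes biv: "has_biv_cdf R (gev_biv_cdf \<gamma> \<xi>)" and \<xi>: "0 \<le> \<xi>" "\<xi> \<le> 1"
begin

lemma R_sets [measurable_cong]: "sets R = sets borel"
  using biv by (simp add: has_biv_cdf_def)

lemma R_prob: "prob_space R"
  using biv by (simp add: has_biv_cdf_def)

lemma R_space: "space R = UNIV"
  using sets_eq_imp_space_eq[OF R_sets] by simp

lemma R_rect: "measure R ({..x} \<times> {..y}) = gev_biv_cdf \<gamma> \<xi> x y"
  using biv by (simp add: has_biv_cdf_def)

lemma rect_sets: "{..x} \<times> {..y} \<in> sets R" for x y :: real
proof -
  have "closed ({..x} \<times> {..y})" by (intro closed_Times closed_atMost)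
  then show ?thesis unfolding R_sets by (rule borel_closed)
qed

lemma fst_measurable [measurable]: "fst \<in> borel_measurable R"
  and snd_measurable [measurable]: "snd \<in> borel_measurable R"
  by (auto simp: measurable_cong_sets[OF R_sets refl] intro!: borel_measurable_continuous_onI continuous_intros)

text \<open>A marginal probability is the limit of rectangle probabilities as the other coordinate
  is exhausted; \<open>A\<close> stands for the growing half-planes.\<close>

lemma distr_eq_gev:
  assumes f: "f \<in> borel_measurable R"
    and lim: "\<And>x. (\<lambda>n. measure R (f -` {..x} \<inter> A n)) \<longlonglongrightarrow> gev_cdf \<gamma> x"
    and A: "\<And>n. A n \<in> sets R" "incseq A" "(\<Union>n. A n) = UNIV"
  shows "distr R borel f = gev_measure \<gamma>"
proof (rule cdf_unique)
  interpret prob_space R by (rule R_prob)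
  show "real_distribution (distr R borel f)" using f by simp
  show "real_distribution (gev_measure \<gamma>)" by (rule real_distribution_gev)
  show "cdf (distr R borel f) = cdf (gev_measure \<gamma>)"
  proof
    fix x
    have fs: "f -` {..x} \<in> sets R" using measurable_sets[OF f, of "{..x}"] by (simp add: R_space)
    have "(\<lambda>n. measure R (f -` {..x} \<inter> A n)) \<longlonglongrightarrow> measure R (\<Union>n. f -` {..x} \<inter> A n)"
      by (rule finite_Lim_measure_incseq) (use fs A in \<open>auto simp: incseq_def\<close>)
    moreover have "(\<Union>n. f -` {..x} \<inter> A n) = f -` {..x}" using A(3) by auto
    ultimately have "measure R (f -` {..x}) = gev_cdf \<gamma> x" using lim[of x] LIMSEQ_unique by metis
    then show "cdf (distr R borel f) x = cdf (gev_measure \<gamma>) x"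
      using f by (simp add: cdf_def[of "distr R borel f"] measure_distr R_space cdf_gev)
  qed
qed

lemma distr_fst: "distr R borel fst = gev_measure \<gamma>"
proof (rule distr_eq_gev[where A = "\<lambda>n. UNIV \<times> {..real n}"])
  have c: "closed ((UNIV :: real set) \<times> {..real n})" for n by (intro closed_Times closed_atMost closed_UNIV)
  show "UNIV \<times> {..real n} \<in> sets R" for n unfolding R_sets by (rule borel_closed[OF c])
  show "(\<Union>n. (UNIV :: real set) \<times> {..real n}) = UNIV" using real_arch_simple by auto
  have "fst -` {..x} \<inter> UNIV \<times> {..real n} = {..x} \<times> {..real n}" for x :: real and n by auto
  then show "(\<lambda>n. measure R (fst -` {..x} \<inter> UNIV \<times> {..real n})) \<longlonglongrightarrow> gev_cdf \<gamma> x" for x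
    using gev_biv_cdf_at_top[OF \<xi>] by (simp add: R_rect)
qed (auto simp: incseq_def)

lemma distr_snd: "distr R borel snd = gev_measure \<gamma>"
proof (rule distr_eq_gev[where A = "\<lambda>n. {..real n} \<times> UNIV"])
  have c: "closed ({..real n} \<times> (UNIV :: real set))" for n by (intro closed_Times closed_atMost closed_UNIV)
  show "{..real n} \<times> UNIV \<in> sets R" for n unfolding R_sets by (rule borel_closed[OF c])
  show "(\<Union>n. {..real n} \<times> (UNIV :: real set)) = UNIV" using real_arch_simple by auto
  have "snd -` {..x} \<inter> {..real n} \<times> UNIV = {..real n} \<times> {..x}" for x :: real and n by auto
  then show "(\<lambda>n. measure R (snd -` {..x} \<inter> {..real n} \<times> UNIV)) \<longlonglongrightarrow> gev_cdf \<gamma> x" for x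
    using gev_biv_cdf_at_top[OF \<xi>] by (simp add: R_rect gev_biv_cdf_commute[of \<gamma> \<xi> "real _"])
qed (auto simp: incseq_def)

lemma marginal_integral:
  fixes f :: "real \<Rightarrow> real"
  assumes f: "f \<in> borel_measurable borel"
  shows "integrable R (\<lambda>z. f (fst z)) \<longleftrightarrow> integrable (gev_measure \<gamma>) f" "(\<integral>z. f (fst z) \<partial>R) = (\<integral>x. f x \<partial>gev_measure \<gamma>)"
    and "integrable R (\<lambda>z. f (snd z)) \<longleftrightarrow> integrable (gev_measure \<gamma>) f" "(\<integral>z. f (snd z) \<partial>R) = (\<integral>x. f x \<partial>gev_measure \<gamma>)"
  using f integrable_distr_eq[OF fst_measurable f] integral_distr[OF fst_measurable f]
    integrable_distr_eq[OF snd_measurable f] integral_distr[OF snd_measurable f]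
  by (simp_all add: distr_fst distr_snd)

abbreviation cv :: "(real \<Rightarrow> real) \<Rightarrow> real" where
  "cv f \<equiv> covariance R (\<lambda>z. f (fst z)) (\<lambda>z. f (snd z))"

abbreviation mean :: "(real \<Rightarrow> real) \<Rightarrow> real" where
  "mean f \<equiv> \<integral>x. f x \<partial>gev_measure \<gamma>"

lemma cv_eq:
  assumes [measurable]: "f \<in> borel_measurable borel"
  shows "cv f = (\<integral>z. (f (fst z) - mean f) * (f (snd z) - mean f) \<partial>R)"
  unfolding covariance_def using marginal_integral[of f] by simp

lemma centred_moment:
  assumes f [measurable]: "f \<in> borel_measurable borel" and i: "integrable (gev_measure \<gamma>) (\<lambda>x. (f x)\<^sup>2)"
  shows "integrable (gev_measure \<gamma>) f" "integrable (gev_measure \<gamma>) (\<lambda>x. (f x - mean f)\<^sup>2)"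
    and "(\<integral>x. (f x - mean f)\<^sup>2 \<partial>gev_measure \<gamma>) \<le> (\<integral>x. (f x)\<^sup>2 \<partial>gev_measure \<gamma>)"
proof -
  interpret G: real_distribution "gev_measure \<gamma>" by (rule real_distribution_gev)
  show 1: "integrable (gev_measure \<gamma>) f" by (rule G.square_integrable_imp_integrable[OF _ i]) simp
  show "integrable (gev_measure \<gamma>) (\<lambda>x. (f x - mean f)\<^sup>2)"
    by (rule integrable_square_diff) (use i in auto)
  show "(\<integral>x. (f x - mean f)\<^sup>2 \<partial>gev_measure \<gamma>) \<le> (\<integral>x. (f x)\<^sup>2 \<partial>gev_measure \<gamma>)"
    using G.variance_eq[OF 1 i] by simp
qed

lemma cv_abs_le_variance:
  assumes f [measurable]: "f \<in> borel_measurable borel" and i: "integrable (gev_measure \<gamma>) (\<lambda>x. (f x)\<^sup>2)"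
  shows "\<bar>cv f\<bar> \<le> prob_space.variance (gev_measure \<gamma>) f"
proof -
  let ?u = "\<lambda>x. f x - mean f"
  have "integrable R (\<lambda>z. (?u (fst z))\<^sup>2)" "integrable R (\<lambda>z. (?u (snd z))\<^sup>2)"
    using marginal_integral[of "\<lambda>x. (?u x)\<^sup>2"] centred_moment[OF f i] by auto
  from pair_integral_le(2)[OF _ _ this zero_less_one]
  show ?thesis
    using marginal_integral[of "\<lambda>x. (?u x)\<^sup>2"] by (simp add: cv_eq)
qed

text \<open>With \<open>u\<close>, \<open>v\<close> the centred difference and sum, the product of
  the two centred copies of \<open>f\<close> minus that of \<open>g\<close> equals
  \<open>(u(x) v(y) + u(y) v(x)) / 2\<close>. The resulting bound sees only the marginals, hence is
  uniform in \<open>\<xi>\<close>.\<close>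

lemma cv_diff_le:
  assumes f [measurable]: "f \<in> borel_measurable borel" and g [measurable]: "g \<in> borel_measurable borel"
    and fi: "integrable (gev_measure \<gamma>) (\<lambda>x. (f x)\<^sup>2)" and gi: "integrable (gev_measure \<gamma>) (\<lambda>x. (g x)\<^sup>2)"
    and \<theta>: "\<theta> > 0"
  shows "\<bar>cv f - cv g\<bar> \<le> (\<theta> * (\<integral>x. (f x - g x)\<^sup>2 \<partial>gev_measure \<gamma>) + (\<integral>x. (f x + g x)\<^sup>2 \<partial>gev_measure \<gamma>) / \<theta>) / 2"
proof -
  interpret G: real_distribution "gev_measure \<gamma>" by (rule real_distribution_gev)
  define u where "u x = (f x - g x) - mean (\<lambda>x. f x - g x)" for x
  define v where "v x = (f x + g x) - mean (\<lambda>x. f x + g x)" for x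
  have [measurable]: "u \<in> borel_measurable borel" "v \<in> borel_measurable borel"
    unfolding u_def[abs_def] v_def[abs_def] by measurable
  have i: "integrable (gev_measure \<gamma>) (\<lambda>x. (f x - g x)\<^sup>2)" "integrable (gev_measure \<gamma>) (\<lambda>x. (f x + g x)\<^sup>2)"
    by (auto intro!: integrable_square_diff fi gi)
  have iu: "integrable (gev_measure \<gamma>) (\<lambda>x. (u x)\<^sup>2)" and ule: "(\<integral>x. (u x)\<^sup>2 \<partial>gev_measure \<gamma>) \<le> (\<integral>x. (f x - g x)\<^sup>2 \<partial>gev_measure \<gamma>)"
    unfolding u_def using centred_moment[of "\<lambda>x. f x - g x"] i by auto
  have iv: "integrable (gev_measure \<gamma>) (\<lambda>x. (v x)\<^sup>2)" and vle: "(\<integral>x. (v x)\<^sup>2 \<partial>gev_measure \<gamma>) \<le> (\<integral>x. (f x + g x)\<^sup>2 \<partial>gev_measure \<gamma>)"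
    unfolding v_def using centred_moment[of "\<lambda>x. f x + g x"] i by auto
  have mi: "integrable (gev_measure \<gamma>) f" "integrable (gev_measure \<gamma>) g"
    by (rule centred_moment(1)[OF f fi], rule centred_moment(1)[OF g gi])
  have uv: "u x = (f x - mean f) - (g x - mean g)" "v x = (f x - mean f) + (g x - mean g)" for x
    unfolding u_def v_def using mi by auto
  have ui: "integrable R (\<lambda>z. (u (fst z))\<^sup>2)" "integrable R (\<lambda>z. (u (snd z))\<^sup>2)" "integrable R (\<lambda>z. (v (fst z))\<^sup>2)" "integrable R (\<lambda>z. (v (snd z))\<^sup>2)"
    using marginal_integral[of "\<lambda>x. (u x)\<^sup>2"] marginal_integral[of "\<lambda>x. (v x)\<^sup>2"] iu iv by auto
  have fi': "integrable R (\<lambda>z. (f (fst z) - mean f) * (f (snd z) - mean f))" "integrable R (\<lambda>z. (g (fst z) - mean g) * (g (snd z) - mean g))"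
    using marginal_integral[of "\<lambda>x. (f x - mean f)\<^sup>2"] marginal_integral[of "\<lambda>x. (g x - mean g)\<^sup>2"]
      centred_moment[OF f fi] centred_moment[OF g gi]
    by (auto intro!: pair_integral_le(1)[where \<theta> = 1])
  have "cv f - cv g = (\<integral>z. (f (fst z) - mean f) * (f (snd z) - mean f) - (g (fst z) - mean g) * (g (snd z) - mean g) \<partial>R)"
    using fi' by (simp add: cv_eq)
  also have "\<dots> = (\<integral>z. (u (fst z) * v (snd z) + u (snd z) * v (fst z)) / 2 \<partial>R)"
    by (intro Bochner_Integration.integral_cong refl) (simp add: uv algebra_simps)
  also have "\<dots> = ((\<integral>z. u (fst z) * v (snd z) \<partial>R) + (\<integral>z. u (snd z) * v (fst z) \<partial>R)) / 2"
    using pair_integral_le(1)[OF _ _ ui(1,4) \<theta>] pair_integral_le(1)[OF _ _ ui(2,3) \<theta>] by simp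
  finally have eq: "cv f - cv g = ((\<integral>z. u (fst z) * v (snd z) \<partial>R) + (\<integral>z. u (snd z) * v (fst z) \<partial>R)) / 2" .
  have half: "\<bar>D\<bar> \<le> (\<bar>A\<bar> + \<bar>B\<bar>) / 2" if "D = (A + B) / 2" for A B D :: real
    using abs_triangle_ineq[of A B] by (simp add: that)
  have "\<bar>cv f - cv g\<bar> \<le> (\<bar>\<integral>z. u (fst z) * v (snd z) \<partial>R\<bar> + \<bar>\<integral>z. u (snd z) * v (fst z) \<partial>R\<bar>) / 2"
    by (rule half[OF eq])
  also have "\<dots> \<le> (\<theta> * (\<integral>x. (u x)\<^sup>2 \<partial>gev_measure \<gamma>) + (\<integral>x. (v x)\<^sup>2 \<partial>gev_measure \<gamma>) / \<theta>) / 2"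
  proof -
    have avg: "(A + B) / 2 \<le> T" if "A \<le> T" "B \<le> T" for A B T :: real using that by simp
    show ?thesis
      using pair_integral_le(2)[OF _ _ ui(1,4) \<theta>] pair_integral_le(2)[OF _ _ ui(2,3) \<theta>]
        marginal_integral[of "\<lambda>x. (u x)\<^sup>2"] marginal_integral[of "\<lambda>x. (v x)\<^sup>2"] by (intro avg) simp_all
  qed
  also have "\<dots> \<le> (\<theta> * (\<integral>x. (f x - g x)\<^sup>2 \<partial>gev_measure \<gamma>) + (\<integral>x. (f x + g x)\<^sup>2 \<partial>gev_measure \<gamma>) / \<theta>) / 2"
    using \<theta> ule vle by (intro divide_right_mono add_mono mult_left_mono) auto
  finally show ?thesis .
qed

lemma cv_step_fun:
  assumes J: "finite J"
  shows "cv (step_fun J c y) = step_cov \<gamma> J c y \<xi>"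
proof -
  interpret R: prob_space R by (rule R_prob)
  interpret G: real_distribution "gev_measure \<gamma>" by (rule real_distribution_gev)
  let ?G = "gev_measure \<gamma>" and ?g = "step_fun J c y"
  have mean: "mean ?g = (\<Sum>j\<in>J. c j * gev_cdf \<gamma> (y j))"
  proof -
    have "mean ?g = (\<Sum>j\<in>J. \<integral>x. c j * indicator {..y j} x \<partial>?G)"
      unfolding step_fun_def by (intro Bochner_Integration.integral_sum integrable_mult_right integrable_real_indicator) (auto simp: G.emeasure_eq_measure)
    also have "\<dots> = (\<Sum>j\<in>J. c j * gev_cdf \<gamma> (y j))"
      by (simp add: cdf_gev[symmetric] cdf_def)
    finally show ?thesis .
  qed
  have gi: "integrable ?G ?g"
    by (rule centred_moment(1)) (auto intro: step_fun_square_integrable G.prob_space_axioms J)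
  have ind: "indicator {..y j} (fst z) * indicator {..y j'} (snd z) = indicat_real ({..y j} \<times> {..y j'}) z" for j j' z
    by (auto simp: indicator_def mem_Times_iff)
  have "(\<integral>z. ?g (fst z) * ?g (snd z) \<partial>R) = (\<integral>z. (\<Sum>j\<in>J. \<Sum>j'\<in>J. c j * c j' * indicat_real ({..y j} \<times> {..y j'}) z) \<partial>R)"
    unfolding step_fun_def sum_product ind[symmetric] by (simp only: mult_ac)
  also have "\<dots> = (\<Sum>j\<in>J. \<Sum>j'\<in>J. \<integral>z. c j * c j' * indicat_real ({..y j} \<times> {..y j'}) z \<partial>R)"
  proof -
    have i: "integrable R (\<lambda>z. c j * c j' * indicat_real ({..y j} \<times> {..y j'}) z)" for j j'
      using rect_sets by (intro integrable_mult_right integrable_real_indicator) (auto simp: R.emeasure_eq_measure)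
    show ?thesis
      by (subst Bochner_Integration.integral_sum, (intro Bochner_Integration.integrable_sum i),
          intro sum.cong refl Bochner_Integration.integral_sum i)
  qed
  also have "\<dots> = (\<Sum>j\<in>J. \<Sum>j'\<in>J. c j * c j' * gev_biv_cdf \<gamma> \<xi> (y j) (y j'))"
    using rect_sets by (simp add: R_rect R_space)
  finally have prod: "(\<integral>z. ?g (fst z) * ?g (snd z) \<partial>R) = (\<Sum>j\<in>J. \<Sum>j'\<in>J. c j * c j' * gev_biv_cdf \<gamma> \<xi> (y j) (y j'))" .
  have gi': "integrable R (\<lambda>z. ?g (fst z))" "integrable R (\<lambda>z. ?g (snd z))" "integrable R (\<lambda>z. ?g (fst z) * ?g (snd z))"
    using marginal_integral[of ?g] gi marginal_integral[of "\<lambda>x. (?g x)\<^sup>2"] step_fun_square_integrable[OF G.prob_space_axioms _ J, of c y]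
    by (auto intro!: pair_integral_le(1)[where \<theta> = 1])
  have "cv ?g = (\<integral>z. ?g (fst z) * ?g (snd z) - mean ?g * ?g (fst z) - mean ?g * ?g (snd z) + mean ?g * mean ?g \<partial>R)"
    unfolding cv_eq[OF step_fun_measurable] by (intro Bochner_Integration.integral_cong refl) (simp add: algebra_simps)
  also have "\<dots> = (\<integral>z. ?g (fst z) * ?g (snd z) \<partial>R) - mean ?g * mean ?g"
    using gi' marginal_integral[of ?g] by (simp add: R.prob_space)
  also have "\<dots> = step_cov \<gamma> J c y \<xi>"
    unfolding prod mean step_cov_def sum_product sum_subtractf[symmetric]
    by (intro sum.cong refl) (simp add: algebra_simps)
  finally show ?thesis .
qed

end


subsection \<open>The covariance as a function of the lag\<close>

text \<open>This is the covariance kernel of the Brownian bridge: the entries are inner products of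
  the centred indicators of \<open>{0<..p j}\<close> on the unit interval, so the quadratic form is
  the integral of a square.\<close>

lemma min_prod_kernel_nonneg:
  fixes p :: "'j \<Rightarrow> real"
  assumes J: "finite J" and p: "\<And>j. j \<in> J \<Longrightarrow> 0 \<le> p j \<and> p j \<le> 1"
  shows "0 \<le> (\<Sum>j\<in>J. \<Sum>j'\<in>J. d j * d j' * (min (p j) (p j') - p j * p j'))"
proof -
  define f where "f j u = indicator {0<..1} u * (indicator {0<..p j} u - p j)" for j and u :: real
  have ind: "integrable lborel (indicat_real {0<..q})" for q :: real
    by (intro integrable_real_indicator emeasure_bounded_finite) auto
  have ff: "f j u * f j' u = indicator {0<..min (p j) (p j')} u - p j' * indicator {0<..p j} u - p j * indicator {0<..p j'} u + p j * p j' * indicator {0<..1} u"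
    if "j \<in> J" "j' \<in> J" for j j' u
    using p[OF that(1)] p[OF that(2)] by (auto simp: f_def indicator_def algebra_simps)
  have int: "integrable lborel (\<lambda>u. f j u * f j' u)" if "j \<in> J" "j' \<in> J" for j j'
    unfolding ff[OF that] by (intro Bochner_Integration.integrable_add Bochner_Integration.integrable_diff integrable_mult_right ind)
  have val: "(\<integral>u. f j u * f j' u \<partial>lborel) = min (p j) (p j') - p j * p j'" if "j \<in> J" "j' \<in> J" for j j'
    unfolding ff[OF that] using p[OF that(1)] p[OF that(2)] by (simp add: ind integrable_mult_right algebra_simps)
  have "0 \<le> (\<integral>u. (\<Sum>j\<in>J. d j * f j u)\<^sup>2 \<partial>lborel)" by simp
  also have "\<dots> = (\<integral>u. (\<Sum>j\<in>J. \<Sum>j'\<in>J. d j * d j' * (f j u * f j' u)) \<partial>lborel)"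
    unfolding power2_eq_square sum_product by (simp only: mult_ac)
  also have "\<dots> = (\<Sum>j\<in>J. \<Sum>j'\<in>J. \<integral>u. d j * d j' * (f j u * f j' u) \<partial>lborel)"
  proof -
    have i: "integrable lborel (\<lambda>u. d j * d j' * (f j u * f j' u))" if "j \<in> J" "j' \<in> J" for j j'
      using int[OF that] by (rule integrable_mult_right)
    have "(\<integral>u. (\<Sum>j\<in>J. \<Sum>j'\<in>J. d j * d j' * (f j u * f j' u)) \<partial>lborel) = (\<Sum>j\<in>J. \<integral>u. (\<Sum>j'\<in>J. d j * d j' * (f j u * f j' u)) \<partial>lborel)"
      by (rule Bochner_Integration.integral_sum) (intro Bochner_Integration.integrable_sum i)
    also have "\<dots> = (\<Sum>j\<in>J. \<Sum>j'\<in>J. \<integral>u. d j * d j' * (f j u * f j' u) \<partial>lborel)"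
      by (intro sum.cong refl Bochner_Integration.integral_sum i)
    finally show ?thesis .
  qed
  also have "\<dots> = (\<Sum>j\<in>J. \<Sum>j'\<in>J. d j * d j' * (min (p j) (p j') - p j * p j'))"
    by (intro sum.cong refl) (simp add: val)
  finally show ?thesis .
qed

text \<open>With \<open>p = G\<^sup>1\<^sup>-\<^sup>\<xi>\<close> the covariance kernel factors as \<open>G(x)\<^sup>\<xi> G(y)\<^sup>\<xi> (min p(x) p(y) - p(x) p(y))\<close>.\<close>

lemma step_cov_nonneg:
  assumes J: "finite J" and \<xi>: "0 < \<xi>" "\<xi> < 1"
  shows "0 \<le> step_cov \<gamma> J c y \<xi>"
proof -
  define p where "p j = gev_cdf \<gamma> (y j) powr (1 - \<xi>)" for j
  define d where "d j = c j * gev_cdf \<gamma> (y j) powr \<xi>" for j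
  have pm: "min (p j) (p j') = gev_cdf \<gamma> (min (y j) (y j')) powr (1 - \<xi>)" for j j'
  proof -
    have mono: "gev_cdf \<gamma> u powr (1 - \<xi>) \<le> gev_cdf \<gamma> v powr (1 - \<xi>)" if "u \<le> v" for u v
      using \<xi> that by (intro powr_mono2 gev_cdf_mono gev_cdf_nonneg) auto
    show ?thesis using mono[of "y j" "y j'"] mono[of "y j'" "y j"] by (cases "y j \<le> y j'") (auto simp: p_def min_def)
  qed
  have pd: "gev_cdf \<gamma> (y j) = gev_cdf \<gamma> (y j) powr \<xi> * p j" for j
    using gev_cdf_nonneg[of \<gamma> "y j"] by (cases "gev_cdf \<gamma> (y j) = 0") (auto simp: p_def powr_add[symmetric])
  have "step_cov \<gamma> J c y \<xi> = (\<Sum>j\<in>J. \<Sum>j'\<in>J. d j * d j' * (min (p j) (p j') - p j * p j'))"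
    unfolding step_cov_def
  proof (intro sum.cong refl)
    fix j j'
    let ?a = "gev_cdf \<gamma> (y j) powr \<xi>" and ?b = "gev_cdf \<gamma> (y j') powr \<xi>"
    have "gev_biv_cdf \<gamma> \<xi> (y j) (y j') = ?a * ?b * min (p j) (p j')" by (simp add: gev_biv_cdf_def pm)
    moreover have "gev_cdf \<gamma> (y j) * gev_cdf \<gamma> (y j') = (?a * p j) * (?b * p j')" using pd[of j] pd[of j'] by simp
    ultimately show "c j * c j' * (gev_biv_cdf \<gamma> \<xi> (y j) (y j') - gev_cdf \<gamma> (y j) * gev_cdf \<gamma> (y j')) = d j * d j' * (min (p j) (p j') - p j * p j')"
      unfolding d_def by (simp only: right_diff_distrib mult_ac)
  qed
  also have "\<dots> \<ge> 0"
    by (rule min_prod_kernel_nonneg[OF J]) (use \<xi> in \<open>auto simp: p_def gev_cdf_nonneg gev_cdf_le_1 intro!: powr_le1\<close>)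
  finally show ?thesis .
qed

lemma step_cov_measurable: "step_cov \<gamma> J c y \<in> borel_measurable borel"
  unfolding step_cov_def[abs_def] using gev_biv_cdf_measurable[measurable] by measurable

text \<open>Where \<open>G\<close> vanishes at the smaller threshold the bivariate term is
  constantly 0; otherwise all bases are positive and the powers are continuous in the
  exponent.\<close>

lemma step_cov_tendsto_0:
  assumes J: "finite J"
  shows "(step_cov \<gamma> J c y \<longlongrightarrow> step_cov \<gamma> J c y 0) (at_right 0)"
proof -
  have "((\<lambda>\<xi>. gev_biv_cdf \<gamma> \<xi> x z) \<longlongrightarrow> gev_biv_cdf \<gamma> 0 x z) (at_right 0)" for x z
  proof (cases "gev_cdf \<gamma> (min x z) = 0")
    case True
    then have "\<forall>\<xi>. gev_biv_cdf \<gamma> \<xi> x z = 0" by (simp add: gev_biv_cdf_def)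
    then show ?thesis by simp
  next
    case False
    then have "gev_cdf \<gamma> (min x z) > 0" using gev_cdf_nonneg[of \<gamma> "min x z"] by linarith
    moreover from this have "gev_cdf \<gamma> x > 0" "gev_cdf \<gamma> z > 0"
      using gev_cdf_mono[of "min x z" x \<gamma>] gev_cdf_mono[of "min x z" z \<gamma>] by auto
    ultimately show ?thesis unfolding gev_biv_cdf_def by (intro tendsto_intros) auto
  qed
  then show ?thesis unfolding step_cov_def[abs_def] by (intro tendsto_intros)
qed

text \<open>At lag 0 both coordinates coincide, so the variance becomes a lag covariance and
  inherits the same approximation by step functions.\<close>

lemma gev_pair_diagonal: "gev_pair \<gamma> 0 (distr (gev_measure \<gamma>) borel (\<lambda>x. (x, x)))"
proof -
  interpret G: real_distribution "gev_measure \<gamma>" by (rule real_distribution_gev)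
  have m: "(\<lambda>x. (x, x)) \<in> measurable (gev_measure \<gamma>) borel"
    unfolding measurable_cong_sets[OF G.events_eq_borel refl]
    by (intro borel_measurable_continuous_onI continuous_intros)
  have "measure (distr (gev_measure \<gamma>) borel (\<lambda>x. (x, x))) ({..x} \<times> {..y}) = gev_biv_cdf \<gamma> 0 x y" for x y
  proof -
    have c: "closed ({..x} \<times> {..y})" by (intro closed_Times closed_atMost)
    have "(\<lambda>x. (x, x)) -` ({..x} \<times> {..y}) = {..min x y}" by auto
    then have "measure (distr (gev_measure \<gamma>) borel (\<lambda>x. (x, x))) ({..x} \<times> {..y}) = gev_cdf \<gamma> (min x y)"
      using m borel_closed[OF c] by (simp add: measure_distr cdf_gev[symmetric] cdf_def)
    \<comment> \<open>A factor with exponent 0 is 1 unless its base vanishes; then \<open>G\<close>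
      vanishes at the minimum too and both sides are 0.\<close>
    moreover have "gev_cdf \<gamma> (min x y) = gev_biv_cdf \<gamma> 0 x y"
      using gev_cdf_nonneg[of \<gamma> x] gev_cdf_nonneg[of \<gamma> y] gev_cdf_nonneg[of \<gamma> "min x y"] gev_cdf_mono[of "min x y" x \<gamma>] gev_cdf_mono[of "min x y" y \<gamma>]
      by (auto simp: gev_biv_cdf_def powr_def)
    ultimately show ?thesis by simp
  qed
  then have "has_biv_cdf (distr (gev_measure \<gamma>) borel (\<lambda>x. (x, x))) (gev_biv_cdf \<gamma> 0)"
    using m by (auto simp: has_biv_cdf_def G.prob_space_distr)
  then show ?thesis by unfold_locales auto
qed

locale gev_pair_family =
  fixes \<gamma> :: real and Q :: "real \<Rightarrow> (real \<times> real) measure" and h :: "real \<Rightarrow> real"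
  assumes Q: "\<And>\<xi>. \<xi> \<in> {0..1} \<Longrightarrow> has_biv_cdf (Q \<xi>) (gev_biv_cdf \<gamma> \<xi>)"
    and h [measurable]: "h \<in> borel_measurable borel" and cont: "AE x in lborel. isCont h x"
    and square_integrable: "integrable (gev_measure \<gamma>) (\<lambda>x. (h x)\<^sup>2)"
begin

abbreviation lag_cov :: "real \<Rightarrow> real" where
  "lag_cov \<xi> \<equiv> covariance (Q \<xi>) (\<lambda>z. h (fst z)) (\<lambda>z. h (snd z))"

text \<open>Twice the error bound of \<open>gev_pair.cv_diff_le\<close> for \<open>h\<close> against
  a step function; it depends on the common marginal and not on \<open>\<xi>\<close>.\<close>

definition gap :: "real \<Rightarrow> 'j set \<Rightarrow> ('j \<Rightarrow> real) \<Rightarrow> ('j \<Rightarrow> real) \<Rightarrow> real" where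
  "gap \<theta> J c y = \<theta> * (\<integral>x. (h x - step_fun J c y x)\<^sup>2 \<partial>gev_measure \<gamma>) + (\<integral>x. (h x + step_fun J c y x)\<^sup>2 \<partial>gev_measure \<gamma>) / \<theta>"

lemma pairI: "\<xi> \<in> {0..1} \<Longrightarrow> gev_pair \<gamma> \<xi> (Q \<xi>)"
  by (intro gev_pair.intro Q) auto

lemma step_square_integrable: "finite J \<Longrightarrow> integrable (gev_measure \<gamma>) (\<lambda>x. (step_fun J c y x)\<^sup>2)"
proof -
  interpret G: real_distribution "gev_measure \<gamma>" by (rule real_distribution_gev)
  show "finite J \<Longrightarrow> integrable (gev_measure \<gamma>) (\<lambda>x. (step_fun J c y x)\<^sup>2)"
    by (rule step_fun_square_integrable[OF G.prob_space_axioms]) auto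
qed

lemma lag_cov_approx:
  assumes "\<xi> \<in> {0..1}" "finite J" "\<theta> > 0"
  shows "\<bar>lag_cov \<xi> - step_cov \<gamma> J c y \<xi>\<bar> \<le> gap \<theta> J c y / 2"
  using gev_pair.cv_diff_le[OF pairI[OF assms(1)] h step_fun_measurable square_integrable step_square_integrable[OF assms(2)] assms(3), of c y]
  unfolding gev_pair.cv_step_fun[OF pairI[OF assms(1)] assms(2), of c y] gap_def .

lemma variance_approx:
  assumes "finite J" "\<theta> > 0"
  shows "\<bar>prob_space.variance (gev_measure \<gamma>) h - step_cov \<gamma> J c y 0\<bar> \<le> gap \<theta> J c y / 2"
proof -
  interpret G: real_distribution "gev_measure \<gamma>" by (rule real_distribution_gev)
  let ?D = "distr (gev_measure \<gamma>) borel (\<lambda>x. (x, x))"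
  interpret D: gev_pair \<gamma> 0 ?D by (rule gev_pair_diagonal)
  have m: "(\<lambda>x. (x, x)) \<in> measurable (gev_measure \<gamma>) borel"
    unfolding measurable_cong_sets[OF G.events_eq_borel refl]
    by (intro borel_measurable_continuous_onI continuous_intros)
  let ?u = "\<lambda>x. h x - D.mean h"
  have f: "(\<lambda>z. ?u (fst z) * ?u (snd z)) \<in> borel_measurable borel"
    by (intro borel_measurable_times borel_measurable_diff measurable_compose[OF _ h] borel_measurable_const
        borel_measurable_continuous_onI continuous_intros)
  have "D.cv h = prob_space.variance (gev_measure \<gamma>) h"
    unfolding D.cv_eq[OF h] by (subst integral_distr[OF m f]) (simp add: power2_eq_square)
  then show ?thesis
    using D.cv_diff_le[OF h step_fun_measurable square_integrable step_square_integrable[OF assms(1)] assms(2), of c y]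
    unfolding D.cv_step_fun[OF assms(1), of c y] gap_def by simp
qed

lemma approx:
  assumes "\<epsilon> > 0"
  obtains J :: "(int \<times> bool) set" and c y \<theta> where "finite J" "\<theta> > 0" "gap \<theta> J c y < \<epsilon>"
  using step_fun_approx[OF real_distribution_gev h AE_gev_of_AE_lborel[OF cont] square_integrable assms]
  unfolding gap_def by blast

lemma abs_lag_cov_le: "\<xi> \<in> {0..1} \<Longrightarrow> \<bar>lag_cov \<xi>\<bar> \<le> prob_space.variance (gev_measure \<gamma>) h"
  by (rule gev_pair.cv_abs_le_variance[OF pairI h square_integrable])

lemma lag_cov_nonneg:
  assumes "0 < \<xi>" "\<xi> < 1"
  shows "0 \<le> lag_cov \<xi>"
proof (rule field_le_epsilon)
  fix e :: real assume "e > 0"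
  then obtain J :: "(int \<times> bool) set" and c y \<theta> where J: "finite J" "\<theta> > 0" "gap \<theta> J c y < e" by (rule approx)
  then show "0 \<le> lag_cov \<xi> + e"
    using lag_cov_approx[of \<xi> J \<theta> c y, unfolded abs_diff_le_iff] step_cov_nonneg[OF J(1) assms, of \<gamma> c y] assms \<open>e > 0\<close> by simp
qed

text \<open>Continuity at lag 0 is available for step functions, and the uniform approximation
  transports it to \<open>h\<close>.\<close>

lemma lag_cov_positive:
  assumes v: "prob_space.variance (gev_measure \<gamma>) h > 0"
  shows "\<exists>d>0. d \<le> 1 / 2 \<and> (\<forall>\<xi>. 0 < \<xi> \<and> \<xi> < d \<longrightarrow> lag_cov \<xi> \<ge> prob_space.variance (gev_measure \<gamma>) h / 2)"
proof -
  let ?v = "prob_space.variance (gev_measure \<gamma>) h"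
  \<comment> \<open>The two approximation errors are below \<open>?v / 8\<close> each and the
    continuity error is below \<open>?v / 4\<close>; together they leave at least
    \<open>?v / 2\<close>.\<close>
  have "?v / 4 > 0" using v by simp
  then obtain J :: "(int \<times> bool) set" and c y \<theta> where J: "finite J" "\<theta> > 0" "gap \<theta> J c y < ?v / 4" by (rule approx)
  have "\<forall>\<^sub>F \<xi> in at_right 0. step_cov \<gamma> J c y 0 - ?v / 4 < step_cov \<gamma> J c y \<xi>"
    using v by (intro order_tendstoD(1)[OF step_cov_tendsto_0[OF J(1)]]) auto
  then obtain b where b: "b > 0" "\<And>\<xi>. 0 < \<xi> \<Longrightarrow> \<xi> < b \<Longrightarrow> step_cov \<gamma> J c y 0 - ?v / 4 < step_cov \<gamma> J c y \<xi>"
    unfolding eventually_at_right_field by blast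
  have "lag_cov \<xi> \<ge> ?v / 2" if "0 < \<xi>" "\<xi> < min b (1 / 2)" for \<xi>
  proof -
    have "\<bar>lag_cov \<xi> - step_cov \<gamma> J c y \<xi>\<bar> \<le> gap \<theta> J c y / 2" using that J by (intro lag_cov_approx) auto
    moreover have "step_cov \<gamma> J c y 0 - ?v / 4 < step_cov \<gamma> J c y \<xi>" using that by (intro b) auto
    moreover have "\<bar>?v - step_cov \<gamma> J c y 0\<bar> \<le> gap \<theta> J c y / 2" by (rule variance_approx[OF J(1,2)])
    ultimately show ?thesis using J(3) unfolding abs_diff_le_iff by linarith
  qed
  then show ?thesis using b(1) by (intro exI[of _ "min b (1 / 2)"]) auto
qed

text \<open>Nothing is assumed about how \<open>Q\<close> depends on \<open>\<xi>\<close>.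
  Measurability comes from the step functions, whose lag covariances are explicit in
  \<open>\<xi>\<close> and converge pointwise.\<close>

lemma lag_cov_measurable: "(\<lambda>\<xi>. indicator {0..1} \<xi> * lag_cov \<xi>) \<in> borel_measurable borel"
proof -
  have "\<exists>(J :: (int \<times> bool) set) c y \<theta>. finite J \<and> \<theta> > 0 \<and> gap \<theta> J c y < inverse (real (Suc n))" for n
    using approx[of "inverse (real (Suc n))"] by (metis inverse_positive_iff_positive of_nat_0_less_iff zero_less_Suc)
  then obtain J :: "nat \<Rightarrow> (int \<times> bool) set" and c y \<theta> where J: "\<And>n. finite (J n)" "\<And>n. \<theta> n > 0"
    "\<And>n. gap (\<theta> n) (J n) (c n) (y n) < inverse (real (Suc n))" by metis
  have "(\<lambda>n. indicator {0..1} \<xi> * step_cov \<gamma> (J n) (c n) (y n) \<xi>) \<longlonglongrightarrow> indicator {0..1} \<xi> * lag_cov \<xi>" for \<xi>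
  proof (cases "\<xi> \<in> {0..1}")
    case True
    have "(\<lambda>n. step_cov \<gamma> (J n) (c n) (y n) \<xi> - lag_cov \<xi>) \<longlonglongrightarrow> 0"
    proof (rule Lim_null_comparison[OF _ LIMSEQ_inverse_real_of_nat])
      show "\<forall>\<^sub>F n in sequentially. norm (step_cov \<gamma> (J n) (c n) (y n) \<xi> - lag_cov \<xi>) \<le> inverse (real (Suc n))"
      proof (intro always_eventually allI)
        fix n
        have "\<bar>lag_cov \<xi> - step_cov \<gamma> (J n) (c n) (y n) \<xi>\<bar> \<le> gap (\<theta> n) (J n) (c n) (y n) / 2" by (rule lag_cov_approx[OF True J(1,2)])
        moreover have "0 < inverse (real (Suc n))" by simp
        ultimately show "norm (step_cov \<gamma> (J n) (c n) (y n) \<xi> - lag_cov \<xi>) \<le> inverse (real (Suc n))"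
          unfolding real_norm_def abs_minus_commute[of "step_cov _ _ _ _ _"] using J(3)[of n] by linarith
      qed
    qed
    then show ?thesis using True by (simp add: LIM_zero_iff)
  qed simp
  then show ?thesis
    by (rule borel_measurable_LIMSEQ_real) (intro borel_measurable_times borel_measurable_indicator step_cov_measurable, simp)
qed

section \<open>Integrals of the lag covariance and the limiting variances\<close>

lemma weighted_integrable:
  assumes [measurable]: "w \<in> borel_measurable borel" and w: "\<And>\<xi>. \<xi> \<in> {0..1} \<Longrightarrow> \<bar>w \<xi>\<bar> \<le> B"
  shows "integrable lborel (\<lambda>\<xi>::real. indicator {0..1} \<xi> * (w \<xi> * lag_cov \<xi>))"
proof (rule Bochner_Integration.integrable_bound)
  show "integrable lborel (\<lambda>\<xi>::real. (B * prob_space.variance (gev_measure \<gamma>) h) * indicat_real {0..1} \<xi>)"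
    by (intro integrable_mult_right integrable_real_indicator emeasure_bounded_finite) auto
  have "(\<lambda>\<xi>. w \<xi> * (indicator {0..1} \<xi> * lag_cov \<xi>)) \<in> borel_measurable lborel"
    using lag_cov_measurable by measurable
  then show "(\<lambda>\<xi>. indicator {0..1} \<xi> * (w \<xi> * lag_cov \<xi>)) \<in> borel_measurable lborel" by (simp only: mult_ac)
  have "norm (indicator {0..1} \<xi> * (w \<xi> * lag_cov \<xi>)) \<le> norm ((B * prob_space.variance (gev_measure \<gamma>) h) * indicat_real {0..1} \<xi>)" for \<xi>
  proof (cases "\<xi> \<in> {0..1}")
    case True
    have "\<bar>w \<xi> * lag_cov \<xi>\<bar> \<le> B * prob_space.variance (gev_measure \<gamma>) h"
      unfolding abs_mult using w[OF True] by (intro mult_mono abs_lag_cov_le True) auto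
    then show ?thesis using True by simp
  qed simp
  then show "AE \<xi> in lborel. norm (indicator {0..1} \<xi> * (w \<xi> * lag_cov \<xi>)) \<le> norm ((B * prob_space.variance (gev_measure \<gamma>) h) * indicat_real {0..1} \<xi>)"
    by simp
qed

text \<open>The conditions on \<open>w\<close> are chosen to fit both weights that occur:
  \<open>\<xi>\<close> is at least \<open>\<delta>\<close> from \<open>\<delta>\<close> on, and
  \<open>k - \<xi>\<close> is at least \<open>1 / 2\<close> up to \<open>1 / 2\<close>. The first
  shows that the naive variance is too small, the second that it is positive.\<close>

lemma weighted_integral_pos:
  assumes v: "prob_space.variance (gev_measure \<gamma>) h > 0"
    and w [measurable]: "w \<in> borel_measurable borel" and wB: "\<And>\<xi>. \<xi> \<in> {0..1} \<Longrightarrow> \<bar>w \<xi>\<bar> \<le> B"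
    and w0: "\<And>\<xi>. 0 \<le> \<xi> \<Longrightarrow> \<xi> \<le> 1 \<Longrightarrow> w \<xi> \<ge> 0" and w1: "\<And>\<delta> \<xi>. 0 < \<delta> \<Longrightarrow> \<delta> \<le> \<xi> \<Longrightarrow> \<xi> \<le> 1 / 2 \<Longrightarrow> w \<xi> \<ge> min \<delta> (1 / 2)"
  shows "(\<integral>\<xi>. indicator {0..1} \<xi> * (w \<xi> * lag_cov \<xi>) \<partial>lborel) > 0"
proof -
  let ?v = "prob_space.variance (gev_measure \<gamma>) h"
  obtain d where d: "d > 0" "d \<le> 1 / 2" "\<And>\<xi>. 0 < \<xi> \<Longrightarrow> \<xi> < d \<Longrightarrow> lag_cov \<xi> \<ge> ?v / 2"
    using lag_cov_positive[OF v] by blast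
  \<comment> \<open>On \<open>{d / 2..<d}\<close> the weight is at least \<open>d / 2\<close> and
    the covariance at least half the variance; elsewhere the integrand is nonnegative off the
    endpoints.\<close>
  have "0 < (d / 2 * (?v / 2)) * (d / 2)" using d v by simp
  also have "\<dots> = (\<integral>\<xi>. (d / 2 * (?v / 2)) * indicator {d / 2..<d} \<xi> \<partial>lborel)"
    using d by simp
  also have "\<dots> \<le> (\<integral>\<xi>. indicator {0..1} \<xi> * (w \<xi> * lag_cov \<xi>) \<partial>lborel)"
  proof (rule integral_mono_AE)
    show "integrable lborel (\<lambda>\<xi>::real. (d / 2 * (?v / 2)) * indicator {d / 2..<d} \<xi>)"
      by (intro integrable_mult_right integrable_real_indicator emeasure_bounded_finite) auto
    show "integrable lborel (\<lambda>\<xi>::real. indicator {0..1} \<xi> * (w \<xi> * lag_cov \<xi>))" by (rule weighted_integrable[OF w wB])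
    show "AE \<xi> in lborel. (d / 2 * (?v / 2)) * indicator {d / 2..<d} \<xi> \<le> indicator {0..1} \<xi> * (w \<xi> * lag_cov \<xi>)"
      using AE_lborel_singleton[of 0] AE_lborel_singleton[of 1]
    proof eventually_elim
      fix \<xi> :: real assume ne: "\<xi> \<noteq> 0" "\<xi> \<noteq> 1"
      show "(d / 2 * (?v / 2)) * indicator {d / 2..<d} \<xi> \<le> indicator {0..1} \<xi> * (w \<xi> * lag_cov \<xi>)"
      proof (cases "\<xi> \<in> {d / 2..<d}")
        case True
        have "d / 2 \<le> w \<xi>" using w1[of "d / 2" \<xi>] True d by auto
        moreover have "?v / 2 \<le> lag_cov \<xi>" using True d by auto
        ultimately have "d / 2 * (?v / 2) \<le> w \<xi> * lag_cov \<xi>" using d v by (intro mult_mono) auto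
        then show ?thesis using True d by (simp add: indicator_def)
      next
        case False
        then show ?thesis
          using ne lag_cov_nonneg[of \<xi>] w0[of \<xi>] by (cases "\<xi> \<in> {0..1}") auto
      qed
    qed
  qed
  finally show ?thesis .
qed

text \<open>Merging the two integrals produces the weight \<open>k - \<xi>\<close>, the form in
  which the limit of the empirical variances appears.\<close>

lemma sigma_naive_eq:
  assumes k: "k > 0"
  shows "sigma_naive Q h k = 2 / real k * (\<integral>\<xi>. indicator {0..1} \<xi> * ((real k - \<xi>) * lag_cov \<xi>) \<partial>lborel)"
    and "sigma_sliding Q h - sigma_naive Q h k = 2 / real k * (\<integral>\<xi>. indicator {0..1} \<xi> * (\<xi> * lag_cov \<xi>) \<partial>lborel)"
proof -
  have i1: "integrable lborel (\<lambda>\<xi>::real. indicator {0..1} \<xi> * (1 * lag_cov \<xi>))" by (rule weighted_integrable[where B = 1]) auto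
  have i2: "integrable lborel (\<lambda>\<xi>::real. indicator {0..1} \<xi> * (\<xi> * lag_cov \<xi>))" by (rule weighted_integrable[where B = 1]) auto
  have "(\<integral>\<xi>. indicator {0..1} \<xi> * ((real k - \<xi>) * lag_cov \<xi>) \<partial>lborel)
    = (\<integral>\<xi>. real k * (indicator {0..1} \<xi> * (1 * lag_cov \<xi>)) - indicator {0..1} \<xi> * (\<xi> * lag_cov \<xi>) \<partial>lborel)"
    by (intro Bochner_Integration.integral_cong refl) (simp add: algebra_simps)
  also have "\<dots> = real k * (\<integral>\<xi>. indicator {0..1} \<xi> * (1 * lag_cov \<xi>) \<partial>lborel) - (\<integral>\<xi>. indicator {0..1} \<xi> * (\<xi> * lag_cov \<xi>) \<partial>lborel)"
    using i1 i2 by simp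
  finally show "sigma_naive Q h k = 2 / real k * (\<integral>\<xi>. indicator {0..1} \<xi> * ((real k - \<xi>) * lag_cov \<xi>) \<partial>lborel)"
    using k by (simp add: sigma_naive_def sigma_sliding_def set_lebesgue_integral_def field_simps)
  show "sigma_sliding Q h - sigma_naive Q h k = 2 / real k * (\<integral>\<xi>. indicator {0..1} \<xi> * (\<xi> * lag_cov \<xi>) \<partial>lborel)"
    by (simp add: sigma_naive_def set_lebesgue_integral_def)
qed

lemma sigma_naive_less_sliding:
  assumes "prob_space.variance (gev_measure \<gamma>) h > 0" "k > 0"
  shows "sigma_naive Q h k < sigma_sliding Q h"
proof -
  have "(\<integral>\<xi>. indicator {0..1} \<xi> * (\<xi> * lag_cov \<xi>) \<partial>lborel) > 0"
    by (rule weighted_integral_pos[OF assms(1), where B = 1]) auto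
  then have "0 < 2 / real k * (\<integral>\<xi>. indicator {0..1} \<xi> * (\<xi> * lag_cov \<xi>) \<partial>lborel)" using assms(2) by simp
  then show ?thesis using sigma_naive_eq(2)[OF assms(2)] by linarith
qed

lemma sigma_naive_pos:
  assumes "prob_space.variance (gev_measure \<gamma>) h > 0" "k > 0"
  shows "sigma_naive Q h k > 0"
proof -
  have k1: "real k \<ge> 1" using assms(2) by linarith
  have "(\<integral>\<xi>. indicator {0..1} \<xi> * ((real k - \<xi>) * lag_cov \<xi>) \<partial>lborel) > 0"
  proof (rule weighted_integral_pos[OF assms(1), where B = "real k"])
    show "min \<delta> (1 / 2) \<le> real k - \<xi>" if "\<xi> \<le> 1 / 2" for \<delta> \<xi> :: real using that k1 by linarith
  qed (use k1 in auto)
  then show ?thesis using sigma_naive_eq(1)[OF assms(2)] assms(2) by simp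
qed

lemma sigma_naive_zero:
  assumes "prob_space.variance (gev_measure \<gamma>) h = 0" "k > 0"
  shows "sigma_naive Q h k = 0"
proof -
  have z: "indicator {0..1} \<xi> * ((real k - \<xi>) * lag_cov \<xi>) = 0" for \<xi>
    using abs_lag_cov_le[of \<xi>] assms(1) by (cases "\<xi> \<in> {0..1}") auto
  show ?thesis unfolding sigma_naive_eq(1)[OF assms(2)] z by simp
qed

text \<open>The integrands differ by at most \<open>k * gap / 2\<close> on the unit interval, and
  the prefactor \<open>2 / k\<close> turns this into \<open>gap\<close>.\<close>

lemma sigma_naive_approx:
  assumes J: "finite J" and \<theta>: "\<theta> > 0" and k: "k > 0"
  shows "\<bar>sigma_naive Q h k - 2 / real k * (\<integral>\<xi>. indicator {0<..<1} \<xi> * ((real k - \<xi>) * step_cov \<gamma> J c y \<xi>) \<partial>lborel)\<bar> \<le> gap \<theta> J c y"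
proof -
  let ?R = "gap \<theta> J c y"
  have k1: "real k \<ge> 1" using k by linarith
  have i1: "integrable lborel (\<lambda>\<xi>::real. indicator {0..1} \<xi> * ((real k - \<xi>) * lag_cov \<xi>))"
    by (rule weighted_integrable[where B = "real k"]) (use k1 in auto)
  have bound: "\<bar>indicator {0..1} \<xi> * ((real k - \<xi>) * lag_cov \<xi>) - indicator {0..1} \<xi> * ((real k - \<xi>) * step_cov \<gamma> J c y \<xi>)\<bar>
      \<le> real k * (?R / 2) * indicator {0..1} \<xi>" for \<xi>
  proof (cases "\<xi> \<in> {0..1}")
    case True
    have "\<bar>real k - \<xi>\<bar> * \<bar>lag_cov \<xi> - step_cov \<gamma> J c y \<xi>\<bar> \<le> real k * (?R / 2)"
      using True k1 by (intro mult_mono lag_cov_approx J \<theta>) auto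
    then show ?thesis using True by (simp add: right_diff_distrib[symmetric] abs_mult[symmetric])
  qed simp
  have iB: "integrable lborel (\<lambda>\<xi>::real. real k * (?R / 2) * indicat_real {0..1} \<xi>)"
    by (intro integrable_mult_right integrable_real_indicator emeasure_bounded_finite) auto
  have m: "(\<lambda>\<xi>. indicator {0..1} \<xi> * ((real k - \<xi>) * step_cov \<gamma> J c y \<xi>)) \<in> borel_measurable lborel"
    using step_cov_measurable[of \<gamma> J c y] by measurable
  have iD: "integrable lborel (\<lambda>\<xi>::real. indicator {0..1} \<xi> * ((real k - \<xi>) * lag_cov \<xi>) - indicator {0..1} \<xi> * ((real k - \<xi>) * step_cov \<gamma> J c y \<xi>))"
    by (rule Bochner_Integration.integrable_bound[OF iB borel_measurable_diff[OF borel_measurable_integrable[OF i1] m]])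
      (use bound in \<open>auto intro: AE_I2 order_trans[OF _ abs_ge_self]\<close>)
  have i2: "integrable lborel (\<lambda>\<xi>::real. indicator {0..1} \<xi> * ((real k - \<xi>) * step_cov \<gamma> J c y \<xi>))"
    using Bochner_Integration.integrable_diff[OF i1 iD] by simp
  \<comment> \<open>Lag sums lead to the open interval and the variance formulas use the closed one;
    the endpoints are null.\<close>
  have e: "(\<integral>\<xi>. indicator {0<..<1} \<xi> * ((real k - \<xi>) * step_cov \<gamma> J c y \<xi>) \<partial>lborel) = (\<integral>\<xi>. indicator {0..1} \<xi> * ((real k - \<xi>) * step_cov \<gamma> J c y \<xi>) \<partial>lborel)"
  proof (rule integral_cong_AE)
    show "(\<lambda>\<xi>. indicator {0<..<1} \<xi> * ((real k - \<xi>) * step_cov \<gamma> J c y \<xi>)) \<in> borel_measurable lborel"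
      using step_cov_measurable[of \<gamma> J c y] by measurable
    show "AE \<xi> in lborel. indicator {0<..<1} \<xi> * ((real k - \<xi>) * step_cov \<gamma> J c y \<xi>) = indicator {0..1} \<xi> * ((real k - \<xi>) * step_cov \<gamma> J c y \<xi>)"
      using AE_lborel_singleton[of 0] AE_lborel_singleton[of 1] by eventually_elim (auto simp: indicator_def)
  qed (rule m)
  have "\<bar>(\<integral>\<xi>. indicator {0..1} \<xi> * ((real k - \<xi>) * lag_cov \<xi>) \<partial>lborel) - (\<integral>\<xi>. indicator {0..1} \<xi> * ((real k - \<xi>) * step_cov \<gamma> J c y \<xi>) \<partial>lborel)\<bar>
    = \<bar>\<integral>\<xi>. indicator {0..1} \<xi> * ((real k - \<xi>) * lag_cov \<xi>) - indicator {0..1} \<xi> * ((real k - \<xi>) * step_cov \<gamma> J c y \<xi>) \<partial>lborel\<bar>"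
    using i1 i2 by simp
  also have "\<dots> \<le> (\<integral>\<xi>. \<bar>indicator {0..1} \<xi> * ((real k - \<xi>) * lag_cov \<xi>) - indicator {0..1} \<xi> * ((real k - \<xi>) * step_cov \<gamma> J c y \<xi>)\<bar> \<partial>lborel)"
    by (rule integral_abs_bound)
  also have "\<dots> \<le> (\<integral>\<xi>. real k * (?R / 2) * indicat_real {0..1::real} \<xi> \<partial>lborel)"
    by (intro integral_mono integrable_abs iD iB bound)
  also have "\<dots> = real k * (?R / 2)" by simp
  finally have "2 / real k * \<bar>(\<integral>\<xi>. indicator {0..1} \<xi> * ((real k - \<xi>) * lag_cov \<xi>) \<partial>lborel) - (\<integral>\<xi>. indicator {0..1} \<xi> * ((real k - \<xi>) * step_cov \<gamma> J c y \<xi>) \<partial>lborel)\<bar> \<le> 2 / real k * (real k * (?R / 2))"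
    using k by (intro mult_left_mono) auto
  moreover have "\<bar>2 / real k * A - 2 / real k * B\<bar> = 2 / real k * \<bar>A - B\<bar>" for A B :: real
    by (simp only: right_diff_distrib[symmetric] abs_mult) simp
  ultimately show ?thesis unfolding sigma_naive_eq(1)[OF k] e using k by simp
qed

end

text \<open>This identifies the limit obtained from the data with the covariance integral of the
  same step function.\<close>

lemma (in extremal_series) step_var_eq_integral:
  assumes J: "finite J"
  shows "step_var k J c y = 2 / real k * (\<integral>\<xi>. indicator {0<..<1} \<xi> * ((real k - \<xi>) * step_cov \<gamma> J c y \<xi>) \<partial>lborel)"
proof -
  let ?f = "\<lambda>x z \<xi>. indicator {0<..<1} \<xi> * ((real k - \<xi>) * (gev_biv_cdf \<gamma> \<xi> x z - gev_cdf \<gamma> x * gev_cdf \<gamma> z))"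
  have i: "integrable lborel (?f x z)" for x z
  proof (rule Bochner_Integration.integrable_bound)
    show "integrable lborel (\<lambda>\<xi>::real. (real k + 1) * indicat_real {0<..<1} \<xi>)"
      by (intro integrable_mult_right integrable_real_indicator emeasure_bounded_finite) auto
    show "?f x z \<in> borel_measurable lborel" using gev_biv_cdf_measurable[of \<gamma> x z] by measurable
    have "norm (?f x z \<xi>) \<le> norm ((real k + 1) * indicat_real {0<..<1} \<xi>)" for \<xi>
    proof (cases "\<xi> \<in> {0<..<1}")
      case True
      have "0 \<le> gev_cdf \<gamma> x * gev_cdf \<gamma> z" "gev_cdf \<gamma> x * gev_cdf \<gamma> z \<le> 1"
        by (auto simp: gev_cdf_nonneg gev_cdf_le_1 mult_le_one)
      moreover have "0 \<le> gev_biv_cdf \<gamma> \<xi> x z" "gev_biv_cdf \<gamma> \<xi> x z \<le> 1"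
        using True by (auto simp: gev_biv_cdf_nonneg intro!: gev_biv_cdf_le_1)
      ultimately have "\<bar>gev_biv_cdf \<gamma> \<xi> x z - gev_cdf \<gamma> x * gev_cdf \<gamma> z\<bar> \<le> 1" by linarith
      then have "\<bar>real k - \<xi>\<bar> * \<bar>gev_biv_cdf \<gamma> \<xi> x z - gev_cdf \<gamma> x * gev_cdf \<gamma> z\<bar> \<le> (real k + 1) * 1"
        using True by (intro mult_mono) auto
      then show ?thesis using True by (simp add: abs_mult)
    qed simp
    then show "AE \<xi> in lborel. norm (?f x z \<xi>) \<le> norm ((real k + 1) * indicat_real {0<..<1} \<xi>)" by simp
  qed
  have "(\<integral>\<xi>. indicator {0<..<1} \<xi> * ((real k - \<xi>) * step_cov \<gamma> J c y \<xi>) \<partial>lborel)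
      = (\<integral>\<xi>. (\<Sum>j\<in>J. \<Sum>j'\<in>J. c j * c j' * ?f (y j) (y j') \<xi>) \<partial>lborel)"
    unfolding step_cov_def sum_distrib_left by (simp only: mult_ac)
  also have "\<dots> = (\<Sum>j\<in>J. \<Sum>j'\<in>J. \<integral>\<xi>. c j * c j' * ?f (y j) (y j') \<xi> \<partial>lborel)"
    by (subst Bochner_Integration.integral_sum, (intro Bochner_Integration.integrable_sum integrable_mult_right i),
        intro sum.cong refl Bochner_Integration.integral_sum integrable_mult_right i)
  also have "\<dots> = (\<Sum>j\<in>J. \<Sum>j'\<in>J. c j * c j' * lag_integral k (y j) (y j'))"
    unfolding lag_integral_def by (simp only: integral_mult_right_zero)
  finally show ?thesis by (simp add: step_var_def)
qed

section \<open>Consistency of the bootstrap\<close>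

text \<open>By the uniform resampling theorem a discrepancy beyond \<open>\<epsilon>\<close> forces,
  for large \<open>m\<close> and outside a null set, a deviation of the empirical variance or of the
  Lyapunov ratio by a fixed \<open>\<delta>\<close>. Markov's inequality bounds both.\<close>

lemma (in block_scheme) small_oP_of_resample_law:
  fixes D :: "real measure \<Rightarrow> real"
  assumes k: "k > 0" and m: "filterlim m at_top sequentially" and h: "h \<in> borel_measurable borel"
    and ms_int: "\<forall>\<^sub>F n in sequentially. integrable M (\<lambda>\<omega>. mean_square (m n) (block_dev a b X (r n) k (m n) h \<omega>))"
    and ms_lim: "(\<lambda>n. expectation (\<lambda>\<omega>. \<bar>mean_square (m n) (block_dev a b X (r n) k (m n) h \<omega>) - \<sigma>\<bar>)) \<longlonglongrightarrow> 0"
    and L_int: "\<forall>\<^sub>F n in sequentially. integrable M (\<lambda>\<omega>. lyapunov_ratio p (m n) (block_dev a b X (r n) k (m n) h \<omega>))"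
    and L_lim: "(\<lambda>n. expectation (\<lambda>\<omega>. lyapunov_ratio p (m n) (block_dev a b X (r n) k (m n) h \<omega>))) \<longlonglongrightarrow> 0"
    and law: "\<forall>\<^sub>F n in sequentially. n \<in> A \<longrightarrow> (AE \<omega> in M. resample_law (\<kappa> n \<omega>) (m n) (block_dev a b X (r n) k (m n) h \<omega>))"
    and p: "2 \<le> p" "p \<le> 3"
    and N: "real_distribution N" "\<And>t. char N t = complex_of_real (exp (- (\<sigma> * t\<^sup>2) / 2))"
    and D: "\<And>\<mu>. (\<And>j. real_distribution (\<mu> j)) \<Longrightarrow> weak_conv_m \<mu> N \<Longrightarrow> (\<lambda>j. D (\<mu> j)) \<longlonglongrightarrow> 0"
  shows "small_oP M (\<lambda>n \<omega>. D (\<kappa> n \<omega>)) (inf sequentially (principal A))"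
  unfolding small_oP_def
proof (intro allI impI)
  fix \<epsilon> :: real assume \<epsilon>: "\<epsilon> > 0"
  let ?c = "\<lambda>n \<omega>. block_dev a b X (r n) k (m n) h \<omega>"
  let ?ms = "\<lambda>n \<omega>. mean_square (m n) (?c n \<omega>)" and ?L = "\<lambda>n \<omega>. lyapunov_ratio p (m n) (?c n \<omega>)"
  have D': "(\<lambda>j. \<bar>D (\<mu> j)\<bar>) \<longlonglongrightarrow> 0" if "\<And>j. real_distribution (\<mu> j)" "weak_conv_m \<mu> N" for \<mu>
    using D[OF that] by (rule tendsto_rabs_zero)
  obtain \<delta> where \<delta>: "\<delta> > 0" and close: "\<And>\<mu> m c. resample_law \<mu> m c \<Longrightarrow> 1 / real m < \<delta> \<Longrightarrow> \<bar>mean_square m c - \<sigma>\<bar> < \<delta> \<Longrightarrow>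
      lyapunov_ratio p m c < \<delta> \<Longrightarrow> \<bar>D \<mu>\<bar> < \<epsilon>"
  proof -
    have "\<exists>\<delta>>0. \<forall>\<mu> m c. resample_law \<mu> m c \<longrightarrow> 1 / real m < \<delta> \<longrightarrow> \<bar>mean_square m c - \<sigma>\<bar> < \<delta> \<longrightarrow>
        lyapunov_ratio p m c < \<delta> \<longrightarrow> \<bar>D \<mu>\<bar> < \<epsilon>"
      by (rule resample_law_uniform[OF p N _ \<epsilon>]) (rule D')
    then show ?thesis using that by blast
  qed
  let ?B = "\<lambda>n. expectation (\<lambda>\<omega>. \<bar>?ms n \<omega> - \<sigma>\<bar>) / \<delta> + expectation (?L n) / \<delta>"
  have "filterlim (\<lambda>n. real (m n)) at_top sequentially" by (rule filterlim_compose[OF filterlim_real_sequentially m])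
  then have "(\<lambda>n. 1 / real (m n)) \<longlonglongrightarrow> 0"
    by (intro tendsto_divide_0[OF tendsto_const] filterlim_at_top_imp_at_infinity)
  then have m_small: "\<forall>\<^sub>F n in sequentially. 1 / real (m n) < \<delta>" using \<delta> by (rule order_tendstoD(2))
  have bound: "\<forall>\<^sub>F n in sequentially. n \<in> A \<longrightarrow> prob {\<omega> \<in> space M. \<bar>D (\<kappa> n \<omega>)\<bar> > \<epsilon>} \<le> ?B n"
    using ms_int L_int law m_small
  proof eventually_elim
    fix n
    assume ims: "integrable M (?ms n)" and iL: "integrable M (?L n)"
      and law: "n \<in> A \<longrightarrow> (AE \<omega> in M. resample_law (\<kappa> n \<omega>) (m n) (?c n \<omega>))" and m_small: "1 / real (m n) < \<delta>"
    show "n \<in> A \<longrightarrow> prob {\<omega> \<in> space M. \<bar>D (\<kappa> n \<omega>)\<bar> > \<epsilon>} \<le> ?B n"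
    proof
      assume "n \<in> A"
      with law have "AE \<omega> in M. resample_law (\<kappa> n \<omega>) (m n) (?c n \<omega>)" by simp
      note mm [measurable] = mean_square_measurable[OF h, of "m n" "r n" k] and lm [measurable] = lyapunov_ratio_measurable[OF h, of p "m n" "r n" k]
      define S1 where "S1 = {\<omega> \<in> space M. \<bar>?ms n \<omega> - \<sigma>\<bar> \<ge> \<delta>}"
      define S2 where "S2 = {\<omega> \<in> space M. ?L n \<omega> \<ge> \<delta>}"
      have S: "S1 \<in> events" "S2 \<in> events" unfolding S1_def S2_def by measurable
      have "AE \<omega> in M. \<omega> \<in> {\<omega> \<in> space M. \<bar>D (\<kappa> n \<omega>)\<bar> > \<epsilon>} \<longrightarrow> \<omega> \<in> S1 \<union> S2"
        using \<open>AE \<omega> in M. resample_law (\<kappa> n \<omega>) (m n) (?c n \<omega>)\<close>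
      proof eventually_elim
        fix \<omega> assume "resample_law (\<kappa> n \<omega>) (m n) (?c n \<omega>)"
        from close[OF this m_small] show "\<omega> \<in> {\<omega> \<in> space M. \<bar>D (\<kappa> n \<omega>)\<bar> > \<epsilon>} \<longrightarrow> \<omega> \<in> S1 \<union> S2"
          unfolding S1_def S2_def by fastforce
      qed
      \<comment> \<open>Only the dominating set has to be measurable here, so no measurability of
        \<open>D\<close> along \<open>\<kappa>\<close> is called for.\<close>
      then have "prob {\<omega> \<in> space M. \<bar>D (\<kappa> n \<omega>)\<bar> > \<epsilon>} \<le> prob (S1 \<union> S2)"
        by (rule finite_measure_mono_AE) (use S in auto)
      also have "\<dots> \<le> prob S1 + prob S2" by (rule measure_subadditive) (use S in \<open>auto simp: emeasure_eq_measure\<close>)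
      also have "prob S1 \<le> expectation (\<lambda>\<omega>. \<bar>?ms n \<omega> - \<sigma>\<bar>) / \<delta>"
        unfolding S1_def by (rule integral_Markov_inequality_measure[OF _ sets.empty_sets _ \<delta>]) (use ims in auto)
      also have "prob S2 \<le> expectation (?L n) / \<delta>"
        unfolding S2_def by (rule integral_Markov_inequality_measure[OF iL sets.empty_sets _ \<delta>]) (auto simp: lyapunov_ratio_def sum_nonneg)
      finally show "prob {\<omega> \<in> space M. \<bar>D (\<kappa> n \<omega>)\<bar> > \<epsilon>} \<le> ?B n" by simp
    qed
  qed
  have "?B \<longlonglongrightarrow> 0 / \<delta> + 0 / \<delta>" using \<delta> by (intro tendsto_add tendsto_divide ms_lim L_lim tendsto_const) auto
  then have Blim: "?B \<longlonglongrightarrow> 0" by simp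
  show "((\<lambda>n. prob {\<omega> \<in> space M. \<bar>D (\<kappa> n \<omega>)\<bar> > \<epsilon>}) \<longlongrightarrow> 0) (inf sequentially (principal A))"
  proof (rule tendsto_sandwich[where f = "\<lambda>_. 0" and h = ?B])
    show "\<forall>\<^sub>F n in inf sequentially (principal A). prob {\<omega> \<in> space M. \<bar>D (\<kappa> n \<omega>)\<bar> > \<epsilon>} \<le> ?B n"
      using bound by (simp add: eventually_inf_principal)
    show "(?B \<longlongrightarrow> 0) (inf sequentially (principal A))"
      using Blim by (rule tendsto_mono[rotated]) simp
  qed auto
qed

section \<open>Block numbers, moments and mixing rates from the assumptions\<close>

lemma filterlim_div_at_top:
  fixes r :: "nat \<Rightarrow> nat"
  assumes r: "(\<lambda>n. real (r n) / real n) \<longlonglongrightarrow> 0" and pos: "\<forall>\<^sub>F n in sequentially. r n > 0" and k: "k > 0"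
  shows "filterlim (\<lambda>n. n div (k * r n)) at_top sequentially"
  unfolding filterlim_at_top
proof
  fix Z :: nat
  define K where "K = real k * (real Z + 1)"
  have K: "K > 0" using k by (simp add: K_def)
  then have "0 < 1 / K" by simp
  then have "\<forall>\<^sub>F n in sequentially. real (r n) / real n < 1 / K" by (rule order_tendstoD(2)[OF r])
  then show "\<forall>\<^sub>F n in sequentially. Z \<le> n div (k * r n)"
    using pos eventually_gt_at_top[of 0]
  proof eventually_elim
    fix n assume H: "real (r n) / real n < 1 / K" "r n > 0" "0 < n"
    then have "real (r n) * K < real n" using K by (simp add: field_simps)
    moreover have "real Z * (real k * real (r n)) \<le> real (r n) * K" by (simp add: K_def algebra_simps)
    ultimately have "real (Z * (k * r n)) \<le> real n" by simp
    then have "Z * (k * r n) \<le> n" by (simp only: of_nat_le_iff)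
    then show "Z \<le> n div (k * r n)" using k H by (subst less_eq_div_iff_mult_less_eq) auto
  qed
qed

text \<open>Finite limsup of a larger moment bounds the smaller one, since
  \<open>|u| powr p \<le> 1 + |u| powr s\<close>. Lowering the exponent brings it into the range of
  the characteristic function estimate.\<close>

lemma (in block_scheme) moment_boundI_limsup:
  assumes h [measurable]: "h \<in> borel_measurable borel"
    and lim: "limsup (\<lambda>m. \<integral>\<^sup>+ x. ennreal (\<bar>h (norm_block_max a b X m 1 x)\<bar> powr s) \<partial>M) < \<infinity>"
    and p: "0 < p" "p \<le> s"
  shows "moment_bound h p"
proof -
  obtain C where C: "limsup (\<lambda>m. \<integral>\<^sup>+ x. ennreal (\<bar>h (norm_block_max a b X m 1 x)\<bar> powr s) \<partial>M) < C" "C < \<infinity>"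
    using dense[OF lim] by blast
  have "\<forall>\<^sub>F q in sequentially. (\<integral>\<^sup>+ x. ennreal (\<bar>h (norm_block_max a b X q 1 x)\<bar> powr s) \<partial>M) < C"
    using C(1) by (rule Limsup_lessD)
  then have "\<forall>\<^sub>F n in sequentially. (\<integral>\<^sup>+ x. ennreal (\<bar>h (Zn n x)\<bar> powr s) \<partial>M) < C"
    by (rule eventually_compose_filterlim[OF _ r_lim])
  then have "\<forall>\<^sub>F n in sequentially. integrable M (\<lambda>\<omega>. \<bar>h (Zn n \<omega>)\<bar> powr p) \<and> expectation (\<lambda>\<omega>. \<bar>h (Zn n \<omega>)\<bar> powr p) \<le> 1 + enn2real C"
  proof eventually_elim
    fix n assume n: "(\<integral>\<^sup>+ x. ennreal (\<bar>h (Zn n x)\<bar> powr s) \<partial>M) < C"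
    have is': "integrable M (\<lambda>\<omega>. \<bar>h (Zn n \<omega>)\<bar> powr s)"
      by (rule integrableI_nonneg) (use n C(2) in \<open>auto intro: less_trans\<close>)
    have es: "expectation (\<lambda>\<omega>. \<bar>h (Zn n \<omega>)\<bar> powr s) \<le> enn2real C"
      using n C(2) by (subst integral_eq_nn_integral) (auto intro!: enn2real_mono)
    have le: "\<bar>u\<bar> powr p \<le> 1 + \<bar>u\<bar> powr s" for u :: real
    proof (cases "\<bar>u\<bar> \<le> 1")
      case True
      then have "\<bar>u\<bar> powr p \<le> 1" using p by (intro powr_le1) auto
      then show ?thesis by (simp add: add_increasing2)
    next
      case False
      then have "\<bar>u\<bar> powr p \<le> \<bar>u\<bar> powr s" using p by (intro powr_mono) auto
      then show ?thesis by simp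
    qed
    have i: "integrable M (\<lambda>\<omega>. 1 + \<bar>h (Zn n \<omega>)\<bar> powr s)" using is' by auto
    have ip: "integrable M (\<lambda>\<omega>. \<bar>h (Zn n \<omega>)\<bar> powr p)"
      by (rule Bochner_Integration.integrable_bound[OF i]) (use le in \<open>auto intro!: AE_I2\<close>)
    have "expectation (\<lambda>\<omega>. \<bar>h (Zn n \<omega>)\<bar> powr p) \<le> expectation (\<lambda>\<omega>. 1 + \<bar>h (Zn n \<omega>)\<bar> powr s)"
      by (intro integral_mono ip i le)
    also have "\<dots> = 1 + expectation (\<lambda>\<omega>. \<bar>h (Zn n \<omega>)\<bar> powr s)" using is' by (simp add: prob_space)
    finally show "integrable M (\<lambda>\<omega>. \<bar>h (Zn n \<omega>)\<bar> powr p) \<and> expectation (\<lambda>\<omega>. \<bar>h (Zn n \<omega>)\<bar> powr p) \<le> 1 + enn2real C"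
      using ip es by simp
  qed
  then show ?thesis unfolding moment_bound_def by blast
qed

text \<open>Eventually \<open>n / r n\<close> is at least 1, so the rate for
  \<open>n / r n * \<alpha>(l n)\<close> forces \<open>\<alpha>(l n)\<close> itself to
  vanish.\<close>

lemma block_schemeI:
  assumes "prob_space M" and mda: "MDA M X a b \<gamma>" and bm: "BM M X r \<omega>"
  shows "\<exists>l. block_scheme M X a b \<gamma> r l"
proof -
  interpret E: extremal_series M X a b \<gamma>
    by (intro extremal_series.intro stationary_series.intro stationary_series_axioms.intro extremal_series_axioms.intro assms)
      (use mda in \<open>simp add: MDA_def\<close>)
  obtain l :: "nat \<Rightarrow> nat" where l: "(\<lambda>n. real (l n)) \<in> o(\<lambda>n. real (r n))"
    "(\<lambda>n. real n / real (r n) * alpha_mixing M X (l n)) \<in> o(\<lambda>_. 1)"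
    using bm unfolding BM_def by blast
  have r: "filterlim r at_top sequentially" "(\<lambda>n. real (r n)) \<in> o(\<lambda>n. real n)" using bm unfolding BM_def by auto
  have rpos: "\<forall>\<^sub>F n in sequentially. r n > 0"
    using r(1)[THEN eventually_compose_filterlim[OF eventually_gt_at_top[of 0]]] .
  have small: "\<forall>\<^sub>F n in sequentially. real (r n) / real n < 1"
    by (rule order_tendstoD(2)[OF smalloD_tendsto[OF r(2)]]) simp
  have lim: "(\<lambda>n. real n / real (r n) * alpha_mixing M X (l n)) \<longlonglongrightarrow> 0"
    using smalloD_tendsto[OF l(2)] by simp
  have "(\<lambda>n. alpha_mixing M X (l n)) \<longlonglongrightarrow> 0"
  proof (rule tendsto_sandwich[OF _ _ tendsto_const lim])
    show "\<forall>\<^sub>F n in sequentially. 0 \<le> alpha_mixing M X (l n)" by (simp add: E.alpha_mixing_nonneg)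
    show "\<forall>\<^sub>F n in sequentially. alpha_mixing M X (l n) \<le> real n / real (r n) * alpha_mixing M X (l n)"
      using small rpos eventually_gt_at_top[of 0]
    proof eventually_elim
      fix n assume "real (r n) / real n < 1" "r n > 0" "0 < n"
      then have "1 \<le> real n / real (r n)" by (simp add: divide_less_eq le_divide_eq)
      then have "1 * alpha_mixing M X (l n) \<le> real n / real (r n) * alpha_mixing M X (l n)"
        by (intro mult_right_mono E.alpha_mixing_nonneg)
      then show "alpha_mixing M X (l n) \<le> real n / real (r n) * alpha_mixing M X (l n)" by simp
    qed
  qed
  then have "block_scheme M X a b \<gamma> r l"
    by unfold_locales (use r smalloD_tendsto[OF l(1)] in auto)
  then show ?thesis by blast
qed

theorem mainTheorem4:
  fixes M :: "'a measure" and X :: "int \<Rightarrow> 'a \<Rightarrow> real"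
    and a b :: "nat \<Rightarrow> real" and \<gamma> \<omega> \<nu> :: real
    and r :: "nat \<Rightarrow> nat" and k :: nat and h :: "real \<Rightarrow> real"
    and W :: "nat \<Rightarrow> nat \<Rightarrow> 'a \<Rightarrow> nat"
    and \<kappa> :: "nat \<Rightarrow> 'a \<Rightarrow> real measure"
    and Q :: "real \<Rightarrow> (real \<times> real) measure"
  assumes prob: "prob_space M"
    and mda: "MDA M X a b \<gamma>"
    and bm: "BM M X r \<omega>"
    and h_meas: "h \<in> borel_measurable borel"
    and h_cont: "AE x in lborel. isCont h x"
    and nu: "\<nu> > 2 / \<omega>"
    and h_mom: "limsup (\<lambda>m. \<integral>\<^sup>+ x. ennreal (\<bar>h (norm_block_max a b X m 1 x)\<bar> powr (2 + \<nu>)) \<partial>M) < \<infinity>"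
    and k: "k \<ge> 1"
    and W_multinomial: "\<And>n. k * r n dvd n \<Longrightarrow>
          multinomial M {1..n div (k * r n)} (n div (k * r n))
            (\<lambda>_. 1 / real (n div (k * r n))) (W n)"
    and W_indep: "\<And>n. k * r n dvd n \<Longrightarrow>
          prob_space.indep_set M
            (sets (generated_sigma M borel X UNIV))
            (sets (generated_sigma M (count_space UNIV) (W n) {1..n div (k * r n)}))"
    and cond_law: "\<And>n. k * r n dvd n \<Longrightarrow>
          is_cond_law M (generated_sigma M borel X {1..int (n + r n) - 1})
            (boot_process a b X n (r n) k (W n) h) (\<kappa> n)"
    and Q: "\<And>\<xi>. \<xi> \<in> {0..1} \<Longrightarrow> has_biv_cdf (Q \<xi>) (gev_biv_cdf \<gamma> \<xi>)"
  shows "(prob_space.variance (gev_measure \<gamma>) h > 0 \<longrightarrow>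
            small_oP M (\<lambda>n x. kolmogorov_dist (\<kappa> n x) (centred_normal (sigma_naive Q h k)))
              (admissible_sizes k r)) \<and>
         (prob_space.variance (gev_measure \<gamma>) h = 0 \<longrightarrow>
            sigma_naive Q h k = 0 \<and>
            (\<forall>\<delta>>0. small_oP M (\<lambda>n x. measure (\<kappa> n x) {y. \<bar>y\<bar> > \<delta>}) (admissible_sizes k r))) \<and>
         (prob_space.variance (gev_measure \<gamma>) h > 0 \<longrightarrow>
            (\<forall>j\<ge>1. sigma_naive Q h j < sigma_sliding Q h))"
proof -
  obtain l where l: "block_scheme M X a b \<gamma> r l" using block_schemeI[OF prob mda bm] by blast
  interpret block_scheme M X a b \<gamma> r l by (rule l)
  \<comment> \<open>The exponent has to exceed 2 for the Lyapunov ratio to vanish and stay at most 3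
    for \<open>iexp_approx_powr\<close>.\<close>
  define p where "p = 2 + min \<nu> 1"
  have "\<omega> > 0" using bm by (simp add: BM_def)
  then have "\<nu> > 0" using nu by (meson divide_pos_pos less_trans zero_less_numeral)
  then have p: "p > 2" "p \<le> 3" "0 < p" "p \<le> 2 + \<nu>" "2 \<le> p" by (auto simp: p_def)
  have k0: "k > 0" using k by simp
  have mom: "moment_bound h p" by (rule moment_boundI_limsup[OF h_meas h_mom p(3,4)])
  define m where "m n = n div (k * r n)" for n
  have m: "filterlim m at_top sequentially"
    unfolding m_def
  proof (rule filterlim_div_at_top[OF _ r_pos k0])
    show "(\<lambda>n. real (r n) / real n) \<longlonglongrightarrow> 0" using bm unfolding BM_def by (auto dest: smalloD_tendsto)
  qed
  interpret F: gev_pair_family \<gamma> Q h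
    by (intro gev_pair_family.intro Q h_meas h_cont second_moment(1)[OF h_meas h_cont p(1) mom])
  let ?\<sigma> = "sigma_naive Q h k"
  have ms_lim: "(\<lambda>n. expectation (\<lambda>\<omega>. \<bar>mean_square (m n) (block_dev a b X (r n) k (m n) h \<omega>) - ?\<sigma>\<bar>)) \<longlonglongrightarrow> 0"
  proof (rule mean_square_tendsto[OF k0 m h_meas h_cont p(1) mom, where C = 1])
    fix J :: "(int \<times> bool) set" and c y and \<theta> :: real assume J: "finite J" "\<theta> > 0"
    show "\<bar>?\<sigma> - step_var k J c y\<bar> \<le> 1 * (\<theta> * (\<integral>x. (h x - step_fun J c y x)\<^sup>2 \<partial>gev_measure \<gamma>) + (\<integral>x. (h x + step_fun J c y x)\<^sup>2 \<partial>gev_measure \<gamma>) / \<theta>)"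
      using F.sigma_naive_approx[OF J k0, of c y] unfolding step_var_eq_integral[OF J(1)] F.gap_def by simp
  qed simp
  let ?A = "{n. k * r n dvd n}"
  have law: "\<forall>\<^sub>F n in sequentially. n \<in> ?A \<longrightarrow> (AE \<omega> in M. resample_law (\<kappa> n \<omega>) (m n) (block_dev a b X (r n) k (m n) h \<omega>))"
    using ev_sizes[OF k0 m]
  proof eventually_elim
    fix n assume sz: "m n > 0 \<and> r n > 0 \<and> r n \<le> k * r n \<and> l n \<le> k * r n"
    show "n \<in> ?A \<longrightarrow> (AE \<omega> in M. resample_law (\<kappa> n \<omega>) (m n) (block_dev a b X (r n) k (m n) h \<omega>))"
    proof
      assume "n \<in> ?A"
      then have n: "k * r n dvd n" by simp
      show "AE \<omega> in M. resample_law (\<kappa> n \<omega>) (m n) (block_dev a b X (r n) k (m n) h \<omega>)"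
      proof (rule boot_cond_law[OF prob X_measurable h_meas])
        show "n = m n * (k * r n)" using n by (simp add: m_def)
        show "multinomial M {1..m n} (m n) (\<lambda>_. 1 / real (m n)) (W n)" unfolding m_def by (rule W_multinomial[OF n])
        show "indep_set (sets (generated_sigma M borel X UNIV)) (sets (generated_sigma M (count_space UNIV) (W n) {1..m n}))"
          unfolding m_def by (rule W_indep[OF n])
      qed (use sz k0 cond_law[OF n] in auto)
    qed
  qed
  \<comment> \<open>The limit law and the discrepancy are left open, to be instantiated once for the
    normal limit and once for the point mass.\<close>
  note consistency = small_oP_of_resample_law[OF k0 m h_meas mean_square_integrable[OF k0 m h_meas h_cont p(1) mom] ms_lim
      lyapunov_ratio_tendsto[OF k0 m h_meas h_cont p(1) mom] law p(5,2), folded admissible_sizes_def]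
  have "small_oP M (\<lambda>n x. kolmogorov_dist (\<kappa> n x) (centred_normal ?\<sigma>)) (admissible_sizes k r)"
    if v: "prob_space.variance (gev_measure \<gamma>) h > 0"
  proof (rule consistency)
    have \<sigma>: "?\<sigma> > 0" by (rule F.sigma_naive_pos[OF v k0])
    show "real_distribution (centred_normal ?\<sigma>)" by (rule real_distribution_centred_normal[OF \<sigma>])
    show "char (centred_normal ?\<sigma>) t = complex_of_real (exp (- (?\<sigma> * t\<^sup>2) / 2))" for t by (rule char_centred_normal[OF \<sigma>])
    show "(\<lambda>j. kolmogorov_dist (\<mu> j) (centred_normal ?\<sigma>)) \<longlonglongrightarrow> 0"
      if "\<And>j. real_distribution (\<mu> j)" "weak_conv_m \<mu> (centred_normal ?\<sigma>)" for \<mu>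
      by (intro kolmogorov_dist_tendsto_0 that real_distribution_centred_normal isCont_cdf_centred_normal \<sigma>)
  qed
  \<comment> \<open>With vanishing variance the limit has a jump at 0, so the statement becomes
    concentration of the conditional law around 0.\<close>
  moreover have "?\<sigma> = 0 \<and> (\<forall>\<delta>>0. small_oP M (\<lambda>n x. measure (\<kappa> n x) {y. \<bar>y\<bar> > \<delta>}) (admissible_sizes k r))"
    if v: "prob_space.variance (gev_measure \<gamma>) h = 0"
  proof (intro conjI allI impI)
    show \<sigma>: "?\<sigma> = 0" by (rule F.sigma_naive_zero[OF v k0])
    fix \<delta> :: real assume \<delta>: "\<delta> > 0"
    show "small_oP M (\<lambda>n x. measure (\<kappa> n x) {y. \<bar>y\<bar> > \<delta>}) (admissible_sizes k r)"
    proof (rule consistency)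
      interpret R: prob_space "return borel (0::real)" by (rule prob_space_return) simp
      show "real_distribution (return borel (0::real))" by standard auto
      show "char (return borel 0) t = complex_of_real (exp (- (?\<sigma> * t\<^sup>2) / 2))" for t by (simp add: char_return_0 \<sigma>)
      show "(\<lambda>j. measure (\<mu> j) {y. \<bar>y\<bar> > \<delta>}) \<longlonglongrightarrow> 0"
        if "\<And>j. real_distribution (\<mu> j)" "weak_conv_m \<mu> (return borel 0)" for \<mu>
        by (rule tail_tendsto_0_of_weak_conv_return[OF that \<delta>])
    qed
  qed
  moreover have "sigma_naive Q h j < sigma_sliding Q h" if "prob_space.variance (gev_measure \<gamma>) h > 0" "j \<ge> 1" for j
    using that by (intro F.sigma_naive_less_sliding) auto
  ultimately show ?thesis by blast
qed

end
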